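(* Let $k$ be a field of characteristic zero. Let $M$ be a finitely generated monoid acting on an algebraic variety $V/k$. Let $x\in V(k)$. Then the following are equivalent: (a) $x$ is $M$-periodic. (b) $x$ is $N$-periodic for every $2$-generated submonoid $N\leq M$. If moreover $M$ is a group, then conditions (a) and (b) are equivalent to: (c) $x$ is $\langle f\rangle$-periodic for every $f\in M$.
   Context: An algebraic variety over $k$ is a reduced separated scheme of finite type over $k$ (not necessarily irreducible). A monoid $M$ acts on $V$ by endomorphisms of $V$ as a $k$-scheme, i.e. via a monoid homomorphism from $M$ to the monoid of $k$-endomorphisms of $V$; this induces an action on $V(k)$. Given a set $X$ and a monoid $M$ acting on $X$ by endomorphisms (self-maps), a point $x\in X$ is called $M$-periodic if the orbit $M\cdot x=\{g(x):g\in M\}$ is finite and $M$ permutes the elements of $M\cdot x$ (i.e. each element of $M$ restricts to a bijection of $M\cdot x$ onto itself). Here this is applied with $X=V(k)$. A $2$-generated submonoid is one generated by two (not necessarily distinct) elements of $M$, and $\langle f\rangle$ is the submonoid generated by $f$. *)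

theory Defs
  imports
    "HOL-Analysis.Abstract_Topology"
    "HOL-Algebra.Ideal"
    "HOL-Algebra.Generated_Rings"
begin

section \<open>Locally ringed spaces\<close>

text \<open>
  A space X carries a topology, a ring of sections sections X U for every open U, and
  restriction maps res X U V from sections over U to sections over V, where V is contained in U.
  The values of sections and res at sets that are not open are irrelevant.
\<close>

record ('p, 'a) ringed_space =
  topo :: "'p topology"
  sections :: "'p set \<Rightarrow> 'a ring"
  res :: "'p set \<Rightarrow> 'p set \<Rightarrow> 'a \<Rightarrow> 'a"

abbreviation points :: "('p, 'a) ringed_space \<Rightarrow> 'p set"
  where "points X \<equiv> topspace (topo X)"

abbreviation open_in :: "('p, 'a) ringed_space \<Rightarrow> 'p set \<Rightarrow> bool"
  where "open_in X \<equiv> openin (topo X)"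

definition presheaf_of_rings :: "('p, 'a) ringed_space \<Rightarrow> bool"
  where "presheaf_of_rings X \<longleftrightarrow>
    (\<forall>U. open_in X U \<longrightarrow> cring (sections X U)) \<and>
    (\<forall>U V. open_in X U \<and> open_in X V \<and> V \<subseteq> U \<longrightarrow>
      res X U V \<in> ring_hom (sections X U) (sections X V)) \<and>
    (\<forall>U s. open_in X U \<and> s \<in> carrier (sections X U) \<longrightarrow> res X U U s = s) \<and>
    (\<forall>U V W s. open_in X U \<and> open_in X V \<and> open_in X W \<and> W \<subseteq> V \<and> V \<subseteq> U \<and>
      s \<in> carrier (sections X U) \<longrightarrow> res X V W (res X U V s) = res X U W s)"

definition sheaf_of_rings :: "('p, 'a) ringed_space \<Rightarrow> bool"
  where "sheaf_of_rings X \<longleftrightarrow> presheaf_of_rings X \<and>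
    (\<forall>\<U>. (\<forall>U\<in>\<U>. open_in X U) \<longrightarrow>
      (\<forall>s\<in>carrier (sections X (\<Union>\<U>)). \<forall>t\<in>carrier (sections X (\<Union>\<U>)).
        (\<forall>U\<in>\<U>. res X (\<Union>\<U>) U s = res X (\<Union>\<U>) U t) \<longrightarrow> s = t) \<and>
      (\<forall>s. (\<forall>U\<in>\<U>. s U \<in> carrier (sections X U)) \<and>
        (\<forall>U\<in>\<U>. \<forall>V\<in>\<U>. res X U (U \<inter> V) (s U) = res X V (U \<inter> V) (s V)) \<longrightarrow>
        (\<exists>t\<in>carrier (sections X (\<Union>\<U>)). \<forall>U\<in>\<U>. res X (\<Union>\<U>) U t = s U)))"

text \<open>
  The germ at x of a section s over U, as the class of all pairs (V, t) that agree with (U, s)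
  near x.  The operations on the stalk are the unions over all choices of representatives; every
  such choice gives the same class.
\<close>

definition germ :: "('p, 'a) ringed_space \<Rightarrow> 'p \<Rightarrow> 'p set \<Rightarrow> 'a \<Rightarrow> ('p set \<times> 'a) set"
  where "germ X x U s = {(V, t). open_in X V \<and> x \<in> V \<and> t \<in> carrier (sections X V) \<and>
    (\<exists>W. open_in X W \<and> x \<in> W \<and> W \<subseteq> U \<inter> V \<and> res X U W s = res X V W t)}"

definition stalk :: "('p, 'a) ringed_space \<Rightarrow> 'p \<Rightarrow> ('p set \<times> 'a) set ring"
  where "stalk X x =
    \<lparr>carrier = {germ X x U s | U s. open_in X U \<and> x \<in> U \<and> s \<in> carrier (sections X U)},
     mult = (\<lambda>a b. \<Union>(U, s)\<in>a. \<Union>(V, t)\<in>b. germ X x (U \<inter> V)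
       (res X U (U \<inter> V) s \<otimes>\<^bsub>sections X (U \<inter> V)\<^esub> res X V (U \<inter> V) t)),
     one = germ X x (points X) \<one>\<^bsub>sections X (points X)\<^esub>,
     zero = germ X x (points X) \<zero>\<^bsub>sections X (points X)\<^esub>,
     add = (\<lambda>a b. \<Union>(U, s)\<in>a. \<Union>(V, t)\<in>b. germ X x (U \<inter> V)
       (res X U (U \<inter> V) s \<oplus>\<^bsub>sections X (U \<inter> V)\<^esub> res X V (U \<inter> V) t))\<rparr>"

definition local_ring :: "'a ring \<Rightarrow> bool"
  where "local_ring R \<longleftrightarrow> cring R \<and> (\<exists>!m. maximalideal m R)"

definition locally_ringed_space :: "('p, 'a) ringed_space \<Rightarrow> bool"
  where "locally_ringed_space X \<longleftrightarrow>
    sheaf_of_rings X \<and> (\<forall>x\<in>points X. local_ring (stalk X x))"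

definition open_subspace :: "('p, 'a) ringed_space \<Rightarrow> 'p set \<Rightarrow> ('p, 'a) ringed_space"
  where "open_subspace X U = X\<lparr>topo := subtopology (topo X) U\<rparr>"


section \<open>Morphisms\<close>

record ('p, 'a, 'q, 'b) rs_morphism =
  pt_map :: "'p \<Rightarrow> 'q"
  sec_map :: "'q set \<Rightarrow> 'b \<Rightarrow> 'a"

definition preimage :: "('p, 'a) ringed_space \<Rightarrow> ('p, 'a, 'q, 'b) rs_morphism \<Rightarrow> 'q set \<Rightarrow> 'p set"
  where "preimage X f V = {x \<in> points X. pt_map f x \<in> V}"

definition stalk_map :: "('p, 'a) ringed_space \<Rightarrow> ('p, 'a, 'q, 'b) rs_morphism \<Rightarrow> 'p \<Rightarrow>
    ('q set \<times> 'b) set \<Rightarrow> ('p set \<times> 'a) set"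
  where "stalk_map X f x a = (\<Union>(V, t)\<in>a. germ X x (preimage X f V) (sec_map f V t))"

text \<open>
  The first three conditions fix the values of the maps outside their domains, so that two
  morphisms are equal as terms iff they are equal as morphisms.
\<close>

definition lrs_morphism :: "('p, 'a) ringed_space \<Rightarrow> ('q, 'b) ringed_space \<Rightarrow>
    ('p, 'a, 'q, 'b) rs_morphism \<Rightarrow> bool"
  where "lrs_morphism X Y f \<longleftrightarrow>
    pt_map f \<in> extensional (points X) \<and>
    sec_map f \<in> extensional {V. open_in Y V} \<and>
    (\<forall>V. open_in Y V \<longrightarrow> sec_map f V \<in> extensional (carrier (sections Y V))) \<and>
    continuous_map (topo X) (topo Y) (pt_map f) \<and>
    (\<forall>V. open_in Y V \<longrightarrow>
      sec_map f V \<in> ring_hom (sections Y V) (sections X (preimage X f V))) \<and>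
    (\<forall>V W t. open_in Y V \<and> open_in Y W \<and> W \<subseteq> V \<and> t \<in> carrier (sections Y V) \<longrightarrow>
      sec_map f W (res Y V W t) = res X (preimage X f V) (preimage X f W) (sec_map f V t)) \<and>
    (\<forall>x\<in>points X. \<forall>m n. maximalideal m (stalk Y (pt_map f x)) \<and> maximalideal n (stalk X x) \<longrightarrow>
      stalk_map X f x ` m \<subseteq> n)"

definition id_morphism :: "('p, 'a) ringed_space \<Rightarrow> ('p, 'a, 'p, 'a) rs_morphism"
  where "id_morphism X =
    \<lparr>pt_map = (\<lambda>x\<in>points X. x),
     sec_map = (\<lambda>U\<in>{U. open_in X U}. \<lambda>s\<in>carrier (sections X U). s)\<rparr>"

text \<open>comp_morphism X Y Z g f is the composite of f from X to Y followed by g from Y to Z.\<close>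

definition comp_morphism :: "('p, 'a) ringed_space \<Rightarrow> ('q, 'b) ringed_space \<Rightarrow>
    ('r, 'c) ringed_space \<Rightarrow> ('q, 'b, 'r, 'c) rs_morphism \<Rightarrow> ('p, 'a, 'q, 'b) rs_morphism \<Rightarrow>
    ('p, 'a, 'r, 'c) rs_morphism"
  where "comp_morphism X Y Z g f =
    \<lparr>pt_map = (\<lambda>x\<in>points X. pt_map g (pt_map f x)),
     sec_map = (\<lambda>W\<in>{W. open_in Z W}. \<lambda>t\<in>carrier (sections Z W).
       sec_map f (preimage Y g W) (sec_map g W t))\<rparr>"

definition lrs_isomorphic :: "('p, 'a) ringed_space \<Rightarrow> ('q, 'b) ringed_space \<Rightarrow> bool"
  where "lrs_isomorphic X Y \<longleftrightarrow>
    (\<exists>f g. lrs_morphism X Y f \<and> lrs_morphism Y X g \<and>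
      comp_morphism X Y X g f = id_morphism X \<and> comp_morphism Y X Y f g = id_morphism Y)"


section \<open>Spectra and schemes\<close>

text \<open>
  The fraction a/s in the localization of R at the prime p, as its class of pairs.  As for stalks,
  the operations are unions over all choices of representatives.
\<close>

definition fraction :: "'a ring \<Rightarrow> 'a set \<Rightarrow> 'a \<Rightarrow> 'a \<Rightarrow> ('a \<times> 'a) set"
  where "fraction R p a s = {(b, t) \<in> carrier R \<times> (carrier R - p).
    \<exists>u\<in>carrier R - p. u \<otimes>\<^bsub>R\<^esub> (a \<otimes>\<^bsub>R\<^esub> t \<ominus>\<^bsub>R\<^esub> b \<otimes>\<^bsub>R\<^esub> s) = \<zero>\<^bsub>R\<^esub>}"

definition localization :: "'a ring \<Rightarrow> 'a set \<Rightarrow> ('a \<times> 'a) set ring"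
  where "localization R p =
    \<lparr>carrier = {fraction R p a s | a s. a \<in> carrier R \<and> s \<in> carrier R - p},
     mult = (\<lambda>A B. \<Union>(a, s)\<in>A. \<Union>(b, t)\<in>B. fraction R p (a \<otimes>\<^bsub>R\<^esub> b) (s \<otimes>\<^bsub>R\<^esub> t)),
     one = fraction R p \<one>\<^bsub>R\<^esub> \<one>\<^bsub>R\<^esub>,
     zero = fraction R p \<zero>\<^bsub>R\<^esub> \<one>\<^bsub>R\<^esub>,
     add = (\<lambda>A B. \<Union>(a, s)\<in>A. \<Union>(b, t)\<in>B.
       fraction R p (a \<otimes>\<^bsub>R\<^esub> t \<oplus>\<^bsub>R\<^esub> b \<otimes>\<^bsub>R\<^esub> s) (s \<otimes>\<^bsub>R\<^esub> t))\<rparr>"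

definition zariski_topology :: "'a ring \<Rightarrow> 'a set topology"
  where "zariski_topology R =
    topology_generated_by {{p. primeideal p R \<and> f \<notin> p} | f. f \<in> carrier R}"

text \<open>
  Sections over U are the functions taking each p in U to an element of the localization at p
  that are locally given by one fraction.
\<close>

definition regular_functions :: "'a ring \<Rightarrow> 'a set set \<Rightarrow> ('a set \<Rightarrow> ('a \<times> 'a) set) set"
  where "regular_functions R U = {s \<in> Pi\<^sub>E U (\<lambda>p. carrier (localization R p)).
    \<forall>p\<in>U. \<exists>V a f. openin (zariski_topology R) V \<and> p \<in> V \<and> V \<subseteq> U \<and>
      a \<in> carrier R \<and> f \<in> carrier R \<and> (\<forall>q\<in>V. f \<notin> q \<and> s q = fraction R q a f)}"

definition Spec :: "'a ring \<Rightarrow> ('a set, 'a set \<Rightarrow> ('a \<times> 'a) set) ringed_space"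
  where "Spec R =
    \<lparr>topo = zariski_topology R,
     sections = (\<lambda>U.
       \<lparr>carrier = regular_functions R U,
        mult = (\<lambda>s t. \<lambda>p\<in>U. s p \<otimes>\<^bsub>localization R p\<^esub> t p),
        one = (\<lambda>p\<in>U. \<one>\<^bsub>localization R p\<^esub>),
        zero = (\<lambda>p\<in>U. \<zero>\<^bsub>localization R p\<^esub>),
        add = (\<lambda>s t. \<lambda>p\<in>U. s p \<oplus>\<^bsub>localization R p\<^esub> t p)\<rparr>),
     res = (\<lambda>U V s. restrict s V)\<rparr>"

text \<open>
  It is no restriction that the ring R below has the element type of the sections of X: it is
  necessarily isomorphic to the ring of global sections.
\<close>

definition affine_scheme :: "('p, 'a) ringed_space \<Rightarrow> bool"
  where "affine_scheme X \<longleftrightarrow> locally_ringed_space X \<and>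
    (\<exists>R :: 'a ring. cring R \<and> lrs_isomorphic X (Spec R))"

definition affine_open :: "('p, 'a) ringed_space \<Rightarrow> 'p set \<Rightarrow> bool"
  where "affine_open X U \<longleftrightarrow> open_in X U \<and> affine_scheme (open_subspace X U)"

definition scheme :: "('p, 'a) ringed_space \<Rightarrow> bool"
  where "scheme X \<longleftrightarrow> locally_ringed_space X \<and> (\<forall>x\<in>points X. \<exists>U. x \<in> U \<and> affine_open X U)"


section \<open>Varieties\<close>

definition reduced_scheme :: "('p, 'a) ringed_space \<Rightarrow> bool"
  where "reduced_scheme X \<longleftrightarrow> scheme X \<and>
    (\<forall>U s n. open_in X U \<and> s \<in> carrier (sections X U) \<and>
      s [^]\<^bsub>sections X U\<^esub> (n::nat) = \<zero>\<^bsub>sections X U\<^esub> \<longrightarrow> s = \<zero>\<^bsub>sections X U\<^esub>)"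

definition finitely_generated_algebra :: "'b ring \<Rightarrow> 'a ring \<Rightarrow> ('b \<Rightarrow> 'a) \<Rightarrow> bool"
  where "finitely_generated_algebra B A \<phi> \<longleftrightarrow>
    (\<exists>F. finite F \<and> F \<subseteq> carrier A \<and> generate_ring A (\<phi> ` carrier B \<union> F) = carrier A)"

definition finite_type :: "('p, 'a) ringed_space \<Rightarrow> ('q, 'b) ringed_space \<Rightarrow>
    ('p, 'a, 'q, 'b) rs_morphism \<Rightarrow> bool"
  where "finite_type X Y f \<longleftrightarrow>
    (\<exists>\<V>. \<Union>\<V> = points Y \<and>
      (\<forall>V\<in>\<V>. affine_open Y V \<and>
        (\<exists>\<U>. finite \<U> \<and> \<Union>\<U> = preimage X f V \<and>
          (\<forall>U\<in>\<U>. affine_open X U \<and>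
            finitely_generated_algebra (sections Y V) (sections X U)
              (\<lambda>t. res X (preimage X f V) U (sec_map f V t))))))"

text \<open>
  The last condition of closed_immersion is surjectivity of the map from the structure sheaf of
  Y to the direct image of that of X, as a map of sheaves.
\<close>

definition closed_immersion :: "('p, 'a) ringed_space \<Rightarrow> ('q, 'b) ringed_space \<Rightarrow>
    ('p, 'a, 'q, 'b) rs_morphism \<Rightarrow> bool"
  where "closed_immersion X Y f \<longleftrightarrow> lrs_morphism X Y f \<and>
    embedding_map (topo X) (topo Y) (pt_map f) \<and>
    closedin (topo Y) (pt_map f ` points X) \<and>
    (\<forall>V y s. open_in Y V \<and> y \<in> V \<and> s \<in> carrier (sections X (preimage X f V)) \<longrightarrow>
      (\<exists>W t. open_in Y W \<and> y \<in> W \<and> W \<subseteq> V \<and> t \<in> carrier (sections Y W) \<and>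
        sec_map f W t = res X (preimage X f V) (preimage X f W) s))"

text \<open>
  P with projections p and q is a fibre product of X and Y over S along s and t, in the category of
  schemes with the same point and section types as P.
\<close>

definition fibre_product :: "('r, 'c) ringed_space \<Rightarrow>
    ('p, 'a) ringed_space \<Rightarrow> ('p, 'a, 'r, 'c) rs_morphism \<Rightarrow>
    ('q, 'b) ringed_space \<Rightarrow> ('q, 'b, 'r, 'c) rs_morphism \<Rightarrow>
    ('u, 'd) ringed_space \<Rightarrow> ('u, 'd, 'p, 'a) rs_morphism \<Rightarrow> ('u, 'd, 'q, 'b) rs_morphism \<Rightarrow> bool"
  where "fibre_product S X s Y t P p q \<longleftrightarrow>
    scheme P \<and> lrs_morphism P X p \<and> lrs_morphism P Y q \<and>
    comp_morphism P X S s p = comp_morphism P Y S t q \<and>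
    (\<forall>(T :: ('u, 'd) ringed_space) a b.
      scheme T \<and> lrs_morphism T X a \<and> lrs_morphism T Y b \<and>
      comp_morphism T X S s a = comp_morphism T Y S t b \<longrightarrow>
      (\<exists>!h. lrs_morphism T P h \<and> comp_morphism T P X p h = a \<and> comp_morphism T P Y q h = b))"

text \<open>
  The diagonal of X over S is a closed immersion.  The types for the fibre product P are large
  enough to contain a copy of the fibre product in the category of all schemes: its points can be
  encoded as triples (x, y, z), where x and y have the same image in S and z is a prime ideal of
  the tensor product of the residue fields of x and y over that of their image (a set of finite
  sums of elementary tensors, and these are encoded by lists), and a section over an open set of P
  is determined by the function taking each point to the germ there, where each stalk has at most
  as many elements as there are lists.  Since that copy is then also a test object in the
  definition of fibre_product, P is isomorphic to it.
\<close>

type_synonym ('p, 'a) square_point = "'p \<times> 'p \<times> 'a list set"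

definition separated :: "('p, 'a) ringed_space \<Rightarrow> ('r, 'c) ringed_space \<Rightarrow>
    ('p, 'a, 'r, 'c) rs_morphism \<Rightarrow> bool"
  where "separated X S s \<longleftrightarrow>
    (\<exists>(P :: (('p, 'a) square_point, ('p, 'a) square_point \<Rightarrow> 'a list) ringed_space) p q \<Delta>.
      fibre_product S X s X s P p q \<and> lrs_morphism X P \<Delta> \<and>
      comp_morphism X P X p \<Delta> = id_morphism X \<and> comp_morphism X P X q \<Delta> = id_morphism X \<and>
      closed_immersion X P \<Delta>)"

text \<open>Varieties need not be irreducible, and the empty scheme is allowed.\<close>

definition algebraic_variety :: "'k ring \<Rightarrow> ('p, 'a) ringed_space \<Rightarrow>
    ('p, 'a, 'k set, 'k set \<Rightarrow> ('k \<times> 'k) set) rs_morphism \<Rightarrow> bool"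
  where "algebraic_variety k V \<pi> \<longleftrightarrow> scheme V \<and> lrs_morphism V (Spec k) \<pi> \<and>
    reduced_scheme V \<and> separated V (Spec k) \<pi> \<and> finite_type V (Spec k) \<pi>"

definition rational_points :: "'k ring \<Rightarrow> ('p, 'a) ringed_space \<Rightarrow>
    ('p, 'a, 'k set, 'k set \<Rightarrow> ('k \<times> 'k) set) rs_morphism \<Rightarrow>
    ('k set, 'k set \<Rightarrow> ('k \<times> 'k) set, 'p, 'a) rs_morphism set"
  where "rational_points k V \<pi> = {x. lrs_morphism (Spec k) V x \<and>
    comp_morphism (Spec k) V (Spec k) \<pi> x = id_morphism (Spec k)}"

definition endomorphism_monoid :: "'k ring \<Rightarrow> ('p, 'a) ringed_space \<Rightarrow>
    ('p, 'a, 'k set, 'k set \<Rightarrow> ('k \<times> 'k) set) rs_morphism \<Rightarrow> ('p, 'a, 'p, 'a) rs_morphism monoid"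
  where "endomorphism_monoid k V \<pi> =
    \<lparr>carrier = {f. lrs_morphism V V f \<and> comp_morphism V V (Spec k) \<pi> f = \<pi>},
     mult = comp_morphism V V V,
     one = id_morphism V\<rparr>"


section \<open>Monoid actions and periodic points\<close>

definition acts_by_endomorphisms :: "'m monoid \<Rightarrow> 'k ring \<Rightarrow> ('p, 'a) ringed_space \<Rightarrow>
    ('p, 'a, 'k set, 'k set \<Rightarrow> ('k \<times> 'k) set) rs_morphism \<Rightarrow>
    ('m \<Rightarrow> ('p, 'a, 'p, 'a) rs_morphism) \<Rightarrow> bool"
  where "acts_by_endomorphisms M k V \<pi> \<rho> \<longleftrightarrow>
    \<rho> \<in> hom M (endomorphism_monoid k V \<pi>) \<and> \<rho> \<one>\<^bsub>M\<^esub> = \<one>\<^bsub>endomorphism_monoid k V \<pi>\<^esub>"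

definition point_action :: "'k ring \<Rightarrow> ('p, 'a) ringed_space \<Rightarrow>
    ('m \<Rightarrow> ('p, 'a, 'p, 'a) rs_morphism) \<Rightarrow> 'm \<Rightarrow>
    ('k set, 'k set \<Rightarrow> ('k \<times> 'k) set, 'p, 'a) rs_morphism \<Rightarrow>
    ('k set, 'k set \<Rightarrow> ('k \<times> 'k) set, 'p, 'a) rs_morphism"
  where "point_action k V \<rho> g x = comp_morphism (Spec k) V V (\<rho> g) x"

definition generated_submonoid :: "'m monoid \<Rightarrow> 'm set \<Rightarrow> 'm set"
  where "generated_submonoid M F = (\<lambda>N. submonoid N M) hull F"

definition finitely_generated_monoid :: "'m monoid \<Rightarrow> bool"
  where "finitely_generated_monoid M \<longleftrightarrow>
    (\<exists>F. finite F \<and> F \<subseteq> carrier M \<and> generated_submonoid M F = carrier M)"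

definition two_generated_submonoid :: "'m set \<Rightarrow> 'm monoid \<Rightarrow> bool"
  where "two_generated_submonoid N M \<longleftrightarrow>
    (\<exists>f\<in>carrier M. \<exists>g\<in>carrier M. N = generated_submonoid M {f, g})"

definition orbit :: "('m \<Rightarrow> 'x \<Rightarrow> 'x) \<Rightarrow> 'm set \<Rightarrow> 'x \<Rightarrow> 'x set"
  where "orbit \<phi> N x = (\<lambda>g. \<phi> g x) ` N"

definition periodic :: "('m \<Rightarrow> 'x \<Rightarrow> 'x) \<Rightarrow> 'm set \<Rightarrow> 'x \<Rightarrow> bool"
  where "periodic \<phi> N x \<longleftrightarrow>
    finite (orbit \<phi> N x) \<and> (\<forall>g\<in>N. bij_betw (\<phi> g) (orbit \<phi> N x) (orbit \<phi> N x))"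

end

theory Submission
  imports Defs
    "HOL-Algebra.Finite_Extensions"
    "HOL-Computational_Algebra.Primes"
begin

text \<open>Either of the conditions (b) and (c) makes every point of the orbit periodic under
  every single element of the monoid: for (b) one applies it to the submonoid generated by f and
  g, for (c) to a conjugate of f (two_generated_cyclic, group_cyclic). Conversely, if the orbit of
  x has this property and is finite, then x is periodic under the monoid (cyclic_finite_periodic).
  The theorem therefore says that an orbit all of whose points have finite cycles under all
  elements is finite (finite_orbit), and this is proved by reduction modulo primes, with words in
  the generators in place of the elements of the monoid.

  The variety enters only through an atlas: finitely many affine charts, each with finitely many
  coordinates that separate its rational points, in which an endomorphism is given locally by
  fractions of polynomials whose denominators generate the unit ideal. All coefficients that occur
  in the formulas for the generators, and the coordinates of the point, lie in a finitely
  generated subring of the field. Such a ring is contained in a valuation ring of the field so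
  that only finitely many residues of its elements occur and a prescribed positive integer is a
  unit (finite_residue_valuation). This combines Chevalley's extension theorem
  (extend_to_valuation_ring) with induction on the number of ring generators.

  Fix such a valuation ring. Consider pairs of a chart and a point whose coordinates in that chart
  are integral, with residues from the finite set. They fall into finitely many residue discs. At
  every pair one of the denominators is a unit, and choosing the first such formula lifts each
  generator to a map of pairs. It maps discs into discs and is differentiable on each of them:
  differences of coordinates are transformed by a linear form up to terms of strictly larger value
  (lift_smooth). Say that two words are equal in jets if they agree in this sense to first order
  on every disc. This is a congruence on words, and it has finite index because there are only
  finitely many discs and finitely many linear forms over the finite residue ring
  (jet_eq_finite_index).

  Suppose that w and ww are equal in jets, and that z lies on a cycle of length q under the lift
  of w, where q is a unit of the valuation ring. The points z, wz, wwz, ... lie in one disc, and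
  to first order any two consecutive differences agree. They sum to zero over the cycle, so q
  times the first difference is negligible in comparison with the largest difference on the cycle.
  Since q is a unit, all differences are negligible in comparison with the largest one, which is
  therefore zero: w fixes z (jet_idempotent_fixes). Hence the period of a point under a word w of
  this kind is divisible by no prime that is a unit (period_coprime). With two valuation rings of
  different residue characteristics this leaves only the period 1. So every word that is
  idempotent modulo the common refinement of the two congruences fixes x, and then a general
  argument about finite monoids shows that the point wx depends only on the class of the word w
  (finite_orbit_of_congruence).

  It remains to construct the atlas. A morphism from the spectrum of k to V is replaced by the
  point that it hits together with the values of sections there (kpoint). In an affine chart these
  values determine the point (kpoint_determined), and an endomorphism is locally given by
  fractions (endo_formulas). Finitely many of these suffice by the partition of unity for the
  spectrum (endo_covers).\<close>

section \<open>Extension of subrings to valuation rings\<close>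

context field
begin

definition valuation_ring :: "'a set \<Rightarrow> bool"
  where "valuation_ring B \<longleftrightarrow> subring B R \<and> (\<forall>x\<in>carrier R. x \<noteq> \<zero> \<longrightarrow> x \<in> B \<or> inv x \<in> B)"

definition nonunits :: "'a set \<Rightarrow> 'a set"
  where "nonunits B = {x \<in> B. x = \<zero> \<or> inv x \<notin> B}"

definition ideal_of :: "'a set \<Rightarrow> 'a set \<Rightarrow> bool"
  where "ideal_of B I \<longleftrightarrow> I \<subseteq> B \<and> \<zero> \<in> I \<and> (\<forall>u\<in>I. \<forall>v\<in>I. u \<oplus> v \<in> I) \<and>
    (\<forall>b\<in>B. \<forall>u\<in>I. b \<otimes> u \<in> I)"

text \<open>The polynomials in a with n coefficients from I, in Horner form. For an ideal I of the
  ring B their union over n is the ideal of B[a] that is generated by I. Bounding the degree by n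
  is what the descent in polys_no_both works with.\<close>

primrec polys :: "'a set \<Rightarrow> 'a \<Rightarrow> nat \<Rightarrow> 'a set" where
  "polys I a 0 = {\<zero>}"
| "polys I a (Suc n) = {u \<oplus> a \<otimes> w | u w. u \<in> I \<and> w \<in> polys I a n}"

lemma polys_SucI: "u \<in> I \<Longrightarrow> w \<in> polys I a n \<Longrightarrow> u \<oplus> a \<otimes> w \<in> polys I a (Suc n)"
  by auto

lemma polys_SucE:
  assumes "z \<in> polys I a (Suc n)"
  obtains u w where "u \<in> I" "w \<in> polys I a n" "z = u \<oplus> a \<otimes> w"
  using assms by auto

declare polys.simps(2) [simp del]

lemma nonzero_inv:
  assumes "x \<in> carrier R" "x \<noteq> \<zero>"
  shows "inv x \<in> carrier R" "x \<otimes> inv x = \<one>" "inv x \<otimes> x = \<one>" "inv x \<noteq> \<zero>"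
proof -
  have u: "x \<in> Units R" using assms field_Units by auto
  show c: "inv x \<in> carrier R" "x \<otimes> inv x = \<one>" "inv x \<otimes> x = \<one>"
    using u by simp_all
  show "inv x \<noteq> \<zero>" using c(2) assms(1) by force
qed

lemma inv_unique_field:
  assumes "x \<in> carrier R" "y \<in> carrier R" "x \<otimes> y = \<one>"
  shows "inv x = y"
  using comm_inv_char[OF assms] .

lemma ideal_of_carrier:
  assumes "subring B R" "ideal_of B I"
  shows "I \<subseteq> B" "B \<subseteq> carrier R" "I \<subseteq> carrier R" "\<zero> \<in> I"
    "\<And>u v. u \<in> I \<Longrightarrow> v \<in> I \<Longrightarrow> u \<oplus> v \<in> I" "\<And>u b. b \<in> B \<Longrightarrow> u \<in> I \<Longrightarrow> b \<otimes> u \<in> I"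
    "\<And>u b. b \<in> B \<Longrightarrow> u \<in> I \<Longrightarrow> u \<otimes> b \<in> I"
    "\<And>u. u \<in> I \<Longrightarrow> \<ominus> u \<in> I"
    "\<And>u v. u \<in> I \<Longrightarrow> v \<in> I \<Longrightarrow> u \<ominus> v \<in> I"
proof -
  note B = subringE[OF assms(1)]
  show c: "I \<subseteq> B" "B \<subseteq> carrier R" "I \<subseteq> carrier R" "\<zero> \<in> I"
    using B(1) assms(2) unfolding ideal_of_def by auto
  show a: "\<And>u v. u \<in> I \<Longrightarrow> v \<in> I \<Longrightarrow> u \<oplus> v \<in> I"
    and m: "\<And>u b. b \<in> B \<Longrightarrow> u \<in> I \<Longrightarrow> b \<otimes> u \<in> I"
    using assms(2) unfolding ideal_of_def by auto
  show "u \<otimes> b \<in> I" if "b \<in> B" "u \<in> I" for u b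
  proof -
    have "u \<otimes> b = b \<otimes> u" using that c by (intro m_comm) blast+
    thus ?thesis using m[OF that] by simp
  qed
  show n: "\<ominus> u \<in> I" if "u \<in> I" for u
  proof -
    have "\<ominus> \<one> \<otimes> u \<in> I" using m B(3,5) that by blast
    thus ?thesis using subsetD[OF c(3) that] by (simp add: l_minus)
  qed
  show "\<And>u v. u \<in> I \<Longrightarrow> v \<in> I \<Longrightarrow> u \<ominus> v \<in> I"
    unfolding a_minus_def by (rule a[OF _ n])
qed

lemma ideal_of_self: "subring B R \<Longrightarrow> ideal_of B B"
  unfolding ideal_of_def by (intro conjI ballI subset_refl) (use subringE(2,6,7) in auto)

lemma polys_props:
  assumes B: "subring B R" and I: "ideal_of B I" and a: "a \<in> carrier R"
  shows polys_carrier: "polys I a n \<subseteq> carrier R"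
    and polys_zero: "\<zero> \<in> polys I a n"
    and polys_add: "w \<in> polys I a n \<Longrightarrow> z \<in> polys I a n \<Longrightarrow> w \<oplus> z \<in> polys I a n"
    and polys_scale: "b \<in> B \<Longrightarrow> w \<in> polys I a n \<Longrightarrow> b \<otimes> w \<in> polys I a n"
    and polys_shift: "w \<in> polys I a n \<Longrightarrow> a \<otimes> w \<in> polys I a (Suc n)"
    and polys_Suc: "polys I a n \<subseteq> polys I a (Suc n)"
    and polys_const: "u \<in> I \<Longrightarrow> u \<in> polys I a (Suc n)"
proof -
  note c = ideal_of_carrier[OF B I]
  show car: "polys I a n \<subseteq> carrier R" for n
  proof (induct n)
    case (Suc n)
    show ?case
    proof
      fix z assume "z \<in> polys I a (Suc n)"
      thus "z \<in> carrier R" by (rule polys_SucE) (use Suc c(3) a in blast)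
    qed
  qed simp
  show z: "\<zero> \<in> polys I a n" for n
  proof (induct n)
    case (Suc n)
    have "\<zero> = \<zero> \<oplus> a \<otimes> \<zero>" using a by simp
    thus ?case using polys_SucI[OF c(4) Suc] by simp
  qed simp
  show "w \<in> polys I a n \<Longrightarrow> z \<in> polys I a n \<Longrightarrow> w \<oplus> z \<in> polys I a n"
  proof (induct n arbitrary: w z)
    case (Suc n)
    obtain u w' where h1: "u \<in> I" "w' \<in> polys I a n" "w = u \<oplus> a \<otimes> w'"
      using Suc.prems(1) by (rule polys_SucE)
    obtain v z' where h2: "v \<in> I" "z' \<in> polys I a n" "z = v \<oplus> a \<otimes> z'"
      using Suc.prems(2) by (rule polys_SucE)
    note h = h1(3) h2(3) h1(1) h2(1) h1(2) h2(2)
    have k: "u \<in> carrier R" "v \<in> carrier R" "w' \<in> carrier R" "z' \<in> carrier R"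
      using h(3-6) subsetD[OF c(3)] subsetD[OF car] by blast+
    have "w \<oplus> z = (u \<oplus> v) \<oplus> a \<otimes> (w' \<oplus> z')"
      unfolding h using k a by algebra
    thus ?case using polys_SucI[OF c(5)[OF h(3,4)] Suc.hyps[OF h(5,6)]] by simp
  qed auto
  show "b \<in> B \<Longrightarrow> w \<in> polys I a n \<Longrightarrow> b \<otimes> w \<in> polys I a n"
  proof (induct n arbitrary: w)
    case (Suc n)
    obtain u w' where h: "u \<in> I" "w' \<in> polys I a n" "w = u \<oplus> a \<otimes> w'"
      using Suc.prems(2) by (rule polys_SucE)
    have k: "u \<in> carrier R" "w' \<in> carrier R" "b \<in> carrier R"
      using h(1,2) subsetD[OF c(2)] subsetD[OF c(3)] subsetD[OF car] Suc.prems(1) by blast+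
    have "b \<otimes> w = (b \<otimes> u) \<oplus> a \<otimes> (b \<otimes> w')"
      unfolding h using k a by algebra
    thus ?case using polys_SucI[OF c(6)[OF Suc.prems(1) h(1)] Suc.hyps[OF Suc.prems(1) h(2)]] by simp
  qed (use c(2) in auto)
  show sh: "w \<in> polys I a n \<Longrightarrow> a \<otimes> w \<in> polys I a (Suc n)" for w n
  proof -
    assume h: "w \<in> polys I a n"
    have "a \<otimes> w = \<zero> \<oplus> a \<otimes> w" using subsetD[OF car h] a by simp
    thus ?thesis using polys_SucI[OF c(4) h] by simp
  qed
  show "polys I a n \<subseteq> polys I a (Suc n)"
  proof (induct n)
    case 0
    then show ?case using z[of 1] by simp
  next
    case (Suc n)
    show ?case
    proof
      fix w assume "w \<in> polys I a (Suc n)"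
      then obtain u w' where "u \<in> I" "w' \<in> polys I a n" "w = u \<oplus> a \<otimes> w'" by (rule polys_SucE)
      thus "w \<in> polys I a (Suc (Suc n))" using polys_SucI[of u I w' a "Suc n"] Suc by blast
    qed
  qed
  show "u \<in> I \<Longrightarrow> u \<in> polys I a (Suc n)"
  proof -
    assume h: "u \<in> I"
    have "u = u \<oplus> a \<otimes> \<zero>" using subsetD[OF c(3) h] a by simp
    thus ?thesis using polys_SucI[OF h z[of n]] by simp
  qed
qed

lemma polys_mono:
  assumes B: "subring B R" and I: "ideal_of B I" and a: "a \<in> carrier R" and "n \<le> m"
  shows "polys I a n \<subseteq> polys I a m"
  using \<open>n \<le> m\<close> by (induct rule: dec_induct) (use polys_Suc[OF B I a] in blast)+

lemma polys_shift_pow: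
  assumes B: "subring B R" and I: "ideal_of B I" and a: "a \<in> carrier R" and "w \<in> polys I a n"
  shows "a [^] (k::nat) \<otimes> w \<in> polys I a (n + k)"
proof (induct k)
  case 0
  then show ?case using assms(4) subsetD[OF polys_carrier[OF B I a] assms(4)] by simp
next
  case (Suc k)
  have "a [^] Suc k \<otimes> w = a \<otimes> (a [^] k \<otimes> w)"
    using a assms(4) polys_carrier[OF B I a, of n] by (auto simp: m_ac)
  thus ?case using polys_shift[OF B I a Suc] by simp
qed

text \<open>Horner form splits off the constant coefficient; this splits off the leading one.\<close>

lemma polys_top:
  assumes B: "subring B R" and I: "ideal_of B I" and a: "a \<in> carrier R"
    and "w \<in> polys I a (Suc n)"
  shows "\<exists>w'\<in>polys I a n. \<exists>u\<in>I. w = w' \<oplus> u \<otimes> a [^] n"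
  using assms(4)
proof (induct n arbitrary: w)
  case 0
  then obtain u z where u: "u \<in> I" "z \<in> polys I a 0" "w = u \<oplus> a \<otimes> z" by (rule polys_SucE)
  hence "w = \<zero> \<oplus> u \<otimes> a [^] (0::nat)" using a subsetD[OF ideal_of_carrier(3)[OF B I] u(1)] by simp
  thus ?case using u(1) by auto
next
  case (Suc n)
  obtain u z where h: "u \<in> I" "z \<in> polys I a (Suc n)" "w = u \<oplus> a \<otimes> z"
    using Suc.prems by (rule polys_SucE)
  then obtain z' v where z: "z' \<in> polys I a n" "v \<in> I" "z = z' \<oplus> v \<otimes> a [^] n"
    using Suc.hyps by blast
  have k: "u \<in> carrier R" "z' \<in> carrier R" "v \<in> carrier R" "a [^] n \<in> carrier R"
    using h(1) z(1,2) subsetD[OF ideal_of_carrier(3)[OF B I]] subsetD[OF polys_carrier[OF B I a]] a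
    by blast+
  have "w = (u \<oplus> a \<otimes> z') \<oplus> v \<otimes> (a [^] n \<otimes> a)"
    unfolding h z using k a by algebra
  moreover have "u \<oplus> a \<otimes> z' \<in> polys I a (Suc n)" using polys_SucI[OF h(1) z(1)] .
  ultimately show ?case using z(2) by (metis nat_pow_Suc)
qed

definition all_polys :: "'a set \<Rightarrow> 'a \<Rightarrow> 'a set"
  where "all_polys I a = (\<Union>n. polys I a n)"

lemma all_polysI: "w \<in> polys I a n \<Longrightarrow> w \<in> all_polys I a"
  unfolding all_polys_def by auto

lemma all_polys_add:
  assumes B: "subring B R" and I: "ideal_of B I" and a: "a \<in> carrier R"
    and "w \<in> all_polys I a" "z \<in> all_polys I a"
  shows "w \<oplus> z \<in> all_polys I a"
proof -
  obtain n m where "w \<in> polys I a n" "z \<in> polys I a m"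
    using assms unfolding all_polys_def by auto
  hence "w \<in> polys I a (max n m)" "z \<in> polys I a (max n m)"
    using polys_mono[OF B I a, of n "max n m"] polys_mono[OF B I a, of m "max n m"] by auto
  thus ?thesis using polys_add[OF B I a] all_polysI by blast
qed

lemma all_polys_mult:
  assumes B: "subring B R" and I: "ideal_of B I" and a: "a \<in> carrier R"
    and "w \<in> all_polys I a" "z \<in> polys B a m"
  shows "z \<otimes> w \<in> all_polys I a"
  using assms(5)
proof (induct m arbitrary: z)
  case 0
  obtain n where "w \<in> polys I a n" using assms(4) unfolding all_polys_def by auto
  hence "w \<in> carrier R" using polys_carrier[OF B I a] by auto
  thus ?case using 0 polys_zero[OF B I a, of 0] all_polysI by (metis l_null polys.simps(1) singletonD)
next
  case (Suc m)
  obtain n where n: "w \<in> polys I a n" using assms(4) unfolding all_polys_def by auto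
  obtain b z' where h: "b \<in> B" "z' \<in> polys B a m" "z = b \<oplus> a \<otimes> z'"
    using Suc.prems by (rule polys_SucE)
  have k: "w \<in> carrier R" "b \<in> carrier R" "z' \<in> carrier R"
    using n h subsetD[OF polys_carrier[OF B I a]] subsetD[OF subringE(1)[OF B]]
      subsetD[OF polys_carrier[OF B ideal_of_self[OF B] a]] by blast+
  have "z \<otimes> w = b \<otimes> w \<oplus> a \<otimes> (z' \<otimes> w)" unfolding h using k a by algebra
  moreover have "b \<otimes> w \<in> all_polys I a" using polys_scale[OF B I a h(1) n] all_polysI by blast
  moreover have "a \<otimes> (z' \<otimes> w) \<in> all_polys I a"
  proof -
    obtain l where "z' \<otimes> w \<in> polys I a l" using Suc.hyps[OF h(2)] unfolding all_polys_def by auto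
    thus ?thesis using polys_shift[OF B I a] all_polysI by blast
  qed
  ultimately show ?case using all_polys_add[OF B I a] by simp
qed

lemma all_polys_ideal:
  assumes B: "subring B R" and I: "ideal_of B I" and a: "a \<in> carrier R"
  shows "subring (all_polys B a) R" "ideal_of (all_polys B a) (all_polys I a)"
    "B \<subseteq> all_polys B a" "I \<subseteq> all_polys I a" "a \<in> all_polys B a"
proof -
  note BB = ideal_of_self[OF B]
  have one: "\<one> \<in> all_polys B a" using polys_const[OF B BB a subringE(3)[OF B]] all_polysI by blast
  have car: "all_polys B a \<subseteq> carrier R"
    using polys_carrier[OF B BB a] unfolding all_polys_def by auto
  show s: "subring (all_polys B a) R"
  proof (rule subringI[OF car one])
    fix h1 h2 assume h: "h1 \<in> all_polys B a" "h2 \<in> all_polys B a"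
    show m: "h1 \<otimes> h2 \<in> all_polys B a"
    proof -
      obtain m where "h1 \<in> polys B a m" using h(1) unfolding all_polys_def by auto
      thus ?thesis using all_polys_mult[OF B BB a h(2)] by simp
    qed
    show "h1 \<oplus> h2 \<in> all_polys B a" by (rule all_polys_add[OF B BB a h])
  next
    fix h1 assume h: "h1 \<in> all_polys B a"
    have "\<ominus> \<one> \<in> B" using subringE(3,5)[OF B] by auto
    moreover obtain m where "h1 \<in> polys B a m" using h unfolding all_polys_def by auto
    ultimately have "\<ominus> \<one> \<otimes> h1 \<in> all_polys B a"
      using polys_scale[OF B BB a] all_polysI by blast
    moreover have "\<ominus> \<one> \<otimes> h1 = \<ominus> h1" using subsetD[OF car h] by (simp add: l_minus)
    ultimately show "\<ominus> h1 \<in> all_polys B a" by simp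
  qed
  have sub: "polys I a n \<subseteq> polys B a n" for n
  proof (induct n)
    case (Suc n)
    show ?case
    proof
      fix z assume "z \<in> polys I a (Suc n)"
      then obtain u w where "u \<in> I" "w \<in> polys I a n" "z = u \<oplus> a \<otimes> w" by (rule polys_SucE)
      thus "z \<in> polys B a (Suc n)" using polys_SucI[of u B w a n] Suc ideal_of_carrier(1)[OF B I] by blast
    qed
  qed simp
  show "ideal_of (all_polys B a) (all_polys I a)"
    unfolding ideal_of_def
  proof (intro conjI ballI)
    show "all_polys I a \<subseteq> all_polys B a" using sub unfolding all_polys_def by blast
    show "\<zero> \<in> all_polys I a" using polys_zero[OF B I a] all_polysI by blast
    show "u \<oplus> v \<in> all_polys I a" if "u \<in> all_polys I a" "v \<in> all_polys I a" for u v
      using all_polys_add[OF B I a that] .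
    show "b \<otimes> u \<in> all_polys I a" if bu: "b \<in> all_polys B a" "u \<in> all_polys I a" for b u
    proof -
      obtain m where "b \<in> polys B a m" using bu(1) unfolding all_polys_def[of B] by blast
      thus ?thesis using all_polys_mult[OF B I a bu(2)] by simp
    qed
  qed
  show "B \<subseteq> all_polys B a" using polys_const[OF B BB a] all_polysI by blast
  show "I \<subseteq> all_polys I a" using polys_const[OF B I a] all_polysI by blast
  have "a \<otimes> \<one> \<in> all_polys B a"
    by (rule all_polysI[OF polys_shift[OF B BB a polys_const[OF B BB a subringE(3)[OF B]]]])
  thus "a \<in> all_polys B a" using a by simp
qed

text \<open>Such pairs, ordered by inclusion of both components, are the domain of Zorn's lemma in
  the proof of Chevalley's extension theorem.\<close>

definition proper_pair :: "'a set \<Rightarrow> 'a set \<Rightarrow> bool"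
  where "proper_pair B I \<longleftrightarrow> subring B R \<and> ideal_of B I \<and> \<one> \<notin> I"

lemma chain_two:
  assumes "subset.chain A C" "M \<in> C" "N \<in> C"
  obtains L where "L \<in> C" "M \<subseteq> L" "N \<subseteq> L"
proof -
  have "M \<subseteq> N \<or> N \<subseteq> M" using assms unfolding subset_chain_def by auto
  thus thesis using that[of M] that[of N] assms(2,3) by auto
qed

text \<open>A pair of sets is encoded by its disjoint union, which turns the order on pairs into
  inclusion of sets, as Zorn's lemma for sets requires.\<close>

lemma proper_pair_chain_union:
  assumes C: "C \<noteq> {}" and chain: "subset.chain {M. proper_pair (Inl -` M) (Inr -` M)} C"
  shows "proper_pair (Inl -` \<Union>C) (Inr -` \<Union>C)"
proof -
  have p: "proper_pair (Inl -` M) (Inr -` M)" if "M \<in> C" for M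
    using chain that unfolding subset_chain_def by auto
  have B: "subring (Inl -` M) R" and I: "ideal_of (Inl -` M) (Inr -` M)" and n: "Inr \<one> \<notin> M"
    if "M \<in> C" for M
    using p[OF that] unfolding proper_pair_def by auto
  note s = subringE[OF B]
  note i = ideal_of_carrier[OF B I]
  obtain M0 where M0: "M0 \<in> C" using C by auto
  have sub: "subring (Inl -` \<Union>C) R"
  proof (rule subringI)
    show "Inl -` \<Union>C \<subseteq> carrier R" using s(1) by blast
    show "\<one> \<in> Inl -` \<Union>C" using s(3)[OF M0] M0 by blast
  next
    fix h assume "h \<in> Inl -` \<Union>C"
    then obtain M where "M \<in> C" "h \<in> Inl -` M" by auto
    thus "\<ominus> h \<in> Inl -` \<Union>C" using s(5)[of M h] by blast
  next
    fix h k assume "h \<in> Inl -` \<Union>C" "k \<in> Inl -` \<Union>C"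
    then obtain M N where "M \<in> C" "h \<in> Inl -` M" "N \<in> C" "k \<in> Inl -` N" by auto
    moreover then obtain L where "L \<in> C" "M \<subseteq> L" "N \<subseteq> L" using chain_two[OF chain] by metis
    ultimately have L: "L \<in> C" "h \<in> Inl -` L" "k \<in> Inl -` L" by auto
    show "h \<otimes> k \<in> Inl -` \<Union>C" using s(6)[OF L] L(1) by blast
    show "h \<oplus> k \<in> Inl -` \<Union>C" using s(7)[OF L] L(1) by blast
  qed
  have "ideal_of (Inl -` \<Union>C) (Inr -` \<Union>C)"
    unfolding ideal_of_def
  proof (intro conjI ballI)
    show "Inr -` \<Union>C \<subseteq> Inl -` \<Union>C" using i(1) by blast
    show "\<zero> \<in> Inr -` \<Union>C" using i(4)[OF M0 M0] M0 by blast
  next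
    fix h k assume "h \<in> Inr -` \<Union>C" "k \<in> Inr -` \<Union>C"
    then obtain M N where "M \<in> C" "h \<in> Inr -` M" "N \<in> C" "k \<in> Inr -` N" by auto
    moreover then obtain L where "L \<in> C" "M \<subseteq> L" "N \<subseteq> L" using chain_two[OF chain] by metis
    ultimately have L: "L \<in> C" "h \<in> Inr -` L" "k \<in> Inr -` L" by auto
    show "h \<oplus> k \<in> Inr -` \<Union>C" using i(5)[OF L(1) L] L(1) by blast
  next
    fix h k assume "h \<in> Inl -` \<Union>C" "k \<in> Inr -` \<Union>C"
    then obtain M N where "M \<in> C" "h \<in> Inl -` M" "N \<in> C" "k \<in> Inr -` N" by auto
    moreover then obtain L where "L \<in> C" "M \<subseteq> L" "N \<subseteq> L" using chain_two[OF chain] by metis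
    ultimately have L: "L \<in> C" "h \<in> Inl -` L" "k \<in> Inr -` L" by auto
    show "h \<otimes> k \<in> Inr -` \<Union>C" using i(6)[OF L(1) L] L(1) by blast
  qed
  thus ?thesis unfolding proper_pair_def using sub n by blast
qed

lemma maximal_proper_pair:
  assumes "proper_pair A J"
  obtains B I where "proper_pair B I" "A \<subseteq> B" "J \<subseteq> I"
    "\<And>B' I'. proper_pair B' I' \<Longrightarrow> B \<subseteq> B' \<Longrightarrow> I \<subseteq> I' \<Longrightarrow> B' = B \<and> I' = I"
proof -
  define \<A> where "\<A> = {M. proper_pair (Inl -` M) (Inr -` M)} \<inter> {M. A <+> J \<subseteq> M}"
  have "\<exists>M\<in>\<A>. \<forall>N\<in>\<A>. M \<subseteq> N \<longrightarrow> N = M"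
  proof (rule subset_Zorn_nonempty)
    have "Inl -` (A <+> J) = A" "Inr -` (A <+> J) = J" by auto
    hence "A <+> J \<in> \<A>" using assms unfolding \<A>_def by simp
    thus "\<A> \<noteq> {}" by blast
  next
    fix C assume C: "C \<noteq> {}" "subset.chain \<A> C"
    have "subset.chain {M. proper_pair (Inl -` M) (Inr -` M)} C"
      using C(2) unfolding \<A>_def subset_chain_def by blast
    from proper_pair_chain_union[OF C(1) this]
    have "proper_pair (Inl -` \<Union>C) (Inr -` \<Union>C)" .
    moreover have "A <+> J \<subseteq> \<Union>C" using C unfolding \<A>_def subset_chain_def by blast
    ultimately show "\<Union>C \<in> \<A>" unfolding \<A>_def by blast
  qed
  then obtain M where M: "M \<in> \<A>" and max: "\<And>N. N \<in> \<A> \<Longrightarrow> M \<subseteq> N \<Longrightarrow> N = M" by blast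
  show thesis
  proof (rule that[of "Inl -` M" "Inr -` M"])
    show "proper_pair (Inl -` M) (Inr -` M)" using M unfolding \<A>_def by blast
    show "A \<subseteq> Inl -` M" "J \<subseteq> Inr -` M" using M unfolding \<A>_def by blast+
    fix B' I' assume h: "proper_pair B' I'" "Inl -` M \<subseteq> B'" "Inr -` M \<subseteq> I'"
    have e: "Inl -` (B' <+> I') = B'" "Inr -` (B' <+> I') = I'" by auto
    have s: "M \<subseteq> B' <+> I'"
    proof
      fix z assume "z \<in> M"
      thus "z \<in> B' <+> I'" using h(2,3) by (cases z) auto
    qed
    hence "B' <+> I' \<in> \<A>" using h(1) M unfolding \<A>_def by (auto simp: e)
    from max[OF this s] have "B' <+> I' = M" .
    thus "B' = Inl -` M \<and> I' = Inr -` M" using e by blast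
  qed
qed

text \<open>A polynomial of degree less than l in c = 1/a becomes a polynomial in a after
  multiplication by the power of a with exponent l - 1. That power is written with exponent l and
  the additional factor c, so that l = 0 is no exception.\<close>

lemma polys_reverse:
  assumes B: "subring B R" and I: "ideal_of B I" and a: "a \<in> carrier R" and c: "c \<in> carrier R"
    and ac: "a \<otimes> c = \<one>" and "w \<in> polys I c l"
  shows "c \<otimes> (w \<otimes> a [^] l) \<in> polys I a l"
  using assms(6)
proof (induct l arbitrary: w)
  case 0
  then show ?case using c by simp
next
  case (Suc l)
  obtain u z where h: "u \<in> I" "z \<in> polys I c l" "w = u \<oplus> c \<otimes> z"
    using Suc.prems by (rule polys_SucE)
  have k: "u \<in> carrier R" "z \<in> carrier R" "a [^] l \<in> carrier R"
    using subsetD[OF ideal_of_carrier(3)[OF B I] h(1)] subsetD[OF polys_carrier[OF B I c] h(2)] a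
    by simp_all
  have "c \<otimes> (w \<otimes> a [^] Suc l) = (a \<otimes> c) \<otimes> (a [^] l \<otimes> u) \<oplus> (a \<otimes> c) \<otimes> (c \<otimes> (z \<otimes> a [^] l))"
    unfolding h nat_pow_Suc using k a c by algebra
  also have "\<dots> = a [^] l \<otimes> u \<oplus> c \<otimes> (z \<otimes> a [^] l)" using ac k c by simp
  finally have e: "c \<otimes> (w \<otimes> a [^] Suc l) = a [^] l \<otimes> u \<oplus> c \<otimes> (z \<otimes> a [^] l)" .
  have "a [^] l \<otimes> u \<in> polys I a (Suc 0 + l)"
    by (rule polys_shift_pow[OF B I a polys_const[OF B I a h(1)]])
  moreover have "c \<otimes> (z \<otimes> a [^] l) \<in> polys I a (Suc l)"
    using Suc.hyps[OF h(2)] polys_Suc[OF B I a] by blast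
  ultimately show ?case unfolding e using polys_add[OF B I a] by simp
qed

text \<open>Chevalley's descent. The relation in c = 1/a, whose degree is not the larger one, can
  be solved for 1 because its constant coefficient v is such that 1 - v is a unit. After
  multiplication by a power of a it expresses the leading power of a in the other relation by
  lower ones.\<close>

lemma polys_reduce:
  assumes B: "subring B R" and I: "ideal_of B I" and a: "a \<in> carrier R" and c: "c \<in> carrier R"
    and ac: "a \<otimes> c = \<one>" and units: "\<And>v. v \<in> I \<Longrightarrow> \<exists>e\<in>B. e \<otimes> (\<one> \<ominus> v) = \<one>"
    and n: "\<one> \<in> polys I a n" and l: "\<one> \<in> polys I c l" and le: "l \<le> n"
  shows "\<exists>n'<n. \<one> \<in> polys I a n'"
proof -
  obtain n' where n': "n = Suc n'" using n by (cases n) auto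
  obtain l' where l': "l = Suc l'" using l by (cases l) auto
  obtain v w where vw: "v \<in> I" "w \<in> polys I c l'" "\<one> = v \<oplus> c \<otimes> w"
    using l unfolding l' by (rule polys_SucE)
  obtain e where e: "e \<in> B" "e \<otimes> (\<one> \<ominus> v) = \<one>" using units[OF vw(1)] by blast
  have k: "v \<in> carrier R" "w \<in> carrier R" "e \<in> carrier R"
    using subsetD[OF ideal_of_carrier(3)[OF B I] vw(1)] subsetD[OF polys_carrier[OF B I c] vw(2)]
      subsetD[OF subringE(1)[OF B] e(1)] by simp_all
  have "\<one> \<ominus> v = c \<otimes> w"
  proof -
    have "(v \<oplus> c \<otimes> w) \<ominus> v = c \<otimes> w" using k c by algebra
    thus ?thesis using vw(3) by simp
  qed
  hence ecw: "e \<otimes> (c \<otimes> w) = \<one>" using e(2) by simp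
  have "c \<otimes> (w \<otimes> a [^] l') \<in> polys I a l'" by (rule polys_reverse[OF B I a c ac vw(2)])
  hence "a [^] (n' - l') \<otimes> (e \<otimes> (c \<otimes> (w \<otimes> a [^] l'))) \<in> polys I a (l' + (n' - l'))"
    by (intro polys_shift_pow[OF B I a] polys_scale[OF B I a e(1)])
  moreover have "l' + (n' - l') = n'" using le l' n' by simp
  moreover have "a [^] (n' - l') \<otimes> (e \<otimes> (c \<otimes> (w \<otimes> a [^] l'))) = a [^] n'"
  proof -
    have p: "a [^] (n' - l') \<in> carrier R" "a [^] l' \<in> carrier R" using a by simp_all
    have "a [^] (n' - l') \<otimes> (e \<otimes> (c \<otimes> (w \<otimes> a [^] l')))
      = (e \<otimes> (c \<otimes> w)) \<otimes> (a [^] (n' - l') \<otimes> a [^] l')"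
      using p k c by algebra
    also have "\<dots> = a [^] n'" using ecw a le l' n' by (simp add: nat_pow_mult)
    finally show ?thesis .
  qed
  ultimately have an: "a [^] n' \<in> polys I a n'" by simp
  obtain w' u where wu: "w' \<in> polys I a n'" "u \<in> I" "\<one> = w' \<oplus> u \<otimes> a [^] n'"
    using polys_top[OF B I a n[unfolded n']] by blast
  have "u \<otimes> a [^] n' \<in> polys I a n'"
    using polys_scale[OF B I a _ an] wu(2) ideal_of_carrier(1)[OF B I] by blast
  hence "\<one> \<in> polys I a n'" using wu polys_add[OF B I a] by metis
  thus ?thesis using n' by blast
qed

text \<open>Two such relations would lead to an infinite descent, since the larger of the two
  degrees can always be lowered.\<close>

lemma polys_no_both:
  assumes B: "subring B R" and I: "ideal_of B I"
    and units: "\<And>v. v \<in> I \<Longrightarrow> \<exists>e\<in>B. e \<otimes> (\<one> \<ominus> v) = \<one>"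
  shows "a \<in> carrier R \<Longrightarrow> c \<in> carrier R \<Longrightarrow> a \<otimes> c = \<one> \<Longrightarrow>
    \<one> \<in> polys I a n \<Longrightarrow> \<one> \<in> polys I c l \<Longrightarrow> False"
proof (induct "n + l" arbitrary: a c n l rule: less_induct)
  case less
  show ?case
  proof (cases "l \<le> n")
    case True
    then obtain n' where "n' < n" "\<one> \<in> polys I a n'"
      using polys_reduce[OF B I less.prems(1-3) units less.prems(4,5)] by blast
    thus False using less.hyps[of n' l a c] less.prems by simp
  next
    case False
    have ca: "c \<otimes> a = \<one>" using less.prems m_comm by simp
    obtain l' where "l' < l" "\<one> \<in> polys I c l'"
      using polys_reduce[OF B I less.prems(2,1) ca units less.prems(5,4)] False by auto
    thus False using less.hyps[of n l' a c] less.prems by simp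
  qed
qed

text \<open>Multiplication by a power of d clears the denominators of a polynomial in 1/d.\<close>

lemma polys_clear:
  assumes B: "subring B R" and I: "ideal_of B I" and a: "a \<in> carrier R" and d: "d \<in> B"
    and ad: "a \<otimes> d = \<one>" and "w \<in> polys I a n"
  shows "w \<otimes> d [^] n \<in> I"
  using assms(6)
proof (induct n arbitrary: w)
  case 0
  then show ?case using ideal_of_carrier(4)[OF B I] subringE(1)[OF B] d by auto
next
  case (Suc n)
  obtain u z where h: "u \<in> I" "z \<in> polys I a n" "w = u \<oplus> a \<otimes> z"
    using Suc.prems by (rule polys_SucE)
  have dc: "d \<in> carrier R" using d subringE(1)[OF B] by blast
  have k: "u \<in> carrier R" "z \<in> carrier R" "d [^] n \<in> carrier R"
    using subsetD[OF ideal_of_carrier(3)[OF B I] h(1)] subsetD[OF polys_carrier[OF B I a] h(2)] dc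
    by simp_all
  have "w \<otimes> d [^] Suc n = (d [^] n \<otimes> d) \<otimes> u \<oplus> (a \<otimes> d) \<otimes> (z \<otimes> d [^] n)"
    unfolding h nat_pow_Suc using k a dc by algebra
  also have "\<dots> = d [^] Suc n \<otimes> u \<oplus> z \<otimes> d [^] n" using ad k by simp
  finally have e: "w \<otimes> d [^] Suc n = d [^] Suc n \<otimes> u \<oplus> z \<otimes> d [^] n" .
  have "d [^] m \<in> B" for m :: nat
    by (induct m) (use subringE(3,6)[OF B] d in auto)
  hence "d [^] Suc n \<otimes> u \<in> I" using ideal_of_carrier(6)[OF B I _ h(1)] by blast
  thus ?case unfolding e using Suc.hyps[OF h(2)] ideal_of_carrier(5)[OF B I] by blast
qed

lemma ideal_of_mem_units:
  assumes "proper_pair B I" "x \<in> I" "y \<in> B" "x \<otimes> y = \<one>"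
  shows False
  using assms ideal_of_carrier(7)[of B I y x] unfolding proper_pair_def by auto

text \<open>The element d = 1 - v is congruent to 1 modulo I, so no power of d lies in I. Hence
  1/d can be adjoined to B without making I improper, and by maximality 1/d belongs to B already.\<close>

lemma maximal_proper_pair_units:
  assumes p: "proper_pair B I"
    and max: "\<And>B' I'. proper_pair B' I' \<Longrightarrow> B \<subseteq> B' \<Longrightarrow> I \<subseteq> I' \<Longrightarrow> B' = B \<and> I' = I"
    and v: "v \<in> I"
  shows "\<exists>e\<in>B. e \<otimes> (\<one> \<ominus> v) = \<one>"
proof -
  have B: "subring B R" and I: "ideal_of B I" and n: "\<one> \<notin> I" using p unfolding proper_pair_def by auto
  note c = ideal_of_carrier[OF B I]
  define d where "d = \<one> \<ominus> v"
  have vc: "v \<in> carrier R" and dB: "d \<in> B" and dc: "d \<in> carrier R"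
    using v c(1-3) subringE(3,5,7)[OF B] unfolding d_def a_minus_def by blast+
  have "d \<noteq> \<zero>"
  proof
    assume "d = \<zero>"
    hence "v = \<one>" using vc unfolding d_def by simp
    thus False using v n by simp
  qed
  note a = nonzero_inv[OF dc this]
  have pow: "d [^] m \<in> B \<and> \<one> \<ominus> d [^] m \<in> I" for m :: nat
  proof (induct m)
    case 0
    then show ?case using subringE(3)[OF B] c(4) by (simp add: a_minus_def r_neg)
  next
    case (Suc m)
    have dm: "d [^] m \<in> carrier R" using dc by simp
    have "\<one> \<ominus> d [^] Suc m = (\<one> \<ominus> d [^] m) \<oplus> d [^] m \<otimes> v"
      unfolding nat_pow_Suc d_def using dm vc unfolding d_def by algebra
    moreover have "d [^] m \<otimes> v \<in> I" using Suc c(6) v by blast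
    ultimately show ?case using Suc c(5) subringE(6)[OF B _ dB] by simp
  qed
  have "\<one> \<notin> all_polys I (inv d)"
  proof
    assume "\<one> \<in> all_polys I (inv d)"
    then obtain m where "\<one> \<in> polys I (inv d) m" unfolding all_polys_def by auto
    hence "\<one> \<otimes> d [^] m \<in> I" using polys_clear[OF B I a(1) dB a(3)] by blast
    hence "d [^] m \<in> I" using dc by simp
    hence "(\<one> \<ominus> d [^] m) \<oplus> d [^] m \<in> I" using pow c(5) by blast
    moreover have "(\<one> \<ominus> d [^] m) \<oplus> d [^] m = \<one>" using dc by (simp add: a_minus_def a_assoc l_neg)
    ultimately show False using n by simp
  qed
  hence "proper_pair (all_polys B (inv d)) (all_polys I (inv d))"
    unfolding proper_pair_def using all_polys_ideal[OF B I a(1)] by simp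
  hence "all_polys B (inv d) = B" using max all_polys_ideal[OF B I a(1)] by simp
  hence "inv d \<in> B" using all_polys_ideal(5)[OF B I a(1)] by simp
  thus ?thesis using a(3) unfolding d_def by blast
qed

text \<open>Chevalley's extension theorem. In a maximal pair, if neither x nor 1/x were in B, then
  adjoining either of them would make the ideal improper. This gives two expressions of 1 as a
  polynomial over I, in x and in 1/x, which is impossible by polys_no_both.\<close>

theorem extend_to_valuation_ring:
  assumes "proper_pair A J"
  obtains B where "valuation_ring B" "A \<subseteq> B" "J \<subseteq> nonunits B"
proof -
  obtain B I where p: "proper_pair B I" and AB: "A \<subseteq> B" "J \<subseteq> I"
    and max: "\<And>B' I'. proper_pair B' I' \<Longrightarrow> B \<subseteq> B' \<Longrightarrow> I \<subseteq> I' \<Longrightarrow> B' = B \<and> I' = I"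
    using maximal_proper_pair[OF assms] by blast
  have B: "subring B R" and I: "ideal_of B I" and n: "\<one> \<notin> I" using p unfolding proper_pair_def by auto
  have one: "\<exists>k. \<one> \<in> polys I a k" if a: "a \<in> carrier R" "a \<notin> B" for a
  proof (rule ccontr)
    assume "\<nexists>k. \<one> \<in> polys I a k"
    hence "proper_pair (all_polys B a) (all_polys I a)"
      unfolding proper_pair_def using all_polys_ideal[OF B I a(1)] by (simp add: all_polys_def)
    hence "all_polys B a = B" using max all_polys_ideal[OF B I a(1)] by simp
    thus False using all_polys_ideal(5)[OF B I a(1)] a by simp
  qed
  have "x \<in> B \<or> inv x \<in> B" if x: "x \<in> carrier R" "x \<noteq> \<zero>" for x
  proof (rule ccontr)
    assume "\<not> (x \<in> B \<or> inv x \<in> B)"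
    then obtain k l where "\<one> \<in> polys I x k" "\<one> \<in> polys I (inv x) l"
      using one x(1) nonzero_inv(1)[OF x] by blast
    thus False
      using polys_no_both[OF B I maximal_proper_pair_units[OF p max] x(1)]
        nonzero_inv(1,2)[OF x] by blast
  qed
  hence "valuation_ring B" using B unfolding valuation_ring_def by blast
  moreover have "I \<subseteq> nonunits B"
  proof
    fix u assume u: "u \<in> I"
    have uc: "u \<in> carrier R" using ideal_of_carrier(3)[OF B I] u by blast
    show "u \<in> nonunits B"
      unfolding nonunits_def
      using u ideal_of_carrier(1)[OF B I] ideal_of_mem_units[OF p u] nonzero_inv(2)[OF uc] by blast
  qed
  ultimately show thesis using that AB by blast
qed

lemma valuation_ring_cases:
  assumes "valuation_ring B"
  shows "x \<in> B \<Longrightarrow> x \<notin> nonunits B \<Longrightarrow> x \<noteq> \<zero> \<and> inv x \<in> B"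
    and "x \<in> carrier R \<Longrightarrow> x \<notin> B \<Longrightarrow> x \<noteq> \<zero> \<and> inv x \<in> nonunits B"
proof -
  have B: "subring B R" using assms unfolding valuation_ring_def by auto
  show "x \<in> B \<Longrightarrow> x \<notin> nonunits B \<Longrightarrow> x \<noteq> \<zero> \<and> inv x \<in> B"
    unfolding nonunits_def by auto
  assume x: "x \<in> carrier R" "x \<notin> B"
  have x0: "x \<noteq> \<zero>" using x subringE(2)[OF B] by auto
  have "inv x \<in> B" using assms x x0 unfolding valuation_ring_def by blast
  moreover have "inv (inv x) = x"
    using inv_unique_field[OF nonzero_inv(1)[OF x(1) x0] x(1) nonzero_inv(3)[OF x(1) x0]] .
  ultimately show "x \<noteq> \<zero> \<and> inv x \<in> nonunits B" using x x0 unfolding nonunits_def by simp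
qed

lemma valuation_ring_pair:
  assumes V: "valuation_ring B"
  shows "proper_pair B (nonunits B)"
proof -
  have B: "subring B R" using assms unfolding valuation_ring_def by auto
  note c = subringE[OF B]
  have mult: "b \<otimes> u \<in> nonunits B" if h: "b \<in> B" "u \<in> nonunits B" for b u
  proof (rule ccontr)
    have k: "b \<in> carrier R" "u \<in> carrier R" "u \<in> B" using h c(1) unfolding nonunits_def by auto
    assume n: "b \<otimes> u \<notin> nonunits B"
    have bu: "b \<otimes> u \<in> B" using c(6) h(1) k(3) by blast
    have bu0: "b \<otimes> u \<noteq> \<zero>" and i: "inv (b \<otimes> u) \<in> B"
      using valuation_ring_cases(1)[OF V bu n] by auto
    have ic: "inv (b \<otimes> u) \<in> carrier R" using i c(1) by blast
    have "u \<noteq> \<zero>" using bu0 k by auto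
    have "u \<otimes> (b \<otimes> inv (b \<otimes> u)) = (b \<otimes> u) \<otimes> inv (b \<otimes> u)" using k ic by (simp add: m_ac)
    also have "\<dots> = \<one>" using nonzero_inv(2) bu0 k by simp
    finally have "inv u = b \<otimes> inv (b \<otimes> u)"
      by (rule inv_unique_field[OF k(2) m_closed[OF k(1) ic]])
    hence "inv u \<in> B" using c(6)[OF h(1) i] by simp
    thus False using h(2) \<open>u \<noteq> \<zero>\<close> unfolding nonunits_def by blast
  qed
  \<comment> \<open>Of two nonzero elements one divides the other, and then it also divides the
    sum, with a quotient in the ring.\<close>
  have quot: "x \<oplus> y \<in> nonunits B"
    if h: "x \<in> nonunits B" "y \<in> nonunits B" "y \<noteq> \<zero>" and q: "x \<otimes> inv y \<in> B" for x y
  proof -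
    have k: "x \<in> carrier R" "y \<in> carrier R" using h c(1) unfolding nonunits_def by auto
    note iy = nonzero_inv[OF k(2) h(3)]
    have "(\<one> \<oplus> x \<otimes> inv y) \<otimes> y = y \<oplus> x \<otimes> (inv y \<otimes> y)" using k iy(1) by algebra
    also have "\<dots> = x \<oplus> y" using k iy a_comm by simp
    finally have "x \<oplus> y = (\<one> \<oplus> x \<otimes> inv y) \<otimes> y" by simp
    thus ?thesis using mult[OF c(7)[OF c(3) q] h(2)] by simp
  qed
  have add: "x \<oplus> y \<in> nonunits B" if h: "x \<in> nonunits B" "y \<in> nonunits B" for x y
  proof -
    have k: "x \<in> carrier R" "y \<in> carrier R" using h c(1) unfolding nonunits_def by blast+
    show ?thesis
    proof (cases "x = \<zero> \<or> y = \<zero>")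
      case True
      thus ?thesis
      proof
        assume "x = \<zero>" thus ?thesis using h(2) k by simp
      next
        assume "y = \<zero>" thus ?thesis using h(1) k by simp
      qed
    next
      case False
      hence x0: "x \<noteq> \<zero>" and y0: "y \<noteq> \<zero>" by auto
      note ix = nonzero_inv[OF k(1) x0] and iy = nonzero_inv[OF k(2) y0]
      show ?thesis
      proof (cases "x \<otimes> inv y \<in> B")
        case True
        thus ?thesis using quot[OF h y0] by simp
      next
        case F: False
        have xy: "x \<otimes> inv y \<in> carrier R" using k iy by simp
        have "(x \<otimes> inv y) \<otimes> (y \<otimes> inv x) = (x \<otimes> inv x) \<otimes> (inv y \<otimes> y)"
          using k ix(1) iy(1) by (simp add: m_ac)
        hence "(x \<otimes> inv y) \<otimes> (y \<otimes> inv x) = \<one>" using ix iy by simp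
        hence "inv (x \<otimes> inv y) = y \<otimes> inv x"
          by (rule inv_unique_field[OF xy m_closed[OF k(2) ix(1)]])
        hence "y \<otimes> inv x \<in> B" using valuation_ring_cases(2)[OF V xy F] unfolding nonunits_def by simp
        hence "y \<oplus> x \<in> nonunits B" using quot[OF h(2,1) x0] by simp
        thus ?thesis using a_comm k by simp
      qed
    qed
  qed
  have "ideal_of B (nonunits B)"
    unfolding ideal_of_def using mult add c(2) by (auto simp: nonunits_def)
  moreover have "\<one> \<notin> nonunits B" using c(3) unfolding nonunits_def by simp
  ultimately show ?thesis using B unfolding proper_pair_def by simp
qed

lemma valuation_ring_facts:
  assumes "valuation_ring B"
  shows "subring B R" "ideal_of B (nonunits B)" "\<one> \<notin> nonunits B"
    "\<And>x y. x \<in> B \<Longrightarrow> y \<in> B \<Longrightarrow> x \<otimes> y \<in> nonunits B \<Longrightarrow> x \<in> nonunits B \<or> y \<in> nonunits B"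
proof -
  note p = valuation_ring_pair[OF assms]
  show B: "subring B R" and I: "ideal_of B (nonunits B)" and "\<one> \<notin> nonunits B"
    using p unfolding proper_pair_def by auto
  fix x y assume h: "x \<in> B" "y \<in> B" "x \<otimes> y \<in> nonunits B"
  have k: "x \<in> carrier R" "y \<in> carrier R" using h subringE(1)[OF B] by auto
  show "x \<in> nonunits B \<or> y \<in> nonunits B"
  proof (rule disjCI, rule ccontr)
    assume "y \<notin> nonunits B" "x \<notin> nonunits B"
    hence i: "x \<noteq> \<zero>" "y \<noteq> \<zero>" "inv x \<in> B" "inv y \<in> B"
      using valuation_ring_cases(1)[OF assms] h by auto
    have "(x \<otimes> y) \<otimes> (inv x \<otimes> inv y) = (x \<otimes> inv x) \<otimes> (y \<otimes> inv y)"
      using k nonzero_inv(1) i by (simp add: m_ac)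
    also have "\<dots> = \<one>" using nonzero_inv(2) i k by simp
    finally show False using ideal_of_mem_units[OF p h(3)] subringE(6)[OF B i(3,4)] by blast
  qed
qed

section \<open>Valuation rings with finite residues\<close>

text \<open>The image of S modulo I is finite. The representatives are asked to lie in S, so that
  S may be any subring of the valuation ring whose maximal ideal is I.\<close>

definition fin_mod :: "'a set \<Rightarrow> 'a set \<Rightarrow> bool"
  where "fin_mod I S \<longleftrightarrow> (\<exists>F. finite F \<and> F \<subseteq> S \<and> (\<forall>x\<in>S. \<exists>f\<in>F. x \<ominus> f \<in> I))"

text \<open>Representatives may be found outside of S: each of them can be exchanged for an
  element of S with the same residue.\<close>

lemma fin_modI:
  assumes B: "subring B R" and I: "ideal_of B I" and S: "S \<subseteq> B" and F: "finite F" "F \<subseteq> carrier R"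
    and "\<And>x. x \<in> S \<Longrightarrow> \<exists>f\<in>F. x \<ominus> f \<in> I"
  shows "fin_mod I S"
proof -
  define P where "P f x \<longleftrightarrow> x \<in> S \<and> x \<ominus> f \<in> I" for f x
  define G where "G = (\<lambda>f. SOME x. P f x) ` {f \<in> F. \<exists>x. P f x}"
  have "\<exists>g\<in>G. x \<ominus> g \<in> I" if x: "x \<in> S" for x
  proof -
    obtain f where f: "f \<in> F" "x \<ominus> f \<in> I" using assms(6)[OF x] by blast
    define y where "y = (SOME x. P f x)"
    have ex: "\<exists>x. P f x" using x f(2) unfolding P_def by blast
    hence y: "P f y" unfolding y_def by (rule someI_ex)
    hence yG: "y \<in> G" using f(1) ex unfolding G_def y_def by blast
    have k: "x \<in> carrier R" "y \<in> carrier R" "f \<in> carrier R"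
      using x y S F(2) f(1) subringE(1)[OF B] unfolding P_def by blast+
    have "x \<ominus> y = (x \<ominus> f) \<ominus> (y \<ominus> f)" using k by algebra
    moreover have "(x \<ominus> f) \<ominus> (y \<ominus> f) \<in> I"
      using ideal_of_carrier(9)[OF B I f(2)] y unfolding P_def by blast
    ultimately show ?thesis using yG by metis
  qed
  moreover have "G \<subseteq> S" using someI_ex[of "P _"] unfolding G_def P_def by auto
  moreover have "finite G" using F unfolding G_def by simp
  ultimately show ?thesis unfolding fin_mod_def by blast
qed

lemma fin_mod_power_relation:
  assumes B: "subring B R" and I: "ideal_of B I" and A: "subring A R"
    and f: "fin_mod I A" and b: "b \<in> A"
  shows "\<exists>i j. (i::nat) < j \<and> b [^] i \<ominus> b [^] j \<in> I"
proof -
  obtain F where F: "finite F" "F \<subseteq> A" "\<And>x. x \<in> A \<Longrightarrow> \<exists>f\<in>F. x \<ominus> f \<in> I"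
    using f unfolding fin_mod_def by blast
  have pow: "b [^] (i::nat) \<in> A" for i
    by (induct i) (use subringE(3,6)[OF A] b in auto)
  hence "\<forall>i::nat. \<exists>f. f \<in> F \<and> b [^] i \<ominus> f \<in> I" using F(3) by blast
  then obtain g where "\<forall>i::nat. g i \<in> F \<and> b [^] i \<ominus> g i \<in> I" by (rule choice[THEN exE])
  hence g: "g i \<in> F \<and> b [^] i \<ominus> g i \<in> I" for i :: nat by blast
  have "\<not> inj g"
  proof
    assume "inj g"
    moreover have "finite (range g)" using g F(1) by (meson finite_subset image_subsetI)
    ultimately show False using finite_imageD infinite_UNIV_nat by blast
  qed
  then obtain i j where ij: "i < j" "g i = g j" unfolding inj_def by (metis linorder_neqE_nat)
  have k: "b [^] i \<in> carrier R" "b [^] j \<in> carrier R" "g j \<in> carrier R"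
    using pow g F(2) subringE(1)[OF A] by blast+
  have "b [^] i \<ominus> b [^] j = (b [^] i \<ominus> g j) \<ominus> (b [^] j \<ominus> g j)" using k by algebra
  moreover have "(b [^] i \<ominus> g j) \<ominus> (b [^] j \<ominus> g j) \<in> I"
    using g[of i] g[of j] ij(2) ideal_of_carrier(9)[OF B I] by auto
  ultimately show ?thesis using ij(1) by metis
qed

text \<open>A finite integral domain, here the image of A in the residue field, is a field.\<close>

lemma residue_inverse:
  assumes V: "valuation_ring B" and A: "subring A R" "A \<subseteq> B"
    and f: "fin_mod (nonunits B) A" and b: "b \<in> A" "b \<notin> nonunits B"
  shows "\<exists>c\<in>A. c \<otimes> b \<ominus> \<one> \<in> nonunits B"
proof -
  note v = valuation_ring_facts[OF V]
  obtain i j where ij: "(i::nat) < j" "b [^] i \<ominus> b [^] j \<in> nonunits B"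
    using fin_mod_power_relation[OF v(1,2) A(1) f b(1)] by blast
  have bc: "b \<in> carrier R" using b(1) A(1) subringE(1) by blast
  have pow: "b [^] (i::nat) \<in> A" for i
    by (induct i) (use subringE(3,6)[OF A(1)] b in auto)
  have npow: "b [^] (i::nat) \<notin> nonunits B" for i
  proof (induct i)
    case 0
    then show ?case using v(3) by simp
  next
    case (Suc i)
    have "b [^] i \<in> B" "b \<in> B" using pow b(1) A(2) by blast+
    from v(4)[OF this] Suc b(2) show ?case by auto
  qed
  define l where "l = j - i - 1"
  have j: "j = i + Suc l" using ij(1) l_def by simp
  have ci: "b [^] i \<in> carrier R" "b [^] l \<in> carrier R" using bc by simp_all
  have "b [^] j = b [^] i \<otimes> (b [^] l \<otimes> b)"
    unfolding j using bc nat_pow_mult[of b i "Suc l"] by simp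
  hence "b [^] i \<ominus> b [^] j = b [^] i \<otimes> (\<one> \<ominus> b [^] l \<otimes> b)" using ci bc by algebra
  moreover have m: "\<one> \<ominus> b [^] l \<otimes> b \<in> B" "b [^] i \<in> B"
  proof -
    have "b [^] l \<otimes> b \<in> A" using pow[of "Suc l"] by simp
    thus "\<one> \<ominus> b [^] l \<otimes> b \<in> B" unfolding a_minus_def
      using A subringE(3,5,7)[OF A(1)] by blast
    show "b [^] i \<in> B" using pow A(2) by blast
  qed
  ultimately have "\<one> \<ominus> b [^] l \<otimes> b \<in> nonunits B"
    using v(4)[OF m(2,1)] ij(2) npow by auto
  hence "\<ominus> (\<one> \<ominus> b [^] l \<otimes> b) \<in> nonunits B" using ideal_of_carrier(8)[OF v(1,2)] by blast
  moreover have "\<ominus> (\<one> \<ominus> b [^] l \<otimes> b) = b [^] l \<otimes> b \<ominus> \<one>" using ci bc by algebra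
  ultimately show ?thesis using pow by auto
qed

text \<open>A strong form of the Nullstellensatz for A: every nonzero element of A survives in
  some finite residue field, and the residue map comes from a valuation of the ambient field. In
  this form the property passes from A to A[s] for every element s of the field.\<close>

definition specializable :: "'a set \<Rightarrow> bool"
  where "specializable A \<longleftrightarrow> subring A R \<and> (\<forall>b\<in>A. b \<noteq> \<zero> \<longrightarrow>
    (\<exists>B. valuation_ring B \<and> A \<subseteq> B \<and> b \<notin> nonunits B \<and> fin_mod (nonunits B) A))"

text \<open>In the representation by coefficient lists without leading zeros, the constant 0 is
  the empty list.\<close>

lemma const_poly:
  assumes "subring A R" "a \<in> A"
  obtains p where "p \<in> carrier (A[X])" "\<And>x. x \<in> carrier R \<Longrightarrow> eval p x = a"
proof (cases "a = \<zero>")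
  case True
  have "[] \<in> carrier (A[X])" unfolding univ_poly_carrier[symmetric] polynomial_def by simp
  thus thesis using that[of "[]"] True by simp
next
  case False
  have "[a] \<in> carrier (A[X])" using assms False
    unfolding univ_poly_carrier[symmetric] polynomial_def by simp
  moreover have "a \<in> carrier R" using assms subringE(1) by blast
  ultimately show thesis using that[of "[a]"] by simp
qed

text \<open>The ring A[s] is a polynomial ring. If b = p(s), choose \<xi> in A that is not a root
  of p and a valuation for the nonzero element p(\<xi>) of A. Substituting \<xi> for s composes
  the residue map of A to one of A[s] that takes b to a nonzero residue, and its kernel is
  contained in the maximal ideal of a valuation ring that contains A[s].\<close>

lemma specializable_transcendental:
  assumes A: "specializable A" and s: "s \<in> carrier R" and tr: "(transcendental over A) s"
    and inf: "infinite A"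
  shows "specializable (simple_extension A s)"
proof -
  have sA: "subring A R" using A unfolding specializable_def by blast
  define P where "P = carrier (A[X])"
  have ext: "simple_extension A s = (\<lambda>p. eval p s) ` P"
    unfolding P_def by (rule simple_extension_as_eval_img[OF subringE(1)[OF sA] s])
  have sext: "subring (simple_extension A s) R" by (rule simple_extension_is_subring[OF sA s])
  interpret P: ring "A[X]" by (rule univ_poly_is_ring[OF sA])
  have inj: "p = q" if "p \<in> P" "q \<in> P" "eval p s = eval q s" for p q
    using tr that unfolding over_def transcendental_def inj_on_def P_def by blast
  show ?thesis
    unfolding specializable_def
  proof (intro conjI sext ballI impI)
    fix b assume b: "b \<in> simple_extension A s" "b \<noteq> \<zero>"
    then obtain p where p: "p \<in> P" "b = eval p s" unfolding ext by blast
    have "p \<noteq> []" using b(2) p(2) by auto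
    have "p \<in> carrier (poly_ring R)" using carrier_polynomial_shell[OF sA] p(1) unfolding P_def by blast
    hence "finite {x. is_root p x}" by (rule finite_number_of_roots)
    then obtain \<xi> where \<xi>: "\<xi> \<in> A" "\<not> is_root p \<xi>" using inf
      by (metis (mono_tags, lifting) finite_subset mem_Collect_eq subsetI)
    have \<xi>c: "\<xi> \<in> carrier R" using \<xi>(1) subringE(1)[OF sA] by blast
    have hom: "(\<lambda>p. eval p x) \<in> ring_hom (A[X]) R" if "x \<in> carrier R" for x
      by (rule eval_is_hom[OF sA that])
    note h1 = ring_hom_memE[OF hom[OF s], folded P_def]
    note h2 = ring_hom_memE[OF hom[OF \<xi>c], folded P_def]
    have evA: "eval q \<xi> \<in> A" if "q \<in> P" for q
    proof -
      have "eval q \<xi> \<in> simple_extension A \<xi>"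
        using simple_extension_as_eval_img[OF subringE(1)[OF sA] \<xi>c] that unfolding P_def by blast
      thus ?thesis using simple_extension_subring_incl[OF sA subset_refl \<xi>(1)] by blast
    qed
    define \<beta> where "\<beta> = eval p \<xi>"
    have \<beta>: "\<beta> \<in> A" "\<beta> \<noteq> \<zero>"
      using evA[OF p(1)] \<xi>(2) \<xi>c \<open>p \<noteq> []\<close> unfolding \<beta>_def is_root_def by auto
    then obtain B where V: "valuation_ring B" and AB: "A \<subseteq> B" and \<beta>B: "\<beta> \<notin> nonunits B"
      and fin: "fin_mod (nonunits B) A"
      using A unfolding specializable_def by blast
    note v = valuation_ring_facts[OF V]
    note c = ideal_of_carrier[OF v(1,2)]
    \<comment> \<open>The kernel of the residue map on A[s] that takes s to the residue of \<xi>.\<close>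
    define J where "J = {eval q s | q. q \<in> P \<and> eval q \<xi> \<in> nonunits B}"
    have JI: "eval q s \<in> J" if "q \<in> P" "eval q \<xi> \<in> nonunits B" for q using that unfolding J_def by blast
    have "proper_pair (simple_extension A s) J"
      unfolding proper_pair_def
    proof (intro conjI sext)
      show "ideal_of (simple_extension A s) J"
        unfolding ideal_of_def
      proof (intro conjI ballI)
        show "J \<subseteq> simple_extension A s" unfolding ext J_def by blast
        have "[] \<in> P" unfolding P_def univ_poly_carrier[symmetric] polynomial_def by simp
        from JI[OF this] show "\<zero> \<in> J" using c(4) by simp
      next
        fix u w assume "u \<in> J" "w \<in> J"
        then obtain q r where qr: "q \<in> P" "r \<in> P" "u = eval q s" "w = eval r s"
          "eval q \<xi> \<in> nonunits B" "eval r \<xi> \<in> nonunits B" unfolding J_def by blast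
        have sum: "q \<oplus>\<^bsub>A[X]\<^esub> r \<in> P" using qr(1,2) P.a_closed unfolding P_def by blast
        have "eval (q \<oplus>\<^bsub>A[X]\<^esub> r) \<xi> \<in> nonunits B" unfolding h2(3)[OF qr(1,2)] using c(5) qr(5,6) by blast
        from JI[OF sum this] show "u \<oplus> w \<in> J" unfolding h1(3)[OF qr(1,2)] qr(3,4) .
      next
        fix u w assume "u \<in> simple_extension A s" "w \<in> J"
        then obtain q r where qr: "q \<in> P" "r \<in> P" "u = eval q s" "w = eval r s"
          "eval r \<xi> \<in> nonunits B" unfolding J_def ext by blast
        have prod: "q \<otimes>\<^bsub>A[X]\<^esub> r \<in> P" using qr(1,2) P.m_closed unfolding P_def by blast
        have "eval q \<xi> \<in> B" using evA[OF qr(1)] AB by blast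
        hence "eval (q \<otimes>\<^bsub>A[X]\<^esub> r) \<xi> \<in> nonunits B" unfolding h2(2)[OF qr(1,2)] using c(6) qr(5) by blast
        from JI[OF prod this] show "u \<otimes> w \<in> J" unfolding h1(2)[OF qr(1,2)] qr(3,4) .
      qed
      show "\<one> \<notin> J"
      proof
        assume "\<one> \<in> J"
        then obtain q where q: "q \<in> P" "eval q s = \<one>" "eval q \<xi> \<in> nonunits B" unfolding J_def by force
        have "q = \<one>\<^bsub>A[X]\<^esub>" using inj[OF q(1)] h1(4) q(2) P.one_closed unfolding P_def by metis
        thus False using q(3) h2(4) v(3) by simp
      qed
    qed
    then obtain B' where V': "valuation_ring B'" and AB': "simple_extension A s \<subseteq> B'"
      and J': "J \<subseteq> nonunits B'" by (rule extend_to_valuation_ring)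
    note v' = valuation_ring_facts[OF V']
    note c' = ideal_of_carrier[OF v'(1,2)]
    have AB'': "A \<subseteq> B'" using simple_extension_incl[OF subringE(1)[OF sA] s] AB' by blast
    \<comment> \<open>The residues of A[s] in the new valuation ring are those of A in the old
      one.\<close>
    have diff: "eval q s \<ominus> a \<in> nonunits B'" if q: "q \<in> P" and a: "a \<in> A" "eval q \<xi> \<ominus> a \<in> nonunits B" for q a
    proof -
      have na: "\<ominus> a \<in> A" using a(1) subringE(5)[OF sA] by blast
      obtain r where r: "r \<in> P" "\<And>x. x \<in> carrier R \<Longrightarrow> eval r x = \<ominus> a"
        using const_poly[OF sA na] unfolding P_def by blast
      have sum: "q \<oplus>\<^bsub>A[X]\<^esub> r \<in> P" using q r P.a_closed unfolding P_def by blast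
      have "eval (q \<oplus>\<^bsub>A[X]\<^esub> r) \<xi> \<in> nonunits B"
        unfolding h2(3)[OF q r(1)] r(2)[OF \<xi>c] using a(2) unfolding a_minus_def .
      from JI[OF sum this] have "eval q s \<ominus> a \<in> J"
        unfolding h1(3)[OF q r(1)] r(2)[OF s] a_minus_def .
      thus ?thesis using J' by blast
    qed
    show "\<exists>B. valuation_ring B \<and> simple_extension A s \<subseteq> B \<and> b \<notin> nonunits B
      \<and> fin_mod (nonunits B) (simple_extension A s)"
    proof (intro exI[of _ B'] conjI V' AB')
      show "b \<notin> nonunits B'"
      proof
        assume bn: "b \<in> nonunits B'"
        obtain e where e: "e \<in> A" "e \<otimes> \<beta> \<ominus> \<one> \<in> nonunits B"
          using residue_inverse[OF V sA AB fin \<beta>(1) \<beta>B] by blast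
        obtain r where r: "r \<in> P" "\<And>x. x \<in> carrier R \<Longrightarrow> eval r x = e"
          using const_poly[OF sA e(1)] unfolding P_def by blast
        have prod: "r \<otimes>\<^bsub>A[X]\<^esub> p \<in> P" using p r P.m_closed unfolding P_def by blast
        have "eval (r \<otimes>\<^bsub>A[X]\<^esub> p) \<xi> \<ominus> \<one> \<in> nonunits B"
          unfolding h2(2)[OF r(1) p(1)] r(2)[OF \<xi>c] using e(2) unfolding \<beta>_def .
        from diff[OF prod subringE(3)[OF sA] this]
        have "e \<otimes> b \<ominus> \<one> \<in> nonunits B'" unfolding h1(2)[OF r(1) p(1)] r(2)[OF s] p(2) .
        moreover have "e \<otimes> b \<in> nonunits B'" using c'(6)[OF _ bn] e(1) AB'' by blast
        ultimately have "e \<otimes> b \<ominus> (e \<otimes> b \<ominus> \<one>) \<in> nonunits B'" using c'(9) by blast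
        moreover have k: "e \<in> carrier R" "b \<in> carrier R"
          using e(1) bn c'(3) subringE(1)[OF sA] by blast+
        have "e \<otimes> b \<ominus> (e \<otimes> b \<ominus> \<one>) = \<one>" using k by algebra
        ultimately show False using v'(3) by simp
      qed
      obtain F where F: "finite F" "F \<subseteq> A" "\<And>x. x \<in> A \<Longrightarrow> \<exists>f\<in>F. x \<ominus> f \<in> nonunits B"
        using fin unfolding fin_mod_def by blast
      show "fin_mod (nonunits B') (simple_extension A s)"
      proof (rule fin_modI[OF v'(1,2) AB' F(1)])
        show "F \<subseteq> carrier R" using F(2) subringE(1)[OF sA] by blast
        fix x assume "x \<in> simple_extension A s"
        then obtain q where q: "q \<in> P" "x = eval q s" unfolding ext by blast
        obtain f where f: "f \<in> F" "eval q \<xi> \<ominus> f \<in> nonunits B" using F(3)[OF evA[OF q(1)]] by blast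
        have "x \<ominus> f \<in> nonunits B'" using diff[OF q(1) _ f(2)] F(2) f(1) unfolding q(2) by blast
        thus "\<exists>f\<in>F. x \<ominus> f \<in> nonunits B'" using f(1) by blast
      qed
    qed
  qed
qed

lemma eval_in_polys:
  assumes A: "subring A R" and s: "s \<in> carrier R" and q: "set q \<subseteq> A"
  shows "eval q s \<in> polys A s (length q)"
  using q
proof (induct q rule: rev_induct)
  case Nil
  then show ?case by simp
next
  case (snoc a q)
  have k: "set q \<subseteq> carrier R" "a \<in> carrier R" "a \<in> A" using snoc.prems subringE(1)[OF A] by auto
  have e: "eval q s \<in> carrier R" using eval_in_carrier[OF k(1) s] .
  have "eval (q @ [a]) s = a \<oplus> s \<otimes> eval q s"
    unfolding eval_append_aux[OF k(1,2) s] using k e s by (simp add: a_comm m_comm)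
  thus ?case using polys_SucI[OF k(3), of "eval q s" s "length q"] snoc by simp
qed

text \<open>A valuation ring is integrally closed. If s is not in B, then u = 1/s is a nonunit,
  and multiplying the equation by the power of u with exponent the degree expresses its leading
  coefficient c, the head of the list, by nonunits.\<close>

lemma root_in_valuation_ring:
  assumes V: "valuation_ring B" and s: "s \<in> carrier R" and q: "set (c # q) \<subseteq> B"
    and c: "c \<notin> nonunits B" and root: "eval (c # q) s = \<zero>"
  shows "s \<in> B"
proof (rule ccontr)
  assume n: "s \<notin> B"
  note v = valuation_ring_facts[OF V]
  note i = ideal_of_carrier[OF v(1,2)]
  define u where "u = inv s"
  have s0: "s \<noteq> \<zero>" and u: "u \<in> nonunits B" using valuation_ring_cases(2)[OF V s n] unfolding u_def by auto
  have uc: "u \<in> carrier R" and su: "s \<otimes> u = \<one>" using nonzero_inv(1,2)[OF s s0] unfolding u_def by auto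
  have sm: "s [^] m \<otimes> u [^] m = \<one>" for m :: nat
    using s uc su by (simp add: nat_pow_distrib[symmetric])
  have main: "u [^] length p \<otimes> eval p s \<in> nonunits B" if "set p \<subseteq> B" for p
    using that
  proof (induct p)
    case Nil
    then show ?case using i(4) by simp
  next
    case (Cons a p)
    have k: "a \<in> carrier R" "set p \<subseteq> carrier R" using Cons.prems i(2) by auto
    have e: "eval p s \<in> carrier R" using eval_in_carrier[OF k(2) s] .
    have pc: "s [^] length p \<in> carrier R" "u [^] length p \<in> carrier R" using s uc by simp_all
    have "u [^] length (a # p) \<otimes> eval (a # p) s
      = (s [^] length p \<otimes> u [^] length p) \<otimes> (a \<otimes> u) \<oplus> u \<otimes> (u [^] length p \<otimes> eval p s)"
      using k e pc uc by (simp, algebra)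
    also have "\<dots> = a \<otimes> u \<oplus> u \<otimes> (u [^] length p \<otimes> eval p s)" using sm k uc by simp
    finally have eq: "u [^] length (a # p) \<otimes> eval (a # p) s = \<dots>" .
    have "a \<in> B" "u \<in> B" using Cons.prems u i(1) by auto
    hence "a \<otimes> u \<in> nonunits B" "u \<otimes> (u [^] length p \<otimes> eval p s) \<in> nonunits B"
      using i(6) u Cons by auto
    thus ?case unfolding eq by (rule i(5))
  qed
  have k: "c \<in> carrier R" "set q \<subseteq> carrier R" "c \<in> B" using q i(2) by auto
  have e: "eval q s \<in> carrier R" using eval_in_carrier[OF k(2) s] .
  have pc: "s [^] length q \<in> carrier R" "u [^] length q \<in> carrier R" using s uc by simp_all
  have "u [^] length q \<otimes> eval (c # q) s = (s [^] length q \<otimes> u [^] length q) \<otimes> c \<oplus> u [^] length q \<otimes> eval q s"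
    using k e pc by (simp, algebra)
  also have "\<dots> = c \<oplus> u [^] length q \<otimes> eval q s" using sm k by simp
  finally have "c \<oplus> u [^] length q \<otimes> eval q s = \<zero>" using root pc by simp
  hence "c = \<ominus> (u [^] length q \<otimes> eval q s)" using k e pc by (metis m_closed minus_equality)
  moreover have "u [^] length q \<otimes> eval q s \<in> nonunits B" using main q by simp
  ultimately show False using c i(8) by blast
qed

lemma fin_mod_polys:
  assumes B: "subring B R" and I: "ideal_of B I" and A: "subring A R" "A \<subseteq> B" and s: "s \<in> B"
    and f: "fin_mod I A"
  shows "\<exists>F. finite F \<and> F \<subseteq> B \<and> (\<forall>x\<in>polys A s n. \<exists>f\<in>F. x \<ominus> f \<in> I)"
proof (induct n)
  note c = ideal_of_carrier[OF B I]
  case 0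
  show ?case using subringE(2)[OF B] c(4) by (intro exI[of _ "{\<zero>}"]) (simp add: a_minus_def)
next
  note c = ideal_of_carrier[OF B I]
  case (Suc n)
  then obtain F where F: "finite F" "F \<subseteq> B" "\<And>x. x \<in> polys A s n \<Longrightarrow> \<exists>f\<in>F. x \<ominus> f \<in> I" by blast
  obtain G where G: "finite G" "G \<subseteq> A" "\<And>x. x \<in> A \<Longrightarrow> \<exists>f\<in>G. x \<ominus> f \<in> I"
    using f unfolding fin_mod_def by blast
  define H where "H = (\<lambda>(g, f). g \<oplus> s \<otimes> f) ` (G \<times> F)"
  have sc: "s \<in> carrier R" using s c(2) by blast
  have "\<exists>h\<in>H. x \<ominus> h \<in> I" if x: "x \<in> polys A s (Suc n)" for x
  proof -
    obtain u w where h: "u \<in> A" "w \<in> polys A s n" "x = u \<oplus> s \<otimes> w" using x by (rule polys_SucE)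
    obtain g where g: "g \<in> G" "u \<ominus> g \<in> I" using G(3)[OF h(1)] by blast
    obtain f where f: "f \<in> F" "w \<ominus> f \<in> I" using F(3)[OF h(2)] by blast
    have k: "u \<in> carrier R" "w \<in> carrier R" "g \<in> carrier R" "f \<in> carrier R"
      using h g f G(2) F(2) c(2) subringE(1)[OF A(1)] polys_carrier[OF A(1) ideal_of_self[OF A(1)] sc]
      by blast+
    have "x \<ominus> (g \<oplus> s \<otimes> f) = (u \<ominus> g) \<oplus> s \<otimes> (w \<ominus> f)" unfolding h(3) using k sc by algebra
    moreover have "(u \<ominus> g) \<oplus> s \<otimes> (w \<ominus> f) \<in> I" using g(2) c(6)[OF s f(2)] c(5) by blast
    ultimately have "x \<ominus> (g \<oplus> s \<otimes> f) \<in> I" by simp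
    moreover have "g \<oplus> s \<otimes> f \<in> H" using g(1) f(1) unfolding H_def by (intro image_eqI[of _ _ "(g, f)"]) auto
    ultimately show ?thesis by blast
  qed
  moreover have "finite H" using F(1) G(1) unfolding H_def by simp
  moreover have "H \<subseteq> B" proof
    fix h assume "h \<in> H"
    then obtain g f where "g \<in> G" "f \<in> F" and h: "h = g \<oplus> s \<otimes> f" unfolding H_def by auto
    hence "g \<in> B" "f \<in> B" using F(2) G(2) A(2) by blast+
    thus "h \<in> B" unfolding h using subringE(6)[OF B s] subringE(7)[OF B] by simp
  qed
  ultimately show ?case by blast
qed

definition fractions :: "'a set \<Rightarrow> 'a set"
  where "fractions A = {a \<otimes> inv d | a d. a \<in> A \<and> d \<in> A \<and> d \<noteq> \<zero>}"

lemma subfield_fractions: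
  assumes A: "subring A R"
  shows "subfield (fractions A) R" "A \<subseteq> fractions A"
proof -
  note a = subringE[OF A]
  have F: "a \<otimes> inv d \<in> fractions A" if "a \<in> A" "d \<in> A" "d \<noteq> \<zero>" for a d
    using that unfolding fractions_def by blast
  have inv1: "inv \<one> = \<one>" by (rule inv_unique_field) auto
  show sub: "A \<subseteq> fractions A"
  proof
    fix x assume x: "x \<in> A"
    hence "x \<otimes> inv \<one> = x" using a(1) inv1 by auto
    thus "x \<in> fractions A" using F[OF x a(3)] by simp
  qed
  have prod_inv: "inv d \<otimes> inv e = inv (d \<otimes> e)" "d \<otimes> e \<in> A" "d \<otimes> e \<noteq> \<zero>"
    if h: "d \<in> A" "d \<noteq> \<zero>" "e \<in> A" "e \<noteq> \<zero>" for d e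
  proof -
    have k: "d \<in> carrier R" "e \<in> carrier R" using h a(1) by blast+
    note i = nonzero_inv[OF k(1) h(2)] nonzero_inv[OF k(2) h(4)]
    have "(d \<otimes> e) \<otimes> (inv d \<otimes> inv e) = (d \<otimes> inv d) \<otimes> (e \<otimes> inv e)" using k i(1,5) by (simp add: m_ac)
    hence "(d \<otimes> e) \<otimes> (inv d \<otimes> inv e) = \<one>" using i(2,6) by simp
    thus "inv d \<otimes> inv e = inv (d \<otimes> e)"
      using inv_unique_field[OF m_closed[OF k] m_closed[OF i(1,5)]] by simp
    show "d \<otimes> e \<in> A" using a(6) h by blast
    show "d \<otimes> e \<noteq> \<zero>" using integral k h by blast
  qed
  have s: "subring (fractions A) R"
  proof (rule subringI)
    show "fractions A \<subseteq> carrier R" unfolding fractions_def using a(1) nonzero_inv(1) by blast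
    show "\<one> \<in> fractions A" using sub a(3) by blast
  next
    fix h assume "h \<in> fractions A"
    then obtain x d where h: "x \<in> A" "d \<in> A" "d \<noteq> \<zero>" "h = x \<otimes> inv d" unfolding fractions_def by blast
    have "d \<in> carrier R" "x \<in> carrier R" using h a(1) by blast+
    hence "\<ominus> h = (\<ominus> x) \<otimes> inv d" using nonzero_inv(1) h(3,4) by (simp add: l_minus)
    thus "\<ominus> h \<in> fractions A" using F a(5) h by simp
  next
    fix h k assume "h \<in> fractions A" "k \<in> fractions A"
    then obtain x d y e where h: "x \<in> A" "d \<in> A" "d \<noteq> \<zero>" "h = x \<otimes> inv d"
      "y \<in> A" "e \<in> A" "e \<noteq> \<zero>" "k = y \<otimes> inv e" unfolding fractions_def by blast
    have c: "d \<in> carrier R" "x \<in> carrier R" "e \<in> carrier R" "y \<in> carrier R" using h a(1) by blast+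
    note i = nonzero_inv[OF c(1) h(3)] nonzero_inv[OF c(3) h(7)]
    note p = prod_inv[OF h(2,3,6,7)]
    have "h \<otimes> k = (x \<otimes> y) \<otimes> (inv d \<otimes> inv e)" unfolding h using c i(1,5) by (simp add: m_ac)
    also have "\<dots> = (x \<otimes> y) \<otimes> inv (d \<otimes> e)" using p(1) by simp
    finally have "h \<otimes> k = (x \<otimes> y) \<otimes> inv (d \<otimes> e)" .
    thus "h \<otimes> k \<in> fractions A" using F[OF _ p(2,3)] a(6) h by simp
    have "(x \<otimes> e \<oplus> y \<otimes> d) \<otimes> (inv d \<otimes> inv e)
      = (x \<otimes> inv d) \<otimes> (e \<otimes> inv e) \<oplus> (y \<otimes> inv e) \<otimes> (d \<otimes> inv d)"
      using c i(1,5) by algebra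
    also have "\<dots> = h \<oplus> k" unfolding h using c i by simp
    finally have "h \<oplus> k = (x \<otimes> e \<oplus> y \<otimes> d) \<otimes> inv (d \<otimes> e)" using p(1) by simp
    moreover have "x \<otimes> e \<oplus> y \<otimes> d \<in> A" using a(6,7) h by blast
    ultimately show "h \<oplus> k \<in> fractions A" using F[OF _ p(2,3)] by simp
  qed
  show "subfield (fractions A) R"
  proof (rule subfieldI'[OF s])
    fix k assume k: "k \<in> fractions A - {\<zero>}"
    then obtain x d where h: "x \<in> A" "d \<in> A" "d \<noteq> \<zero>" "k = x \<otimes> inv d" unfolding fractions_def by blast
    have c: "d \<in> carrier R" "x \<in> carrier R" using h a(1) by blast+
    note i = nonzero_inv[OF c(1) h(3)]
    have x0: "x \<noteq> \<zero>" using k h i by auto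
    note j = nonzero_inv[OF c(2) x0]
    have kc: "k \<in> carrier R" using h c i by simp
    have "k \<otimes> (d \<otimes> inv x) = (x \<otimes> inv x) \<otimes> (inv d \<otimes> d)" unfolding h using c i(1) j(1) by (simp add: m_ac)
    hence "k \<otimes> (d \<otimes> inv x) = \<one>" using i j by simp
    hence "inv k = d \<otimes> inv x" by (rule inv_unique_field[OF kc m_closed[OF c(1) j(1)]])
    thus "inv k \<in> fractions A" using F[OF h(2,1) x0] by simp
  qed
qed

text \<open>Elements that are polynomials in s over the fraction field of A have a common
  denominator in A.\<close>

lemma fractions_extension_denominator:
  assumes A: "subring A R" and s: "s \<in> carrier R" and z: "z \<in> simple_extension (fractions A) s"
  shows "\<exists>d\<in>A. d \<noteq> \<zero> \<and> d \<otimes> z \<in> simple_extension A s"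
  using z
proof (induct rule: simple_extension.induct)
  case zero
  show ?case using subringE(3)[OF A] by (intro bexI[of _ \<one>]) auto
next
  note a = subringE[OF A]
  case (lin k1 k2)
  have k1c: "k1 \<in> carrier R"
    using simple_extension_in_carrier[OF _ s, of "fractions A"] lin(1) subfieldE(3)[OF subfield_fractions(1)[OF A]] by blast
  obtain d where d: "d \<in> A" "d \<noteq> \<zero>" "d \<otimes> k1 \<in> simple_extension A s" using lin(2) by blast
  obtain x e where e: "x \<in> A" "e \<in> A" "e \<noteq> \<zero>" "k2 = x \<otimes> inv e" using lin(3) unfolding fractions_def by blast
  have c: "d \<in> carrier R" "x \<in> carrier R" "e \<in> carrier R" using d e a(1) by blast+
  note i = nonzero_inv[OF c(3) e(3)]
  have "(d \<otimes> e) \<otimes> (k1 \<otimes> s \<oplus> k2) = (e \<otimes> (d \<otimes> k1)) \<otimes> s \<oplus> (e \<otimes> inv e) \<otimes> (d \<otimes> x)"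
    unfolding e using c i(1) k1c s by algebra
  also have "\<dots> = (e \<otimes> (d \<otimes> k1)) \<otimes> s \<oplus> d \<otimes> x" using i c by simp
  finally have eq: "(d \<otimes> e) \<otimes> (k1 \<otimes> s \<oplus> k2) = (e \<otimes> (d \<otimes> k1)) \<otimes> s \<oplus> d \<otimes> x" .
  have "e \<in> simple_extension A s" using simple_extension_incl[OF a(1) s] e by blast
  hence "e \<otimes> (d \<otimes> k1) \<in> simple_extension A s"
    using subringE(6)[OF simple_extension_is_subring[OF A s]] d(3) by blast
  hence "(d \<otimes> e) \<otimes> (k1 \<otimes> s \<oplus> k2) \<in> simple_extension A s"
    unfolding eq using simple_extension.lin a(6) d(1) e(1) by blast
  moreover have "d \<otimes> e \<in> A" "d \<otimes> e \<noteq> \<zero>" using a(6) d e integral c by blast+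
  ultimately show ?case by blast
qed

text \<open>Let c be the leading coefficient of an equation for s over A, and let e in A be a
  denominator of 1/b. In a valuation ring where c and e are units, s is integral and b is a unit.
  The equation for s reduces the residues of A[s] to those of polynomials of bounded degree in s.\<close>

lemma specializable_algebraic:
  assumes A: "specializable A" and s: "s \<in> carrier R" and alg: "(algebraic over A) s"
  shows "specializable (simple_extension A s)"
proof -
  have sA: "subring A R" using A unfolding specializable_def by blast
  note a = subringE[OF sA]
  have sext: "subring (simple_extension A s) R" by (rule simple_extension_is_subring[OF sA s])
  obtain p where p: "p \<in> carrier (A[X])" "p \<noteq> []" "eval p s = \<zero>"
    using algebraicE[OF sA s alg] by blast
  then obtain c q where cq: "p = c # q" by (cases p) auto
  have c: "c \<in> A" "c \<noteq> \<zero>" "set q \<subseteq> A"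
    using p(1) unfolding cq univ_poly_carrier[symmetric] polynomial_def by auto
  have cc: "c \<in> carrier R" using c(1) a(1) by blast
  note fr = subfield_fractions[OF sA]
  have algF: "(algebraic over (fractions A)) s" by (rule algebraic_mono[OF fr(2) alg])
  have fieldF: "subfield (simple_extension (fractions A) s) R"
    using simple_extension_is_subfield[OF fr(1) s] algF by blast
  show ?thesis
    unfolding specializable_def
  proof (intro conjI sext ballI impI)
    fix b assume b: "b \<in> simple_extension A s" "b \<noteq> \<zero>"
    have bc: "b \<in> carrier R" using b(1) subringE(1)[OF sext] by blast
    note ib = nonzero_inv[OF bc b(2)]
    have "inv b \<in> simple_extension (fractions A) s"
      using subfield_m_inv(1)[OF fieldF] b mono_simple_extension[OF fr(2), of s] by blast
    then obtain e where e: "e \<in> A" "e \<noteq> \<zero>" "e \<otimes> inv b \<in> simple_extension A s"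
      using fractions_extension_denominator[OF sA s] by blast
    have ec: "e \<in> carrier R" using e a(1) by blast
    have "c \<otimes> e \<in> A" "c \<otimes> e \<noteq> \<zero>" using a(6) c e integral cc ec by blast+
    then obtain B where V: "valuation_ring B" and AB: "A \<subseteq> B" and ce: "c \<otimes> e \<notin> nonunits B"
      and fin: "fin_mod (nonunits B) A"
      using A unfolding specializable_def by blast
    note v = valuation_ring_facts[OF V]
    note i = ideal_of_carrier[OF v(1,2)]
    have cn: "c \<notin> nonunits B" and en: "e \<notin> nonunits B"
      using ce i(6,7) c(1) e(1) AB by blast+
    have sB: "s \<in> B" using root_in_valuation_ring[OF V s _ cn] p(3) c AB unfolding cq by auto
    have extB: "simple_extension A s \<subseteq> B" by (rule simple_extension_subring_incl[OF v(1) AB sB])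
    have bn: "b \<notin> nonunits B"
    proof
      assume "b \<in> nonunits B"
      hence "(e \<otimes> inv b) \<otimes> b \<in> nonunits B" using i(6) e(3) extB by blast
      moreover have "(e \<otimes> inv b) \<otimes> b = e" using ec bc ib by (simp add: m_assoc)
      ultimately show False using en by simp
    qed
    define n where "n = length q"
    note AA = ideal_of_self[OF sA]
    have pc: "polys A s m \<subseteq> carrier R" for m by (rule polys_carrier[OF sA AA s])
    obtain c' where c': "c' \<in> A" "c' \<otimes> c \<ominus> \<one> \<in> nonunits B"
      using residue_inverse[OF V sA AB fin c(1) cn] by blast
    have c'c: "c' \<in> carrier R" using c' a(1) by blast
    \<comment> \<open>Modulo nonunits this is the power of s with exponent n, expressed by lower
      powers.\<close>
    define w0 where "w0 = \<ominus> c' \<otimes> eval q s"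
    have "eval q s \<in> polys A s n" unfolding n_def by (rule eval_in_polys[OF sA s c(3)])
    hence w0: "w0 \<in> polys A s n" unfolding w0_def using polys_scale[OF sA AA s] a(5)[OF c'(1)] by blast
    have sn: "s [^] n \<ominus> w0 \<in> nonunits B"
    proof -
      have ev: "eval q s \<in> carrier R" using eval_in_carrier c(3) a(1) s by blast
      have pw: "s [^] n \<in> carrier R" "s [^] n \<in> B"
      proof -
        show "s [^] n \<in> carrier R" using s by simp
        show "s [^] n \<in> B" by (induct n) (use subringE(3,6)[OF v(1)] sB in auto)
      qed
      have "c \<otimes> s [^] n \<oplus> eval q s = \<zero>" using p(3) unfolding cq n_def by simp
      hence e: "eval q s = \<ominus> (c \<otimes> s [^] n)" using cc pw(1) ev
        by (metis a_comm m_closed minus_equality)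
      have "s [^] n \<ominus> w0 = s [^] n \<otimes> (\<ominus> (c' \<otimes> c \<ominus> \<one>))"
        unfolding w0_def e using cc c'c pw(1) by algebra
      thus ?thesis using i(6)[OF pw(2) i(8)[OF c'(2)]] by simp
    qed
    have red: "\<exists>w\<in>polys A s n. x \<ominus> w \<in> nonunits B" if "x \<in> simple_extension A s" for x
      using that
    proof (induct rule: simple_extension.induct)
      case zero
      show ?case using polys_zero[OF sA AA s] i(4) by (intro bexI[of _ \<zero>]) (simp_all add: a_minus_def)
    next
      case (lin k1 k2)
      then obtain w where w: "w \<in> polys A s n" "k1 \<ominus> w \<in> nonunits B" by blast
      obtain w' u where wu: "w' \<in> polys A s n" "u \<in> A" "k2 \<oplus> s \<otimes> w = w' \<oplus> u \<otimes> s [^] n"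
        using polys_top[OF sA AA s polys_SucI[OF lin(3) w(1)]] by blast
      have k: "k1 \<in> carrier R" "k2 \<in> carrier R" "w \<in> carrier R" "w' \<in> carrier R" "u \<in> carrier R"
        "w0 \<in> carrier R" "s [^] n \<in> carrier R"
        using lin(1,3) w(1) wu(1,2) w0 pc a(1) subringE(1)[OF sext] s by (blast, blast, blast, blast, blast, blast, simp)
      have "k1 \<otimes> s \<oplus> k2 \<ominus> (w' \<oplus> u \<otimes> w0)
        = s \<otimes> (k1 \<ominus> w) \<oplus> (k2 \<oplus> s \<otimes> w) \<ominus> (w' \<oplus> u \<otimes> w0)"
        using k s by algebra
      also have "\<dots> = s \<otimes> (k1 \<ominus> w) \<oplus> u \<otimes> (s [^] n \<ominus> w0)" unfolding wu(3) using k s by algebra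
      finally have eq: "k1 \<otimes> s \<oplus> k2 \<ominus> (w' \<oplus> u \<otimes> w0) = \<dots>" .
      have mem: "s \<otimes> (k1 \<ominus> w) \<oplus> u \<otimes> (s [^] n \<ominus> w0) \<in> nonunits B"
        using i(5)[OF i(6)[OF sB w(2)] i(6)[OF subsetD[OF AB wu(2)] sn]] .
      have mem2: "w' \<oplus> u \<otimes> w0 \<in> polys A s n"
        using polys_add[OF sA AA s wu(1) polys_scale[OF sA AA s wu(2) w0]] .
      show ?case using mem[folded eq] mem2 by (rule bexI)
    qed
    obtain F where F: "finite F" "F \<subseteq> B" "\<And>x. x \<in> polys A s n \<Longrightarrow> \<exists>f\<in>F. x \<ominus> f \<in> nonunits B"
      using fin_mod_polys[OF v(1,2) sA AB sB fin, of n] by blast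
    have "fin_mod (nonunits B) (simple_extension A s)"
    proof (rule fin_modI[OF v(1,2) extB F(1)])
      show "F \<subseteq> carrier R" using F(2) i(2) by blast
      fix x assume x: "x \<in> simple_extension A s"
      obtain w where w: "w \<in> polys A s n" "x \<ominus> w \<in> nonunits B" using red[OF x] by blast
      obtain f where f: "f \<in> F" "w \<ominus> f \<in> nonunits B" using F(3)[OF w(1)] by blast
      have k: "x \<in> carrier R" "w \<in> carrier R" "f \<in> carrier R"
        using x w(1) f(1) F(2) i(2) pc subringE(1)[OF sext] by blast+
      have eq: "x \<ominus> f = (x \<ominus> w) \<oplus> (w \<ominus> f)" using k by algebra
      show "\<exists>f\<in>F. x \<ominus> f \<in> nonunits B" using i(5)[OF w(2) f(2), folded eq] f(1) by (rule bexI)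
    qed
    thus "\<exists>B. valuation_ring B \<and> simple_extension A s \<subseteq> B \<and> b \<notin> nonunits B
      \<and> fin_mod (nonunits B) (simple_extension A s)"
      using V extB bn by blast
  qed
qed

definition char_zero :: bool
  where "char_zero \<longleftrightarrow> (\<forall>n::nat. n > 0 \<longrightarrow> [n] \<cdot> \<one> \<noteq> \<zero>)"

lemma int_embed:
  shows "[(z + w)] \<cdot> \<one> = [(z::int)] \<cdot> \<one> \<oplus> [w] \<cdot> \<one>" "[(z * w)] \<cdot> \<one> = [z] \<cdot> \<one> \<otimes> [w] \<cdot> \<one>"
    "[(- z)] \<cdot> \<one> = \<ominus> ([z] \<cdot> \<one>)" "[z] \<cdot> \<one> \<in> carrier R" "[(1::int)] \<cdot> \<one> = \<one>"
    "[(int n)] \<cdot> \<one> = [n] \<cdot> \<one>"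
proof -
  show "[(z + w)] \<cdot> \<one> = [z] \<cdot> \<one> \<oplus> [w] \<cdot> \<one>" by (simp add: add.int_pow_mult)
  show c: "[z] \<cdot> \<one> \<in> carrier R" for z :: int by simp
  show "[(- z)] \<cdot> \<one> = \<ominus> ([z] \<cdot> \<one>)" by (simp add: add.int_pow_neg)
  have "[z] \<cdot> \<one> \<otimes> [w] \<cdot> \<one> = [z] \<cdot> (\<one> \<otimes> [w] \<cdot> \<one>)" by (rule add_pow_ldistr_int) simp_all
  also have "\<dots> = [(w * z)] \<cdot> \<one>" using add.int_pow_pow[of \<one> z w] by (simp add: mult.commute)
  finally show "[(z * w)] \<cdot> \<one> = [z] \<cdot> \<one> \<otimes> [w] \<cdot> \<one>" by (simp add: mult.commute)
  show "[(1::int)] \<cdot> \<one> = \<one>" by (simp add: add.int_pow_1)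
  show "[(int n)] \<cdot> \<one> = [n] \<cdot> \<one>" by (simp add: add_pow_int_ge)
qed

lemma int_embed_eq_zero:
  assumes "char_zero" "[(z::int)] \<cdot> \<one> = \<zero>"
  shows "z = 0"
proof (rule ccontr)
  assume "z \<noteq> 0"
  hence "nat \<bar>z\<bar> > 0" by simp
  moreover have "[(nat \<bar>z\<bar>)] \<cdot> \<one> = \<zero>"
    using assms(2) int_embed(3)[of z] int_embed(6)[of "nat \<bar>z\<bar>"] by (cases "z \<ge> 0") simp_all
  ultimately show False using assms(1) unfolding char_zero_def by blast
qed

text \<open>For an integer z, a valuation ring in which N = |z| + 1 is a nonunit has z as a unit,
  and the integers have at most N residues there.\<close>

lemma specializable_ints:
  assumes "char_zero"
  shows "specializable (range (\<lambda>z::int. [z] \<cdot> \<one>))"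
proof -
  define E where "E = (\<lambda>z::int. [z] \<cdot> \<one>)"
  have E: "E (z + w) = E z \<oplus> E w" "E (z * w) = E z \<otimes> E w" "E (- z) = \<ominus> E z" "E z \<in> carrier R"
    "E 1 = \<one>" for z w
    unfolding E_def using int_embed(1)[of z w] int_embed(2)[of z w] int_embed(3)[of z]
      int_embed(4)[of z] int_embed(5) by blast+
  have E0: "E 0 = \<zero>" using E(1)[of 0 0] E(4)[of 0] by (metis add_0 add.r_cancel_one')
  have sE: "subring (range E) R"
  proof (rule subringI)
    show "range E \<subseteq> carrier R" using E(4) by blast
    show "\<one> \<in> range E" unfolding E(5)[symmetric] by simp
  next
    fix h assume "h \<in> range E" 
    then obtain z where "h = E z" by blast
    thus "\<ominus> h \<in> range E" using E(3)[of z, symmetric] by simp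
  next
    fix h k assume "h \<in> range E" "k \<in> range E"
    then obtain z w where zw: "h = E z" "k = E w" by blast
    show "h \<otimes> k \<in> range E" unfolding zw E(2)[symmetric] by simp
    show "h \<oplus> k \<in> range E" unfolding zw E(1)[symmetric] by simp
  qed
  have "\<exists>B. valuation_ring B \<and> range E \<subseteq> B \<and> b \<notin> nonunits B \<and> fin_mod (nonunits B) (range E)"
    if b: "b \<in> range E" "b \<noteq> \<zero>" for b
  proof -
    obtain z where z: "b = E z" using b by blast
    have z0: "z \<noteq> 0" using b(2) z E0 by auto
    \<comment> \<open>Modulo this number z is a unit, being congruent to 1 or to -1.\<close>
    define N where "N = \<bar>z\<bar> + 1"
    have N: "N \<ge> 2" using z0 unfolding N_def by simp
    define J where "J = range (\<lambda>w. E (N * w))"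
    have "proper_pair (range E) J"
      unfolding proper_pair_def ideal_of_def
    proof (intro conjI sE ballI)
      show "J \<subseteq> range E" unfolding J_def by blast
      show "\<zero> \<in> J" unfolding J_def E0[symmetric] by (intro image_eqI[of _ _ 0]) simp_all
    next
      fix u v assume "u \<in> J" "v \<in> J"
      then obtain w y where "u = E (N * w)" "v = E (N * y)" unfolding J_def by blast
      hence "u \<oplus> v = E (N * (w + y))" by (simp add: E(1) distrib_left)
      thus "u \<oplus> v \<in> J" unfolding J_def by simp
    next
      fix u v assume "u \<in> range E" "v \<in> J"
      then obtain w y where "u = E w" "v = E (N * y)" unfolding J_def by blast
      hence "u \<otimes> v = E (N * (w * y))" by (simp add: E(2)[symmetric] mult.left_commute)
      thus "u \<otimes> v \<in> J" unfolding J_def by simp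
    next
      show "\<one> \<notin> J"
      proof
        assume "\<one> \<in> J"
        \<comment> \<open>In characteristic zero this would make N a divisor of 1.\<close>
        then obtain w where "E 1 = E (N * w)" unfolding J_def E(5) by blast
        hence "E (1 + - (N * w)) = \<zero>" unfolding E(1,3) using E(4) by (simp add: r_neg)
        hence "1 = N * w" using int_embed_eq_zero[OF assms] unfolding E_def by fastforce
        thus False using N by (metis dvd_def not_numeral_le_zero one_le_numeral zdvd1_eq abs_of_nonneg
              numeral_le_one_iff order_trans semiring_norm(69) zero_le_numeral)
      qed
    qed
    then obtain B where V: "valuation_ring B" and AB: "range E \<subseteq> B" and J: "J \<subseteq> nonunits B"
      by (rule extend_to_valuation_ring)
    note v = valuation_ring_facts[OF V]
    note i = ideal_of_carrier[OF v(1,2)]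
    have NJ: "E (N * w) \<in> nonunits B" for w using J unfolding J_def by blast
    have "b \<notin> nonunits B"
    proof
      assume "b \<in> nonunits B"
      hence "E \<bar>z\<bar> \<in> nonunits B" using z i(8) E(3) by (cases "z \<ge> 0") auto
      hence "E N \<ominus> E \<bar>z\<bar> \<in> nonunits B" using NJ[of 1] i(9) by simp
      moreover have "E N \<ominus> E \<bar>z\<bar> = E 1" unfolding a_minus_def E(3)[symmetric] E(1)[symmetric] N_def by simp
      ultimately show False using v(3) E(5) by simp
    qed
    moreover have "fin_mod (nonunits B) (range E)"
    proof (rule fin_modI[OF v(1,2) AB])
      show "finite (E ` {0..<N})" by simp
      show "E ` {0..<N} \<subseteq> carrier R" using E(4) by blast
      fix x assume "x \<in> range E"
      then obtain w where w: "x = E w" by blast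
      have "x \<ominus> E (w mod N) = E (w - w mod N)"
        unfolding w a_minus_def E(3)[symmetric] E(1)[symmetric] by simp
      also have "w - w mod N = N * (w div N)" by (simp add: minus_mod_eq_mult_div)
      finally have "x \<ominus> E (w mod N) \<in> nonunits B" using NJ by simp
      moreover have "w mod N \<in> {0..<N}" using N by simp
      ultimately show "\<exists>f\<in>E ` {0..<N}. x \<ominus> f \<in> nonunits B" by blast
    qed
    ultimately show ?thesis using V AB by blast
  qed
  thus ?thesis using sE unfolding specializable_def E_def by blast
qed

lemma infinite_subring:
  assumes "char_zero" "subring A R"
  shows "infinite A"
proof -
  have "inj (\<lambda>n::nat. [n] \<cdot> \<one>)"
  proof (rule injI)
    fix m n :: nat assume "[m] \<cdot> \<one> = [n] \<cdot> \<one>"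
    hence "[(int m + - int n)] \<cdot> \<one> = \<zero>"
      unfolding int_embed(1,3,6) using int_embed(4)[of "int n"] by (simp add: int_embed(6) r_neg)
    thus "m = n" using int_embed_eq_zero[OF assms(1)] by fastforce
  qed
  moreover have "[n] \<cdot> \<one> \<in> A" for n :: nat
    by (induct n) (use subringE(2,3,7)[OF assms(2)] in auto)
  ultimately show ?thesis by (metis finite_imageD finite_subset image_subsetI infinite_UNIV_nat)
qed

text \<open>Starting from the integers, the elements of S are adjoined one by one.\<close>

theorem finite_residue_valuation:
  assumes "char_zero" "finite S" "S \<subseteq> carrier R" "n > 0"
  obtains B where "valuation_ring B" "S \<subseteq> B" "[(n::nat)] \<cdot> \<one> \<notin> nonunits B"
    "fin_mod (nonunits B) (generate_ring R S)"
proof -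
  have "\<exists>A. specializable A \<and> S \<subseteq> A" using assms(2,3)
  proof (induct S rule: finite_induct)
    case empty
    then show ?case using specializable_ints[OF assms(1)] by blast
  next
    case (insert s S)
    then obtain A where A: "specializable A" "S \<subseteq> A" by blast
    have s: "s \<in> carrier R" using insert by blast
    have sA: "subring A R" using A unfolding specializable_def by blast
    have "specializable (simple_extension A s)"
      using specializable_algebraic[OF A(1) s] specializable_transcendental[OF A(1) s]
        infinite_subring[OF assms(1) sA] unfolding over_def by blast
    moreover have "insert s S \<subseteq> simple_extension A s"
      using simple_extension_mem[OF sA s] simple_extension_incl[OF subringE(1)[OF sA] s] A(2) by blast
    ultimately show ?case by blast
  qed
  then obtain A where A: "specializable A" "S \<subseteq> A" by blast
  have sA: "subring A R" using A unfolding specializable_def by blast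
  have "[n] \<cdot> \<one> \<in> A"
    by (induct n) (use subringE(2,3,7)[OF sA] in auto)
  moreover have "[n] \<cdot> \<one> \<noteq> \<zero>" using assms(1,4) unfolding char_zero_def by blast
  ultimately obtain B where B: "valuation_ring B" "A \<subseteq> B" "[n] \<cdot> \<one> \<notin> nonunits B" "fin_mod (nonunits B) A"
    using A unfolding specializable_def by blast
  have sub: "generate_ring R S \<subseteq> A" by (rule generate_ring_min_subring1[OF assms(3) sA A(2)])
  note v = valuation_ring_facts[OF B(1)]
  obtain F where F: "finite F" "F \<subseteq> A" "\<And>x. x \<in> A \<Longrightarrow> \<exists>f\<in>F. x \<ominus> f \<in> nonunits B"
    using B(4) unfolding fin_mod_def by blast
  have "fin_mod (nonunits B) (generate_ring R S)"
    by (rule fin_modI[OF v(1,2) _ F(1)]) (use sub B(2) F(2,3) subringE(1)[OF sA] in blast)+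
  thus thesis using that B A(2) by blast
qed

end

section \<open>Congruences in a valuation ring\<close>

context field
begin

text \<open>The preimage in B of the residues of A. If these are finite in number, it is a local
  ring with the same residues as A: it contains the inverses of those of its elements that are
  units of B.\<close>

definition residue_ring :: "'a set \<Rightarrow> 'a set \<Rightarrow> 'a set"
  where "residue_ring B A = {z \<in> B. \<exists>r\<in>A. z \<ominus> r \<in> nonunits B}"

lemma residue_ring_facts:
  assumes V: "valuation_ring B" and A: "subring A R" "A \<subseteq> B" and fin: "fin_mod (nonunits B) A"
  shows "subring (residue_ring B A) R" "A \<subseteq> residue_ring B A" "residue_ring B A \<subseteq> B"
    "fin_mod (nonunits B) (residue_ring B A)"
    "\<And>z. z \<in> residue_ring B A \<Longrightarrow> z \<notin> nonunits B \<Longrightarrow> inv z \<in> residue_ring B A"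
proof -
  note v = valuation_ring_facts[OF V]
  note i = ideal_of_carrier[OF v(1,2)]
  note a = subringE[OF A(1)] and b = subringE[OF v(1)]
  show RB: "residue_ring B A \<subseteq> B" unfolding residue_ring_def by blast
  have RI: "z \<in> residue_ring B A" if "z \<in> B" "r \<in> A" "z \<ominus> r \<in> nonunits B" for z r
    using that unfolding residue_ring_def by blast
  have RE: "\<exists>r. r \<in> A \<and> z \<ominus> r \<in> nonunits B \<and> z \<in> B \<and> z \<in> carrier R \<and> r \<in> carrier R \<and> r \<in> B"
    if zz: "z \<in> residue_ring B A" for z
  proof -
    obtain r where r: "r \<in> A" "z \<ominus> r \<in> nonunits B" "z \<in> B" using zz unfolding residue_ring_def by blast
    thus ?thesis using a(1) b(1) A(2) by blast
  qed
  show AR: "A \<subseteq> residue_ring B A"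
  proof
    fix z assume z: "z \<in> A"
    hence "z \<in> carrier R" using a(1) by blast
    hence "z \<ominus> z \<in> nonunits B" using i(4) by (simp add: a_minus_def r_neg)
    thus "z \<in> residue_ring B A" using RI z A(2) by blast
  qed
  show "subring (residue_ring B A) R"
  proof (rule subringI)
    show "residue_ring B A \<subseteq> carrier R" using RB b(1) by blast
    show "\<one> \<in> residue_ring B A" using AR a(3) by blast
  next
    fix h assume "h \<in> residue_ring B A"
    then obtain r where r: "r \<in> A" "h \<ominus> r \<in> nonunits B" "h \<in> B" "h \<in> carrier R" "r \<in> carrier R"
      using RE by blast
    have "\<ominus> h \<ominus> \<ominus> r = \<ominus> (h \<ominus> r)" using r(4,5) by algebra
    thus "\<ominus> h \<in> residue_ring B A" using RI[OF b(5)[OF r(3)] a(5)[OF r(1)]] i(8)[OF r(2)] by simp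
  next
    fix h k assume "h \<in> residue_ring B A" "k \<in> residue_ring B A"
    then obtain r s where r: "r \<in> A" "h \<ominus> r \<in> nonunits B" "h \<in> B" "h \<in> carrier R" "r \<in> carrier R"
      and s: "s \<in> A" "k \<ominus> s \<in> nonunits B" "k \<in> B" "k \<in> carrier R" "s \<in> carrier R" "s \<in> B"
      using RE by metis
    have "h \<oplus> k \<ominus> (r \<oplus> s) = (h \<ominus> r) \<oplus> (k \<ominus> s)" using r(4,5) s(4,5) by algebra
    thus "h \<oplus> k \<in> residue_ring B A"
      using RI[OF b(7)[OF r(3) s(3)] a(7)[OF r(1) s(1)]] i(5)[OF r(2) s(2)] by simp
    have "h \<otimes> k \<ominus> r \<otimes> s = h \<otimes> (k \<ominus> s) \<oplus> s \<otimes> (h \<ominus> r)" using r(4,5) s(4,5) by algebra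
    thus "h \<otimes> k \<in> residue_ring B A"
      using RI[OF b(6)[OF r(3) s(3)] a(6)[OF r(1) s(1)]] i(5)[OF i(6)[OF r(3) s(2)] i(6)[OF s(6) r(2)]]
      by simp
  qed
  obtain F where F: "finite F" "F \<subseteq> A" "\<And>x. x \<in> A \<Longrightarrow> \<exists>f\<in>F. x \<ominus> f \<in> nonunits B"
    using fin unfolding fin_mod_def by blast
  show "fin_mod (nonunits B) (residue_ring B A)"
  proof (rule fin_modI[OF v(1,2) RB F(1)])
    show "F \<subseteq> carrier R" using F(2) a(1) by blast
    fix z assume "z \<in> residue_ring B A"
    then obtain r where r: "r \<in> A" "z \<ominus> r \<in> nonunits B" "z \<in> carrier R" "r \<in> carrier R" using RE by blast
    obtain f where f: "f \<in> F" "r \<ominus> f \<in> nonunits B" using F(3)[OF r(1)] by blast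
    have fc: "f \<in> carrier R" using f(1) F(2) a(1) by blast
    have eq: "z \<ominus> f = (z \<ominus> r) \<oplus> (r \<ominus> f)" using r(3,4) fc by algebra
    show "\<exists>f\<in>F. z \<ominus> f \<in> nonunits B" using i(5)[OF r(2) f(2), folded eq] f(1) by (rule bexI)
  qed
  fix z assume z: "z \<in> residue_ring B A" "z \<notin> nonunits B"
  then obtain r where r: "r \<in> A" "z \<ominus> r \<in> nonunits B" "z \<in> B" "z \<in> carrier R" "r \<in> carrier R" "r \<in> B"
    using RE by blast
  have rn: "r \<notin> nonunits B"
  proof
    assume "r \<in> nonunits B"
    hence "(z \<ominus> r) \<oplus> r \<in> nonunits B" using r(2) i(5) by blast
    moreover have "(z \<ominus> r) \<oplus> r = z" using r(4,5) by algebra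
    ultimately show False using z(2) by simp
  qed
  obtain c where c: "c \<in> A" "c \<otimes> r \<ominus> \<one> \<in> nonunits B"
    using residue_inverse[OF V A fin r(1) rn] by blast
  have cc: "c \<in> carrier R" "c \<in> B" using c a(1) A(2) by blast+
  have iz: "z \<noteq> \<zero>" "inv z \<in> B" using valuation_ring_cases(1)[OF V r(3) z(2)] by auto
  note n = nonzero_inv[OF r(4) iz(1)]
  have "inv z \<ominus> c = (\<ominus> (inv z)) \<otimes> (c \<otimes> (z \<ominus> r) \<oplus> (c \<otimes> r \<ominus> \<one>)) \<oplus> c \<otimes> (inv z \<otimes> z) \<ominus> c"
    using n(1) cc(1) r(4,5) by algebra
  also have "\<dots> = (\<ominus> (inv z)) \<otimes> (c \<otimes> (z \<ominus> r) \<oplus> (c \<otimes> r \<ominus> \<one>))"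
    unfolding n(3) using n(1) cc(1) r(4,5) by algebra
  finally have eq: "inv z \<ominus> c = \<dots>" .
  have "(\<ominus> (inv z)) \<otimes> (c \<otimes> (z \<ominus> r) \<oplus> (c \<otimes> r \<ominus> \<one>)) \<in> nonunits B"
    by (rule i(6)[OF b(5)[OF iz(2)] i(5)[OF i(6)[OF cc(2) r(2)] c(2)]])
  thus "inv z \<in> residue_ring B A" using RI[OF iz(2) c(1)] eq by simp
qed

definition submodule_of :: "'a set \<Rightarrow> 'a set \<Rightarrow> bool"
  where "submodule_of B N \<longleftrightarrow> N \<subseteq> carrier R \<and> \<zero> \<in> N \<and> (\<forall>u\<in>N. \<forall>v\<in>N. u \<oplus> v \<in> N) \<and>
    (\<forall>b\<in>B. \<forall>u\<in>N. b \<otimes> u \<in> N)"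

definition cg :: "'a set \<Rightarrow> 'a \<Rightarrow> 'a \<Rightarrow> bool"
  where "cg N x y \<longleftrightarrow> x \<in> carrier R \<and> y \<in> carrier R \<and> x \<ominus> y \<in> N"

text \<open>For a valuation ring B with maximal ideal m, and t other than zero, the modules scaled
  t B and scaled t m consist of the elements of the field whose value is at least, respectively
  strictly larger than, that of t.\<close>

definition scaled :: "'a \<Rightarrow> 'a set \<Rightarrow> 'a set"
  where "scaled t N = (\<lambda>u. t \<otimes> u) ` N"

lemma submodule_ideal: "subring B R \<Longrightarrow> ideal_of B I \<Longrightarrow> submodule_of B I"
  unfolding submodule_of_def ideal_of_def using subringE(1) by blast

lemma submodule_facts:
  assumes B: "subring B R" and N: "submodule_of B N"
  shows "N \<subseteq> carrier R" "\<zero> \<in> N" "\<And>u v. u \<in> N \<Longrightarrow> v \<in> N \<Longrightarrow> u \<oplus> v \<in> N"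
    "\<And>b u. b \<in> B \<Longrightarrow> u \<in> N \<Longrightarrow> b \<otimes> u \<in> N" "\<And>u. u \<in> N \<Longrightarrow> \<ominus> u \<in> N"
proof -
  show c: "N \<subseteq> carrier R" "\<zero> \<in> N" "\<And>u v. u \<in> N \<Longrightarrow> v \<in> N \<Longrightarrow> u \<oplus> v \<in> N"
    and m: "\<And>b u. b \<in> B \<Longrightarrow> u \<in> N \<Longrightarrow> b \<otimes> u \<in> N"
    using N unfolding submodule_of_def by blast+
  fix u assume u: "u \<in> N"
  have "\<ominus> \<one> \<otimes> u \<in> N" using m u subringE(3,5)[OF B] by blast
  thus "\<ominus> u \<in> N" using subsetD[OF c(1) u] by (simp add: l_minus)
qed

lemma submodule_scaled:
  assumes B: "subring B R" and N: "submodule_of B N" and t: "t \<in> carrier R"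
  shows "submodule_of B (scaled t N)"
  unfolding submodule_of_def
proof (intro conjI ballI)
  note f = submodule_facts[OF B N]
  show "scaled t N \<subseteq> carrier R" using f(1) t unfolding scaled_def by blast
  have "t \<otimes> \<zero> \<in> scaled t N" using f(2) unfolding scaled_def by blast
  thus "\<zero> \<in> scaled t N" using t by simp
  fix v assume "v \<in> scaled t N"
  then obtain v' where v: "v = t \<otimes> v'" "v' \<in> N" "v' \<in> carrier R" using f(1) unfolding scaled_def by blast
  {
    fix u assume "u \<in> scaled t N"
    then obtain u' where u: "u = t \<otimes> u'" "u' \<in> N" "u' \<in> carrier R" using f(1) unfolding scaled_def by blast
    have "u \<oplus> v = t \<otimes> (u' \<oplus> v')" unfolding u v using u v t by (simp add: r_distr)
    thus "u \<oplus> v \<in> scaled t N" unfolding scaled_def using f(3)[OF u(2) v(2)] by blast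
  }
  fix b assume b: "b \<in> B"
  have "b \<in> carrier R" using b subringE(1)[OF B] by blast
  hence "b \<otimes> v = t \<otimes> (b \<otimes> v')" unfolding v using v(3) t by (simp add: m_lcomm)
  thus "b \<otimes> v \<in> scaled t N" unfolding scaled_def using f(4)[OF b v(2)] by blast
qed

lemma scaled_mult:
  assumes t: "t \<in> carrier R" and N: "N \<subseteq> carrier R" and "u \<in> N" "v \<in> scaled t B" "B \<subseteq> carrier R"
    and "\<And>b. b \<in> B \<Longrightarrow> b \<otimes> u \<in> N"
  shows "u \<otimes> v \<in> scaled t N"
proof -
  obtain b where b: "b \<in> B" "v = t \<otimes> b" using assms(4) unfolding scaled_def by blast
  have k: "u \<in> carrier R" "b \<in> carrier R" using assms(3,5) N b by blast+
  have "u \<otimes> v = t \<otimes> (b \<otimes> u)" unfolding b using k t by (simp add: m_ac)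
  thus ?thesis using assms(6)[OF b(1)] unfolding scaled_def by blast
qed

lemma scaled_mono: "N \<subseteq> N' \<Longrightarrow> scaled t N \<subseteq> scaled t N'"
  unfolding scaled_def by blast

lemma scaled_one: "N \<subseteq> carrier R \<Longrightarrow> scaled \<one> N = N"
  unfolding scaled_def by force

lemma cg_rules:
  assumes B: "subring B R" and N: "submodule_of B N"
  shows cg_refl: "x \<in> carrier R \<Longrightarrow> cg N x x"
    and cg_sym: "cg N x y \<Longrightarrow> cg N y x"
    and cg_trans: "cg N x y \<Longrightarrow> cg N y z \<Longrightarrow> cg N x z"
    and cg_add: "cg N x y \<Longrightarrow> cg N x' y' \<Longrightarrow> cg N (x \<oplus> x') (y \<oplus> y')"
    and cg_minus: "cg N x y \<Longrightarrow> cg N x' y' \<Longrightarrow> cg N (x \<ominus> x') (y \<ominus> y')"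
    and cg_neg: "cg N x y \<Longrightarrow> cg N (\<ominus> x) (\<ominus> y)"
    and cg_scale: "b \<in> B \<Longrightarrow> cg N x y \<Longrightarrow> cg N (b \<otimes> x) (b \<otimes> y)"
    and cg_mem: "cg N x y \<Longrightarrow> x \<in> N \<longleftrightarrow> y \<in> N"
proof -
  note f = submodule_facts[OF B N]
  show "x \<in> carrier R \<Longrightarrow> cg N x x" unfolding cg_def using f(2) by (simp add: a_minus_def r_neg)
  show sym: "cg N y x" if "cg N x y" for x y
  proof -
    have k: "x \<in> carrier R" "y \<in> carrier R" "x \<ominus> y \<in> N" using that unfolding cg_def by auto
    have "y \<ominus> x = \<ominus> (x \<ominus> y)" using k(1,2) by algebra
    thus ?thesis unfolding cg_def using f(5)[OF k(3)] k by simp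
  qed
  show "cg N x z" if "cg N x y" "cg N y z"
  proof -
    have k: "x \<in> carrier R" "y \<in> carrier R" "z \<in> carrier R" "x \<ominus> y \<in> N" "y \<ominus> z \<in> N"
      using that unfolding cg_def by auto
    have "x \<ominus> z = (x \<ominus> y) \<oplus> (y \<ominus> z)" using k(1-3) by algebra
    thus ?thesis unfolding cg_def using f(3)[OF k(4,5)] k by simp
  qed
  show add: "cg N (x \<oplus> x') (y \<oplus> y')" if "cg N x y" "cg N x' y'" for x y x' y'
  proof -
    have k: "x \<in> carrier R" "y \<in> carrier R" "x' \<in> carrier R" "y' \<in> carrier R"
      "x \<ominus> y \<in> N" "x' \<ominus> y' \<in> N" using that unfolding cg_def by auto
    have "x \<oplus> x' \<ominus> (y \<oplus> y') = (x \<ominus> y) \<oplus> (x' \<ominus> y')" using k(1-4) by algebra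
    thus ?thesis unfolding cg_def using f(3)[OF k(5,6)] k by simp
  qed
  show neg: "cg N (\<ominus> x) (\<ominus> y)" if "cg N x y" for x y
  proof -
    have k: "x \<in> carrier R" "y \<in> carrier R" "x \<ominus> y \<in> N" using that unfolding cg_def by auto
    have "\<ominus> x \<ominus> \<ominus> y = \<ominus> (x \<ominus> y)" using k(1,2) by algebra
    thus ?thesis unfolding cg_def using f(5)[OF k(3)] k by simp
  qed
  show "cg N (x \<ominus> x') (y \<ominus> y')" if "cg N x y" "cg N x' y'"
    unfolding a_minus_def by (rule add[OF that(1) neg[OF that(2)]])
  show "cg N (b \<otimes> x) (b \<otimes> y)" if "b \<in> B" "cg N x y"
  proof -
    have k: "b \<in> carrier R" "x \<in> carrier R" "y \<in> carrier R" "x \<ominus> y \<in> N"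
      using that subringE(1)[OF B] unfolding cg_def by auto
    have "b \<otimes> x \<ominus> b \<otimes> y = b \<otimes> (x \<ominus> y)" using k(1-3) by algebra
    thus ?thesis unfolding cg_def using f(4)[OF that(1) k(4)] k by simp
  qed
  have mem: "y \<in> N" if "cg N x y" "x \<in> N" for x y
  proof -
    have k: "x \<in> carrier R" "y \<in> carrier R" "y \<ominus> x \<in> N" using sym[OF that(1)] unfolding cg_def by auto
    have "(y \<ominus> x) \<oplus> x = y" using k(1,2) by algebra
    thus ?thesis using f(3)[OF k(3) that(2)] by simp
  qed
  show "cg N x y \<Longrightarrow> x \<in> N \<longleftrightarrow> y \<in> N" using mem sym by blast
qed

lemma cg_mult:
  assumes B: "subring B R" and N: "submodule_of B N" and "cg N x y" "cg N x' y'" "x \<in> B" "y' \<in> B"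
  shows "cg N (x \<otimes> x') (y \<otimes> y')"
proof -
  have k: "x \<in> carrier R" "y \<in> carrier R" "x' \<in> carrier R" "y' \<in> carrier R"
    using assms(3,4) unfolding cg_def by auto
  have "cg N (x \<otimes> x') (x \<otimes> y')" by (rule cg_scale[OF B N assms(5,4)])
  moreover have "cg N (x \<otimes> y') (y \<otimes> y')"
    using cg_scale[OF B N assms(6,3)] k by (simp add: m_comm)
  ultimately show ?thesis by (rule cg_trans[OF B N])
qed

text \<open>Divisibility in a valuation ring is total, so that one of finitely many elements
  divides all others.\<close>

lemma common_divisor:
  assumes V: "valuation_ring B" and D: "finite D" "D \<noteq> {}" "D \<subseteq> carrier R"
  shows "\<exists>t\<in>D. D \<subseteq> scaled t B"
  using D
proof (induct D rule: finite_ne_induct)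
  case (singleton x)
  have B: "subring B R" using valuation_ring_facts(1)[OF V] .
  have "x = x \<otimes> \<one>" using singleton by simp
  thus ?case unfolding scaled_def using subringE(3)[OF B] by blast
next
  case (insert x D)
  note B = valuation_ring_facts(1)[OF V]
  note b = subringE[OF B]
  obtain t where t: "t \<in> D" "D \<subseteq> scaled t B" using insert by blast
  have k: "x \<in> carrier R" "t \<in> carrier R" using insert t by blast+
  have self: "y \<in> scaled y B" if "y \<in> carrier R" for y
    using that b(3) unfolding scaled_def by (intro image_eqI[of _ _ \<one>]) simp_all
  have step: "scaled y B \<subseteq> scaled z B" if "z \<in> carrier R" "q \<in> B" "y = z \<otimes> q" for y z q
  proof
    fix w assume "w \<in> scaled y B"
    then obtain c where c: "c \<in> B" "w = y \<otimes> c" unfolding scaled_def by blast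
    have "w = z \<otimes> (q \<otimes> c)" unfolding c that(3) using that(1) subsetD[OF b(1) that(2)] subsetD[OF b(1) c(1)]
      by (simp add: m_assoc)
    thus "w \<in> scaled z B" unfolding scaled_def using b(6)[OF that(2) c(1)] by blast
  qed
  show ?case
  proof (cases "t = \<zero>")
    case True
    have "D \<subseteq> scaled x B"
    proof
      fix d assume "d \<in> D"
      then obtain c where "c \<in> B" "d = t \<otimes> c" using t(2) unfolding scaled_def by blast
      hence "d = x \<otimes> \<zero>" using True b(1) k by auto
      thus "d \<in> scaled x B" unfolding scaled_def using b(2) by blast
    qed
    thus ?thesis using self[OF k(1)] by blast
  next
    case False
    note n = nonzero_inv[OF k(2) False]
    define q where "q = inv t \<otimes> x"
    have qc: "q \<in> carrier R" unfolding q_def using n k by simp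
    have "t \<otimes> q = (t \<otimes> inv t) \<otimes> x" unfolding q_def using k n(1) by (simp add: m_assoc)
    hence x: "x = t \<otimes> q" using n(2) k by simp
    show ?thesis
    proof (cases "q \<in> B")
      case True
      have "x \<in> scaled t B" unfolding scaled_def using True x by blast
      thus ?thesis using t by blast
    next
      case F: False
      note q = valuation_ring_cases(2)[OF V qc F]
      have qi: "inv q \<in> B" using q unfolding nonunits_def by blast
      note m = nonzero_inv[OF qc]
      have "x \<otimes> inv q = t \<otimes> (q \<otimes> inv q)" unfolding x using k qc m(1) q by (simp add: m_assoc)
      hence "t = x \<otimes> inv q" using m(2) q k by simp
      from step[OF k(1) qi this] show ?thesis using t(2) self[OF k(1)] by blast
    qed
  qed
qed

end

section \<open>Atlases with polynomial coordinates\<close>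

text \<open>Charts U i with finitely many coordinate functions co i l, for l in L i, that embed
  each chart into affine space. Points are compared only within a chart; the charts may overlap.\<close>

locale atlas = field R for R (structure) +
  fixes I :: "'i set" and U :: "'i \<Rightarrow> 'x set" and L :: "'i \<Rightarrow> 'l set" and co :: "'i \<Rightarrow> 'l \<Rightarrow> 'x \<Rightarrow> 'a"
  assumes finite_charts: "finite I"
    and finite_coords: "i \<in> I \<Longrightarrow> finite (L i)"
    and coord_carrier: "i \<in> I \<Longrightarrow> l \<in> L i \<Longrightarrow> y \<in> U i \<Longrightarrow> co i l y \<in> carrier R"
    and coords_separate: "i \<in> I \<Longrightarrow> y \<in> U i \<Longrightarrow> z \<in> U i \<Longrightarrow> (\<And>l. l \<in> L i \<Longrightarrow> co i l y = co i l z) \<Longrightarrow> y = z"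
begin

inductive_set regs :: "'a set \<Rightarrow> 'i \<Rightarrow> ('x \<Rightarrow> 'a) set" for C i where
  const: "c \<in> C \<Longrightarrow> (\<lambda>y. c) \<in> regs C i"
| coord: "l \<in> L i \<Longrightarrow> co i l \<in> regs C i"
| add: "g \<in> regs C i \<Longrightarrow> h \<in> regs C i \<Longrightarrow> (\<lambda>y. g y \<oplus> h y) \<in> regs C i"
| neg: "g \<in> regs C i \<Longrightarrow> (\<lambda>y. \<ominus> g y) \<in> regs C i"
| mult: "g \<in> regs C i \<Longrightarrow> h \<in> regs C i \<Longrightarrow> (\<lambda>y. g y \<otimes> h y) \<in> regs C i"

lemma regs_mono:
  assumes "C \<subseteq> D" shows "regs C i \<subseteq> regs D i"
proof
  fix g assume "g \<in> regs C i"
  thus "g \<in> regs D i" by induct (use assms in \<open>auto intro: regs.intros\<close>)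
qed

lemma regs_finite:
  assumes "g \<in> regs C i"
  shows "\<exists>D\<subseteq>C. finite D \<and> g \<in> regs D i"
  using assms
proof induct
  case (const c)
  thus ?case using regs.const[of c "{c}"] by (intro exI[of _ "{c}"]) auto
next
  case (coord l)
  thus ?case using regs.coord by (intro exI[of _ "{}"]) auto
next
  case (add g h)
  then obtain D E where "D \<subseteq> C" "finite D" "g \<in> regs D i" "E \<subseteq> C" "finite E" "h \<in> regs E i" by auto
  thus ?case using regs.add regs_mono[of D "D \<union> E"] regs_mono[of E "D \<union> E"]
    by (intro exI[of _ "D \<union> E"]) blast
next
  case (neg g)
  thus ?case using regs.neg by blast
next
  case (mult g h)
  then obtain D E where "D \<subseteq> C" "finite D" "g \<in> regs D i" "E \<subseteq> C" "finite E" "h \<in> regs E i" by auto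
  thus ?case using regs.mult regs_mono[of D "D \<union> E"] regs_mono[of E "D \<union> E"]
    by (intro exI[of _ "D \<union> E"]) blast
qed

primrec psum :: "(('x \<Rightarrow> 'a) \<times> ('x \<Rightarrow> 'a) \<times> 'i \<times> ('l \<Rightarrow> 'x \<Rightarrow> 'a)) list \<Rightarrow> 'x \<Rightarrow> 'a" where
  "psum [] y = \<zero>"
| "psum (e # es) y = fst e y \<otimes> fst (snd e) y \<oplus> psum es y"

text \<open>Wherever h does not vanish on the chart i, the map f leads to the chart i' and is
  given there by the fractions a l / h of polynomials. The entry c is the coefficient of h in a
  partition of unity.\<close>

definition local_formula :: "'a set \<Rightarrow> ('x \<Rightarrow> 'x) \<Rightarrow> 'i \<Rightarrow>
    (('x \<Rightarrow> 'a) \<times> ('x \<Rightarrow> 'a) \<times> 'i \<times> ('l \<Rightarrow> 'x \<Rightarrow> 'a)) \<Rightarrow> bool"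
  where "local_formula C f i = (\<lambda>(c, h, i', a). c \<in> regs C i \<and> h \<in> regs C i \<and> i' \<in> I \<and>
    (\<forall>l\<in>L i'. a l \<in> regs C i) \<and>
    (\<forall>y\<in>U i. h y \<noteq> \<zero> \<longrightarrow> f y \<in> U i' \<and> (\<forall>l\<in>L i'. h y \<otimes> co i' l (f y) = a l y)))"

text \<open>The sum of the products c h is 1. Hence the formulas apply everywhere, and this
  remains true after reduction modulo a maximal ideal.\<close>

definition covers :: "'a set \<Rightarrow> ('x \<Rightarrow> 'x) \<Rightarrow> 'i \<Rightarrow>
    (('x \<Rightarrow> 'a) \<times> ('x \<Rightarrow> 'a) \<times> 'i \<times> ('l \<Rightarrow> 'x \<Rightarrow> 'a)) list \<Rightarrow> bool"
  where "covers C f i es \<longleftrightarrow> (\<forall>e\<in>set es. local_formula C f i e) \<and> (\<forall>y\<in>U i. psum es y = \<one>)"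

lemma local_formula_mono: "C \<subseteq> D \<Longrightarrow> local_formula C f i e \<Longrightarrow> local_formula D f i e"
  using regs_mono[of C D i] unfolding local_formula_def by (cases e) auto

lemma covers_mono: "C \<subseteq> D \<Longrightarrow> covers C f i es \<Longrightarrow> covers D f i es"
  using local_formula_mono unfolding covers_def by blast

lemma local_formula_finite:
  assumes "local_formula C f i e"
  shows "\<exists>D\<subseteq>C. finite D \<and> local_formula D f i e"
proof -
  obtain c h i' a where e: "e = (c, h, i', a)" by (cases e) auto
  have p: "c \<in> regs C i" "h \<in> regs C i" "i' \<in> I" "\<forall>l\<in>L i'. a l \<in> regs C i"
    using assms unfolding e local_formula_def by auto
  obtain D1 D2 where D: "D1 \<subseteq> C" "finite D1" "c \<in> regs D1 i" "D2 \<subseteq> C" "finite D2" "h \<in> regs D2 i"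
    using regs_finite p(1,2) by meson
  have "\<forall>l\<in>L i'. \<exists>D\<subseteq>C. finite D \<and> a l \<in> regs D i" using regs_finite p(4) by blast
  then obtain E where E: "\<forall>l\<in>L i'. E l \<subseteq> C \<and> finite (E l) \<and> a l \<in> regs (E l) i" by metis
  define D where "D = D1 \<union> D2 \<union> (\<Union>l\<in>L i'. E l)"
  have fD: "D \<subseteq> C" "finite D" using D E finite_coords[OF p(3)] unfolding D_def by auto
  have "regs D1 i \<subseteq> regs D i" "regs D2 i \<subseteq> regs D i" "\<forall>l\<in>L i'. regs (E l) i \<subseteq> regs D i"
    using regs_mono unfolding D_def by (meson Un_upper1 Un_upper2 UN_upper order_trans)+
  moreover from this(3) have "\<forall>l\<in>L i'. a l \<in> regs D i" using E by blast
  ultimately have "local_formula D f i e"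
    using assms D(3,6) unfolding e local_formula_def by auto
  thus ?thesis using fD by blast
qed

text \<open>Formulas involve finitely many coefficients, so they are defined over a finitely
  generated ring.\<close>

lemma covers_finite:
  assumes "covers C f i es"
  shows "\<exists>D\<subseteq>C. finite D \<and> covers D f i es"
proof -
  have "\<forall>e\<in>set es. \<exists>D\<subseteq>C. finite D \<and> local_formula D f i e"
    using assms local_formula_finite unfolding covers_def by blast
  then obtain E where E: "\<forall>e\<in>set es. E e \<subseteq> C \<and> finite (E e) \<and> local_formula (E e) f i e" by metis
  define D where "D = (\<Union>e\<in>set es. E e)"
  have "D \<subseteq> C" "finite D" using E unfolding D_def by auto
  moreover have "local_formula D f i e" if "e \<in> set es" for e
    using local_formula_mono[of "E e" D] E that unfolding D_def by blast
  ultimately show ?thesis using assms unfolding covers_def by blast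
qed

end

section \<open>Linear forms\<close>

context field
begin

text \<open>Linear forms are taken as functions, so that the chain rule becomes substitution
  (forms_compose). Their coefficients matter only for counting them, by way of lform.\<close>

inductive_set forms :: "'a set \<Rightarrow> 'l set \<Rightarrow> (('l \<Rightarrow> 'a) \<Rightarrow> 'a) set" for C L where
  zero: "(\<lambda>d. \<zero>) \<in> forms C L"
| proj: "l \<in> L \<Longrightarrow> (\<lambda>d. d l) \<in> forms C L"
| add: "p \<in> forms C L \<Longrightarrow> q \<in> forms C L \<Longrightarrow> (\<lambda>d. p d \<oplus> q d) \<in> forms C L"
| scale: "c \<in> C \<Longrightarrow> p \<in> forms C L \<Longrightarrow> (\<lambda>d. c \<otimes> p d) \<in> forms C L"

lemma forms_compose:
  assumes "p \<in> forms C L'" "\<And>l. l \<in> L' \<Longrightarrow> q l \<in> forms C L"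
  shows "(\<lambda>d. p (\<lambda>l. q l d)) \<in> forms C L"
  using assms(1) by induct (use assms(2) in \<open>auto intro: forms.intros\<close>)

lemma forms_mem:
  assumes "subring B R" "submodule_of B N" "C \<subseteq> B" "p \<in> forms C L" "\<And>l. l \<in> L \<Longrightarrow> d l \<in> N"
  shows "p d \<in> N"
  using assms(4) by induct (use assms(3,5) submodule_facts[OF assms(1,2)] in auto)

lemma forms_cg:
  assumes B: "subring B R" and N: "submodule_of B N" and "C \<subseteq> B" "p \<in> forms C L"
    and "\<And>l. l \<in> L \<Longrightarrow> cg N (d l) (d' l)"
  shows "cg N (p d) (p d')"
  using assms(4)
proof induct
  case zero
  show ?case using cg_refl[OF B N] by simp
next
  case (proj l)
  thus ?case using assms(5) by simp
next
  case (add p q)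
  thus ?case using cg_add[OF B N] by simp
next
  case (scale c p)
  thus ?case using cg_scale[OF B N] assms(3) by blast
qed

primrec lform :: "('l \<Rightarrow> 'a) \<Rightarrow> 'l list \<Rightarrow> ('l \<Rightarrow> 'a) \<Rightarrow> 'a" where
  "lform r [] d = \<zero>"
| "lform r (l # ls) d = r l \<otimes> d l \<oplus> lform r ls d"

lemma lform_carrier:
  "(\<And>l. l \<in> set ls \<Longrightarrow> r l \<in> carrier R \<and> d l \<in> carrier R) \<Longrightarrow> lform r ls d \<in> carrier R"
  by (induct ls) auto

lemma lform_add:
  "(\<And>l. l \<in> set ls \<Longrightarrow> r l \<in> carrier R \<and> s l \<in> carrier R \<and> d l \<in> carrier R) \<Longrightarrow>
    lform (\<lambda>l. r l \<oplus> s l) ls d = lform r ls d \<oplus> lform s ls d"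
proof (induct ls)
  case (Cons l ls)
  have k: "r l \<in> carrier R" "s l \<in> carrier R" "d l \<in> carrier R"
    "lform r ls d \<in> carrier R" "lform s ls d \<in> carrier R"
    using Cons.prems lform_carrier[of ls] by auto
  have "lform (\<lambda>l. r l \<oplus> s l) ls d = lform r ls d \<oplus> lform s ls d" using Cons by auto
  hence "lform (\<lambda>l. r l \<oplus> s l) (l # ls) d = (r l \<oplus> s l) \<otimes> d l \<oplus> (lform r ls d \<oplus> lform s ls d)" by simp
  also have "\<dots> = (r l \<otimes> d l \<oplus> lform r ls d) \<oplus> (s l \<otimes> d l \<oplus> lform s ls d)"
    using k by algebra
  finally show ?case by simp
qed simp

lemma lform_scale:
  "c \<in> carrier R \<Longrightarrow> (\<And>l. l \<in> set ls \<Longrightarrow> r l \<in> carrier R \<and> d l \<in> carrier R) \<Longrightarrow>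
    lform (\<lambda>l. c \<otimes> r l) ls d = c \<otimes> lform r ls d"
proof (induct ls)
  case (Cons l ls)
  have "lform r ls d \<in> carrier R" using Cons.prems lform_carrier[of ls] by auto
  thus ?case using Cons by (simp add: r_distr m_assoc)
qed simp

lemma lform_proj:
  "distinct ls \<Longrightarrow> (\<And>l. l \<in> set ls \<Longrightarrow> d l \<in> carrier R) \<Longrightarrow>
    lform (\<lambda>l. if l = k then \<one> else \<zero>) ls d = (if k \<in> set ls then d k else \<zero>)"
  by (induct ls) auto

lemma forms_normal_form:
  assumes C: "subring C R" and L: "finite L" "set ls = L" "distinct ls" and p: "p \<in> forms C L"
  shows "\<exists>r. (\<forall>l. r l \<in> C) \<and> (\<forall>d. (\<forall>l\<in>L. d l \<in> carrier R) \<longrightarrow> p d = lform r ls d)"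
  using p
proof induct
  note c = subringE[OF C]
  case zero
  have z: "lform (\<lambda>l. \<zero>) ks d = \<zero>" if "\<forall>l\<in>set ks. d l \<in> carrier R" for ks d
    using that by (induct ks) auto
  show ?case using c(2) L(2) z[of ls] by (intro exI[of _ "\<lambda>l. \<zero>"]) force
next
  note c = subringE[OF C]
  case (proj l)
  thus ?case using c(2,3) L lform_proj[OF L(3), of _ l] by (intro exI[of _ "\<lambda>k. if k = l then \<one> else \<zero>"]) auto
next
  note c = subringE[OF C]
  case (add p q)
  then obtain r s where r: "\<forall>l. r l \<in> C" "\<forall>d. (\<forall>l\<in>L. d l \<in> carrier R) \<longrightarrow> p d = lform r ls d"
    and s: "\<forall>l. s l \<in> C" "\<forall>d. (\<forall>l\<in>L. d l \<in> carrier R) \<longrightarrow> q d = lform s ls d" by blast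
  show ?case
  proof (intro exI[of _ "\<lambda>l. r l \<oplus> s l"] conjI allI impI)
    fix l show "r l \<oplus> s l \<in> C" using r(1) s(1) c(7) by blast
  next
    fix d assume d: "\<forall>l\<in>L. d l \<in> carrier R"
    have "r l \<in> carrier R" "s l \<in> carrier R" for l using r(1) s(1) c(1) by blast+
    thus "p d \<oplus> q d = lform (\<lambda>l. r l \<oplus> s l) ls d"
      using lform_add[of ls r s d] r(2) s(2) d L(2) by simp
  qed
next
  note c = subringE[OF C]
  case (scale a p)
  then obtain r where r: "\<forall>l. r l \<in> C" "\<forall>d. (\<forall>l\<in>L. d l \<in> carrier R) \<longrightarrow> p d = lform r ls d" by blast
  show ?case
  proof (intro exI[of _ "\<lambda>l. a \<otimes> r l"] conjI allI impI)
    fix l show "a \<otimes> r l \<in> C" using r(1) c(6) scale(1) by blast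
  next
    fix d assume d: "\<forall>l\<in>L. d l \<in> carrier R"
    have "r l \<in> carrier R" for l using r(1) c(1) by blast
    thus "a \<otimes> p d = lform (\<lambda>l. a \<otimes> r l) ls d"
      using lform_scale[of a ls r d] r(2) d L(2) scale(1) c(1) by auto
  qed
qed

text \<open>Reducing the coefficients modulo J leaves finitely many forms. The error is measured
  relative to the size t of the arguments, which may be any element of the field.\<close>

lemma forms_finite_mod:
  assumes B: "subring B R" and I: "ideal_of B J" and C: "subring C R" "C \<subseteq> B" and fin: "fin_mod J C"
    and L: "finite L"
  shows "\<exists>\<Phi>. finite \<Phi> \<and> (\<forall>p\<in>forms C L. \<exists>q\<in>\<Phi>. \<forall>t\<in>carrier R. \<forall>d. (\<forall>l\<in>L. d l \<in> scaled t B) \<longrightarrow>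
    cg (scaled t J) (p d) (q d))"
proof -
  obtain F where F: "finite F" "F \<subseteq> C" "\<And>x. x \<in> C \<Longrightarrow> \<exists>f\<in>F. x \<ominus> f \<in> J"
    using fin unfolding fin_mod_def by blast
  obtain ls where ls: "set ls = L" "distinct ls" using finite_distinct_list[OF L] by blast
  define \<Phi> where "\<Phi> = (\<lambda>r. lform r ls) ` (PiE L (\<lambda>_. F))"
  have "finite \<Phi>" unfolding \<Phi>_def using F(1) L by (intro finite_imageI finite_PiE) auto
  moreover have "\<exists>q\<in>\<Phi>. \<forall>t\<in>carrier R. \<forall>d. (\<forall>l\<in>L. d l \<in> scaled t B) \<longrightarrow> cg (scaled t J) (p d) (q d)"
    if p: "p \<in> forms C L" for p
  proof -
    obtain r where r: "\<forall>l. r l \<in> C" "\<forall>d. (\<forall>l\<in>L. d l \<in> carrier R) \<longrightarrow> p d = lform r ls d"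
      using forms_normal_form[OF C(1) L ls p] by blast
    have "\<forall>l. \<exists>f. f \<in> F \<and> r l \<ominus> f \<in> J" using F(3) r(1) by blast
    then obtain g where "\<forall>l. g l \<in> F \<and> r l \<ominus> g l \<in> J" by (rule choice[THEN exE])
    hence g: "g l \<in> F" "r l \<ominus> g l \<in> J" for l by blast+
    have rc: "r l \<in> carrier R" "g l \<in> carrier R" for l
      using r(1) g(1) F(2) subringE(1)[OF C(1)] by blast+
    show ?thesis
    proof (intro bexI[of _ "lform (restrict g L) ls"] ballI allI impI)
      show "lform (restrict g L) ls \<in> \<Phi>" unfolding \<Phi>_def using g(1) by auto
      fix t d assume t: "t \<in> carrier R" and d: "\<forall>l\<in>L. d l \<in> scaled t B"
      have N: "submodule_of B (scaled t J)" by (rule submodule_scaled[OF B submodule_ideal[OF B I] t])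
      have NB: "submodule_of B (scaled t B)"
        by (rule submodule_scaled[OF B submodule_ideal[OF B ideal_of_self[OF B]] t])
      have dc: "d l \<in> carrier R" if "l \<in> L" for l using d that submodule_facts(1)[OF B NB] by blast
      have "cg (scaled t J) (lform r ks d) (lform (restrict g L) ks d)" if "set ks \<subseteq> L" for ks
        using that
      proof (induct ks)
        case Nil
        show ?case using cg_refl[OF B N] by simp
      next
        case (Cons l ks)
        have l: "l \<in> L" using Cons.prems by simp
        have "(r l \<ominus> g l) \<otimes> d l \<in> scaled t J"
        proof (rule scaled_mult[OF t ideal_of_carrier(3)[OF B I] g(2)])
          show "d l \<in> scaled t B" using d l by blast
          show "B \<subseteq> carrier R" by (rule subringE(1)[OF B])
          show "b \<otimes> (r l \<ominus> g l) \<in> J" if "b \<in> B" for b using ideal_of_carrier(6)[OF B I that g(2)] .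
        qed
        moreover have "r l \<otimes> d l \<ominus> g l \<otimes> d l = (r l \<ominus> g l) \<otimes> d l" using rc[of l] dc[OF l] by algebra
        ultimately have "cg (scaled t J) (r l \<otimes> d l) (g l \<otimes> d l)"
          unfolding cg_def using rc[of l] dc[OF l] by simp
        thus ?case using cg_add[OF B N] Cons l by simp
      qed
      from this[of ls] show "cg (scaled t J) (p d) (lform (restrict g L) ls d)"
        using ls r(2) dc by simp
    qed
  qed
  ultimately show ?thesis by blast
qed

end

section \<open>First-order expansions on residue discs\<close>

text \<open>The reduction of an atlas and of maps f j modulo one valuation. The formulas Q j i are
  fixed because the lifts of the maps depend on their choice.\<close>

locale lifted = atlas R I U L co
  for R (structure) and I :: "'i set" and U :: "'i \<Rightarrow> 'x set" and L :: "'i \<Rightarrow> 'l set"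
    and co :: "'i \<Rightarrow> 'l \<Rightarrow> 'x \<Rightarrow> 'a" +
  fixes C B :: "'a set" and f :: "'j \<Rightarrow> 'x \<Rightarrow> 'x"
    and Q :: "'j \<Rightarrow> 'i \<Rightarrow> (('x \<Rightarrow> 'a) \<times> ('x \<Rightarrow> 'a) \<times> 'i \<times> ('l \<Rightarrow> 'x \<Rightarrow> 'a)) list"
  assumes V: "valuation_ring B" and C_B: "C \<subseteq> B"
    and fin: "fin_mod (nonunits B) (generate_ring R C)"
    and cov: "i \<in> I \<Longrightarrow> covers C (f j) i (Q j i)"
begin

abbreviation "m \<equiv> nonunits B"
text \<open>The coordinates of the points under consideration are taken from this local ring
  rather than from B, because it has a finite residue field.\<close>

definition "Loc = residue_ring B (generate_ring R C)"

lemmas v = valuation_ring_facts[OF V]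
lemmas m_ideal = ideal_of_carrier[OF v(1,2)]
lemmas m_submodule = submodule_ideal[OF v(1,2)]
lemmas B_submodule = submodule_ideal[OF v(1) ideal_of_self[OF v(1)]]
lemmas B_ops = subringE[OF v(1)]
lemmas scaled_m_submodule = submodule_scaled[OF v(1) m_submodule]
lemmas scaled_B_submodule = submodule_scaled[OF v(1) B_submodule]

lemma gen_facts: "subring (generate_ring R C) R" "generate_ring R C \<subseteq> B" "C \<subseteq> generate_ring R C"
proof -
  have c: "C \<subseteq> carrier R" using C_B B_ops(1) by blast
  show "subring (generate_ring R C) R" by (rule generate_ring_is_subring[OF c])
  show "generate_ring R C \<subseteq> B" by (rule generate_ring_min_subring1[OF c v(1) C_B])
  show "C \<subseteq> generate_ring R C" by (auto intro: generate_ring.incl)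
qed

lemma Loc_facts: "subring Loc R" "generate_ring R C \<subseteq> Loc" "Loc \<subseteq> B" "fin_mod m Loc"
  "\<And>z. z \<in> Loc \<Longrightarrow> z \<notin> m \<Longrightarrow> inv z \<in> Loc"
  unfolding Loc_def using residue_ring_facts[OF V gen_facts(1,2) fin] by blast+

lemmas Loc_ops = subringE[OF Loc_facts(1)]

text \<open>Points tagged with a chart in which their coordinates are integral. The tag is part of
  the data because a point may lie in several charts, and a map that moves points has to choose
  one.\<close>

definition T :: "('i \<times> 'x) set"
  where "T = {(i, y). i \<in> I \<and> y \<in> U i \<and> (\<forall>l\<in>L i. co i l y \<in> Loc)}"

definition tco :: "'i \<times> 'x \<Rightarrow> 'l \<Rightarrow> 'a"
  where "tco t l = co (fst t) l (snd t)"

definition diff :: "'i \<times> 'x \<Rightarrow> 'i \<times> 'x \<Rightarrow> 'l \<Rightarrow> 'a"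
  where "diff t t' l = tco t l \<ominus> tco t' l"

text \<open>Nearness is lying in the same residue disc.\<close>

definition near :: "'i \<times> 'x \<Rightarrow> 'i \<times> 'x \<Rightarrow> bool"
  where "near t t' \<longleftrightarrow> fst t = fst t' \<and> (\<forall>l\<in>L (fst t). cg m (tco t l) (tco t' l))"

lemma T_facts:
  assumes "t \<in> T"
  shows "fst t \<in> I" "snd t \<in> U (fst t)" "l \<in> L (fst t) \<Longrightarrow> tco t l \<in> Loc"
    "l \<in> L (fst t) \<Longrightarrow> tco t l \<in> B" "l \<in> L (fst t) \<Longrightarrow> tco t l \<in> carrier R"
proof -
  show "fst t \<in> I" "snd t \<in> U (fst t)" "l \<in> L (fst t) \<Longrightarrow> tco t l \<in> Loc"
    using assms unfolding T_def tco_def by auto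
  thus "l \<in> L (fst t) \<Longrightarrow> tco t l \<in> B" "l \<in> L (fst t) \<Longrightarrow> tco t l \<in> carrier R"
    using Loc_facts(3) B_ops(1) by (blast, blast)
qed

lemma near_refl: "t \<in> T \<Longrightarrow> near t t"
  unfolding near_def using cg_refl[OF v(1) m_submodule] T_facts(5) by blast

lemma near_sym: "near t t' \<Longrightarrow> near t' t"
  unfolding near_def using cg_sym[OF v(1) m_submodule] by auto

lemma near_trans: "near t t' \<Longrightarrow> near t' t'' \<Longrightarrow> near t t''"
  unfolding near_def using cg_trans[OF v(1) m_submodule] by (metis (no_types, lifting))

lemma diff_near: "near t t' \<Longrightarrow> l \<in> L (fst t) \<Longrightarrow> diff t t' l \<in> m"
  unfolding near_def diff_def cg_def by blast

lemma diff_carrier: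
  "t \<in> T \<Longrightarrow> t' \<in> T \<Longrightarrow> near t t' \<Longrightarrow> l \<in> L (fst t) \<Longrightarrow> diff t t' l \<in> carrier R"
  using diff_near m_ideal(3) by blast

text \<open>The form p is the differential of g on the residue disc of t0: if \<tau> bounds the
  differences of the coordinates of two points of the disc, then p predicts the difference of the
  values of g up to an error strictly smaller than \<tau>. One form serves for the whole disc,
  since changing the point changes coefficients only by nonunits.\<close>

definition derives :: "'i \<times> 'x \<Rightarrow> ('x \<Rightarrow> 'a) \<Rightarrow> (('l \<Rightarrow> 'a) \<Rightarrow> 'a) \<Rightarrow> bool"
  where "derives t0 g p \<longleftrightarrow> p \<in> forms Loc (L (fst t0)) \<and>
    (\<forall>t\<in>T. near t0 t \<longrightarrow> g (snd t) \<in> Loc) \<and>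
    (\<forall>t\<in>T. \<forall>t'\<in>T. near t0 t \<longrightarrow> near t0 t' \<longrightarrow> (\<forall>\<tau>\<in>carrier R.
      (\<forall>l\<in>L (fst t0). diff t t' l \<in> scaled \<tau> B) \<longrightarrow>
      cg (scaled \<tau> m) (g (snd t) \<ominus> g (snd t')) (p (diff t t'))))"

lemma derives_const: "c \<in> Loc \<Longrightarrow> derives t0 (\<lambda>y. c) (\<lambda>d. \<zero>)"
  unfolding derives_def
proof (intro conjI ballI impI forms.zero)
  fix \<tau> assume c: "c \<in> Loc" and t: "\<tau> \<in> carrier R"
  have "c \<in> carrier R" using c Loc_ops(1) by blast
  hence "c \<ominus> c = \<zero>" by (simp add: a_minus_def r_neg)
  thus "cg (scaled \<tau> m) (c \<ominus> c) \<zero>" using cg_refl[OF v(1) scaled_m_submodule[OF t]] by simp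
qed

lemma derives_coord:
  assumes "l \<in> L (fst t0)"
  shows "derives t0 (co (fst t0) l) (\<lambda>d. d l)"
  unfolding derives_def
proof (intro conjI ballI impI forms.proj assms)
  fix t assume t: "t \<in> T" "near t0 t"
  hence e: "co (fst t0) l (snd t) = tco t l" unfolding near_def tco_def by simp
  show "co (fst t0) l (snd t) \<in> Loc" unfolding e using T_facts(3)[OF t(1)] assms t(2) unfolding near_def by simp
  fix t' \<tau> assume t': "t' \<in> T" "near t0 t'" "\<tau> \<in> carrier R"
  have n: "near t t'" using near_trans[OF near_sym[OF t(2)] t'(2)] .
  have e': "co (fst t0) l (snd t') = tco t' l" using t'(2) unfolding near_def tco_def by simp
  have "diff t t' l \<in> carrier R" using diff_carrier[OF t(1) t'(1) n] assms t(2) unfolding near_def by simp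
  thus "cg (scaled \<tau> m) (co (fst t0) l (snd t) \<ominus> co (fst t0) l (snd t')) (diff t t' l)"
    unfolding e e' diff_def using cg_refl[OF v(1) scaled_m_submodule[OF t'(3)]] by simp
qed

lemma derivesD:
  assumes "derives t0 g p" "t \<in> T" "near t0 t"
  shows "g (snd t) \<in> Loc" "g (snd t) \<in> B" "g (snd t) \<in> carrier R"
    "t' \<in> T \<Longrightarrow> near t0 t' \<Longrightarrow> \<tau> \<in> carrier R \<Longrightarrow> (\<And>l. l \<in> L (fst t0) \<Longrightarrow> diff t t' l \<in> scaled \<tau> B) \<Longrightarrow>
      cg (scaled \<tau> m) (g (snd t) \<ominus> g (snd t')) (p (diff t t'))"
proof -
  show "g (snd t) \<in> Loc" using assms unfolding derives_def by blast
  thus "g (snd t) \<in> B" "g (snd t) \<in> carrier R" using Loc_facts(3) Loc_ops(1) by (blast, blast)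
  show "t' \<in> T \<Longrightarrow> near t0 t' \<Longrightarrow> \<tau> \<in> carrier R \<Longrightarrow> (\<And>l. l \<in> L (fst t0) \<Longrightarrow> diff t t' l \<in> scaled \<tau> B) \<Longrightarrow>
      cg (scaled \<tau> m) (g (snd t) \<ominus> g (snd t')) (p (diff t t'))"
    using assms unfolding derives_def by simp
qed

lemma cg_diff_zero:
  assumes "x \<in> carrier R" "y \<in> carrier R" "cg N (x \<ominus> y) z" "z \<in> N" "submodule_of B N"
  shows "cg N x y"
proof -
  have "x \<ominus> y \<in> N" using cg_mem[OF v(1) assms(5,3)] assms(4) by simp
  thus ?thesis unfolding cg_def using assms by simp
qed

lemma forms_in_scaled:
  assumes "p \<in> forms Loc M" "\<And>l. l \<in> M \<Longrightarrow> d l \<in> scaled \<tau> B" "\<tau> \<in> carrier R"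
  shows "p d \<in> scaled \<tau> B"
  by (rule forms_mem[OF v(1) scaled_B_submodule[OF assms(3)] Loc_facts(3) assms(1,2)])

lemma derives_near:
  assumes d: "derives t0 g p" and t: "t \<in> T" "near t0 t" and t': "t' \<in> T" "near t0 t'"
  shows "cg m (g (snd t)) (g (snd t'))"
proof -
  have n: "near t t'" by (rule near_trans[OF near_sym[OF t(2)] t'(2)])
  have e: "scaled \<one> m = m" "scaled \<one> B = B" using scaled_one m_ideal(3) B_ops(1) by blast+
  have dm: "diff t t' l \<in> m" if "l \<in> L (fst t0)" for l using diff_near[OF n] that t(2) unfolding near_def by simp
  hence dB: "diff t t' l \<in> B" if "l \<in> L (fst t0)" for l using that m_ideal(1) by blast
  have "cg m (g (snd t) \<ominus> g (snd t')) (p (diff t t'))"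
    using derivesD(4)[OF d t t' one_closed] dB unfolding e by blast
  moreover have "p (diff t t') \<in> m"
  proof -
    have "p \<in> forms Loc (L (fst t0))" using d unfolding derives_def by blast
    from forms_mem[OF v(1) m_submodule Loc_facts(3) this, of "diff t t'"] dm show ?thesis by blast
  qed
  ultimately show ?thesis using cg_diff_zero derivesD(3)[OF d t] derivesD(3)[OF d t'] m_submodule by blast
qed

lemma cg_prod_scaled:
  assumes t: "\<tau> \<in> carrier R" and "cg m x x0" "x \<in> B" "cg (scaled \<tau> m) y y0" "y0 \<in> scaled \<tau> B"
  shows "cg (scaled \<tau> m) (x \<otimes> y) (x0 \<otimes> y0)"
proof -
  note S = scaled_m_submodule[OF t]
  have k: "x \<in> carrier R" "x0 \<in> carrier R" "y \<in> carrier R" "y0 \<in> carrier R" "x \<ominus> x0 \<in> m"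
    using assms unfolding cg_def by auto
  have "cg (scaled \<tau> m) (x \<otimes> y) (x \<otimes> y0)" by (rule cg_scale[OF v(1) S assms(3,4)])
  moreover have "(x \<ominus> x0) \<otimes> y0 \<in> scaled \<tau> m"
    by (rule scaled_mult[OF t m_ideal(3) k(5) assms(5) B_ops(1)]) (use m_ideal(6) k(5) in blast)
  moreover have "x \<otimes> y0 \<ominus> x0 \<otimes> y0 = (x \<ominus> x0) \<otimes> y0" using k(1-4) by algebra
  ultimately have "cg (scaled \<tau> m) (x \<otimes> y) (x \<otimes> y0)" "cg (scaled \<tau> m) (x \<otimes> y0) (x0 \<otimes> y0)"
    unfolding cg_def using k by auto
  thus ?thesis by (rule cg_trans[OF v(1) S])
qed

lemma derives_add:
  assumes g: "derives t0 g p" and h: "derives t0 h q"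
  shows "derives t0 (\<lambda>y. g y \<oplus> h y) (\<lambda>d. p d \<oplus> q d)"
  unfolding derives_def
proof (intro conjI ballI impI)
  show "(\<lambda>d. p d \<oplus> q d) \<in> forms Loc (L (fst t0))" using g h unfolding derives_def by (auto intro: forms.add)
  fix t assume t: "t \<in> T" "near t0 t"
  show "g (snd t) \<oplus> h (snd t) \<in> Loc" using derivesD(1)[OF g t] derivesD(1)[OF h t] Loc_ops(7) by blast
  fix t' \<tau> assume t': "t' \<in> T" "near t0 t'" "\<tau> \<in> carrier R" and d: "\<forall>l\<in>L (fst t0). diff t t' l \<in> scaled \<tau> B"
  note k = derivesD(3)[OF g t] derivesD(3)[OF h t] derivesD(3)[OF g t'(1,2)] derivesD(3)[OF h t'(1,2)]
  have "g (snd t) \<oplus> h (snd t) \<ominus> (g (snd t') \<oplus> h (snd t')) = (g (snd t) \<ominus> g (snd t')) \<oplus> (h (snd t) \<ominus> h (snd t'))"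
    using k by algebra
  thus "cg (scaled \<tau> m) (g (snd t) \<oplus> h (snd t) \<ominus> (g (snd t') \<oplus> h (snd t'))) (p (diff t t') \<oplus> q (diff t t'))"
    using cg_add[OF v(1) scaled_m_submodule[OF t'(3)] derivesD(4)[OF g t t'] derivesD(4)[OF h t t']] d by simp
qed

text \<open>The Leibniz rule. The factors g and h may be evaluated at t0 instead of the points
  under comparison, because they are constant modulo nonunits on the disc.\<close>

lemma derives_mult:
  assumes t0: "t0 \<in> T" and g: "derives t0 g p" and h: "derives t0 h q"
  shows "derives t0 (\<lambda>y. g y \<otimes> h y) (\<lambda>d. g (snd t0) \<otimes> q d \<oplus> h (snd t0) \<otimes> p d)"
  unfolding derives_def
proof (intro conjI ballI impI)
  note n0 = near_refl[OF t0]
  have p: "p \<in> forms Loc (L (fst t0))" "q \<in> forms Loc (L (fst t0))" using g h unfolding derives_def by blast+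
  show "(\<lambda>d. g (snd t0) \<otimes> q d \<oplus> h (snd t0) \<otimes> p d) \<in> forms Loc (L (fst t0))"
    by (intro forms.add forms.scale p derivesD(1)[OF g t0 n0] derivesD(1)[OF h t0 n0])
  fix t assume t: "t \<in> T" "near t0 t"
  show "g (snd t) \<otimes> h (snd t) \<in> Loc" using derivesD(1)[OF g t] derivesD(1)[OF h t] Loc_ops(6) by blast
  fix t' \<tau> assume t': "t' \<in> T" "near t0 t'" "\<tau> \<in> carrier R" and d: "\<forall>l\<in>L (fst t0). diff t t' l \<in> scaled \<tau> B"
  note k = derivesD(3)[OF g t] derivesD(3)[OF h t] derivesD(3)[OF g t'(1,2)] derivesD(3)[OF h t'(1,2)]
  have e: "g (snd t) \<otimes> h (snd t) \<ominus> g (snd t') \<otimes> h (snd t')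
    = g (snd t) \<otimes> (h (snd t) \<ominus> h (snd t')) \<oplus> h (snd t') \<otimes> (g (snd t) \<ominus> g (snd t'))"
    using k by algebra
  show "cg (scaled \<tau> m) (g (snd t) \<otimes> h (snd t) \<ominus> g (snd t') \<otimes> h (snd t'))
      (g (snd t0) \<otimes> q (diff t t') \<oplus> h (snd t0) \<otimes> p (diff t t'))"
    unfolding e
  proof (rule cg_add[OF v(1) scaled_m_submodule[OF t'(3)]])
    show "cg (scaled \<tau> m) (g (snd t) \<otimes> (h (snd t) \<ominus> h (snd t'))) (g (snd t0) \<otimes> q (diff t t'))"
      by (rule cg_prod_scaled[OF t'(3) derives_near[OF g t t0 n0] derivesD(2)[OF g t]
            derivesD(4)[OF h t t'] forms_in_scaled[OF p(2) _ t'(3)]]) (use d in auto)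
    show "cg (scaled \<tau> m) (h (snd t') \<otimes> (g (snd t) \<ominus> g (snd t'))) (h (snd t0) \<otimes> p (diff t t'))"
      by (rule cg_prod_scaled[OF t'(3) derives_near[OF h t'(1,2) t0 n0] derivesD(2)[OF h t'(1,2)]
            derivesD(4)[OF g t t'] forms_in_scaled[OF p(1) _ t'(3)]]) (use d in auto)
  qed
qed

text \<open>The quotient rule for g = a/h, with differential (p - g q)/h, evaluated at t0. The
  denominator h is a unit on the whole disc since it is one at t0.\<close>

lemma derives_divide:
  assumes t0: "t0 \<in> T" and h: "derives t0 h q" and a: "derives t0 a p" and h0: "h (snd t0) \<notin> m"
    and eq: "\<And>t. t \<in> T \<Longrightarrow> near t0 t \<Longrightarrow> g (snd t) \<in> carrier R \<and> h (snd t) \<otimes> g (snd t) = a (snd t)"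
  shows "\<exists>r. derives t0 g r"
proof -
  note n0 = near_refl[OF t0]
  have pq: "p \<in> forms Loc (L (fst t0))" "q \<in> forms Loc (L (fst t0))" using a h unfolding derives_def by blast+
  have hn: "h (snd t) \<notin> m" if "t \<in> T" "near t0 t" for t
    using cg_mem[OF v(1) m_submodule derives_near[OF h that t0 n0]] h0 by simp
  have gO: "g (snd t) \<in> Loc" and ihO: "inv (h (snd t)) \<in> Loc" and
    ih: "inv (h (snd t)) \<in> carrier R" "inv (h (snd t)) \<otimes> h (snd t) = \<one>"
    if t: "t \<in> T" "near t0 t" for t
  proof -
    show i: "inv (h (snd t)) \<in> Loc" using Loc_facts(5)[OF derivesD(1)[OF h t] hn[OF t]] .
    have k: "h (snd t) \<in> carrier R" by (rule derivesD(3)[OF h t])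
    have "h (snd t) \<noteq> \<zero>" using hn[OF t] m_ideal(4) by metis
    note n = nonzero_inv[OF k this]
    show "inv (h (snd t)) \<in> carrier R" "inv (h (snd t)) \<otimes> h (snd t) = \<one>" using n(1,3) by blast+
    have "g (snd t) = (inv (h (snd t)) \<otimes> h (snd t)) \<otimes> g (snd t)" using n eq[OF t] by simp
    also have "\<dots> = inv (h (snd t)) \<otimes> a (snd t)" using n(1) k eq[OF t] by (simp add: m_assoc)
    finally show "g (snd t) \<in> Loc" using Loc_ops(6)[OF i derivesD(1)[OF a t]] by simp
  qed
  have ihc: "cg m (inv (h (snd t))) (inv (h (snd t0)))" if t: "t \<in> T" "near t0 t" for t
  proof -
    note k = derivesD(3)[OF h t] derivesD(3)[OF h t0 n0]
    have "inv (h (snd t)) \<ominus> inv (h (snd t0))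
      = inv (h (snd t)) \<otimes> (inv (h (snd t0)) \<otimes> h (snd t0)) \<ominus> (inv (h (snd t)) \<otimes> h (snd t)) \<otimes> inv (h (snd t0))"
      unfolding ih(2)[OF t] ih(2)[OF t0 n0] using ih(1)[OF t] ih(1)[OF t0 n0] by simp
    also have "\<dots> = (inv (h (snd t)) \<otimes> inv (h (snd t0))) \<otimes> (h (snd t0) \<ominus> h (snd t))"
      using ih(1)[OF t] ih(1)[OF t0 n0] k by algebra
    finally have e: "inv (h (snd t)) \<ominus> inv (h (snd t0)) = \<dots>" .
    have "h (snd t0) \<ominus> h (snd t) \<in> m" using derives_near[OF h t0 n0 t] unfolding cg_def by blast
    moreover have "inv (h (snd t)) \<otimes> inv (h (snd t0)) \<in> B"
      using Loc_ops(6)[OF ihO[OF t] ihO[OF t0 n0]] Loc_facts(3) by blast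
    ultimately show ?thesis unfolding cg_def e using m_ideal(6) ih(1)[OF t] ih(1)[OF t0 n0] by blast
  qed
  have gc: "cg m (g (snd t)) (g (snd t0))" if t: "t \<in> T" "near t0 t" for t
  proof -
    have e: "g (snd s) = inv (h (snd s)) \<otimes> a (snd s)" if s: "s \<in> T" "near t0 s" for s
    proof -
      have "inv (h (snd s)) \<otimes> a (snd s) = (inv (h (snd s)) \<otimes> h (snd s)) \<otimes> g (snd s)"
        using ih(1)[OF s] derivesD(3)[OF h s] eq[OF s] by (simp add: m_assoc)
      thus ?thesis using ih(2)[OF s] eq[OF s] by simp
    qed
    show ?thesis unfolding e[OF t] e[OF t0 n0]
      by (rule cg_mult[OF v(1) m_submodule ihc[OF t] derives_near[OF a t t0 n0]])
        (use Loc_facts(3) ihO[OF t] derivesD(2)[OF a t0 n0] in blast)+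
  qed
  have "derives t0 g (\<lambda>d. inv (h (snd t0)) \<otimes> (p d \<oplus> (\<ominus> g (snd t0)) \<otimes> q d))"
    unfolding derives_def
  proof (intro conjI ballI impI)
    show "(\<lambda>d. inv (h (snd t0)) \<otimes> (p d \<oplus> (\<ominus> g (snd t0)) \<otimes> q d)) \<in> forms Loc (L (fst t0))"
      by (intro forms.add forms.scale pq ihO[OF t0 n0] Loc_ops(5) gO[OF t0 n0])
    fix t assume t: "t \<in> T" "near t0 t"
    show "g (snd t) \<in> Loc" by (rule gO[OF t])
    fix t' \<tau> assume t': "t' \<in> T" "near t0 t'" "\<tau> \<in> carrier R" and d: "\<forall>l\<in>L (fst t0). diff t t' l \<in> scaled \<tau> B"
    note k = derivesD(3)[OF h t] derivesD(3)[OF h t'(1,2)] ih(1)[OF t]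
    have gk: "g (snd t) \<in> carrier R" "g (snd t') \<in> carrier R" using eq t t' by blast+
    have e: "g (snd t) \<ominus> g (snd t') =
      inv (h (snd t)) \<otimes> ((a (snd t) \<ominus> a (snd t')) \<oplus> (\<ominus> g (snd t')) \<otimes> (h (snd t) \<ominus> h (snd t')))"
    proof -
      have "inv (h (snd t)) \<otimes> ((h (snd t) \<otimes> g (snd t) \<ominus> h (snd t') \<otimes> g (snd t'))
          \<oplus> (\<ominus> g (snd t')) \<otimes> (h (snd t) \<ominus> h (snd t')))
        = (inv (h (snd t)) \<otimes> h (snd t)) \<otimes> (g (snd t) \<ominus> g (snd t'))"
        using k gk by algebra
      also have "\<dots> = g (snd t) \<ominus> g (snd t')" using ih(2)[OF t] gk by simp
      finally show ?thesis using eq[OF t] eq[OF t'(1,2)] by simp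
    qed
    note S = scaled_m_submodule[OF t'(3)]
    have pB: "p (diff t t') \<in> scaled \<tau> B" "q (diff t t') \<in> scaled \<tau> B"
      using forms_in_scaled[OF pq(1) _ t'(3)] forms_in_scaled[OF pq(2) _ t'(3)] d by blast+
    have gB: "\<ominus> g (snd t') \<in> B" "\<ominus> g (snd t0) \<in> B" using B_ops(5) gO Loc_facts(3) t' t0 n0 by blast+
    have 1: "cg (scaled \<tau> m) ((\<ominus> g (snd t')) \<otimes> (h (snd t) \<ominus> h (snd t'))) ((\<ominus> g (snd t0)) \<otimes> q (diff t t'))"
      by (rule cg_prod_scaled[OF t'(3) cg_neg[OF v(1) m_submodule gc[OF t'(1,2)]] gB(1)
            derivesD(4)[OF h t t'] pB(2)]) (use d in auto)
    have 2: "cg (scaled \<tau> m) ((a (snd t) \<ominus> a (snd t')) \<oplus> (\<ominus> g (snd t')) \<otimes> (h (snd t) \<ominus> h (snd t')))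
        (p (diff t t') \<oplus> (\<ominus> g (snd t0)) \<otimes> q (diff t t'))"
      by (rule cg_add[OF v(1) S derivesD(4)[OF a t t'] 1]) (use d in auto)
    have 3: "p (diff t t') \<oplus> (\<ominus> g (snd t0)) \<otimes> q (diff t t') \<in> scaled \<tau> B"
      using submodule_facts(3,4)[OF v(1) scaled_B_submodule[OF t'(3)]] pB gB(2) by blast
    show "cg (scaled \<tau> m) (g (snd t) \<ominus> g (snd t'))
      (inv (h (snd t0)) \<otimes> (p (diff t t') \<oplus> (\<ominus> g (snd t0)) \<otimes> q (diff t t')))"
      unfolding e by (rule cg_prod_scaled[OF t'(3) ihc[OF t] _ 2 3]) (use Loc_facts(3) ihO[OF t] in blast)
  qed
  thus ?thesis by blast
qed

lemma regs_derives:
  assumes t0: "t0 \<in> T" and g: "g \<in> regs C (fst t0)"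
  shows "\<exists>p. derives t0 g p"
  using g
proof induct
  case (const c)
  thus ?case using derives_const[of c t0] gen_facts(3) Loc_facts(2) by blast
next
  case (coord l)
  thus ?case using derives_coord by blast
next
  case (add g h)
  thus ?case using derives_add by blast
next
  case (neg g)
  then obtain p where p: "derives t0 g p" by blast
  have one: "\<ominus> \<one> \<in> Loc" using Loc_ops(3,5) by blast
  have "derives t0 (\<lambda>y. \<ominus> \<one> \<otimes> g y) (\<lambda>d. \<ominus> \<one> \<otimes> p d \<oplus> g (snd t0) \<otimes> \<zero>)"
    by (rule derives_mult[OF t0 derives_const[OF one] p])
  note d = this
  have e: "\<ominus> \<one> \<otimes> g (snd t) = \<ominus> g (snd t)" if "t \<in> T" "near t0 t" for t
    using derivesD(3)[OF p that] by (simp add: l_minus)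
  show ?case
    using d e unfolding derives_def by (intro exI[of _ "\<lambda>d. \<ominus> \<one> \<otimes> p d \<oplus> g (snd t0) \<otimes> \<zero>"]) simp
next
  case (mult g h)
  thus ?case using derives_mult[OF t0] by blast
qed

section \<open>Lifting maps to tagged points\<close>

text \<open>The first formula whose denominator is a unit at the given point. Its chart is the tag
  that the lifted map chooses for the image.\<close>

definition pick :: "'j \<Rightarrow> 'i \<times> 'x \<Rightarrow> (('x \<Rightarrow> 'a) \<times> ('x \<Rightarrow> 'a) \<times> 'i \<times> ('l \<Rightarrow> 'x \<Rightarrow> 'a)) option"
  where "pick j t = find (\<lambda>e. fst (snd e) (snd t) \<notin> m) (Q j (fst t))"

text \<open>On T the case None does not occur, by pick_Some.\<close>

definition lift :: "'j \<Rightarrow> 'i \<times> 'x \<Rightarrow> 'i \<times> 'x"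
  where "lift j t = (case pick j t of None \<Rightarrow> t | Some (c, h, i', a) \<Rightarrow> (i', f j (snd t)))"

text \<open>The map G takes the residue disc of t0 into one residue disc, with differential
  \<Psi>, in the sense of derives in each coordinate.\<close>

definition smooth :: "'i \<times> 'x \<Rightarrow> ('i \<times> 'x \<Rightarrow> 'i \<times> 'x) \<Rightarrow> ('l \<Rightarrow> ('l \<Rightarrow> 'a) \<Rightarrow> 'a) \<Rightarrow> bool"
  where "smooth t0 G \<Psi> \<longleftrightarrow> (\<forall>t\<in>T. near t0 t \<longrightarrow> G t \<in> T \<and> near (G t0) (G t)) \<and>
    (\<forall>l\<in>L (fst (G t0)). \<Psi> l \<in> forms Loc (L (fst t0)) \<and>
      (\<forall>t\<in>T. \<forall>t'\<in>T. near t0 t \<longrightarrow> near t0 t' \<longrightarrow> (\<forall>\<tau>\<in>carrier R.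
        (\<forall>k\<in>L (fst t0). diff t t' k \<in> scaled \<tau> B) \<longrightarrow>
        cg (scaled \<tau> m) (diff (G t) (G t') l) (\<Psi> l (diff t t')))))"

text \<open>Otherwise all products in the partition of unity would be nonunits, and so would be
  their sum, which is 1.\<close>

lemma pick_Some:
  assumes t: "t \<in> T"
  shows "\<exists>e. pick j t = Some e"
proof (rule ccontr)
  assume "\<nexists>e. pick j t = Some e"
  hence none: "fst (snd e) (snd t) \<in> m" if "e \<in> set (Q j (fst t))" for e
  proof -
    have "pick j t = None" using \<open>\<nexists>e. pick j t = Some e\<close> by (metis option.exhaust)
    thus ?thesis using that unfolding pick_def find_None_iff by blast
  qed
  note tf = T_facts[OF t]
  have cv: "covers C (f j) (fst t) (Q j (fst t))" by (rule cov[OF tf(1)])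
  have reg: "fst e \<in> regs C (fst t)" if "e \<in> set (Q j (fst t))" for e
    using cv that unfolding covers_def local_formula_def by fastforce
  have "psum es (snd t) \<in> m" if "set es \<subseteq> set (Q j (fst t))" for es
    using that
  proof (induct es)
    case Nil
    show ?case using m_ideal(4) by simp
  next
    case (Cons e es)
    have "e \<in> set (Q j (fst t))" using Cons.prems by simp
    then obtain p where p: "derives t (fst e) p" using regs_derives[OF t reg] by blast
    have "fst e (snd t) \<in> B" by (rule derivesD(2)[OF p t near_refl[OF t]])
    hence "fst e (snd t) \<otimes> fst (snd e) (snd t) \<in> m" using none[of e] Cons.prems m_ideal(6) by simp
    thus ?case using Cons m_ideal(5) by simp
  qed
  moreover have "psum (Q j (fst t)) (snd t) = \<one>" using cv tf(2) unfolding covers_def by blast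
  ultimately show False using v(3) by (metis subset_refl)
qed

lemma find_cong_pred: "(\<And>e. e \<in> set es \<Longrightarrow> P e = P' e) \<Longrightarrow> find P es = find P' es"
  by (induct es) auto

text \<open>Denominators are constant modulo nonunits on a residue disc, so that the same formula
  is picked for all its points.\<close>

lemma lift_local:
  assumes t0: "t0 \<in> T"
  shows "\<exists>h i' a. i' \<in> I \<and> h \<in> regs C (fst t0) \<and> (\<forall>l\<in>L i'. a l \<in> regs C (fst t0)) \<and> h (snd t0) \<notin> m \<and>
    (\<forall>t\<in>T. near t0 t \<longrightarrow> lift j t = (i', f j (snd t)) \<and> f j (snd t) \<in> U i' \<and>
      (\<forall>l\<in>L i'. h (snd t) \<otimes> co i' l (f j (snd t)) = a l (snd t)))"
proof -
  obtain e where e: "pick j t0 = Some e" using pick_Some[OF t0] by blast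
  obtain c h i' a where ee: "e = (c, h, i', a)" by (cases e) auto
  note tf = T_facts[OF t0]
  have eQ: "e \<in> set (Q j (fst t0))" and h0: "h (snd t0) \<notin> m"
    using e unfolding pick_def find_Some_iff ee by (metis nth_mem fst_conv snd_conv)+
  have cv: "covers C (f j) (fst t0) (Q j (fst t0))" by (rule cov[OF tf(1)])
  have lf: "local_formula C (f j) (fst t0) (c, h, i', a)" using cv eQ unfolding covers_def ee by blast
  have reg: "fst (snd e') \<in> regs C (fst t0)" if "e' \<in> set (Q j (fst t0))" for e'
    using cv that unfolding covers_def local_formula_def by fastforce
  have p: "i' \<in> I" "h \<in> regs C (fst t0)" "\<forall>l\<in>L i'. a l \<in> regs C (fst t0)"
    "\<And>y. y \<in> U (fst t0) \<Longrightarrow> h y \<noteq> \<zero> \<Longrightarrow> f j y \<in> U i' \<and> (\<forall>l\<in>L i'. h y \<otimes> co i' l (f j y) = a l y)"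
    using lf unfolding local_formula_def by auto
  have "lift j t = (i', f j (snd t)) \<and> f j (snd t) \<in> U i' \<and>
      (\<forall>l\<in>L i'. h (snd t) \<otimes> co i' l (f j (snd t)) = a l (snd t))" if t: "t \<in> T" "near t0 t" for t
  proof -
    have ft: "fst t = fst t0" using t(2) unfolding near_def by simp
    have same: "g (snd t) \<in> m \<longleftrightarrow> g (snd t0) \<in> m" if g: "g \<in> regs C (fst t0)" for g
    proof -
      obtain q where q: "derives t0 g q" using regs_derives[OF t0 g] by blast
      show ?thesis by (rule cg_mem[OF v(1) m_submodule derives_near[OF q t t0 near_refl[OF t0]]])
    qed
    have "pick j t = pick j t0"
      unfolding pick_def ft by (rule find_cong_pred) (use same reg in blast)
    hence l: "lift j t = (i', f j (snd t))" unfolding lift_def e ee by simp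
    have "h (snd t) \<noteq> \<zero>" using same[OF p(2)] h0 m_ideal(4) by metis
    thus ?thesis using l p(4)[of "snd t"] T_facts(2)[OF t(1)] ft by simp
  qed
  thus ?thesis using p(1-3) h0 by blast
qed

lemma lift_snd: "t \<in> T \<Longrightarrow> snd (lift j t) = f j (snd t)"
proof -
  assume t: "t \<in> T"
  obtain i' where "\<forall>s\<in>T. near t s \<longrightarrow> lift j s = (i', f j (snd s))" using lift_local[OF t, of j] by blast
  thus "snd (lift j t) = f j (snd t)" using t near_refl[OF t] by simp
qed

lemma lift_smooth:
  assumes t0: "t0 \<in> T"
  shows "\<exists>\<Psi>. smooth t0 (lift j) \<Psi>"
proof -
  note n0 = near_refl[OF t0]
  obtain h i' a where p: "i' \<in> I" "h \<in> regs C (fst t0)" "\<forall>l\<in>L i'. a l \<in> regs C (fst t0)" "h (snd t0) \<notin> m"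
    and loc: "\<And>t. t \<in> T \<Longrightarrow> near t0 t \<Longrightarrow> lift j t = (i', f j (snd t)) \<and> f j (snd t) \<in> U i' \<and>
      (\<forall>l\<in>L i'. h (snd t) \<otimes> co i' l (f j (snd t)) = a l (snd t))"
    using lift_local[OF t0, of j] by blast
  obtain q where q: "derives t0 h q" using regs_derives[OF t0 p(2)] by blast
  have "\<forall>l\<in>L i'. \<exists>r. derives t0 (\<lambda>y. co i' l (f j y)) r"
  proof
    fix l assume l: "l \<in> L i'"
    obtain r where r: "derives t0 (a l) r" using regs_derives[OF t0] p(3) l by blast
    show "\<exists>r. derives t0 (\<lambda>y. co i' l (f j y)) r"
      by (rule derives_divide[OF t0 q r p(4)]) (use loc l coord_carrier[OF p(1) l] in blast)
  qed
  then obtain \<Psi> where \<Psi>: "\<And>l. l \<in> L i' \<Longrightarrow> derives t0 (\<lambda>y. co i' l (f j y)) (\<Psi> l)" by metis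
  have tc: "tco (lift j t) l = co i' l (f j (snd t))" if "t \<in> T" "near t0 t" for t l
    using loc[OF that] unfolding tco_def by simp
  have fst0: "fst (lift j t0) = i'" using loc[OF t0 n0] by simp
  have "smooth t0 (lift j) \<Psi>"
    unfolding smooth_def fst0
  proof (intro conjI ballI impI)
    fix t assume t: "t \<in> T" "near t0 t"
    show "lift j t \<in> T" using loc[OF t] p(1) derivesD(1)[OF \<Psi> t] unfolding T_def by simp
    show "near (lift j t0) (lift j t)"
      unfolding near_def fst0 using loc[OF t] tc[OF t] tc[OF t0 n0] derives_near[OF \<Psi> t0 n0 t] by simp
  next
    fix l assume l: "l \<in> L i'"
    show "\<Psi> l \<in> forms Loc (L (fst t0))" using \<Psi>[OF l] unfolding derives_def by blast
    fix t t' \<tau> assume t: "t \<in> T" "near t0 t" and t': "t' \<in> T" "near t0 t'" "\<tau> \<in> carrier R"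
      and d: "\<forall>k\<in>L (fst t0). diff t t' k \<in> scaled \<tau> B"
    show "cg (scaled \<tau> m) (diff (lift j t) (lift j t') l) (\<Psi> l (diff t t'))"
      unfolding diff_def[of "lift j t"] tc[OF t] tc[OF t'(1,2)]
      using derivesD(4)[OF \<Psi>[OF l] t t'] d by blast
  qed
  thus ?thesis by blast
qed

lemma smoothD:
  assumes "smooth t0 G \<Psi>" "t \<in> T" "near t0 t"
  shows "G t \<in> T" "near (G t0) (G t)"
    "l \<in> L (fst (G t0)) \<Longrightarrow> \<Psi> l \<in> forms Loc (L (fst t0))"
    "l \<in> L (fst (G t0)) \<Longrightarrow> t' \<in> T \<Longrightarrow> near t0 t' \<Longrightarrow> \<tau> \<in> carrier R \<Longrightarrow>
      (\<And>k. k \<in> L (fst t0) \<Longrightarrow> diff t t' k \<in> scaled \<tau> B) \<Longrightarrow>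
      cg (scaled \<tau> m) (diff (G t) (G t') l) (\<Psi> l (diff t t'))"
  using assms unfolding smooth_def by simp_all

lemma scaled_m_B: "scaled \<tau> m \<subseteq> scaled \<tau> B"
  by (rule scaled_mono[OF m_ideal(1)])

lemma smooth_bounded:
  assumes s: "smooth t0 G \<Psi>" and t: "t \<in> T" "near t0 t" and t': "t' \<in> T" "near t0 t'" "\<tau> \<in> carrier R"
    and d: "\<And>k. k \<in> L (fst t0) \<Longrightarrow> diff t t' k \<in> scaled \<tau> B" and l: "l \<in> L (fst (G t0))"
  shows "diff (G t) (G t') l \<in> scaled \<tau> B"
proof -
  have c: "cg (scaled \<tau> m) (diff (G t) (G t') l) (\<Psi> l (diff t t'))"
    by (rule smoothD(4)[OF s t l t' d])
  have f: "\<Psi> l (diff t t') \<in> scaled \<tau> B"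
    by (rule forms_in_scaled[OF smoothD(3)[OF s t l] d t'(3)])
  have "diff (G t) (G t') l \<in> carrier R" "\<Psi> l (diff t t') \<in> carrier R"
    "diff (G t) (G t') l \<ominus> \<Psi> l (diff t t') \<in> scaled \<tau> B"
    using c scaled_m_B unfolding cg_def by blast+
  hence "cg (scaled \<tau> B) (diff (G t) (G t') l) (\<Psi> l (diff t t'))" unfolding cg_def by blast
  from cg_mem[OF v(1) scaled_B_submodule[OF t'(3)] this] f show ?thesis by simp
qed

text \<open>The chain rule.\<close>

lemma smooth_compose:
  assumes s: "smooth t0 G \<Psi>" and r: "smooth (G t0) H \<Omega>" and t0: "t0 \<in> T"
  shows "smooth t0 (\<lambda>t. H (G t)) (\<lambda>l d. \<Omega> l (\<lambda>k. \<Psi> k d))"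
  unfolding smooth_def
proof (intro conjI ballI impI)
  fix t assume t: "t \<in> T" "near t0 t"
  show "H (G t) \<in> T" "near (H (G t0)) (H (G t))"
    using smoothD(1,2)[OF r smoothD(1,2)[OF s t]] by blast+
next
  note n0 = near_refl[OF t0]
  note g0 = smoothD(1,2)[OF s t0 n0]
  fix l assume l: "l \<in> L (fst (H (G t0)))"
  have \<Omega>: "\<Omega> l \<in> forms Loc (L (fst (G t0)))" by (rule smoothD(3)[OF r g0 l])
  show "(\<lambda>d. \<Omega> l (\<lambda>k. \<Psi> k d)) \<in> forms Loc (L (fst t0))"
    by (rule forms_compose[OF \<Omega> smoothD(3)[OF s t0 n0]])
  fix t t' \<tau> assume t: "t \<in> T" "near t0 t" and t': "t' \<in> T" "near t0 t'" "\<tau> \<in> carrier R"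
    and d: "\<forall>k\<in>L (fst t0). diff t t' k \<in> scaled \<tau> B"
  have d': "diff (G t) (G t') k \<in> scaled \<tau> B" if "k \<in> L (fst (G t0))" for k
    by (rule smooth_bounded[OF s t t' _ that]) (use d in blast)
  have 1: "cg (scaled \<tau> m) (diff (H (G t)) (H (G t')) l) (\<Omega> l (diff (G t) (G t')))"
    by (rule smoothD(4)[OF r smoothD(1,2)[OF s t] l smoothD(1,2)[OF s t'(1,2)] t'(3) d'])
  have 2: "cg (scaled \<tau> m) (\<Omega> l (diff (G t) (G t'))) (\<Omega> l (\<lambda>k. \<Psi> k (diff t t')))"
    by (rule forms_cg[OF v(1) scaled_m_submodule[OF t'(3)] Loc_facts(3) \<Omega>], rule smoothD(4)[OF s t _ t']) (use d in blast)+
  show "cg (scaled \<tau> m) (diff (H (G t)) (H (G t')) l) (\<Omega> l (\<lambda>k. \<Psi> k (diff t t')))"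
    by (rule cg_trans[OF v(1) scaled_m_submodule[OF t'(3)] 1 2])
qed

section \<open>Jets of words\<close>

definition lifts :: "'j list \<Rightarrow> 'i \<times> 'x \<Rightarrow> 'i \<times> 'x"
  where "lifts w t = foldr lift w t"

definition acts :: "'j list \<Rightarrow> 'x \<Rightarrow> 'x"
  where "acts w y = foldr f w y"

lemma lifts_append: "lifts (u @ w) t = lifts u (lifts w t)"
  unfolding lifts_def by simp

lemma lifts_smooth:
  assumes t0: "t0 \<in> T"
  shows "\<exists>\<Psi>. smooth t0 (lifts w) \<Psi>"
proof (induct w)
  case Nil
  have "smooth t0 (lifts []) (\<lambda>l d. d l)"
    unfolding smooth_def lifts_def
  proof (intro conjI ballI impI)
    fix l assume l: "l \<in> L (fst (foldr lift [] t0))"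
    thus "(\<lambda>d. d l) \<in> forms Loc (L (fst t0))" using forms.proj by simp
    fix t t' \<tau> assume t: "t \<in> T" "near t0 t" and t': "t' \<in> T" "near t0 t'" "\<tau> \<in> carrier R"
    have "diff t t' l \<in> carrier R"
      using diff_carrier[OF t(1) t'(1) near_trans[OF near_sym[OF t(2)] t'(2)]] l t(2) unfolding near_def by simp
    thus "cg (scaled \<tau> m) (diff (foldr lift [] t) (foldr lift [] t') l) (diff t t' l)"
      using cg_refl[OF v(1) scaled_m_submodule[OF t'(3)]] by simp
  qed simp_all
  thus ?case by blast
next
  case (Cons j w)
  then obtain \<Psi> where \<Psi>: "smooth t0 (lifts w) \<Psi>" by blast
  obtain \<Omega> where "smooth (lifts w t0) (lift j) \<Omega>"
    using lift_smooth smoothD(1)[OF \<Psi> t0 near_refl[OF t0]] by blast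
  from smooth_compose[OF \<Psi> this t0] show ?case unfolding lifts_def by auto
qed

lemma lifts_facts:
  assumes t: "t \<in> T"
  shows "lifts w t \<in> T" "snd (lifts w t) = acts w (snd t)"
    "t' \<in> T \<Longrightarrow> near t t' \<Longrightarrow> near (lifts w t) (lifts w t')"
    "t' \<in> T \<Longrightarrow> near t t' \<Longrightarrow> \<tau> \<in> carrier R \<Longrightarrow> (\<And>k. k \<in> L (fst t) \<Longrightarrow> diff t t' k \<in> scaled \<tau> B) \<Longrightarrow>
      l \<in> L (fst (lifts w t)) \<Longrightarrow> diff (lifts w t) (lifts w t') l \<in> scaled \<tau> B"
proof -
  note n = near_refl[OF t]
  obtain \<Psi> where \<Psi>: "smooth t (lifts w) \<Psi>" using lifts_smooth[OF t] by blast
  show "lifts w t \<in> T" by (rule smoothD(1)[OF \<Psi> t n])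
  show "snd (lifts w t) = acts w (snd t)"
  proof (induct w)
    case (Cons j w)
    obtain \<Omega> where "smooth t (lifts w) \<Omega>" using lifts_smooth[OF t] by blast
    from lift_snd[OF smoothD(1)[OF this t n]] Cons show ?case by (simp add: lifts_def acts_def)
  qed (simp add: lifts_def acts_def)
  show "t' \<in> T \<Longrightarrow> near t t' \<Longrightarrow> near (lifts w t) (lifts w t')" using smoothD(2)[OF \<Psi>] by blast
  show "t' \<in> T \<Longrightarrow> near t t' \<Longrightarrow> \<tau> \<in> carrier R \<Longrightarrow> (\<And>k. k \<in> L (fst t) \<Longrightarrow> diff t t' k \<in> scaled \<tau> B) \<Longrightarrow>
      l \<in> L (fst (lifts w t)) \<Longrightarrow> diff (lifts w t) (lifts w t') l \<in> scaled \<tau> B"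
    by (rule smooth_bounded[OF \<Psi> t n])
qed

text \<open>Both words take every residue disc into the same disc, and they have the same
  differential on it, in the sense of derives. Differentials are compared by way of the
  differences that they predict, so that no linear form has to be chosen for a word.\<close>

definition jet_eq :: "'j list \<Rightarrow> 'j list \<Rightarrow> bool"
  where "jet_eq u w \<longleftrightarrow> (\<forall>t\<in>T. near (lifts u t) (lifts w t) \<and> (\<forall>t'\<in>T. near t t' \<longrightarrow>
    (\<forall>\<tau>\<in>carrier R. (\<forall>k\<in>L (fst t). diff t t' k \<in> scaled \<tau> B) \<longrightarrow> (\<forall>l\<in>L (fst (lifts u t)).
      cg (scaled \<tau> m) (diff (lifts u t) (lifts u t') l) (diff (lifts w t) (lifts w t') l)))))"

lemma jet_eqD:
  assumes "jet_eq u w" "t \<in> T"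
  shows "near (lifts u t) (lifts w t)"
    "t' \<in> T \<Longrightarrow> near t t' \<Longrightarrow> \<tau> \<in> carrier R \<Longrightarrow> (\<And>k. k \<in> L (fst t) \<Longrightarrow> diff t t' k \<in> scaled \<tau> B) \<Longrightarrow>
      l \<in> L (fst (lifts u t)) \<Longrightarrow>
      cg (scaled \<tau> m) (diff (lifts u t) (lifts u t') l) (diff (lifts w t) (lifts w t') l)"
  using assms unfolding jet_eq_def by simp_all

lemma jet_eqI:
  assumes "\<And>t. t \<in> T \<Longrightarrow> near (lifts u t) (lifts w t)"
    "\<And>t t' \<tau> l. t \<in> T \<Longrightarrow> t' \<in> T \<Longrightarrow> near t t' \<Longrightarrow> \<tau> \<in> carrier R \<Longrightarrow>
      (\<And>k. k \<in> L (fst t) \<Longrightarrow> diff t t' k \<in> scaled \<tau> B) \<Longrightarrow> l \<in> L (fst (lifts u t)) \<Longrightarrow>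
      cg (scaled \<tau> m) (diff (lifts u t) (lifts u t') l) (diff (lifts w t) (lifts w t') l)"
  shows "jet_eq u w"
  unfolding jet_eq_def using assms by simp

lemma jet_eq_sym: assumes "jet_eq u w" shows "jet_eq w u"
proof (rule jet_eqI)
  fix t assume t: "t \<in> T"
  show n: "near (lifts w t) (lifts u t)" by (rule near_sym[OF jet_eqD(1)[OF assms t]])
  fix t' \<tau> l assume t': "t' \<in> T" "near t t'" "\<tau> \<in> carrier R"
    "\<And>k. k \<in> L (fst t) \<Longrightarrow> diff t t' k \<in> scaled \<tau> B" "l \<in> L (fst (lifts w t))"
  have "l \<in> L (fst (lifts u t))" using n t'(5) unfolding near_def by simp
  from jet_eqD(2)[OF assms t t'(1-4) this]
  show "cg (scaled \<tau> m) (diff (lifts w t) (lifts w t') l) (diff (lifts u t) (lifts u t') l)"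
    by (rule cg_sym[OF v(1) scaled_m_submodule[OF t'(3)]])
qed

lemma jet_eq_trans: assumes "jet_eq u w" "jet_eq w x" shows "jet_eq u x"
proof (rule jet_eqI)
  fix t assume t: "t \<in> T"
  note n = jet_eqD(1)[OF assms(1) t]
  show "near (lifts u t) (lifts x t)" by (rule near_trans[OF n jet_eqD(1)[OF assms(2) t]])
  fix t' \<tau> l assume t': "t' \<in> T" "near t t'" "\<tau> \<in> carrier R"
    "\<And>k. k \<in> L (fst t) \<Longrightarrow> diff t t' k \<in> scaled \<tau> B" "l \<in> L (fst (lifts u t))"
  have l: "l \<in> L (fst (lifts w t))" using n t'(5) unfolding near_def by simp
  show "cg (scaled \<tau> m) (diff (lifts u t) (lifts u t') l) (diff (lifts x t) (lifts x t') l)"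
    by (rule cg_trans[OF v(1) scaled_m_submodule[OF t'(3)] jet_eqD(2)[OF assms(1) t t'] jet_eqD(2)[OF assms(2) t t'(1-4) l]])
qed

lemma jet_eq_right: assumes "jet_eq u u'" shows "jet_eq (u @ w) (u' @ w)"
proof (rule jet_eqI)
  fix t assume t: "t \<in> T"
  note f = lifts_facts[OF t, where w = w]
  show "near (lifts (u @ w) t) (lifts (u' @ w) t)"
    unfolding lifts_append by (rule jet_eqD(1)[OF assms f(1)])
  fix t' \<tau> l assume t': "t' \<in> T" "near t t'" "\<tau> \<in> carrier R"
    "\<And>k. k \<in> L (fst t) \<Longrightarrow> diff t t' k \<in> scaled \<tau> B" "l \<in> L (fst (lifts (u @ w) t))"
  show "cg (scaled \<tau> m) (diff (lifts (u @ w) t) (lifts (u @ w) t') l) (diff (lifts (u' @ w) t) (lifts (u' @ w) t') l)"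
    unfolding lifts_append
    by (rule jet_eqD(2)[OF assms f(1) lifts_facts(1)[OF t'(1)] f(3)[OF t'(1,2)] t'(3)
          f(4)[OF t'(1-4)] t'(5)[unfolded lifts_append]])
qed

text \<open>The word u in front is differentiable on the common image disc, and by linearity its
  differential respects the congruence of differences.\<close>

lemma jet_eq_left: assumes "jet_eq w w'" shows "jet_eq (u @ w) (u @ w')"
proof (rule jet_eqI)
  fix t assume t: "t \<in> T"
  note n = jet_eqD(1)[OF assms t]
  note wt = lifts_facts(1)[OF t]
  show "near (lifts (u @ w) t) (lifts (u @ w') t)"
    unfolding lifts_append by (rule lifts_facts(3)[OF wt wt n])
  fix t' \<tau> l assume t': "t' \<in> T" "near t t'" "\<tau> \<in> carrier R"
    "\<And>k. k \<in> L (fst t) \<Longrightarrow> diff t t' k \<in> scaled \<tau> B" "l \<in> L (fst (lifts (u @ w) t))"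
  note wt' = lifts_facts(1)[OF t'(1)]
  have nw: "near (lifts w t) (lifts w t')" and nw': "near (lifts w' t) (lifts w' t')"
    by (rule lifts_facts(3)[OF t t'(1,2)])+
  have fs: "fst (lifts w' t) = fst (lifts w t)" using n unfolding near_def by simp
  obtain \<Psi> where \<Psi>: "smooth (lifts w t) (lifts u) \<Psi>" using lifts_smooth[OF wt] by blast
  have l: "l \<in> L (fst (lifts u (lifts w t)))" using t'(5) unfolding lifts_append .
  have 1: "cg (scaled \<tau> m) (diff (lifts u (lifts w t)) (lifts u (lifts w t')) l) (\<Psi> l (diff (lifts w t) (lifts w t')))"
    by (rule smoothD(4)[OF \<Psi> wt near_refl[OF wt] l wt' nw t'(3) lifts_facts(4)[OF t t'(1-4)]])
  have d': "diff (lifts w' t) (lifts w' t') k \<in> scaled \<tau> B" if "k \<in> L (fst (lifts w t))" for k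
    using lifts_facts(4)[OF t t'(1-4)] that fs by simp
  have 2: "cg (scaled \<tau> m) (diff (lifts u (lifts w' t)) (lifts u (lifts w' t')) l) (\<Psi> l (diff (lifts w' t) (lifts w' t')))"
    by (rule smoothD(4)[OF \<Psi> wt n l wt' near_trans[OF n nw'] t'(3) d'])
  have 3: "cg (scaled \<tau> m) (\<Psi> l (diff (lifts w t) (lifts w t'))) (\<Psi> l (diff (lifts w' t) (lifts w' t')))"
    by (rule forms_cg[OF v(1) scaled_m_submodule[OF t'(3)] Loc_facts(3) smoothD(3)[OF \<Psi> wt near_refl[OF wt] l]],
        rule jet_eqD(2)[OF assms t t'(1-4)])
  note tr = cg_trans[OF v(1) scaled_m_submodule[OF t'(3)]]
  show "cg (scaled \<tau> m) (diff (lifts (u @ w) t) (lifts (u @ w) t') l) (diff (lifts (u @ w') t) (lifts (u @ w') t') l)"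
    unfolding lifts_append by (rule tr[OF tr[OF 1 3] cg_sym[OF v(1) scaled_m_submodule[OF t'(3)] 2]])
qed

lemma finite_representatives:
  assumes "finite (key ` T)" "\<And>s t. s \<in> T \<Longrightarrow> t \<in> T \<Longrightarrow> key s = key t \<Longrightarrow> near s t"
  shows "\<exists>T0\<subseteq>T. finite T0 \<and> (\<forall>t\<in>T. \<exists>s\<in>T0. near s t)"
proof -
  define r where "r k = (SOME t. t \<in> T \<and> key t = k)" for k
  have r: "r (key t) \<in> T \<and> key (r (key t)) = key t" if "t \<in> T" for t
    unfolding r_def by (rule someI_ex) (use that in blast)
  show ?thesis
  proof (intro exI[of _ "r ` key ` T"] conjI ballI)
    show "r ` key ` T \<subseteq> T" using r by blast
    show "finite (r ` key ` T)" using assms(1) by simp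
    fix t assume t: "t \<in> T"
    have "near (r (key t)) t" using assms(2) r[OF t] t by blast
    thus "\<exists>s\<in>r ` key ` T. near s t" using t by blast
  qed
qed

text \<open>A residue disc is given by a chart and a residue in a finite ring for each of its
  coordinates.\<close>

lemma finite_discs: "\<exists>T0\<subseteq>T. finite T0 \<and> (\<forall>t\<in>T. \<exists>s\<in>T0. near s t)"
proof -
  obtain F where F: "finite F" "F \<subseteq> Loc" "\<And>x. x \<in> Loc \<Longrightarrow> \<exists>a\<in>F. x \<ominus> a \<in> m"
    using Loc_facts(4) unfolding fin_mod_def by blast
  define r where "r x = (SOME a. a \<in> F \<and> x \<ominus> a \<in> m)" for x
  have r: "r x \<in> F" "cg m x (r x)" if x: "x \<in> Loc" for x
  proof -
    have "\<exists>a. a \<in> F \<and> x \<ominus> a \<in> m" using F(3)[OF x] by blast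
    hence "r x \<in> F \<and> x \<ominus> r x \<in> m" unfolding r_def by (rule someI_ex)
    thus "r x \<in> F" "cg m x (r x)" unfolding cg_def using x F(2) Loc_ops(1) by blast+
  qed
  define key where "key t = (fst t, \<lambda>l\<in>L (fst t). r (tco t l))" for t
  show ?thesis
  proof (rule finite_representatives[of key])
    have "key ` T \<subseteq> Sigma I (\<lambda>i. PiE (L i) (\<lambda>_. F))"
      unfolding key_def using T_facts(1,3) r(1) by auto
    moreover have "finite (Sigma I (\<lambda>i. PiE (L i) (\<lambda>_. F)))"
      using finite_charts finite_coords F(1) by (intro finite_SigmaI finite_PiE) auto
    ultimately show "finite (key ` T)" by (rule finite_subset)
    fix s t assume h: "s \<in> T" "t \<in> T" "key s = key t"
    have fs: "fst s = fst t" using h(3) unfolding key_def by simp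
    have "cg m (tco s l) (tco t l)" if l: "l \<in> L (fst s)" for l
    proof -
      have "r (tco s l) = r (tco t l)"
      proof -
        have "snd (key s) l = snd (key t) l" using h(3) by simp
        thus ?thesis unfolding key_def using l fs by simp
      qed
      thus ?thesis
        using cg_trans[OF v(1) m_submodule r(2)[OF T_facts(3)[OF h(1) l]]] cg_sym[OF v(1) m_submodule r(2)[OF T_facts(3)[OF h(2)]]]
          l fs by simp
    qed
    thus "near s t" unfolding near_def using fs by simp
  qed
qed

text \<open>On each of the finitely many discs, a word is described by the image disc and by its
  differential modulo nonunits, for which there are finitely many choices.\<close>

lemma jet_eq_finite_index:
  "\<exists>key :: 'j list \<Rightarrow> 'i \<times> 'x \<Rightarrow> ('i \<times> 'x) \<times> ('l \<Rightarrow> ('l \<Rightarrow> 'a) \<Rightarrow> 'a).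
    finite (range key) \<and> (\<forall>u w. key u = key w \<longrightarrow> jet_eq u w)"
proof -
  obtain T0 where T0: "T0 \<subseteq> T" "finite T0" "\<And>t. t \<in> T \<Longrightarrow> \<exists>s\<in>T0. near s t"
    using finite_discs by blast
  have "\<forall>i\<in>I. \<exists>\<Phi>. finite \<Phi> \<and> (\<forall>p\<in>forms Loc (L i). \<exists>q\<in>\<Phi>. \<forall>t\<in>carrier R. \<forall>d.
    (\<forall>l\<in>L i. d l \<in> scaled t B) \<longrightarrow> cg (scaled t m) (p d) (q d))"
    using forms_finite_mod[OF v(1,2) Loc_facts(1,3,4) finite_coords] by blast
  then obtain \<Phi> where \<Phi>: "\<forall>i\<in>I. finite (\<Phi> i) \<and> (\<forall>p\<in>forms Loc (L i). \<exists>q\<in>\<Phi> i. \<forall>t\<in>carrier R. \<forall>d.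
    (\<forall>l\<in>L i. d l \<in> scaled t B) \<longrightarrow> cg (scaled t m) (p d) (q d))" by (rule bchoice[THEN exE])
  \<comment> \<open>The first component of k represents the disc that w maps the disc of t0 into;
    the second contains a linear form for each coordinate there.\<close>
  define good where "good w t0 k \<longleftrightarrow> fst k \<in> T0 \<and> near (lifts w t0) (fst k) \<and>
    snd k \<in> PiE (L (fst (fst k))) (\<lambda>_. \<Phi> (fst t0)) \<and>
    (\<forall>l\<in>L (fst (fst k)). \<forall>t\<in>T. \<forall>t'\<in>T. near t0 t \<longrightarrow> near t0 t' \<longrightarrow> (\<forall>\<tau>\<in>carrier R.
        (\<forall>k\<in>L (fst t0). diff t t' k \<in> scaled \<tau> B) \<longrightarrow>
        cg (scaled \<tau> m) (diff (lifts w t) (lifts w t') l) (snd k l (diff t t'))))" for w t0 k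
  have "\<exists>k. good w t0 k" if t0: "t0 \<in> T" for w t0
  proof -
    note n0 = near_refl[OF t0]
    obtain \<Psi> where \<Psi>: "smooth t0 (lifts w) \<Psi>" using lifts_smooth[OF t0] by blast
    obtain s where s: "s \<in> T0" "near s (lifts w t0)" using T0(3) lifts_facts(1)[OF t0] by blast
    have fs: "fst s = fst (lifts w t0)" using s(2) unfolding near_def by simp
    have "\<forall>l\<in>L (fst s). \<exists>q. q \<in> \<Phi> (fst t0) \<and> (\<forall>t\<in>carrier R. \<forall>d.
      (\<forall>l\<in>L (fst t0). d l \<in> scaled t B) \<longrightarrow> cg (scaled t m) (\<Psi> l d) (q d))"
      using \<Phi> T_facts(1)[OF t0] smoothD(3)[OF \<Psi> t0 n0] unfolding fs by blast
    then obtain q where q: "\<forall>l\<in>L (fst s). q l \<in> \<Phi> (fst t0) \<and> (\<forall>t\<in>carrier R. \<forall>d.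
      (\<forall>l\<in>L (fst t0). d l \<in> scaled t B) \<longrightarrow> cg (scaled t m) (\<Psi> l d) (q l d))" by (rule bchoice[THEN exE])
    have "good w t0 (s, restrict q (L (fst s)))"
      unfolding good_def
    proof (intro conjI ballI impI)
      show "fst (s, restrict q (L (fst s))) \<in> T0" using s by simp
      show "near (lifts w t0) (fst (s, restrict q (L (fst s))))" using near_sym[OF s(2)] by simp
      show "snd (s, restrict q (L (fst s))) \<in> PiE (L (fst (fst (s, restrict q (L (fst s)))))) (\<lambda>_. \<Phi> (fst t0))"
        using q by auto
      fix l t t' \<tau> assume l: "l \<in> L (fst (fst (s, restrict q (L (fst s)))))" and t: "t \<in> T" "near t0 t"
        and t': "t' \<in> T" "near t0 t'" "\<tau> \<in> carrier R" and d: "\<forall>k\<in>L (fst t0). diff t t' k \<in> scaled \<tau> B"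
      have l': "l \<in> L (fst s)" "l \<in> L (fst (lifts w t0))" using l fs by simp_all
      have 1: "cg (scaled \<tau> m) (diff (lifts w t) (lifts w t') l) (\<Psi> l (diff t t'))"
        by (rule smoothD(4)[OF \<Psi> t l'(2) t']) (use d in blast)
      have 2: "cg (scaled \<tau> m) (\<Psi> l (diff t t')) (q l (diff t t'))" using q l'(1) t'(3) d by blast
      show "cg (scaled \<tau> m) (diff (lifts w t) (lifts w t') l) (snd (s, restrict q (L (fst s))) l (diff t t'))"
        using cg_trans[OF v(1) scaled_m_submodule[OF t'(3)] 1 2] l'(1) by simp
    qed
    thus ?thesis by blast
  qed
  hence "\<forall>w. \<exists>K. \<forall>t0\<in>T0. good w t0 (K t0)" using T0(1) by (intro allI bchoice ballI) blast
  then obtain K where K: "\<And>w t0. t0 \<in> T0 \<Longrightarrow> good w t0 (K w t0)" by metis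
  define key where "key w = restrict (K w) T0" for w
  show ?thesis
  proof (intro exI[of _ key] conjI allI impI)
    have "key w \<in> PiE T0 (\<lambda>t0. Sigma T0 (\<lambda>t1. PiE (L (fst t1)) (\<lambda>_. \<Phi> (fst t0))))" for w
    proof -
      have "K w t0 \<in> Sigma T0 (\<lambda>t1. PiE (L (fst t1)) (\<lambda>_. \<Phi> (fst t0)))" if "t0 \<in> T0" for t0
        using K[OF that, of w] unfolding good_def by (cases "K w t0") auto
      thus ?thesis unfolding key_def by auto
    qed
    hence "range key \<subseteq> PiE T0 (\<lambda>t0. Sigma T0 (\<lambda>t1. PiE (L (fst t1)) (\<lambda>_. \<Phi> (fst t0))))" by blast
    moreover have fI: "fst t0 \<in> I" if "t0 \<in> T0" for t0 using that T0(1) T_facts(1) by blast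
    have "finite (PiE T0 (\<lambda>t0. Sigma T0 (\<lambda>t1. PiE (L (fst t1)) (\<lambda>_. \<Phi> (fst t0)))))"
      using T0(2) finite_coords fI \<Phi> by (intro finite_PiE finite_SigmaI) auto
    ultimately show "finite (range key)" by (rule finite_subset)
    fix u w assume e: "key u = key w"
    have Ke: "K u s = K w s" if "s \<in> T0" for s
      using fun_cong[OF e, of s] that unfolding key_def by simp
    show "jet_eq u w"
    proof (rule jet_eqI)
      fix t assume t: "t \<in> T"
      obtain s where s: "s \<in> T0" "near s t" using T0(3)[OF t] by blast
      have sT: "s \<in> T" using s T0(1) by blast
      have gu: "good u s (K w s)" and gw: "good w s (K w s)" using K[OF s(1)] Ke[OF s(1)] by metis+
      have nu: "near (lifts u t) (fst (K w s))" and nw: "near (lifts w t) (fst (K w s))"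
        using near_trans[OF near_sym[OF lifts_facts(3)[OF sT t s(2)]]] gu gw unfolding good_def by blast+
      show "near (lifts u t) (lifts w t)" by (rule near_trans[OF nu near_sym[OF nw]])
      fix t' \<tau> l assume t': "t' \<in> T" "near t t'" "\<tau> \<in> carrier R"
        "\<And>k. k \<in> L (fst t) \<Longrightarrow> diff t t' k \<in> scaled \<tau> B" "l \<in> L (fst (lifts u t))"
      have s': "near s t'" by (rule near_trans[OF s(2) t'(2)])
      have l: "l \<in> L (fst (fst (K w s)))" using t'(5) nu unfolding near_def by simp
      have d: "\<forall>k\<in>L (fst s). diff t t' k \<in> scaled \<tau> B" using t'(4) s(2) unfolding near_def by simp
      have 1: "cg (scaled \<tau> m) (diff (lifts u t) (lifts u t') l) (snd (K w s) l (diff t t'))"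
        using gu l t t'(1,3) s(2) s' d unfolding good_def by blast
      have 2: "cg (scaled \<tau> m) (diff (lifts w t) (lifts w t') l) (snd (K w s) l (diff t t'))"
        using gw l t t'(1,3) s(2) s' d unfolding good_def by blast
      show "cg (scaled \<tau> m) (diff (lifts u t) (lifts u t') l) (diff (lifts w t) (lifts w t') l)"
        by (rule cg_trans[OF v(1) scaled_m_submodule[OF t'(3)] 1 cg_sym[OF v(1) scaled_m_submodule[OF t'(3)] 2]])
    qed
  qed
qed

text \<open>Every point zz i of the cycle is an image under w, and there w acts on differences as
  the identity up to smaller terms, because ww and w agree to first order. Let \<tau> be the
  largest difference of coordinates on the cycle. The q differences of consecutive points are
  congruent to each other modulo terms smaller than \<tau>, and their sum vanishes. As q is a
  unit, each of them is smaller than \<tau>. Then so is every difference on the cycle, in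
  particular \<tau> itself, so that \<tau> = 0.\<close>

lemma jet_idempotent_fixes:
  assumes idem: "jet_eq w (w @ w)" and z: "z \<in> T" and per: "(lifts w ^^ q) z = z" and q: "q > 0"
    and unit: "[(q::nat)] \<cdot> \<one> \<notin> m"
  shows "lifts w z = z"
proof -
  define zz where "zz i = (lifts w ^^ i) z" for i :: nat
  have zT: "zz i \<in> T" for i
    unfolding zz_def by (induct i) (use z lifts_facts(1) in auto)
  have zS: "zz (Suc i) = lifts w (zz i)" for i unfolding zz_def by simp
  have zper: "zz (i + q) = zz i" for i unfolding zz_def by (simp add: funpow_add per)
  have n1: "near (zz i) (zz (Suc i))" for i
  proof -
    have "near (zz (Suc (i + (q - 1)))) (zz (Suc (Suc (i + (q - 1)))))"
      using jet_eqD(1)[OF idem zT[of "i + (q - 1)"]] unfolding lifts_append zS .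
    moreover have "Suc (i + (q - 1)) = i + q" "Suc (Suc (i + (q - 1))) = Suc i + q" using q by simp_all
    ultimately show ?thesis using zper[of i] zper[of "Suc i"] by simp
  qed
  have n0: "near (zz 0) (zz i)" for i
    by (induct i) (use near_refl[OF zT] near_trans n1 in blast)+
  have n: "near (zz i) (zz k)" for i k by (rule near_trans[OF near_sym[OF n0] n0])
  define i0 where "i0 = fst z"
  have fz: "fst (zz i) = i0" for i using n0[of i] unfolding near_def zz_def i0_def by simp
  define M where "M = L i0"
  have finM: "finite M" using finite_coords T_facts(1)[OF z] unfolding M_def i0_def by blast
  have tc: "tco (zz i) l \<in> carrier R" if "l \<in> M" for i l
    using T_facts(5)[OF zT[of i]] that unfolding M_def fz by blast
  \<comment> \<open>The zero keeps D nonempty when there are no coordinates.\<close>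
  define D where "D = insert \<zero> ((\<lambda>(i, k, l). diff (zz i) (zz k) l) ` ({..<q} \<times> {..<q} \<times> M))"
  have dcar: "diff (zz i) (zz k) l \<in> carrier R" if "l \<in> M" for i k l
    unfolding diff_def using tc[OF that] by simp
  have "finite D" "D \<noteq> {}" "D \<subseteq> carrier R" unfolding D_def using finM dcar by auto
  then obtain \<tau> where \<tau>: "\<tau> \<in> D" "D \<subseteq> scaled \<tau> B" using common_divisor[OF V] by blast
  have \<tau>c: "\<tau> \<in> carrier R" using \<tau>(1) \<open>D \<subseteq> carrier R\<close> by blast
  have zmod: "zz i = zz (i mod q)" for i
  proof (induct i rule: less_induct)
    case (less i)
    show ?case
    proof (cases "i < q")
      case False
      hence "zz i = zz (i - q)" using zper[of "i - q"] by simp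
      thus ?thesis using less[of "i - q"] False q by (simp add: mod_if)
    qed simp
  qed
  have dB: "diff (zz i) (zz k) l \<in> scaled \<tau> B" if l: "l \<in> M" for i k l
  proof -
    have "diff (zz (i mod q)) (zz (k mod q)) l \<in> D"
      unfolding D_def using q l by (intro insertI2 image_eqI[of _ _ "(i mod q, k mod q, l)"]) auto
    thus ?thesis using \<tau>(2) zmod[of i] zmod[of k] by auto
  qed
  note N = scaled_m_submodule[OF \<tau>c]
  note tr = cg_trans[OF v(1) N] and rf = cg_refl[OF v(1) N] and sy = cg_sym[OF v(1) N]
  have shift: "cg (scaled \<tau> m) (diff (zz i) (zz k) l) (diff (zz (Suc i)) (zz (Suc k)) l)" if l: "l \<in> M" for i k l
  proof -
    \<comment> \<open>The predecessors of i and k on the cycle.\<close>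
    define a b where "a = i + (q - 1)" and "b = k + (q - 1)"
    have e: "Suc a = i + q" "Suc (Suc a) = Suc i + q" "Suc b = k + q" "Suc (Suc b) = Suc k + q"
      using q unfolding a_def b_def by simp_all
    have "cg (scaled \<tau> m) (diff (lifts w (zz a)) (lifts w (zz b)) l)
        (diff (lifts (w @ w) (zz a)) (lifts (w @ w) (zz b)) l)"
    proof (rule jet_eqD(2)[OF idem zT zT n \<tau>c])
      show "diff (zz a) (zz b) k' \<in> scaled \<tau> B" if "k' \<in> L (fst (zz a))" for k'
        using that dB unfolding M_def fz by blast
      show "l \<in> L (fst (lifts w (zz a)))" using l unfolding M_def zS[symmetric] fz .
    qed
    thus ?thesis unfolding lifts_append zS[symmetric] e zper .
  qed
  have step: "cg (scaled \<tau> m) (diff (zz 0) (zz 1) l) (diff (zz i) (zz (Suc i)) l)" if l: "l \<in> M" for i l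
  proof (induct i)
    case 0 show ?case using rf dcar[OF l] by simp
  next
    case (Suc i) show ?case by (rule tr[OF Suc shift[OF l]])
  qed
  have sum: "cg (scaled \<tau> m) ([i] \<cdot> diff (zz 0) (zz 1) l) (diff (zz 0) (zz i) l)" if l: "l \<in> M" for i :: nat and l
  proof (induct i)
    case 0
    have "diff (zz 0) (zz 0) l = \<zero>" unfolding diff_def using tc[OF l] by (simp add: a_minus_def r_neg)
    thus ?case using rf by simp
  next
    case (Suc i)
    have k: "tco (zz 0) l \<in> carrier R" "tco (zz i) l \<in> carrier R" "tco (zz (Suc i)) l \<in> carrier R" using tc[OF l] by blast+
    have "diff (zz 0) (zz (Suc i)) l = diff (zz 0) (zz i) l \<oplus> diff (zz i) (zz (Suc i)) l"
      unfolding diff_def using k by algebra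
    thus ?case using cg_add[OF v(1) N Suc step[OF l]] by simp
  qed
  \<comment> \<open>Here the invertibility of q is used.\<close>
  have small1: "diff (zz 0) (zz 1) l \<in> scaled \<tau> m" if l: "l \<in> M" for l
  proof -
    have "diff (zz 0) (zz q) l = \<zero>"
      unfolding diff_def using zper[of 0] tc[OF l] by (simp add: a_minus_def r_neg)
    hence 1: "[q] \<cdot> diff (zz 0) (zz 1) l \<in> scaled \<tau> m"
      using cg_mem[OF v(1) N sum[OF l, of q]] submodule_facts(2)[OF v(1) N] by simp
    have e: "[q] \<cdot> diff (zz 0) (zz 1) l = ([q] \<cdot> \<one>) \<otimes> diff (zz 0) (zz 1) l"
      using add_pow_ldistr[of \<one> "diff (zz 0) (zz 1) l" q] dcar[OF l] by simp
    have qB: "[q] \<cdot> \<one> \<in> B" by (induct q) (use B_ops(2,3,7) in auto)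
    have i: "[q] \<cdot> \<one> \<noteq> \<zero>" "inv ([q] \<cdot> \<one>) \<in> B" using valuation_ring_cases(1)[OF V qB unit] by auto
    have qc: "[q] \<cdot> \<one> \<in> carrier R" by simp
    note j = nonzero_inv[OF qc i(1)]
    have "inv ([q] \<cdot> \<one>) \<otimes> (([q] \<cdot> \<one>) \<otimes> diff (zz 0) (zz 1) l) \<in> scaled \<tau> m"
      using submodule_facts(4)[OF v(1) N i(2) 1] unfolding e .
    moreover have "inv ([q] \<cdot> \<one>) \<otimes> (([q] \<cdot> \<one>) \<otimes> diff (zz 0) (zz 1) l)
      = (inv ([q] \<cdot> \<one>) \<otimes> ([q] \<cdot> \<one>)) \<otimes> diff (zz 0) (zz 1) l"
      by (rule m_assoc[symmetric]) (use j(1) qc dcar[OF l] in auto)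
    ultimately show ?thesis using j(3) dcar[OF l] by simp
  qed
  have small0: "diff (zz 0) (zz i) l \<in> scaled \<tau> m" if l: "l \<in> M" for i l
  proof -
    have "[i] \<cdot> diff (zz 0) (zz 1) l \<in> scaled \<tau> m"
      by (induct i) (use submodule_facts(2,3)[OF v(1) N] small1[OF l] in auto)
    thus ?thesis using cg_mem[OF v(1) N sum[OF l, of i]] by simp
  qed
  have small: "diff (zz i) (zz k) l \<in> scaled \<tau> m" if l: "l \<in> M" for i k l
  proof -
    have t: "tco (zz 0) l \<in> carrier R" "tco (zz i) l \<in> carrier R" "tco (zz k) l \<in> carrier R" using tc[OF l] by blast+
    have "diff (zz i) (zz k) l = \<ominus> diff (zz 0) (zz i) l \<oplus> diff (zz 0) (zz k) l"
      unfolding diff_def using t by algebra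
    thus ?thesis
      using submodule_facts(3)[OF v(1) N submodule_facts(5)[OF v(1) N small0[OF l, of i]] small0[OF l, of k]] by simp
  qed
  have \<tau>0: "\<tau> = \<zero>"
  proof (rule ccontr)
    assume ne: "\<tau> \<noteq> \<zero>"
    then obtain i k l where "l \<in> M" "\<tau> = diff (zz i) (zz k) l" using \<tau>(1) unfolding D_def by auto
    hence "\<tau> \<in> scaled \<tau> m" using small by simp
    then obtain u where u: "u \<in> m" "\<tau> = \<tau> \<otimes> u" unfolding scaled_def by blast
    have "u \<in> carrier R" using u(1) m_ideal(3) by blast
    hence "u = \<one>" using u(2) m_lcancel[OF ne \<tau>c, of u \<one>] \<tau>c by simp
    thus False using u(1) v(3) by simp
  qed
  have "tco (zz 0) l = tco (zz 1) l" if l: "l \<in> M" for l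
  proof -
    have "diff (zz 0) (zz 1) l \<in> scaled \<zero> B" using dB[OF l] \<tau>0 by simp
    hence "diff (zz 0) (zz 1) l = \<zero>" unfolding scaled_def using B_ops(1) by auto
    thus ?thesis unfolding diff_def using tc[OF l] by simp
  qed
  hence "snd (zz 0) = snd (zz 1)"
    using coords_separate[OF T_facts(1)[OF z] , of "snd (zz 0)" "snd (zz 1)"] T_facts(2)[OF zT] fz
    unfolding tco_def M_def i0_def by metis
  hence "zz 0 = zz 1" using fz[of 0] fz[of 1] by (metis prod.collapse)
  thus ?thesis unfolding zz_def by simp
qed

end

section \<open>Words modulo a congruence of finite index\<close>

text \<open>Let u and w be equivalent. In the finite quotient monoid some power of u is
  idempotent; write it as pu. Then pw is idempotent modulo E too, and both fix x, so that p(ux) =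
  p(wx). Since p moves each of the points ux and wx in a cycle, a power of p with positive
  exponent fixes both of them, and they agree. Thus the orbit has at most as many points as there
  are classes.\<close>

lemma finite_orbit_of_congruence:
  fixes a :: "'j \<Rightarrow> 'x \<Rightarrow> 'x" and E :: "'j list \<Rightarrow> 'j list \<Rightarrow> bool" and key :: "'j list \<Rightarrow> 'k"
  assumes sym: "\<And>u w. E u w \<Longrightarrow> E w u" and trans: "\<And>u w z. E u w \<Longrightarrow> E w z \<Longrightarrow> E u z"
    and left: "\<And>u w z. E u w \<Longrightarrow> E (z @ u) (z @ w)" and right: "\<And>u w z. E u w \<Longrightarrow> E (u @ z) (w @ z)"
    and key: "finite (range key)" "\<And>u w. key u = key w \<Longrightarrow> E u w"
    and fixes_x: "\<And>w. E w (w @ w) \<Longrightarrow> foldr a w x = x"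
    and per: "\<And>w u. \<exists>n>0. (foldr a w ^^ n) (foldr a u x) = foldr a u x"
  shows "finite (range (\<lambda>w. foldr a w x))"
proof -
  define pw where "pw w k = concat (replicate k w)" for w :: "'j list" and k
  have pw_add: "pw w (k + l) = pw w k @ pw w l" for w k l
    unfolding pw_def by (simp add: replicate_add)
  have both: "E (u @ u') (w @ w')" if "E u w" "E u' w'" for u w u' w'
    by (rule trans[OF right[OF that(1)] left[OF that(2)]])
  have main: "foldr a u x = foldr a w x" if uw: "E u w" for u w
  proof -
    have "\<not> inj (\<lambda>k::nat. key (pw u (Suc k)))"
      using finite_subset[OF _ key(1)] range_inj_infinite by (metis image_subsetI rangeI)
    then obtain i k where ik: "i < k" "key (pw u (Suc i)) = key (pw u (Suc k))"
      unfolding inj_def by (metis linorder_neqE_nat)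
    define b c where "b = Suc i" and "c = k - i"
    have c: "c > 0" "Suc k = b + c" using ik(1) unfolding b_def c_def by simp_all
    have bc: "E (pw u b) (pw u (b + c))" using key(2)[OF ik(2)] unfolding c(2) b_def .
    have refl: "E z z" for z by (rule key(2)) simp
    have sh: "E (pw u (b + l)) (pw u (b + l + t * c))" for l t
    proof (induct t)
      case (Suc t)
      have "E (pw u (b + (l + t * c))) (pw u (b + c + (l + t * c)))"
        using right[OF bc, of "pw u (l + t * c)"] unfolding pw_add[symmetric] .
      hence "E (pw u (b + l + t * c)) (pw u (b + l + Suc t * c))" by (simp add: ac_simps)
      from trans[OF Suc this] show ?case .
    qed (simp add: refl)
    \<comment> \<open>The powers of u are periodic from the exponent b on, with period c. A
      multiple of c that is at least b gives an idempotent.\<close>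
    define r where "r = b * c"
    have r1: "r \<ge> b" using c(1) mult_le_mono2[of 1 c b] unfolding r_def by simp
    hence r2: "r \<ge> 1" unfolding b_def by simp
    have "E (pw u r) (pw u (r + r))"
      using sh[of "r - b" b] r1 unfolding r_def by (simp add: mult.commute)
    hence e: "E (pw u r) (pw u r @ pw u r)" unfolding pw_add .
    define p where "p = pw u (r - 1)"
    have pu: "pw u r = p @ u" unfolding p_def using r2 pw_add[of u "r - 1" 1] by (simp add: pw_def)
    have pw_e: "E (p @ u) (p @ w)" by (rule left[OF uw])
    have "E (p @ w) ((p @ w) @ (p @ w))"
      using trans[OF sym[OF pw_e] trans[OF e[unfolded pu] both[OF pw_e pw_e]]] .
    hence "foldr a (p @ w) x = x" by (rule fixes_x)
    moreover have "foldr a (p @ u) x = x" by (rule fixes_x) (use e pu in simp)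
    ultimately have eq: "foldr a p (foldr a u x) = foldr a p (foldr a w x)" by simp
    obtain n where n: "n > 0" "(foldr a p ^^ n) (foldr a u x) = foldr a u x" using per by blast
    obtain l where l: "l > 0" "(foldr a p ^^ l) (foldr a w x) = foldr a w x" using per by blast
    have k0: "(g ^^ (n * l)) y = y" if "(g ^^ n) y = y \<or> (g ^^ l) y = y" for g :: "'x \<Rightarrow> 'x" and y
    proof -
      have fixed: "(h ^^ j) y = y" if "h y = y" for h :: "'x \<Rightarrow> 'x" and j
        by (induct j) (use that in auto)
      have 1: "(g ^^ n) ^^ l = g ^^ (n * l)" "(g ^^ l) ^^ n = g ^^ (n * l)"
        by (simp_all add: funpow_mult mult.commute)
      show ?thesis using that fixed[of "g ^^ n" l] fixed[of "g ^^ l" n] unfolding 1 by blast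
    qed
    have nl: "n * l > 0" using n l by simp
    obtain nl' where "n * l = Suc nl'" using nl by (cases "n * l") auto
    hence "(foldr a p ^^ (n * l)) (foldr a u x) = (foldr a p ^^ (n * l)) (foldr a w x)"
      using eq by (simp only: funpow_Suc_right comp_apply)
    thus ?thesis using k0 n(2) l(2) by metis
  qed
  have "range (\<lambda>w. foldr a w x) = (\<lambda>k. foldr a (SOME w. key w = k) x) ` range key"
  proof -
    have "foldr a (SOME v. key v = key w) x = foldr a w x" for w
      by (rule main, rule key(2), rule someI[of _ w]) simp
    thus ?thesis by (auto simp: image_image)
  qed
  thus ?thesis using key(1) by simp
qed

context lifted
begin

definition wpow :: "'j list \<Rightarrow> nat \<Rightarrow> 'j list"
  where "wpow w k = concat (replicate k w)"

lemma lifts_wpow: "lifts (wpow w k) t = (lifts w ^^ k) t"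
proof (induct k)
  case 0
  show ?case by (simp add: wpow_def lifts_def)
next
  case (Suc k)
  have "wpow w (Suc k) = w @ wpow w k" by (simp add: wpow_def)
  thus ?case using Suc by (simp add: lifts_append)
qed

lemma jet_idempotent_wpow:
  assumes "jet_eq w (w @ w)" "k > 0"
  shows "jet_eq (wpow w k) (wpow w k @ wpow w k)"
proof -
  have 1: "jet_eq w (wpow w (Suc k))" for k
  proof (induct k)
    case 0
    show ?case by (rule jet_eq_trans[OF assms(1)]) (use jet_eq_sym[OF assms(1)] in \<open>simp add: wpow_def\<close>)
  next
    case (Suc k)
    have "wpow w (Suc (Suc k)) = w @ wpow w (Suc k)" by (simp add: wpow_def)
    thus ?case using jet_eq_trans[OF assms(1) jet_eq_left[OF Suc]] by simp
  qed
  have w: "jet_eq w (wpow w k)" using 1[of "k - 1"] assms(2) by simp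
  show ?thesis
    by (rule jet_eq_trans[OF jet_eq_sym[OF w] jet_eq_trans[OF assms(1) jet_eq_trans[OF jet_eq_right[OF w] jet_eq_left[OF w]]]])
qed

text \<open>The lift of w need not be periodic at t, as it may change the tag. But there are
  finitely many tags, so the lift is periodic at some z over the same point. Its period N there is
  a multiple of n, hence of q. With N = l q, the lift of the l-th power of w is periodic at z with
  exponent q, so it fixes z, which contradicts the minimality of N.\<close>

lemma period_coprime:
  assumes idem: "jet_eq w (w @ w)" and t: "t \<in> T" and n: "n > 0" "(acts w ^^ n) (snd t) = snd t"
    and least: "\<And>k. 0 < k \<Longrightarrow> k < n \<Longrightarrow> (acts w ^^ k) (snd t) \<noteq> snd t"
    and q: "q dvd n" "q > 1" "[(q::nat)] \<cdot> \<one> \<notin> m"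
  shows False
proof -
  have lT: "(lifts w ^^ k) s \<in> T" "snd ((lifts w ^^ k) s) = (acts w ^^ k) (snd s)" if "s \<in> T" for k s
  proof -
    have "(lifts w ^^ k) s \<in> T \<and> snd ((lifts w ^^ k) s) = (acts w ^^ k) (snd s)"
      by (induct k) (use that lifts_facts(1,2) in auto)
    thus "(lifts w ^^ k) s \<in> T" "snd ((lifts w ^^ k) s) = (acts w ^^ k) (snd s)" by auto
  qed
  have fixed: "(h ^^ j) y = y" if "h y = y" for h :: "'x \<Rightarrow> 'x" and j y
    by (induct j) (use that in auto)
  define s where "s k = (lifts w ^^ (k * n)) t" for k
  have sT: "s k \<in> T" "snd (s k) = snd t" for k
  proof -
    show "s k \<in> T" unfolding s_def by (rule lT(1)[OF t])
    have "(acts w ^^ (k * n)) (snd t) = ((acts w ^^ n) ^^ k) (snd t)" by (simp add: funpow_mult mult.commute)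
    thus "snd (s k) = snd t" unfolding s_def lT(2)[OF t] using fixed[of "acts w ^^ n", OF n(2)] by simp
  qed
  have "range s \<subseteq> I \<times> {snd t}"
  proof
    fix z assume "z \<in> range s"
    then obtain k where "z = s k" by blast
    thus "z \<in> I \<times> {snd t}" using T_facts(1)[OF sT(1)[of k]] sT(2)[of k] by (simp add: mem_Times_iff)
  qed
  hence "finite (range s)" using finite_charts finite_subset by blast
  hence "\<not> inj s" using range_inj_infinite by blast
  then obtain i k where ik: "i < k" "s i = s k" unfolding inj_def by (metis linorder_neqE_nat)
  define z where "z = s i"
  have zT: "z \<in> T" "snd z = snd t" using sT unfolding z_def by blast+
  have "(lifts w ^^ ((k - i) * n)) z = s k"
  proof -
    have "(k - i) * n + i * n = k * n" using ik(1) by (simp add: add_mult_distrib[symmetric])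
    thus ?thesis unfolding z_def s_def by (metis comp_apply funpow_add)
  qed
  hence zper: "(lifts w ^^ ((k - i) * n)) z = z" using ik(2) unfolding z_def by simp
  have pos: "(k - i) * n > 0" using ik(1) n(1) by simp
  define N where "N = (LEAST l. 0 < l \<and> (lifts w ^^ l) z = z)"
  have N: "0 < N" "(lifts w ^^ N) z = z"
    using LeastI[of "\<lambda>l. 0 < l \<and> (lifts w ^^ l) z = z"] zper pos unfolding N_def by blast+
  have Nleast: "(lifts w ^^ l) z \<noteq> z" if "0 < l" "l < N" for l
    using not_less_Least[of l "\<lambda>l. 0 < l \<and> (lifts w ^^ l) z = z"] that unfolding N_def by blast
  have "(acts w ^^ N) (snd t) = snd t" using lT(2)[OF zT(1), of N] N(2) zT(2) by simp
  hence "(acts w ^^ (N mod n)) (snd t) = snd t" using funpow_mod_eq[OF n(2), of N] by simp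
  hence "N mod n = 0" using least[of "N mod n"] n(1) by (cases "N mod n = 0") auto
  hence "q dvd N" using q(1) by (meson dvd_trans mod_0_imp_dvd)
  then obtain l where l: "N = l * q" by (metis dvd_def mult.commute)
  have l0: "l > 0" "l < N" using N(1) q(2) unfolding l by auto
  have e: "(lifts (wpow w l) ^^ q) z = z"
  proof -
    have "lifts (wpow w l) = lifts w ^^ l" using lifts_wpow by (simp add: fun_eq_iff)
    thus ?thesis using N(2) unfolding l by (simp add: funpow_mult)
  qed
  have "lifts (wpow w l) z = z"
    by (rule jet_idempotent_fixes[OF jet_idempotent_wpow[OF idem l0(1)] zT(1) e _ q(3)]) (use q(2) in simp)
  thus False using Nleast[OF l0] unfolding lifts_wpow by simp
qed

end

context field
begin

text \<open>Two of infinitely many natural numbers have the same residue.\<close>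

lemma residue_characteristic:
  assumes V: "valuation_ring B" and A: "subring A R" "A \<subseteq> B" and fin: "fin_mod (nonunits B) A"
  shows "\<exists>n>0. [(n::nat)] \<cdot> \<one> \<in> nonunits B"
proof -
  note v = valuation_ring_facts[OF V]
  note i = ideal_of_carrier[OF v(1,2)]
  obtain F where F: "finite F" "F \<subseteq> A" "\<And>x. x \<in> A \<Longrightarrow> \<exists>f\<in>F. x \<ominus> f \<in> nonunits B"
    using fin unfolding fin_mod_def by blast
  have mult: "[n] \<cdot> \<one> \<in> A" for n :: nat
    by (induct n) (use subringE(2,3,7)[OF A(1)] in auto)
  hence "\<forall>n::nat. \<exists>f. f \<in> F \<and> [n] \<cdot> \<one> \<ominus> f \<in> nonunits B" using F(3) by blast
  then obtain g where "\<forall>n::nat. g n \<in> F \<and> [n] \<cdot> \<one> \<ominus> g n \<in> nonunits B" by (rule choice[THEN exE])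
  hence g: "g n \<in> F" "[n] \<cdot> \<one> \<ominus> g n \<in> nonunits B" for n :: nat by blast+
  have "finite (range g)" using g(1) F(1) by (meson finite_subset image_subsetI)
  hence "\<not> inj g" using range_inj_infinite by blast
  then obtain k l where kl: "k < l" "g k = g l" unfolding inj_def by (metis linorder_neqE_nat)
  have c: "[k] \<cdot> \<one> \<in> carrier R" "[(l - k)] \<cdot> \<one> \<in> carrier R" "g l \<in> carrier R"
    using g(1) F(2) subringE(1)[OF A(1)] by auto
  have "[l] \<cdot> \<one> = [k] \<cdot> \<one> \<oplus> [(l - k)] \<cdot> \<one>"
    using add.nat_pow_mult[of \<one> k "l - k"] kl(1) by simp
  hence "[(l - k)] \<cdot> \<one> = ([l] \<cdot> \<one> \<ominus> g l) \<ominus> ([k] \<cdot> \<one> \<ominus> g l)" using c by (simp, algebra)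
  moreover have "([l] \<cdot> \<one> \<ominus> g l) \<ominus> ([k] \<cdot> \<one> \<ominus> g l) \<in> nonunits B"
    using i(9)[OF g(2)[of l] g(2)[of k]] kl(2) by simp
  ultimately show ?thesis using kl(1) by (intro exI[of _ "l - k"]) simp
qed

text \<open>If q divides n, then n is a nonunit wherever q is one. Otherwise 1 is a combination of
  q and n, which cannot both be nonunits.\<close>

lemma coprime_residue_characteristics:
  assumes V: "valuation_ring B" "valuation_ring B'" and n: "[(n::nat)] \<cdot> \<one> \<in> nonunits B" "[n] \<cdot> \<one> \<notin> nonunits B'"
    and q: "prime q" "[(q::nat)] \<cdot> \<one> \<in> nonunits B" "[q] \<cdot> \<one> \<in> nonunits B'"
  shows False
proof -
  note v = valuation_ring_facts[OF V(1)] and v' = valuation_ring_facts[OF V(2)]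
  note i = ideal_of_carrier[OF v(1,2)] and i' = ideal_of_carrier[OF v'(1,2)]
  have intB: "[(z::int)] \<cdot> \<one> \<in> D" if D: "subring D R" for z D
  proof -
    have "[k] \<cdot> \<one> \<in> D" for k :: nat by (induct k) (use subringE(2,3,7)[OF D] in auto)
    hence n: "[(int k)] \<cdot> \<one> \<in> D" for k unfolding int_embed(6) .
    show ?thesis
    proof (cases z rule: int_cases2)
      case (nonneg k)
      thus ?thesis using n by simp
    next
      case (nonpos k)
      show ?thesis unfolding nonpos int_embed(3) by (rule subringE(5)[OF D n])
    qed
  qed
  show False
  proof (cases "q dvd n")
    case True
    then obtain k where "n = k * q" by (metis dvd_def mult.commute)
    hence "[n] \<cdot> \<one> = [(int k)] \<cdot> \<one> \<otimes> [q] \<cdot> \<one>"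
      using int_embed(2)[of "int k" "int q"] int_embed(6)[of n] int_embed(6)[of q] by simp
    thus False using n(2) i'(6)[OF intB[OF v'(1)] q(3)] by metis
  next
    case False
    hence "gcd (int q) (int n) = 1" using q(1) by (simp add: prime_imp_coprime)
    then obtain a b where ab: "a * int q + b * int n = 1" using bezout_int[of "int q" "int n"] by auto
    have "\<one> = [a] \<cdot> \<one> \<otimes> [q] \<cdot> \<one> \<oplus> [b] \<cdot> \<one> \<otimes> [n] \<cdot> \<one>"
      using int_embed(5) ab int_embed(1)[of "a * int q" "b * int n"] int_embed(2)[of a "int q"]
        int_embed(2)[of b "int n"] int_embed(6)[of n] int_embed(6)[of q] by metis
    moreover have "[a] \<cdot> \<one> \<otimes> [q] \<cdot> \<one> \<oplus> [b] \<cdot> \<one> \<otimes> [n] \<cdot> \<one> \<in> nonunits B"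
      using i(5)[OF i(6)[OF intB[OF v(1)] q(2)] i(6)[OF intB[OF v(1)] n(1)]] .
    ultimately show False using v(3) by metis
  qed
qed

end

context atlas
begin

text \<open>Two valuation rings of different residue characteristics give two congruences on
  words. A word that is idempotent for both of them has period 1 at x: by period_coprime, a prime
  factor of the period would be a nonunit in both rings. This is the assumption on idempotents in
  finite_orbit_of_congruence.\<close>

theorem finite_orbit:
  fixes f :: "'j \<Rightarrow> 'x \<Rightarrow> 'x"
  assumes char0: "char_zero" and J: "finite J" "j0 \<in> J" and i0: "i0 \<in> I" and x: "x \<in> U i0"
    and cov: "\<And>j i. j \<in> J \<Longrightarrow> i \<in> I \<Longrightarrow> \<exists>es. covers (carrier R) (f j) i es"
    and per: "\<And>w u. set w \<subseteq> J \<Longrightarrow> set u \<subseteq> J \<Longrightarrow> \<exists>n>0. (foldr f w ^^ n) (foldr f u x) = foldr f u x"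
  shows "finite {foldr f w x | w. set w \<subseteq> J}"
proof -
  \<comment> \<open>Collect formulas for all generators and charts, with finitely many
    coefficients.\<close>
  have "\<forall>p\<in>J \<times> I. \<exists>e. snd e \<subseteq> carrier R \<and> finite (snd e) \<and> covers (snd e) (f (fst p)) (snd p) (fst e)"
  proof
    fix p assume "p \<in> J \<times> I"
    then obtain es where "covers (carrier R) (f (fst p)) (snd p) es" using cov[of "fst p" "snd p"] by auto
    then obtain D where "D \<subseteq> carrier R" "finite D" "covers D (f (fst p)) (snd p) es" using covers_finite by blast
    thus "\<exists>e. snd e \<subseteq> carrier R \<and> finite (snd e) \<and> covers (snd e) (f (fst p)) (snd p) (fst e)"
      by (intro exI[of _ "(es, D)"]) simp
  qed
  then obtain e0 where e0: "\<forall>p\<in>J \<times> I. snd (e0 p) \<subseteq> carrier R \<and> finite (snd (e0 p)) \<and>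
    covers (snd (e0 p)) (f (fst p)) (snd p) (fst (e0 p))" by (rule bchoice[THEN exE])
  define Q0 D0 where "Q0 p = fst (e0 p)" and "D0 p = snd (e0 p)" for p
  have Q0: "D0 (j, i) \<subseteq> carrier R \<and> finite (D0 (j, i)) \<and> covers (D0 (j, i)) (f j) i (Q0 (j, i))"
    if "j \<in> J" "i \<in> I" for j i
    using bspec[OF e0, of "(j, i)"] that unfolding Q0_def D0_def by simp
  \<comment> \<open>The coordinates of x are included, so that x gives a tagged point for each of
    the valuation rings.\<close>
  define C where "C = (\<Union>p\<in>J \<times> I. D0 p) \<union> (\<lambda>l. co i0 l x) ` L i0"
  \<comment> \<open>Words are lists over the whole index type; indices outside J are made to act
    as j0.\<close>
  define r where "r j = (if j \<in> J then j else j0)" for j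
  have rJ: "r j \<in> J" for j unfolding r_def using J(2) by simp
  define g where "g j = f (r j)" for j
  define Q where "Q j i = Q0 (r j, i)" for j i
  have finC: "finite C" unfolding C_def using Q0 J(1) finite_charts finite_coords[OF i0] by auto
  have Cc: "C \<subseteq> carrier R" unfolding C_def using Q0 coord_carrier[OF i0 _ x] by auto
  have covC: "covers C (g j) i (Q j i)" if "i \<in> I" for i j
  proof -
    have "D0 (r j, i) \<subseteq> C" unfolding C_def using rJ that by blast
    thus ?thesis unfolding g_def Q_def using covers_mono Q0[OF rJ that] by blast
  qed
  obtain B1 where B1: "valuation_ring B1" "C \<subseteq> B1" "fin_mod (nonunits B1) (generate_ring R C)"
    using finite_residue_valuation[OF char0 finC Cc, of 1] by auto
  have gC: "subring (generate_ring R C) R" "generate_ring R C \<subseteq> B1"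
    using generate_ring_is_subring[OF Cc]
      generate_ring_min_subring1[OF Cc valuation_ring_facts(1)[OF B1(1)] B1(2)] by auto
  obtain n1 where n1: "n1 > 0" "[(n1::nat)] \<cdot> \<one> \<in> nonunits B1"
    using residue_characteristic[OF B1(1) gC B1(3)] by blast
  obtain B2 where B2: "valuation_ring B2" "C \<subseteq> B2" "fin_mod (nonunits B2) (generate_ring R C)"
    "[n1] \<cdot> \<one> \<notin> nonunits B2"
    using finite_residue_valuation[OF char0 finC Cc n1(1)] by metis
  interpret L1: lifted R I U L co C B1 g Q by unfold_locales (use B1 covC in auto)
  interpret L2: lifted R I U L co C B2 g Q by unfold_locales (use B2 covC in auto)
  obtain key1 :: "'j list \<Rightarrow> 'i \<times> 'x \<Rightarrow> ('i \<times> 'x) \<times> ('l \<Rightarrow> ('l \<Rightarrow> 'a) \<Rightarrow> 'a)"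
    where key1: "finite (range key1)" "\<And>u w. key1 u = key1 w \<Longrightarrow> L1.jet_eq u w"
    using L1.jet_eq_finite_index by blast
  obtain key2 :: "'j list \<Rightarrow> 'i \<times> 'x \<Rightarrow> ('i \<times> 'x) \<times> ('l \<Rightarrow> ('l \<Rightarrow> 'a) \<Rightarrow> 'a)"
    where key2: "finite (range key2)" "\<And>u w. key2 u = key2 w \<Longrightarrow> L2.jet_eq u w"
    using L2.jet_eq_finite_index by blast
  have xT: "(i0, x) \<in> L1.T" "(i0, x) \<in> L2.T"
  proof -
    have c: "co i0 l x \<in> generate_ring R C" if "l \<in> L i0" for l
      using that unfolding C_def by (auto intro: generate_ring.incl)
    show "(i0, x) \<in> L1.T" "(i0, x) \<in> L2.T"
      unfolding L1.T_def L2.T_def using i0 x c L1.Loc_facts(2) L2.Loc_facts(2) by auto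
  qed
  have fold: "foldr g w y = foldr f (map r w) y" for w y
    by (induct w) (simp_all add: g_def)
  have mapJ: "set (map r w) \<subseteq> J" for w using rJ by auto
  have gper: "\<exists>n>0. (foldr g w ^^ n) (foldr g u x) = foldr g u x" for w u
  proof -
    have "foldr g w = foldr f (map r w)" using fold by blast
    thus ?thesis unfolding fold using per[OF mapJ mapJ] by metis
  qed
  have "finite (range (\<lambda>w. foldr g w x))"
  proof (rule finite_orbit_of_congruence[where E = "\<lambda>u w. L1.jet_eq u w \<and> L2.jet_eq u w" and key = "\<lambda>w. (key1 w, key2 w)"])
    have "range (\<lambda>w. (key1 w, key2 w)) \<subseteq> range key1 \<times> range key2" by blast
    thus "finite (range (\<lambda>w. (key1 w, key2 w)))" using key1(1) key2(1) finite_subset by blast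
  next
    fix w assume idem: "L1.jet_eq w (w @ w) \<and> L2.jet_eq w (w @ w)"
    have a1: "L1.acts w = foldr g w" and a2: "L2.acts w = foldr g w"
      unfolding L1.acts_def L2.acts_def by (rule ext, simp)+
    define P where "P n \<longleftrightarrow> 0 < n \<and> (foldr g w ^^ n) x = x" for n
    have ex: "\<exists>n. P n" using gper[of w "[]"] unfolding P_def by auto
    define n where "n = (LEAST n. P n)"
    have n: "0 < n" "(foldr g w ^^ n) x = x" using LeastI_ex[OF ex] unfolding n_def P_def by blast+
    have least: "(foldr g w ^^ k) x \<noteq> x" if "0 < k" "k < n" for k
      using not_less_Least[of k P] that unfolding n_def P_def by blast
    have "n = 1"
    proof (rule ccontr)
      assume "n \<noteq> 1"
      then obtain q where q: "prime q" "q dvd n" using prime_factor_nat by blast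
      have q1: "q > 1" using prime_gt_1_nat[OF q(1)] .
      have "[q] \<cdot> \<one> \<in> nonunits B1"
      proof (rule ccontr)
        assume "[q] \<cdot> \<one> \<notin> nonunits B1"
        thus False using L1.period_coprime[of w "(i0, x)" n q] idem xT(1) n least q(2) q1 unfolding a1 by auto
      qed
      moreover have "[q] \<cdot> \<one> \<in> nonunits B2"
      proof (rule ccontr)
        assume "[q] \<cdot> \<one> \<notin> nonunits B2"
        thus False using L2.period_coprime[of w "(i0, x)" n q] idem xT(2) n least q(2) q1 unfolding a2 by auto
      qed
      ultimately show False
        using coprime_residue_characteristics[OF B1(1) B2(1) n1(2) B2(4) q(1)] by blast
    qed
    thus "foldr g w x = x" using n(2) by simp
  next
    fix w u show "\<exists>n>0. (foldr g w ^^ n) (foldr g u x) = foldr g u x" by (rule gper)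
  next
    fix u w z assume "L1.jet_eq u w \<and> L2.jet_eq u w" "L1.jet_eq w z \<and> L2.jet_eq w z"
    thus "L1.jet_eq u z \<and> L2.jet_eq u z" using L1.jet_eq_trans[of u w z] L2.jet_eq_trans[of u w z] by simp
  next
    fix u w assume h: "L1.jet_eq u w \<and> L2.jet_eq u w"
    thus "L1.jet_eq w u \<and> L2.jet_eq w u" using L1.jet_eq_sym[of u w] L2.jet_eq_sym[of u w] by simp
    fix z
    show "L1.jet_eq (z @ u) (z @ w) \<and> L2.jet_eq (z @ u) (z @ w)"
      using h L1.jet_eq_left[of u w z] L2.jet_eq_left[of u w z] by simp
    show "L1.jet_eq (u @ z) (w @ z) \<and> L2.jet_eq (u @ z) (w @ z)"
      using h L1.jet_eq_right[of u w z] L2.jet_eq_right[of u w z] by simp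
  next
    fix u w assume "(key1 u, key2 u) = (key1 w, key2 w)"
    thus "L1.jet_eq u w \<and> L2.jet_eq u w" using key1(2)[of u w] key2(2)[of u w] by simp
  qed
  moreover have "{foldr f w x | w. set w \<subseteq> J} \<subseteq> range (\<lambda>w. foldr g w x)"
  proof
    fix y assume "y \<in> {foldr f w x | w. set w \<subseteq> J}"
    then obtain w where w: "set w \<subseteq> J" "y = foldr f w x" by blast
    have "map r w = w" using w(1) by (intro map_idI) (auto simp: r_def)
    hence "y = foldr g w x" unfolding fold w(2) by simp
    thus "y \<in> range (\<lambda>w. foldr g w x)" by blast
  qed
  ultimately show ?thesis by (rule finite_subset[rotated])
qed

end

section \<open>Partitions of unity in a ring\<close>

lemma (in ring) proper_ideal_in_maximal:
  assumes "ideal J R" "\<one> \<notin> J"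
  obtains M where "maximalideal M R" "J \<subseteq> M"
proof -
  define \<A> where "\<A> = {I. ideal I R \<and> J \<subseteq> I \<and> \<one> \<notin> I}"
  have "\<exists>M\<in>\<A>. \<forall>N\<in>\<A>. M \<subseteq> N \<longrightarrow> N = M"
  proof (rule subset_Zorn_nonempty)
    show "\<A> \<noteq> {}" using assms unfolding \<A>_def by blast
    fix C assume C: "C \<noteq> {}" "subset.chain \<A> C"
    have "subset.chain {I. ideal I R} C" using C(2) unfolding \<A>_def subset_chain_def by blast
    from chain_Union_is_ideal[OF this] have "ideal (\<Union>C) R" using C(1) by simp
    moreover have c: "J \<subseteq> N \<and> \<one> \<notin> N" if "N \<in> C" for N
      using C(2) that unfolding \<A>_def subset_chain_def by auto
    have "J \<subseteq> \<Union>C" using c C(1) by auto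
    moreover have "\<one> \<notin> \<Union>C" using c by auto
    ultimately show "\<Union>C \<in> \<A>" unfolding \<A>_def by simp
  qed
  then obtain M where MA: "M \<in> \<A>" and max0: "\<forall>N\<in>\<A>. M \<subseteq> N \<longrightarrow> N = M" by (rule bexE)
  have M: "ideal M R" "J \<subseteq> M" "\<one> \<notin> M" using MA unfolding \<A>_def by simp_all
  have max: "N = M" if "ideal N R" "J \<subseteq> N" "\<one> \<notin> N" "M \<subseteq> N" for N
    using max0 that unfolding \<A>_def by simp
  have "maximalideal M R"
  proof (rule maximalidealI[OF M(1)])
    show "carrier R \<noteq> M" using M(3) one_closed by metis
    fix N assume N: "ideal N R" "M \<subseteq> N" "N \<subseteq> carrier R"
    show "N = M \<or> N = carrier R"
    proof (cases "\<one> \<in> N")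
      case True
      thus ?thesis using ideal.one_imp_carrier[OF N(1)] by simp
    next
      case False
      thus ?thesis using max[OF N(1)] M(2) N(2) by simp
    qed
  qed
  thus thesis using that[of M] M(2) by simp
qed

lemma (in cring) nonunit_in_maximal:
  assumes "a \<in> carrier R" "\<And>b. b \<in> carrier R \<Longrightarrow> a \<otimes> b \<noteq> \<one>"
  obtains M where "maximalideal M R" "a \<in> M"
proof -
  have "\<one> \<notin> PIdl a"
  proof
    assume "\<one> \<in> PIdl a"
    then obtain b where "b \<in> carrier R" "\<one> = b \<otimes> a" unfolding cgenideal_def by auto
    thus False using assms m_comm[of a b] by simp
  qed
  then obtain M where "maximalideal M R" "PIdl a \<subseteq> M"
    using proper_ideal_in_maximal[OF cgenideal_ideal[OF assms(1)]] by blast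
  thus thesis using that cgenideal_self[OF assms(1)] by blast
qed

primrec (in ring) combination :: "('a \<times> 'a) list \<Rightarrow> 'a" where
  "combination [] = \<zero>"
| "combination (p # ps) = fst p \<otimes> snd p \<oplus> combination ps"

lemma (in ring) combination_closed:
  "set ps \<subseteq> carrier R \<times> carrier R \<Longrightarrow> combination ps \<in> carrier R"
  by (induct ps) auto

lemma (in ring) combination_append:
  "set ps \<subseteq> carrier R \<times> carrier R \<Longrightarrow> set qs \<subseteq> carrier R \<times> carrier R \<Longrightarrow>
    combination (ps @ qs) = combination ps \<oplus> combination qs"
  by (induct ps) (auto simp: combination_closed a_assoc)

lemma (in cring) combination_scale:
  "a \<in> carrier R \<Longrightarrow> set ps \<subseteq> carrier R \<times> carrier R \<Longrightarrow>
    combination (map (\<lambda>p. (a \<otimes> fst p, snd p)) ps) = a \<otimes> combination ps"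
  by (induct ps) (auto simp: combination_closed r_distr m_assoc)

text \<open>The linear combinations of elements of S form an ideal, which is contained in no
  maximal ideal.\<close>

lemma (in cring) partition_of_unity:
  assumes S: "S \<subseteq> carrier R" and cover: "\<And>p. primeideal p R \<Longrightarrow> \<exists>h\<in>S. h \<notin> p"
  shows "\<exists>ps. set ps \<subseteq> carrier R \<times> S \<and> combination ps = \<one>"
proof -
  define J where "J = {combination ps | ps. set ps \<subseteq> carrier R \<times> S}"
  have JI: "combination ps \<in> J" if "set ps \<subseteq> carrier R \<times> S" for ps using that unfolding J_def by blast
  have RS: "set ps \<subseteq> carrier R \<times> carrier R" if "set ps \<subseteq> carrier R \<times> S" for ps using that S by blast
  have Jc: "J \<subseteq> carrier R" unfolding J_def using combination_closed RS by blast
  have mult: "x \<otimes> a \<in> J" if ax: "a \<in> J" "x \<in> carrier R" for a x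
  proof -
    obtain ps where ps: "a = combination ps" "set ps \<subseteq> carrier R \<times> S" using ax(1) unfolding J_def by blast
    have "x \<otimes> a = combination (map (\<lambda>p. (x \<otimes> fst p, snd p)) ps)"
      using combination_scale[OF ax(2) RS[OF ps(2)]] ps(1) by simp
    moreover have "set (map (\<lambda>p. (x \<otimes> fst p, snd p)) ps) \<subseteq> carrier R \<times> S" using ps(2) ax(2) by auto
    ultimately show ?thesis using JI by metis
  qed
  have "ideal J R"
  proof (rule idealI)
    show "ring R" by (rule ring_axioms)
    show "subgroup J (add_monoid R)"
    proof
      show "J \<subseteq> carrier (add_monoid R)" using Jc by simp
      have "combination [] \<in> J" by (rule JI) simp
      thus "\<one>\<^bsub>add_monoid R\<^esub> \<in> J" by simp
      fix a b assume "a \<in> J" "b \<in> J"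
      then obtain ps qs where "a = combination ps" "set ps \<subseteq> carrier R \<times> S"
        "b = combination qs" "set qs \<subseteq> carrier R \<times> S" unfolding J_def by blast
      hence "a \<oplus> b = combination (ps @ qs)" "set (ps @ qs) \<subseteq> carrier R \<times> S"
        using combination_append RS by auto
      thus "a \<otimes>\<^bsub>add_monoid R\<^esub> b \<in> J" using JI by simp
    next
      fix a assume a: "a \<in> J"
      have "(\<ominus> \<one>) \<otimes> a \<in> J" using mult[OF a] by simp
      moreover have "(\<ominus> \<one>) \<otimes> a = \<ominus> a" using a Jc by (simp add: l_minus subset_iff)
      ultimately show "inv\<^bsub>add_monoid R\<^esub> a \<in> J" by (simp add: a_inv_def)
    qed
    show "x \<otimes> a \<in> J" if "a \<in> J" "x \<in> carrier R" for a x by (rule mult[OF that])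
    show "a \<otimes> x \<in> J" if "a \<in> J" "x \<in> carrier R" for a x
      using mult[OF that] m_comm that Jc by (metis subsetD)
  qed
  moreover have SJ: "h \<in> J" if "h \<in> S" for h
  proof -
    have "combination [(\<one>, h)] \<in> J" by (rule JI) (use that in auto)
    thus ?thesis using that S by auto
  qed
  ultimately have "\<one> \<in> J"
    using proper_ideal_in_maximal[of J] maximalideal_prime cover by (metis subsetD)
  thus ?thesis unfolding J_def by force
qed

section \<open>Localizations and spectra\<close>

text \<open>The operations of localizations and stalks are unions over all representatives of the
  arguments. Such a union is evaluated by showing that all representatives give the same set.\<close>

lemma union_constant:
  assumes "(a, s) \<in> A" "(b, t) \<in> B" "\<And>a' s' b' t'. (a', s') \<in> A \<Longrightarrow> (b', t') \<in> B \<Longrightarrow> g a' s' b' t' = c"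
  shows "(\<Union>(a, s)\<in>A. \<Union>(b, t)\<in>B. g a s b t) = c"
proof (rule equalityI)
  show "c \<subseteq> (\<Union>(a, s)\<in>A. \<Union>(b, t)\<in>B. g a s b t)"
  proof
    fix x assume "x \<in> c"
    hence "x \<in> g a s b t" using assms(3)[OF assms(1,2)] by simp
    thus "x \<in> (\<Union>(a, s)\<in>A. \<Union>(b, t)\<in>B. g a s b t)"
      by (intro UN_I[OF assms(1)], simp only: prod.case, intro UN_I[OF assms(2)], simp only: prod.case)
  qed
  show "(\<Union>(a, s)\<in>A. \<Union>(b, t)\<in>B. g a s b t) \<subseteq> c"
  proof
    fix x assume "x \<in> (\<Union>(a, s)\<in>A. \<Union>(b, t)\<in>B. g a s b t)"
    then obtain a' s' b' t' where "(a', s') \<in> A" "(b', t') \<in> B" "x \<in> g a' s' b' t'"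
      by (elim UN_E) (simp only: split_paired_all prod.case, elim UN_E, simp only: split_paired_all prod.case)
    thus "x \<in> c" using assms(3)[of a' s' b' t'] by simp
  qed
qed

locale spec_ring = cring R for R :: "'a ring" (structure)
begin

lemma prime_complement:
  assumes "primeideal p R"
  shows "\<one> \<in> carrier R - p" "\<And>s t. s \<in> carrier R - p \<Longrightarrow> t \<in> carrier R - p \<Longrightarrow> s \<otimes> t \<in> carrier R - p"
    "\<zero> \<in> p" "p \<subseteq> carrier R" "\<And>a x. a \<in> p \<Longrightarrow> x \<in> carrier R \<Longrightarrow> a \<otimes> x \<in> p"
    "\<And>a x. a \<in> p \<Longrightarrow> x \<in> carrier R \<Longrightarrow> x \<otimes> a \<in> p"
proof -
  interpret primeideal p R by fact
  show "\<one> \<in> carrier R - p" using I_notcarr one_imp_carrier by auto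
  show "\<And>s t. s \<in> carrier R - p \<Longrightarrow> t \<in> carrier R - p \<Longrightarrow> s \<otimes> t \<in> carrier R - p" using I_prime by blast
  show "\<zero> \<in> p" "p \<subseteq> carrier R" using Icarr by auto
  show "\<And>a x. a \<in> p \<Longrightarrow> x \<in> carrier R \<Longrightarrow> a \<otimes> x \<in> p" "\<And>a x. a \<in> p \<Longrightarrow> x \<in> carrier R \<Longrightarrow> x \<otimes> a \<in> p"
    using I_l_closed I_r_closed by blast+
qed

lemma fraction_mem:
  assumes "a \<in> carrier R" "s \<in> carrier R" "b \<in> carrier R" "t \<in> carrier R"
  shows "(b, t) \<in> fraction R p a s \<longleftrightarrow> t \<notin> p \<and> (\<exists>u\<in>carrier R - p. u \<otimes> (a \<otimes> t) = u \<otimes> (b \<otimes> s))"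
proof -
  have "u \<otimes> (a \<otimes> t \<ominus> b \<otimes> s) = \<zero> \<longleftrightarrow> u \<otimes> (a \<otimes> t) = u \<otimes> (b \<otimes> s)" if "u \<in> carrier R" for u
  proof -
    have "u \<otimes> (a \<otimes> t \<ominus> b \<otimes> s) = u \<otimes> (a \<otimes> t) \<ominus> u \<otimes> (b \<otimes> s)" using that assms by algebra
    thus ?thesis using that assms by simp
  qed
  thus ?thesis unfolding fraction_def using assms(3,4) by auto
qed

text \<open>The multipliers of the two relations are multiplied with each other and with the
  denominator that is to be cancelled.\<close>

lemma fraction_trans:
  assumes p: "primeideal p R"
    and c: "a \<in> carrier R" "s \<in> carrier R - p" "b \<in> carrier R" "t \<in> carrier R - p" "d \<in> carrier R" "r \<in> carrier R - p"
    and 1: "\<exists>u\<in>carrier R - p. u \<otimes> (a \<otimes> t) = u \<otimes> (b \<otimes> s)"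
    and 2: "\<exists>u\<in>carrier R - p. u \<otimes> (b \<otimes> r) = u \<otimes> (d \<otimes> t)"
  shows "\<exists>u\<in>carrier R - p. u \<otimes> (a \<otimes> r) = u \<otimes> (d \<otimes> s)"
proof -
  obtain u w where u: "u \<in> carrier R - p" "u \<otimes> (a \<otimes> t) = u \<otimes> (b \<otimes> s)"
    and w: "w \<in> carrier R - p" "w \<otimes> (b \<otimes> r) = w \<otimes> (d \<otimes> t)" using 1 2 by blast
  have k: "u \<in> carrier R" "w \<in> carrier R" "a \<in> carrier R" "s \<in> carrier R" "b \<in> carrier R" "t \<in> carrier R"
    "d \<in> carrier R" "r \<in> carrier R" using u w c by auto
  have "(u \<otimes> w \<otimes> t) \<otimes> (a \<otimes> r) = (u \<otimes> (a \<otimes> t)) \<otimes> (w \<otimes> r)" using k by algebra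
  also have "\<dots> = (w \<otimes> (b \<otimes> r)) \<otimes> (u \<otimes> s)" unfolding u(2) using k by algebra
  also have "\<dots> = (u \<otimes> w \<otimes> t) \<otimes> (d \<otimes> s)" unfolding w(2) using k by algebra
  finally show ?thesis
    using prime_complement(2)[OF p prime_complement(2)[OF p u(1) w(1)] c(4)] by blast
qed

lemma fraction_eq:
  assumes p: "primeideal p R"
    and c: "a \<in> carrier R" "s \<in> carrier R - p" "b \<in> carrier R" "t \<in> carrier R - p"
  shows "fraction R p a s = fraction R p b t \<longleftrightarrow> (\<exists>u\<in>carrier R - p. u \<otimes> (a \<otimes> t) = u \<otimes> (b \<otimes> s))"
proof
  have k: "s \<in> carrier R" "t \<in> carrier R" using c by auto
  assume "fraction R p a s = fraction R p b t"
  moreover have "(b, t) \<in> fraction R p b t"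
    using fraction_mem[OF c(3) k(2) c(3) k(2)] c prime_complement(1)[OF p] by blast
  ultimately have "(b, t) \<in> fraction R p a s" by simp
  thus "\<exists>u\<in>carrier R - p. u \<otimes> (a \<otimes> t) = u \<otimes> (b \<otimes> s)" using fraction_mem[OF c(1) k(1) c(3) k(2)] by blast
next
  have k: "s \<in> carrier R" "t \<in> carrier R" using c by auto
  assume e: "\<exists>u\<in>carrier R - p. u \<otimes> (a \<otimes> t) = u \<otimes> (b \<otimes> s)"
  hence e': "\<exists>u\<in>carrier R - p. u \<otimes> (b \<otimes> s) = u \<otimes> (a \<otimes> t)" by metis
  have "(d, r) \<in> fraction R p a s \<longleftrightarrow> (d, r) \<in> fraction R p b t" for d r
  proof (cases "d \<in> carrier R \<and> r \<in> carrier R - p")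
    case True
    hence d: "d \<in> carrier R" "r \<in> carrier R - p" "r \<in> carrier R" "r \<notin> p" by auto
    show ?thesis
      unfolding fraction_mem[OF c(1) k(1) d(1,3)] fraction_mem[OF c(3) k(2) d(1,3)]
      using fraction_trans[OF p c(3,4,1,2) d(1,2) e'] fraction_trans[OF p c d(1,2) e] d(4) by blast
  next
    case False
    thus ?thesis unfolding fraction_def by auto
  qed
  thus "fraction R p a s = fraction R p b t" by auto
qed

lemma fraction_self:
  assumes p: "primeideal p R" and c: "a \<in> carrier R" "s \<in> carrier R - p"
  shows "(a, s) \<in> fraction R p a s"
  using fraction_mem[of a s a s p] c prime_complement(1)[OF p] by blast

lemma fraction_elem:
  assumes p: "primeideal p R" and c: "a \<in> carrier R" "s \<in> carrier R - p" and m: "(b, t) \<in> fraction R p a s"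
  shows "b \<in> carrier R" "t \<in> carrier R - p" "\<exists>u\<in>carrier R - p. u \<otimes> (a \<otimes> t) = u \<otimes> (b \<otimes> s)"
proof -
  show bt: "b \<in> carrier R" "t \<in> carrier R - p" using m unfolding fraction_def by auto
  show "\<exists>u\<in>carrier R - p. u \<otimes> (a \<otimes> t) = u \<otimes> (b \<otimes> s)" using fraction_mem[of a s b t p] c bt m by auto
qed

lemma localization_mult:
  assumes p: "primeideal p R"
    and c: "a \<in> carrier R" "s \<in> carrier R - p" "b \<in> carrier R" "t \<in> carrier R - p"
  shows "fraction R p a s \<otimes>\<^bsub>localization R p\<^esub> fraction R p b t = fraction R p (a \<otimes> b) (s \<otimes> t)"
proof -
  have "fraction R p (a' \<otimes> b') (s' \<otimes> t') = fraction R p (a \<otimes> b) (s \<otimes> t)"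
    if 1: "(a', s') \<in> fraction R p a s" and 2: "(b', t') \<in> fraction R p b t" for a' s' b' t'
  proof -
    note e = fraction_elem[OF p c(1,2) 1] and e' = fraction_elem[OF p c(3,4) 2]
    obtain u w where u: "u \<in> carrier R - p" "u \<otimes> (a \<otimes> s') = u \<otimes> (a' \<otimes> s)"
      and w: "w \<in> carrier R - p" "w \<otimes> (b \<otimes> t') = w \<otimes> (b' \<otimes> t)" using e(3) e'(3) by blast
    have k: "u \<in> carrier R" "w \<in> carrier R" "a \<in> carrier R" "s \<in> carrier R" "b \<in> carrier R" "t \<in> carrier R"
      "a' \<in> carrier R" "s' \<in> carrier R" "b' \<in> carrier R" "t' \<in> carrier R" using u w c e e' by auto
    have "(u \<otimes> w) \<otimes> ((a' \<otimes> b') \<otimes> (s \<otimes> t)) = (u \<otimes> (a' \<otimes> s)) \<otimes> (w \<otimes> (b' \<otimes> t))" using k by algebra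
    also have "\<dots> = (u \<otimes> w) \<otimes> ((a \<otimes> b) \<otimes> (s' \<otimes> t'))" unfolding u(2)[symmetric] w(2)[symmetric] using k by algebra
    finally show ?thesis
      using fraction_eq[OF p m_closed[OF k(7,9)] prime_complement(2)[OF p e(2) e'(2)]
          m_closed[OF k(3,5)] prime_complement(2)[OF p c(2,4)]] prime_complement(2)[OF p u(1) w(1)] by blast
  qed
  from union_constant[OF fraction_self[OF p c(1,2)] fraction_self[OF p c(3,4)], of "\<lambda>a s b t. fraction R p (a \<otimes> b) (s \<otimes> t)", OF this]
  show ?thesis unfolding localization_def by simp
qed

lemma localization_add:
  assumes p: "primeideal p R"
    and c: "a \<in> carrier R" "s \<in> carrier R - p" "b \<in> carrier R" "t \<in> carrier R - p"
  shows "fraction R p a s \<oplus>\<^bsub>localization R p\<^esub> fraction R p b t = fraction R p (a \<otimes> t \<oplus> b \<otimes> s) (s \<otimes> t)"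
proof -
  have "fraction R p (a' \<otimes> t' \<oplus> b' \<otimes> s') (s' \<otimes> t') = fraction R p (a \<otimes> t \<oplus> b \<otimes> s) (s \<otimes> t)"
    if 1: "(a', s') \<in> fraction R p a s" and 2: "(b', t') \<in> fraction R p b t" for a' s' b' t'
  proof -
    note e = fraction_elem[OF p c(1,2) 1] and e' = fraction_elem[OF p c(3,4) 2]
    obtain u w where u: "u \<in> carrier R - p" "u \<otimes> (a \<otimes> s') = u \<otimes> (a' \<otimes> s)"
      and w: "w \<in> carrier R - p" "w \<otimes> (b \<otimes> t') = w \<otimes> (b' \<otimes> t)" using e(3) e'(3) by blast
    have k: "u \<in> carrier R" "w \<in> carrier R" "a \<in> carrier R" "s \<in> carrier R" "b \<in> carrier R" "t \<in> carrier R"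
      "a' \<in> carrier R" "s' \<in> carrier R" "b' \<in> carrier R" "t' \<in> carrier R" using u w c e e' by auto
    have "(u \<otimes> w) \<otimes> ((a' \<otimes> t' \<oplus> b' \<otimes> s') \<otimes> (s \<otimes> t))
      = (u \<otimes> (a' \<otimes> s)) \<otimes> (w \<otimes> t' \<otimes> t) \<oplus> (w \<otimes> (b' \<otimes> t)) \<otimes> (u \<otimes> s' \<otimes> s)" using k by algebra
    also have "\<dots> = (u \<otimes> w) \<otimes> ((a \<otimes> t \<oplus> b \<otimes> s) \<otimes> (s' \<otimes> t'))"
      unfolding u(2)[symmetric] w(2)[symmetric] using k by algebra
    finally have "\<exists>u\<in>carrier R - p. u \<otimes> ((a' \<otimes> t' \<oplus> b' \<otimes> s') \<otimes> (s \<otimes> t)) = u \<otimes> ((a \<otimes> t \<oplus> b \<otimes> s) \<otimes> (s' \<otimes> t'))"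
      using prime_complement(2)[OF p u(1) w(1)] by blast
    moreover have "a' \<otimes> t' \<oplus> b' \<otimes> s' \<in> carrier R" "a \<otimes> t \<oplus> b \<otimes> s \<in> carrier R" using k by simp_all
    ultimately show ?thesis
      using fraction_eq[OF p _ prime_complement(2)[OF p e(2) e'(2)] _ prime_complement(2)[OF p c(2,4)]] by blast
  qed
  from union_constant[OF fraction_self[OF p c(1,2)] fraction_self[OF p c(3,4)],
      of "\<lambda>a s b t. fraction R p (a \<otimes> t \<oplus> b \<otimes> s) (s \<otimes> t)", OF this]
  show ?thesis unfolding localization_def by simp
qed

lemma localization_carrier:
  "carrier (localization R p) = {fraction R p a s | a s. a \<in> carrier R \<and> s \<in> carrier R - p}"
  "\<one>\<^bsub>localization R p\<^esub> = fraction R p \<one> \<one>" "\<zero>\<^bsub>localization R p\<^esub> = fraction R p \<zero> \<one>"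
  unfolding localization_def by simp_all

definition basic :: "'a \<Rightarrow> 'a set set"
  where "basic h = {p. primeideal p R \<and> h \<notin> p}"

lemma openin_basic: "h \<in> carrier R \<Longrightarrow> openin (zariski_topology R) (basic h)"
  unfolding zariski_topology_def basic_def by (intro topology_generated_by_Basis) blast

lemma basic_mult:
  assumes "g \<in> carrier R" "h \<in> carrier R"
  shows "basic (g \<otimes> h) = basic g \<inter> basic h"
proof -
  have "g \<otimes> h \<notin> p \<longleftrightarrow> g \<notin> p \<and> h \<notin> p" if "primeideal p R" for p
    using prime_complement(2,5,6)[OF that] assms by blast
  thus ?thesis unfolding basic_def by auto
qed

lemma basic_one: "basic \<one> = {p. primeideal p R}"
  unfolding basic_def using prime_complement(1) by auto

lemma spec_points: "topspace (zariski_topology R) = {p. primeideal p R}"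
proof -
  have "topspace (zariski_topology R) = (\<Union>f\<in>carrier R. basic f)"
    unfolding zariski_topology_def topology_generated_by_topspace basic_def by auto
  moreover have "\<dots> = {p. primeideal p R}"
    using basic_one unfolding basic_def by blast
  ultimately show ?thesis by simp
qed

lemma zariski_basis:
  assumes W: "openin (zariski_topology R) W" and p: "p \<in> W"
  shows "\<exists>h\<in>carrier R. h \<notin> p \<and> basic h \<subseteq> W"
proof -
  have pp: "primeideal p R" using openin_subset[OF W] p spec_points by auto
  have "generate_topology_on {{p. primeideal p R \<and> f \<notin> p} | f. f \<in> carrier R} W"
    using W unfolding zariski_topology_def openin_topology_generated_by_iff .
  thus ?thesis using p
  proof (induct rule: generate_topology_on.induct)
    case (Int a b)
    then obtain g h where "g \<in> carrier R" "g \<notin> p" "basic g \<subseteq> a" "h \<in> carrier R" "h \<notin> p" "basic h \<subseteq> b" by blast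
    thus ?case using basic_mult[of g h] prime_complement(2)[OF pp, of g h]
      by (intro bexI[of _ "g \<otimes> h"]) auto
  next
    case (UN K)
    then obtain k where "k \<in> K" "p \<in> k" by blast
    thus ?case using UN(2) by blast
  next
    case (Basis s)
    then obtain f where "f \<in> carrier R" "s = basic f" unfolding basic_def by blast
    thus ?case using Basis unfolding basic_def by blast
  qed simp
qed

definition frac_section :: "'a \<Rightarrow> 'a \<Rightarrow> 'a set set \<Rightarrow> 'a set \<Rightarrow> ('a \<times> 'a) set"
  where "frac_section a f W = (\<lambda>p\<in>W. fraction R p a f)"

lemma spec_simps:
  "topo (Spec R) = zariski_topology R"
  "carrier (sections (Spec R) W) = regular_functions R W"
  "s \<otimes>\<^bsub>sections (Spec R) W\<^esub> t = (\<lambda>p\<in>W. s p \<otimes>\<^bsub>localization R p\<^esub> t p)"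
  "s \<oplus>\<^bsub>sections (Spec R) W\<^esub> t = (\<lambda>p\<in>W. s p \<oplus>\<^bsub>localization R p\<^esub> t p)"
  "\<one>\<^bsub>sections (Spec R) W\<^esub> = (\<lambda>p\<in>W. \<one>\<^bsub>localization R p\<^esub>)"
  "\<zero>\<^bsub>sections (Spec R) W\<^esub> = (\<lambda>p\<in>W. \<zero>\<^bsub>localization R p\<^esub>)"
  "res (Spec R) W W' s = restrict s W'"
  unfolding Spec_def by simp_all

lemma open_primes: "openin (zariski_topology R) W \<Longrightarrow> p \<in> W \<Longrightarrow> primeideal p R"
  using openin_subset spec_points by blast

lemma frac_section_regular:
  assumes W: "openin (zariski_topology R) W" and "a \<in> carrier R" "f \<in> carrier R" "\<And>p. p \<in> W \<Longrightarrow> f \<notin> p"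
  shows "frac_section a f W \<in> regular_functions R W"
proof -
  have "fraction R p a f \<in> carrier (localization R p)" if "p \<in> W" for p
    unfolding localization_carrier by (intro CollectI exI[of _ a] exI[of _ f]) (use assms that in simp)
  moreover have "\<exists>V a' f'. openin (zariski_topology R) V \<and> p \<in> V \<and> V \<subseteq> W \<and> a' \<in> carrier R \<and> f' \<in> carrier R \<and>
      (\<forall>q\<in>V. f' \<notin> q \<and> (\<lambda>p\<in>W. fraction R p a f) q = fraction R q a' f')" if "p \<in> W" for p
    by (rule exI[of _ W], rule exI[of _ a], rule exI[of _ f]) (use assms that in simp)
  ultimately show ?thesis unfolding regular_functions_def frac_section_def by simp
qed

lemma regular_at:
  assumes "s \<in> regular_functions R W" "p \<in> W"
  shows "\<exists>V a f. openin (zariski_topology R) V \<and> p \<in> V \<and> V \<subseteq> W \<and> a \<in> carrier R \<and> f \<in> carrier R \<and>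
    (\<forall>q\<in>V. f \<notin> q \<and> s q = fraction R q a f)"
  using assms unfolding regular_functions_def by simp

end

locale spec_field = field k for k :: "'k ring" (structure)

sublocale spec_field \<subseteq> spec_ring k
  by (rule spec_ring.intro) (rule cring_axioms)

context spec_field
begin

abbreviation pt :: "'k set" where "pt \<equiv> {\<zero>}"

text \<open>The values of sections at rational points lie in this isomorphic copy of k.\<close>

definition K :: "('k set \<Rightarrow> ('k \<times> 'k) set) ring" where "K = sections (Spec k) {pt}"

definition scalar :: "'k \<Rightarrow> 'k set \<Rightarrow> ('k \<times> 'k) set" where "scalar a = frac_section a \<one> {pt}"

lemma prime_iff: "primeideal p k \<longleftrightarrow> p = pt"
proof
  assume p: "primeideal p k"
  have "ideal p k" using p by (rule primeideal.axioms(1))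
  hence "p \<in> {{\<zero>}, carrier k}" using all_ideals by blast
  moreover have "p \<noteq> carrier k" using primeideal.I_notcarr[OF p] by simp
  ultimately show "p = pt" by simp
qed (use zeroprimeideal in simp)

lemma spec_k_points: "points (Spec k) = {pt}"
  unfolding spec_simps spec_points prime_iff by simp

lemma spec_k_open: "open_in (Spec k) W \<longleftrightarrow> W = {} \<or> W = {pt}"
proof
  assume "open_in (Spec k) W"
  hence "W \<subseteq> {pt}" using openin_subset[of "topo (Spec k)" W] spec_k_points by simp
  thus "W = {} \<or> W = {pt}" by blast
next
  assume "W = {} \<or> W = {pt}"
  thus "open_in (Spec k) W" using openin_topspace[of "topo (Spec k)"] unfolding spec_k_points by auto
qed

lemma one_not_pt: "\<one> \<in> carrier k - pt" by simp

lemma pt_prime: "primeideal pt k" using prime_iff by simp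

lemma scalar_apply: "scalar a pt = fraction k pt a \<one>"
  unfolding scalar_def frac_section_def by simp

lemma K_carrier: "carrier K = scalar ` carrier k"
proof
  show "scalar ` carrier k \<subseteq> carrier K"
  proof
    fix s assume "s \<in> scalar ` carrier k"
    then obtain a where a: "a \<in> carrier k" "s = scalar a" by blast
    have "openin (zariski_topology k) {pt}" using spec_k_open[of "{pt}"] unfolding spec_simps by simp
    thus "s \<in> carrier K" unfolding a(2) scalar_def K_def spec_simps
      by (rule frac_section_regular) (use a in auto)
  qed
  show "carrier K \<subseteq> scalar ` carrier k"
  proof
    fix s assume "s \<in> carrier K"
    hence s: "s \<in> regular_functions k {pt}" unfolding K_def spec_simps .
    obtain V a f where h: "a \<in> carrier k" "f \<in> carrier k" "pt \<in> V" "\<forall>q\<in>V. f \<notin> q \<and> s q = fraction k q a f"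
      using regular_at[OF s, of pt] by auto
    have f: "f \<noteq> \<zero>" "s pt = fraction k pt a f" using h(3,4) by auto
    have fu: "f \<in> Units k" using h(2) f(1) field_Units by simp
    have fi: "inv f \<in> carrier k" "f \<otimes> inv f = \<one>" using fu by simp_all
    have "a \<otimes> \<one> = a \<otimes> (f \<otimes> inv f)" using fi(2) by simp
    also have "\<dots> = (a \<otimes> inv f) \<otimes> f" using h fi(1) by (simp add: m_ac)
    finally have "fraction k pt a f = fraction k pt (a \<otimes> inv f) \<one>"
      using fraction_eq[OF pt_prime h(1) _ m_closed[OF h(1) fi(1)] one_not_pt, of f] h(2) f(1) one_not_pt
      by (metis DiffI singletonD)
    hence "s pt = scalar (a \<otimes> inv f) pt" using f(2) scalar_apply by simp
    moreover have "s \<in> extensional {pt}" using s unfolding regular_functions_def by (auto simp: PiE_def)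
    moreover have "scalar (a \<otimes> inv f) \<in> extensional {pt}" unfolding scalar_def frac_section_def by simp
    ultimately have "s = scalar (a \<otimes> inv f)" by (intro extensionalityI[of _ "{pt}"]) auto
    thus "s \<in> scalar ` carrier k" using h(1) fi(1) by blast
  qed
qed

lemma scalar_inj: "inj_on scalar (carrier k)"
proof (rule inj_onI)
  fix a b assume h: "a \<in> carrier k" "b \<in> carrier k" "scalar a = scalar b"
  have "fraction k pt a \<one> = fraction k pt b \<one>" using fun_cong[OF h(3), of pt] scalar_apply by simp
  then obtain u where u: "u \<in> carrier k - pt" "u \<otimes> (a \<otimes> \<one>) = u \<otimes> (b \<otimes> \<one>)"
    using fraction_eq[OF pt_prime h(1) one_not_pt h(2) one_not_pt] by blast
  thus "a = b" using h(1,2) m_lcancel[of u a b] by simp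
qed

lemma scalar_iso: "scalar \<in> ring_iso k K"
proof (rule ring_iso_memI)
  show "scalar x \<in> carrier K" if "x \<in> carrier k" for x using that K_carrier by blast
  show "scalar (x \<otimes> y) = scalar x \<otimes>\<^bsub>K\<^esub> scalar y" if "x \<in> carrier k" "y \<in> carrier k" for x y
    unfolding K_def spec_simps scalar_def frac_section_def
    using localization_mult[OF pt_prime that(1) one_not_pt that(2) one_not_pt] by (intro restrict_ext) simp
  show "scalar (x \<oplus> y) = scalar x \<oplus>\<^bsub>K\<^esub> scalar y" if "x \<in> carrier k" "y \<in> carrier k" for x y
    unfolding K_def spec_simps scalar_def frac_section_def
    using localization_add[OF pt_prime that(1) one_not_pt that(2) one_not_pt] that by (intro restrict_ext) simp
  show "scalar \<one> = \<one>\<^bsub>K\<^esub>" unfolding K_def spec_simps localization_carrier scalar_def frac_section_def ..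
  show "bij_betw scalar (carrier k) (carrier K)"
    unfolding bij_betw_def using scalar_inj K_carrier by simp
qed

lemma scalar_zero: "scalar \<zero> = \<zero>\<^bsub>K\<^esub>"
  unfolding K_def spec_simps localization_carrier scalar_def frac_section_def ..

lemma K_field: "field K"
proof -
  have "field (K\<lparr>zero := scalar \<zero>\<rparr>)" by (rule ring_iso_imp_img_field[OF scalar_iso])
  thus ?thesis unfolding scalar_zero by simp
qed

lemma K_char: "[n] \<cdot>\<^bsub>K\<^esub> \<one>\<^bsub>K\<^esub> = scalar ([(n::nat)] \<cdot> \<one>)"
proof -
  interpret L: field K by (rule K_field)
  have hom: "scalar \<in> ring_hom k K" using scalar_iso unfolding ring_iso_def by simp
  show ?thesis
    by (induct n) (simp_all add: scalar_zero ring_hom_add[OF hom] ring_hom_one[OF hom])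
qed

lemma sections_empty: "s \<in> carrier (sections (Spec k) {}) \<longleftrightarrow> s = (\<lambda>x. undefined)"
  unfolding spec_simps regular_functions_def by auto

text \<open>The germ of s: the point has no neighbourhood besides the whole space, so that the
  class of s has a single representative.\<close>

definition gm :: "('k set \<Rightarrow> ('k \<times> 'k) set) \<Rightarrow> ('k set set \<times> ('k set \<Rightarrow> ('k \<times> 'k) set)) set"
  where "gm s = {({pt}, s)}"

lemma K_restrict: "s \<in> carrier K \<Longrightarrow> restrict s {pt} = s"
  unfolding K_def spec_simps regular_functions_def by (auto simp: PiE_def extensional_restrict)

lemma germ_spec: "s \<in> carrier K \<Longrightarrow> germ (Spec k) pt {pt} s = gm s"
proof -
  assume s: "s \<in> carrier K"
  have "(V, t) \<in> germ (Spec k) pt {pt} s \<longleftrightarrow> V = {pt} \<and> t = s" for V t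
  proof
    assume "(V, t) \<in> germ (Spec k) pt {pt} s"
    then obtain W where h: "open_in (Spec k) V" "pt \<in> V" "t \<in> carrier (sections (Spec k) V)"
      "open_in (Spec k) W" "pt \<in> W" "W \<subseteq> {pt} \<inter> V" "res (Spec k) {pt} W s = res (Spec k) V W t"
      unfolding germ_def by blast
    have V: "V = {pt}" and W: "W = {pt}" using h(1,2,4,5) spec_k_open by blast+
    show "V = {pt} \<and> t = s"
      using h(7,3) K_restrict[OF s] K_restrict[of t] unfolding V W spec_simps(7) K_def by simp
  next
    assume "V = {pt} \<and> t = s"
    thus "(V, t) \<in> germ (Spec k) pt {pt} s"
      unfolding germ_def using s spec_k_open[of "{pt}"] unfolding K_def by auto
  qed
  thus ?thesis unfolding gm_def by auto
qed

lemma stalk_spec_carrier: "carrier (stalk (Spec k) pt) = gm ` carrier K"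
proof
  show "carrier (stalk (Spec k) pt) \<subseteq> gm ` carrier K"
  proof
    fix a assume "a \<in> carrier (stalk (Spec k) pt)"
    then obtain U s where h: "a = germ (Spec k) pt U s" "open_in (Spec k) U" "pt \<in> U" "s \<in> carrier (sections (Spec k) U)"
      unfolding stalk_def by auto
    have U: "U = {pt}" using h(2,3) spec_k_open by blast
    have "s \<in> carrier K" using h(4) unfolding U K_def .
    thus "a \<in> gm ` carrier K" using germ_spec h(1) unfolding U by blast
  qed
  show "gm ` carrier K \<subseteq> carrier (stalk (Spec k) pt)"
  proof
    fix a assume "a \<in> gm ` carrier K"
    then obtain s where s: "s \<in> carrier K" "a = gm s" by blast
    have "a = germ (Spec k) pt {pt} s \<and> open_in (Spec k) {pt} \<and> pt \<in> {pt} \<and> s \<in> carrier (sections (Spec k) {pt})"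
      using germ_spec[OF s(1)] s spec_k_open[of "{pt}"] unfolding K_def by simp
    thus "a \<in> carrier (stalk (Spec k) pt)" unfolding stalk_def by auto
  qed
qed

lemma gm_iso: "gm \<in> ring_iso K (stalk (Spec k) pt)"
proof (rule ring_iso_memI)
  interpret L: field K by (rule K_field)
  show "gm s \<in> carrier (stalk (Spec k) pt)" if "s \<in> carrier K" for s using that stalk_spec_carrier by blast
  have ops: "gm s \<otimes>\<^bsub>stalk (Spec k) pt\<^esub> gm t = gm (s \<otimes>\<^bsub>K\<^esub> t)"
    "gm s \<oplus>\<^bsub>stalk (Spec k) pt\<^esub> gm t = gm (s \<oplus>\<^bsub>K\<^esub> t)" if st: "s \<in> carrier K" "t \<in> carrier K" for s t
  proof -
    have "gm s \<otimes>\<^bsub>stalk (Spec k) pt\<^esub> gm t = germ (Spec k) pt {pt} (s \<otimes>\<^bsub>K\<^esub> t)"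
      unfolding stalk_def gm_def using K_restrict st unfolding K_def by (simp add: spec_simps(7))
    thus "gm s \<otimes>\<^bsub>stalk (Spec k) pt\<^esub> gm t = gm (s \<otimes>\<^bsub>K\<^esub> t)" using germ_spec st by simp
    have "gm s \<oplus>\<^bsub>stalk (Spec k) pt\<^esub> gm t = germ (Spec k) pt {pt} (s \<oplus>\<^bsub>K\<^esub> t)"
      unfolding stalk_def gm_def using K_restrict st unfolding K_def by (simp add: spec_simps(7))
    thus "gm s \<oplus>\<^bsub>stalk (Spec k) pt\<^esub> gm t = gm (s \<oplus>\<^bsub>K\<^esub> t)" using germ_spec st by simp
  qed
  show "gm (s \<otimes>\<^bsub>K\<^esub> t) = gm s \<otimes>\<^bsub>stalk (Spec k) pt\<^esub> gm t" if "s \<in> carrier K" "t \<in> carrier K" for s t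
    using ops(1)[OF that] by simp
  show "gm (s \<oplus>\<^bsub>K\<^esub> t) = gm s \<oplus>\<^bsub>stalk (Spec k) pt\<^esub> gm t" if "s \<in> carrier K" "t \<in> carrier K" for s t
    using ops(2)[OF that] by simp
  show "gm \<one>\<^bsub>K\<^esub> = \<one>\<^bsub>stalk (Spec k) pt\<^esub>"
    using germ_spec[OF L.one_closed] unfolding stalk_def spec_k_points K_def by simp
  show "bij_betw gm (carrier K) (carrier (stalk (Spec k) pt))"
    unfolding bij_betw_def stalk_spec_carrier inj_on_def gm_def by simp
qed

lemma stalk_spec_maximal: "maximalideal {gm \<zero>\<^bsub>K\<^esub>} (stalk (Spec k) pt)"
proof -
  interpret L: field K by (rule K_field)
  have z: "gm \<zero>\<^bsub>K\<^esub> = \<zero>\<^bsub>stalk (Spec k) pt\<^esub>"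
    using germ_spec[OF L.zero_closed] unfolding stalk_def spec_k_points K_def by simp
  have "field ((stalk (Spec k) pt)\<lparr>zero := gm \<zero>\<^bsub>K\<^esub>\<rparr>)" by (rule L.ring_iso_imp_img_field[OF gm_iso])
  hence "field (stalk (Spec k) pt)" unfolding z by simp
  from field.zeromaximalideal[OF this] show ?thesis unfolding z .
qed

end

section \<open>Sections near a point\<close>

lemma presheafD:
  assumes "presheaf_of_rings Xs"
  shows "open_in Xs U \<Longrightarrow> cring (sections Xs U)"
    "open_in Xs U \<Longrightarrow> open_in Xs V \<Longrightarrow> V \<subseteq> U \<Longrightarrow> res Xs U V \<in> ring_hom (sections Xs U) (sections Xs V)"
    "open_in Xs U \<Longrightarrow> s \<in> carrier (sections Xs U) \<Longrightarrow> res Xs U U s = s"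
    "open_in Xs U \<Longrightarrow> open_in Xs V \<Longrightarrow> open_in Xs W \<Longrightarrow> W \<subseteq> V \<Longrightarrow> V \<subseteq> U \<Longrightarrow> s \<in> carrier (sections Xs U) \<Longrightarrow>
      res Xs V W (res Xs U V s) = res Xs U W s"
    "open_in Xs U \<Longrightarrow> open_in Xs V \<Longrightarrow> V \<subseteq> U \<Longrightarrow> s \<in> carrier (sections Xs U) \<Longrightarrow> res Xs U V s \<in> carrier (sections Xs V)"
proof -
  show "open_in Xs U \<Longrightarrow> cring (sections Xs U)"
    and r: "open_in Xs U \<Longrightarrow> open_in Xs V \<Longrightarrow> V \<subseteq> U \<Longrightarrow> res Xs U V \<in> ring_hom (sections Xs U) (sections Xs V)"
    and "open_in Xs U \<Longrightarrow> s \<in> carrier (sections Xs U) \<Longrightarrow> res Xs U U s = s"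
    and "open_in Xs U \<Longrightarrow> open_in Xs V \<Longrightarrow> open_in Xs W \<Longrightarrow> W \<subseteq> V \<Longrightarrow> V \<subseteq> U \<Longrightarrow> s \<in> carrier (sections Xs U) \<Longrightarrow>
      res Xs V W (res Xs U V s) = res Xs U W s"
    using assms unfolding presheaf_of_rings_def by simp_all
  show "open_in Xs U \<Longrightarrow> open_in Xs V \<Longrightarrow> V \<subseteq> U \<Longrightarrow> s \<in> carrier (sections Xs U) \<Longrightarrow> res Xs U V s \<in> carrier (sections Xs V)"
    using ring_hom_closed[OF r] by simp
qed

text \<open>The germ of s at x is a unit. Stating this in terms of sections avoids the arithmetic
  of the stalk.\<close>

definition unit_near :: "('p, 'a) ringed_space \<Rightarrow> 'p \<Rightarrow> 'p set \<Rightarrow> 'a \<Rightarrow> bool"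
  where "unit_near Xs x U s \<longleftrightarrow> (\<exists>W t. open_in Xs W \<and> x \<in> W \<and> W \<subseteq> U \<and> t \<in> carrier (sections Xs W) \<and>
    res Xs U W s \<otimes>\<^bsub>sections Xs W\<^esub> t = \<one>\<^bsub>sections Xs W\<^esub>)"

lemma germ_memI:
  assumes "open_in Xs V" "x \<in> V" "t \<in> carrier (sections Xs V)" "open_in Xs W" "x \<in> W" "W \<subseteq> U" "W \<subseteq> V"
    "res Xs U W s = res Xs V W t"
  shows "(V, t) \<in> germ Xs x U s"
  using assms unfolding germ_def by auto

lemma germ_memE:
  assumes "(V, t) \<in> germ Xs x U s"
  obtains W where "open_in Xs V" "x \<in> V" "t \<in> carrier (sections Xs V)" "open_in Xs W" "x \<in> W" "W \<subseteq> U" "W \<subseteq> V"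
    "res Xs U W s = res Xs V W t"
  using assms unfolding germ_def by auto

lemma germ_eq:
  assumes P: "presheaf_of_rings Xs" and U: "open_in Xs U" "s \<in> carrier (sections Xs U)"
    and m: "(V, t) \<in> germ Xs x U s"
  shows "germ Xs x V t = germ Xs x U s"
proof -
  note p = presheafD[OF P]
  obtain W where W: "open_in Xs V" "x \<in> V" "t \<in> carrier (sections Xs V)" "open_in Xs W" "x \<in> W" "W \<subseteq> U" "W \<subseteq> V"
    "res Xs U W s = res Xs V W t" using m by (rule germ_memE)
  have sub: "res Xs U Z s = res Xs V Z t" if Z: "open_in Xs Z" "Z \<subseteq> W" for Z
    using p(4)[OF U(1) W(4) Z(1) Z(2) W(6) U(2)] p(4)[OF W(1,4) Z(1) Z(2) W(7,3)] W(8) by simp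
  have "(V', t') \<in> germ Xs x V t \<longleftrightarrow> (V', t') \<in> germ Xs x U s" for V' t'
  proof
    assume "(V', t') \<in> germ Xs x V t"
    then obtain Z where Z: "open_in Xs V'" "x \<in> V'" "t' \<in> carrier (sections Xs V')" "open_in Xs Z" "x \<in> Z" "Z \<subseteq> V" "Z \<subseteq> V'"
      "res Xs V Z t = res Xs V' Z t'" by (rule germ_memE)
    have o: "open_in Xs (W \<inter> Z)" using W(4) Z(4) by blast
    have "res Xs V (W \<inter> Z) t = res Xs V' (W \<inter> Z) t'"
      using p(4)[OF W(1) Z(4) o _ Z(6) W(3)] p(4)[OF Z(1) Z(4) o _ Z(7) Z(3)] Z(8) by simp
    hence "res Xs U (W \<inter> Z) s = res Xs V' (W \<inter> Z) t'" using sub[OF o] by simp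
    thus "(V', t') \<in> germ Xs x U s" using germ_memI[OF Z(1-3) o] W(5,6) Z(5,7) by blast
  next
    assume "(V', t') \<in> germ Xs x U s"
    then obtain Z where Z: "open_in Xs V'" "x \<in> V'" "t' \<in> carrier (sections Xs V')" "open_in Xs Z" "x \<in> Z" "Z \<subseteq> U" "Z \<subseteq> V'"
      "res Xs U Z s = res Xs V' Z t'" by (rule germ_memE)
    have o: "open_in Xs (W \<inter> Z)" using W(4) Z(4) by blast
    have "res Xs U (W \<inter> Z) s = res Xs V' (W \<inter> Z) t'"
      using p(4)[OF U(1) Z(4) o _ Z(6) U(2)] p(4)[OF Z(1) Z(4) o _ Z(7) Z(3)] Z(8) by simp
    hence "res Xs V (W \<inter> Z) t = res Xs V' (W \<inter> Z) t'" using sub[OF o] by simp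
    thus "(V', t') \<in> germ Xs x V t" using germ_memI[OF Z(1-3) o] W(5,7) Z(5,7) by blast
  qed
  thus ?thesis by auto
qed

lemma germ_self:
  assumes "open_in Xs U" "x \<in> U" "s \<in> carrier (sections Xs U)"
  shows "(U, s) \<in> germ Xs x U s"
  by (rule germ_memI[OF assms assms(1,2)]) simp_all

lemma germ_carrier:
  assumes "open_in Xs U" "x \<in> U" "s \<in> carrier (sections Xs U)"
  shows "germ Xs x U s \<in> carrier (stalk Xs x)"
  using assms unfolding stalk_def by auto

text \<open>A nonunit lies in some maximal ideal, and the stalk has only one. A product with
  another germ that equals 1 in the stalk does so on a neighbourhood.\<close>

lemma nonunit_germ_in_maximal:
  assumes P: "presheaf_of_rings Xs" and loc: "local_ring (stalk Xs x)" and m: "maximalideal m (stalk Xs x)"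
    and U: "open_in Xs U" "x \<in> U" "s \<in> carrier (sections Xs U)" and n: "\<not> unit_near Xs x U s"
  shows "germ Xs x U s \<in> m"
proof -
  note p = presheafD[OF P]
  interpret S: cring "stalk Xs x" using loc unfolding local_ring_def by blast
  have uniq: "m' = m" if "maximalideal m' (stalk Xs x)" for m' using loc m that unfolding local_ring_def by blast
  have "germ Xs x U s \<otimes>\<^bsub>stalk Xs x\<^esub> b \<noteq> \<one>\<^bsub>stalk Xs x\<^esub>" if b: "b \<in> carrier (stalk Xs x)" for b
  proof
    assume e: "germ Xs x U s \<otimes>\<^bsub>stalk Xs x\<^esub> b = \<one>\<^bsub>stalk Xs x\<^esub>"
    obtain V t where V: "b = germ Xs x V t" "open_in Xs V" "x \<in> V" "t \<in> carrier (sections Xs V)"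
      using b unfolding stalk_def by auto
    define q where "q = res Xs U (U \<inter> V) s \<otimes>\<^bsub>sections Xs (U \<inter> V)\<^esub> res Xs V (U \<inter> V) t"
    have o: "open_in Xs (U \<inter> V)" using U V by blast
    interpret C: cring "sections Xs (U \<inter> V)" by (rule p(1)[OF o])
    have r: "res Xs U (U \<inter> V) s \<in> carrier (sections Xs (U \<inter> V))" "res Xs V (U \<inter> V) t \<in> carrier (sections Xs (U \<inter> V))"
      using p(5)[OF U(1) o _ U(3)] p(5)[OF V(2) o _ V(4)] by auto
    have qc: "q \<in> carrier (sections Xs (U \<inter> V))" unfolding q_def using r by simp
    have "germ Xs x (U \<inter> V) q \<subseteq> germ Xs x U s \<otimes>\<^bsub>stalk Xs x\<^esub> b"
      unfolding stalk_def V(1) q_def using germ_self[OF U] germ_self[OF V(2-4)] by force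
    hence "(U \<inter> V, q) \<in> germ Xs x (points Xs) \<one>\<^bsub>sections Xs (points Xs)\<^esub>"
      using germ_self[OF o _ qc] U(2) V(3) e unfolding stalk_def by auto
    then obtain W where W: "open_in Xs W" "x \<in> W" "W \<subseteq> points Xs" "W \<subseteq> U \<inter> V"
      "res Xs (points Xs) W \<one>\<^bsub>sections Xs (points Xs)\<^esub> = res Xs (U \<inter> V) W q" by (rule germ_memE)
    have "res Xs (points Xs) W \<one>\<^bsub>sections Xs (points Xs)\<^esub> = \<one>\<^bsub>sections Xs W\<^esub>"
      by (rule ring_hom_one[OF p(2)]) (use W in auto)
    hence "res Xs (U \<inter> V) W q = \<one>\<^bsub>sections Xs W\<^esub>" using W(5) by simp
    moreover have "res Xs (U \<inter> V) W q = res Xs (U \<inter> V) W (res Xs U (U \<inter> V) s) \<otimes>\<^bsub>sections Xs W\<^esub> res Xs (U \<inter> V) W (res Xs V (U \<inter> V) t)"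
      unfolding q_def by (rule ring_hom_mult[OF p(2)[OF o W(1,4)] r])
    moreover have "res Xs (U \<inter> V) W (res Xs U (U \<inter> V) s) = res Xs U W s"
      by (rule p(4)[OF U(1) o W(1) W(4) _ U(3)]) simp
    moreover have "res Xs (U \<inter> V) W (res Xs V (U \<inter> V) t) \<in> carrier (sections Xs W)" by (rule p(5)[OF o W(1,4) r(2)])
    ultimately have "unit_near Xs x U s" unfolding unit_near_def using W(1,2,4) by auto
    thus False using n by simp
  qed
  then obtain m' where "maximalideal m' (stalk Xs x)" "germ Xs x U s \<in> m'"
    using S.nonunit_in_maximal[OF germ_carrier[OF U]] by blast
  thus ?thesis using uniq by simp
qed

lemma unit_germ_not_in_maximal:
  assumes P: "presheaf_of_rings Xs" and m: "maximalideal m (stalk Xs x)"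
    and U: "open_in Xs U" "x \<in> U" "s \<in> carrier (sections Xs U)" and u: "unit_near Xs x U s"
  shows "germ Xs x U s \<notin> m"
proof
  note p = presheafD[OF P]
  interpret M: maximalideal m "stalk Xs x" by (rule m)
  assume sm: "germ Xs x U s \<in> m"
  obtain W t where W: "open_in Xs W" "x \<in> W" "W \<subseteq> U" "t \<in> carrier (sections Xs W)"
    "res Xs U W s \<otimes>\<^bsub>sections Xs W\<^esub> t = \<one>\<^bsub>sections Xs W\<^esub>" using u unfolding unit_near_def by blast
  let ?one = "\<one>\<^bsub>sections Xs (points Xs)\<^esub>"
  have Xo: "open_in Xs (points Xs)" by simp
  have oneX: "?one \<in> carrier (sections Xs (points Xs))"
  proof -
    interpret C: cring "sections Xs (points Xs)" by (rule p(1)[OF Xo])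
    show ?thesis by simp
  qed
  have "germ Xs x (U' \<inter> V') (res Xs U' (U' \<inter> V') s' \<otimes>\<^bsub>sections Xs (U' \<inter> V')\<^esub> res Xs V' (U' \<inter> V') t') = germ Xs x (points Xs) ?one"
    if 1: "(U', s') \<in> germ Xs x U s" and 2: "(V', t') \<in> germ Xs x W t" for U' s' V' t'
  proof (rule germ_eq[OF P Xo oneX])
    obtain Y where Y: "open_in Xs U'" "x \<in> U'" "s' \<in> carrier (sections Xs U')" "open_in Xs Y" "x \<in> Y" "Y \<subseteq> U" "Y \<subseteq> U'"
      "res Xs U Y s = res Xs U' Y s'" using 1 by (rule germ_memE)
    obtain Z where Z: "open_in Xs V'" "x \<in> V'" "t' \<in> carrier (sections Xs V')" "open_in Xs Z" "x \<in> Z" "Z \<subseteq> W" "Z \<subseteq> V'"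
      "res Xs W Z t = res Xs V' Z t'" using 2 by (rule germ_memE)
    define Q where "Q = Y \<inter> Z"
    have o: "open_in Xs (U' \<inter> V')" using Y Z by blast
    have Q: "open_in Xs Q" "x \<in> Q" "Q \<subseteq> U'" "Q \<subseteq> V'" "Q \<subseteq> Y" "Q \<subseteq> Z" "Q \<subseteq> W" "Q \<subseteq> U" "Q \<subseteq> U' \<inter> V'"
      using Y Z W(3) unfolding Q_def by auto
    interpret C: cring "sections Xs (U' \<inter> V')" by (rule p(1)[OF o])
    have r: "res Xs U' (U' \<inter> V') s' \<in> carrier (sections Xs (U' \<inter> V'))" "res Xs V' (U' \<inter> V') t' \<in> carrier (sections Xs (U' \<inter> V'))"
      using p(5)[OF Y(1) o _ Y(3)] p(5)[OF Z(1) o _ Z(3)] by auto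
    have a: "res Xs U Q s = res Xs U' Q s'"
      using p(4)[OF U(1) Y(4) Q(1) Q(5) Y(6) U(3)] p(4)[OF Y(1,4) Q(1) Q(5) Y(7) Y(3)] Y(8) by simp
    have b: "res Xs W Q t = res Xs V' Q t'"
      using p(4)[OF W(1) Z(4) Q(1) Q(6) Z(6) W(4)] p(4)[OF Z(1,4) Q(1) Q(6) Z(7) Z(3)] Z(8) by simp
    have "res Xs (U' \<inter> V') Q (res Xs U' (U' \<inter> V') s' \<otimes>\<^bsub>sections Xs (U' \<inter> V')\<^esub> res Xs V' (U' \<inter> V') t')
      = res Xs (U' \<inter> V') Q (res Xs U' (U' \<inter> V') s') \<otimes>\<^bsub>sections Xs Q\<^esub> res Xs (U' \<inter> V') Q (res Xs V' (U' \<inter> V') t')"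
      by (rule ring_hom_mult[OF p(2)[OF o Q(1,9)] r])
    also have "\<dots> = res Xs U' Q s' \<otimes>\<^bsub>sections Xs Q\<^esub> res Xs V' Q t'"
      using p(4)[OF Y(1) o Q(1) Q(9) _ Y(3)] p(4)[OF Z(1) o Q(1) Q(9) _ Z(3)] by simp
    also have "\<dots> = res Xs W Q (res Xs U W s) \<otimes>\<^bsub>sections Xs Q\<^esub> res Xs W Q t"
      using a b p(4)[OF U(1) W(1) Q(1) Q(7) W(3) U(3)] by simp
    also have "\<dots> = res Xs W Q (res Xs U W s \<otimes>\<^bsub>sections Xs W\<^esub> t)"
      using ring_hom_mult[OF p(2)[OF W(1) Q(1,7)] p(5)[OF U(1) W(1) W(3) U(3)] W(4)] by simp
    also have "\<dots> = \<one>\<^bsub>sections Xs Q\<^esub>" unfolding W(5) by (rule ring_hom_one[OF p(2)[OF W(1) Q(1,7)]])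
    also have "\<dots> = res Xs (points Xs) Q ?one" using ring_hom_one[OF p(2)[OF Xo Q(1)]] openin_subset[OF Q(1)] by simp
    finally show "(U' \<inter> V', res Xs U' (U' \<inter> V') s' \<otimes>\<^bsub>sections Xs (U' \<inter> V')\<^esub> res Xs V' (U' \<inter> V') t') \<in> germ Xs x (points Xs) ?one"
      using germ_memI[OF o _ C.m_closed[OF r] Q(1,2) openin_subset[OF Q(1)] Q(9)] Y(2) Z(2) by simp
  qed
  from union_constant[OF germ_self[OF U] germ_self[OF W(1,2,4)], of "\<lambda>U' s' V' t'. germ Xs x (U' \<inter> V')
      (res Xs U' (U' \<inter> V') s' \<otimes>\<^bsub>sections Xs (U' \<inter> V')\<^esub> res Xs V' (U' \<inter> V') t')", OF this]
  have "germ Xs x U s \<otimes>\<^bsub>stalk Xs x\<^esub> germ Xs x W t = \<one>\<^bsub>stalk Xs x\<^esub>" unfolding stalk_def by simp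
  moreover have "germ Xs x U s \<otimes>\<^bsub>stalk Xs x\<^esub> germ Xs x W t \<in> m"
    by (rule M.I_r_closed[OF sm germ_carrier[OF W(1,2,4)]])
  ultimately have "\<one>\<^bsub>stalk Xs x\<^esub> \<in> m" by simp
  thus False using M.one_imp_carrier M.I_notcarr by simp
qed


section \<open>Morphisms\<close>

lemma lrsD:
  assumes "lrs_morphism Xs Y f"
  shows "pt_map f \<in> extensional (points Xs)" "sec_map f \<in> extensional {W. open_in Y W}"
    "open_in Y W \<Longrightarrow> sec_map f W \<in> extensional (carrier (sections Y W))"
    "continuous_map (topo Xs) (topo Y) (pt_map f)"
    "open_in Y W \<Longrightarrow> sec_map f W \<in> ring_hom (sections Y W) (sections Xs (preimage Xs f W))"
    "open_in Y W \<Longrightarrow> open_in Y W' \<Longrightarrow> W' \<subseteq> W \<Longrightarrow> s \<in> carrier (sections Y W) \<Longrightarrow>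
      sec_map f W' (res Y W W' s) = res Xs (preimage Xs f W) (preimage Xs f W') (sec_map f W s)"
    "x \<in> points Xs \<Longrightarrow> maximalideal m (stalk Y (pt_map f x)) \<Longrightarrow> maximalideal n (stalk Xs x) \<Longrightarrow>
      stalk_map Xs f x ` m \<subseteq> n"
    "open_in Y W \<Longrightarrow> open_in Xs (preimage Xs f W)"
    "x \<in> points Xs \<Longrightarrow> pt_map f x \<in> points Y"
    "open_in Y W \<Longrightarrow> s \<in> carrier (sections Y W) \<Longrightarrow> sec_map f W s \<in> carrier (sections Xs (preimage Xs f W))"
proof -
  note d = assms[unfolded lrs_morphism_def]
  show "pt_map f \<in> extensional (points Xs)" "sec_map f \<in> extensional {W. open_in Y W}"
    "open_in Y W \<Longrightarrow> sec_map f W \<in> extensional (carrier (sections Y W))"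
    using d by simp_all
  show c: "continuous_map (topo Xs) (topo Y) (pt_map f)" using d by simp
  show h: "open_in Y W \<Longrightarrow> sec_map f W \<in> ring_hom (sections Y W) (sections Xs (preimage Xs f W))" using d by simp
  show "open_in Y W \<Longrightarrow> open_in Y W' \<Longrightarrow> W' \<subseteq> W \<Longrightarrow> s \<in> carrier (sections Y W) \<Longrightarrow>
      sec_map f W' (res Y W W' s) = res Xs (preimage Xs f W) (preimage Xs f W') (sec_map f W s)" using d by simp
  show "x \<in> points Xs \<Longrightarrow> maximalideal m (stalk Y (pt_map f x)) \<Longrightarrow> maximalideal n (stalk Xs x) \<Longrightarrow>
      stalk_map Xs f x ` m \<subseteq> n"
  proof -
    assume a: "x \<in> points Xs" "maximalideal m (stalk Y (pt_map f x))" "maximalideal n (stalk Xs x)"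
    have "\<forall>x\<in>points Xs. \<forall>m n. maximalideal m (stalk Y (pt_map f x)) \<and> maximalideal n (stalk Xs x) \<longrightarrow>
      stalk_map Xs f x ` m \<subseteq> n" using d by (elim conjE) assumption
    from bspec[OF this a(1)] a(2,3) show "stalk_map Xs f x ` m \<subseteq> n" by simp
  qed
  show "open_in Y W \<Longrightarrow> open_in Xs (preimage Xs f W)"
    unfolding preimage_def by (rule openin_continuous_map_preimage[OF c])
  show "x \<in> points Xs \<Longrightarrow> pt_map f x \<in> points Y" using c unfolding continuous_map_def by auto
  show "open_in Y W \<Longrightarrow> s \<in> carrier (sections Y W) \<Longrightarrow> sec_map f W s \<in> carrier (sections Xs (preimage Xs f W))"
    using ring_hom_closed[OF h] by simp
qed

lemma preimage_mono: "W' \<subseteq> W \<Longrightarrow> preimage Xs f W' \<subseteq> preimage Xs f W"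
  unfolding preimage_def by blast

lemma union_constant1:
  assumes "(a, s) \<in> A" "\<And>a' s'. (a', s') \<in> A \<Longrightarrow> g a' s' = c"
  shows "(\<Union>(a, s)\<in>A. g a s) = c"
proof (rule equalityI)
  show "c \<subseteq> (\<Union>(a, s)\<in>A. g a s)"
  proof
    fix x assume "x \<in> c"
    hence "x \<in> g a s" using assms(2)[OF assms(1)] by simp
    thus "x \<in> (\<Union>(a, s)\<in>A. g a s)" by (intro UN_I[OF assms(1)], simp only: prod.case)
  qed
  show "(\<Union>(a, s)\<in>A. g a s) \<subseteq> c"
  proof
    fix x assume "x \<in> (\<Union>(a, s)\<in>A. g a s)"
    then obtain a' s' where "(a', s') \<in> A" "x \<in> g a' s'"
      by (elim UN_E) (simp only: split_paired_all prod.case)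
    thus "x \<in> c" using assms(2)[of a' s'] by simp
  qed
qed

lemma stalk_map_germ:
  assumes f: "lrs_morphism Xs Y f" and P: "presheaf_of_rings Xs" and PY: "presheaf_of_rings Y"
    and x: "x \<in> points Xs" and W: "open_in Y W" "pt_map f x \<in> W" "s \<in> carrier (sections Y W)"
  shows "stalk_map Xs f x (germ Y (pt_map f x) W s) = germ Xs x (preimage Xs f W) (sec_map f W s)"
proof -
  note d = lrsD[OF f]
  have "germ Xs x (preimage Xs f V) (sec_map f V t) = germ Xs x (preimage Xs f W) (sec_map f W s)"
    if Vt: "(V, t) \<in> germ Y (pt_map f x) W s" for V t
  proof (rule germ_eq[OF P d(8)[OF W(1)] d(10)[OF W(1,3)]])
    obtain Z where Z: "open_in Y V" "pt_map f x \<in> V" "t \<in> carrier (sections Y V)" "open_in Y Z" "pt_map f x \<in> Z"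
      "Z \<subseteq> W" "Z \<subseteq> V" "res Y W Z s = res Y V Z t" using Vt by (rule germ_memE)
    show "(preimage Xs f V, sec_map f V t) \<in> germ Xs x (preimage Xs f W) (sec_map f W s)"
    proof (rule germ_memI[OF d(8)[OF Z(1)] _ d(10)[OF Z(1,3)] d(8)[OF Z(4)]])
      show "x \<in> preimage Xs f V" "x \<in> preimage Xs f Z" using x Z unfolding preimage_def by auto
      show "preimage Xs f Z \<subseteq> preimage Xs f W" "preimage Xs f Z \<subseteq> preimage Xs f V"
        by (rule preimage_mono[OF Z(6)], rule preimage_mono[OF Z(7)])
      show "res Xs (preimage Xs f W) (preimage Xs f Z) (sec_map f W s) = res Xs (preimage Xs f V) (preimage Xs f Z) (sec_map f V t)"
        using d(6)[OF W(1) Z(4,6) W(3)] d(6)[OF Z(1,4,7,3)] Z(8) by simp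
    qed
  qed
  from union_constant1[OF germ_self[OF W], of "\<lambda>V t. germ Xs x (preimage Xs f V) (sec_map f V t)", OF this]
  show ?thesis unfolding stalk_map_def .
qed

text \<open>This is the condition that the maps of stalks are local, expressed without stalks.\<close>

lemma unit_near_pullback:
  assumes f: "lrs_morphism Xs Y f" and Xs: "locally_ringed_space Xs" and Y: "locally_ringed_space Y"
    and x: "x \<in> points Xs" and W: "open_in Y W" "pt_map f x \<in> W" "s \<in> carrier (sections Y W)"
    and u: "unit_near Xs x (preimage Xs f W) (sec_map f W s)"
  shows "unit_near Y (pt_map f x) W s"
proof (rule ccontr)
  note d = lrsD[OF f]
  have PX: "presheaf_of_rings Xs" and PY: "presheaf_of_rings Y"
    using Xs Y unfolding locally_ringed_space_def sheaf_of_rings_def by auto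
  have lX: "local_ring (stalk Xs x)" and lY: "local_ring (stalk Y (pt_map f x))"
    using Xs Y x d(9)[OF x] unfolding locally_ringed_space_def by auto
  obtain m n where m: "maximalideal m (stalk Y (pt_map f x))" and n: "maximalideal n (stalk Xs x)"
    using lX lY unfolding local_ring_def by blast
  assume "\<not> unit_near Y (pt_map f x) W s"
  hence "germ Y (pt_map f x) W s \<in> m" by (rule nonunit_germ_in_maximal[OF PY lY m W])
  hence "germ Xs x (preimage Xs f W) (sec_map f W s) \<in> n"
    using d(7)[OF x m n] stalk_map_germ[OF f PX PY x W] by auto
  moreover have "germ Xs x (preimage Xs f W) (sec_map f W s) \<notin> n"
    by (rule unit_germ_not_in_maximal[OF PX n d(8)[OF W(1)] _ d(10)[OF W(1,3)] u])
      (use x W(2) in \<open>simp add: preimage_def\<close>)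
  ultimately show False by simp
qed

context spec_field
begin

lemma preimage_spec: "preimage (Spec k) y W = (if pt_map y pt \<in> W then {pt} else {})"
  unfolding preimage_def spec_k_points by auto

text \<open>For a morphism from the spectrum of a field, locality says that a section with nonzero
  value is invertible near the point.\<close>

lemma unit_near_rational:
  assumes y: "lrs_morphism (Spec k) V y" and V: "locally_ringed_space V"
    and W: "open_in V W" "pt_map y pt \<in> W" "s \<in> carrier (sections V W)" and nz: "sec_map y W s \<noteq> \<zero>\<^bsub>K\<^esub>"
  shows "unit_near V (pt_map y pt) W s"
proof (rule ccontr)
  note d = lrsD[OF y]
  have PV: "presheaf_of_rings V" using V unfolding locally_ringed_space_def sheaf_of_rings_def by auto
  have x: "pt \<in> points (Spec k)" using spec_k_points by simp
  have lV: "local_ring (stalk V (pt_map y pt))" using V d(9)[OF x] unfolding locally_ringed_space_def by auto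
  obtain m where m: "maximalideal m (stalk V (pt_map y pt))" using lV unfolding local_ring_def by blast
  have sK: "sec_map y V' t \<in> carrier K" if "open_in V V'" "pt_map y pt \<in> V'" "t \<in> carrier (sections V V')" for V' t
    using d(10)[OF that(1,3)] that(2) unfolding preimage_spec K_def by simp
  assume "\<not> unit_near V (pt_map y pt) W s"
  hence g: "germ V (pt_map y pt) W s \<in> m" by (rule nonunit_germ_in_maximal[OF PV lV m W])
  have "germ (Spec k) pt (preimage (Spec k) y V') (sec_map y V' t) = gm (sec_map y W s)"
    if Vt: "(V', t) \<in> germ V (pt_map y pt) W s" for V' t
  proof -
    obtain Z where Z: "open_in V V'" "pt_map y pt \<in> V'" "t \<in> carrier (sections V V')" "open_in V Z" "pt_map y pt \<in> Z"
      "Z \<subseteq> W" "Z \<subseteq> V'" "res V W Z s = res V V' Z t" using Vt by (rule germ_memE)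
    have "sec_map y Z (res V W Z s) = sec_map y W s"
      using d(6)[OF W(1) Z(4,6) W(3)] W(2) Z(5) K_restrict[OF sK[OF W]] unfolding preimage_spec spec_simps by simp
    moreover have "sec_map y Z (res V V' Z t) = sec_map y V' t"
      using d(6)[OF Z(1,4,7,3)] Z(2,5) K_restrict[OF sK[OF Z(1-3)]] unfolding preimage_spec spec_simps by simp
    ultimately show ?thesis using germ_spec[OF sK[OF Z(1-3)]] Z(2,8) unfolding preimage_spec by simp
  qed
  from union_constant1[OF germ_self[OF W], of "\<lambda>V' t. germ (Spec k) pt (preimage (Spec k) y V') (sec_map y V' t)", OF this]
  have "stalk_map (Spec k) y pt (germ V (pt_map y pt) W s) = gm (sec_map y W s)"
    unfolding stalk_map_def .
  hence "gm (sec_map y W s) \<in> {gm \<zero>\<^bsub>K\<^esub>}" using d(7)[OF x m stalk_spec_maximal] g by auto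
  thus False using nz unfolding gm_def by simp
qed

end

section \<open>Affine charts\<close>

lemma (in spec_ring) regular_restrict:
  assumes s: "s \<in> regular_functions R W" and D: "openin (zariski_topology R) D" "D \<subseteq> W"
  shows "restrict s D \<in> regular_functions R D"
proof -
  have "s p \<in> carrier (localization R p)" if "p \<in> D" for p
    using s that D(2) unfolding regular_functions_def by auto
  moreover have "\<exists>V a f. openin (zariski_topology R) V \<and> p \<in> V \<and> V \<subseteq> D \<and> a \<in> carrier R \<and> f \<in> carrier R \<and>
    (\<forall>q\<in>V. f \<notin> q \<and> restrict s D q = fraction R q a f)" if p: "p \<in> D" for p
  proof -
    obtain V a f where h: "openin (zariski_topology R) V" "p \<in> V" "a \<in> carrier R" "f \<in> carrier R"
      "\<forall>q\<in>V. f \<notin> q \<and> s q = fraction R q a f" using regular_at[OF s subsetD[OF D(2) p]] by blast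
    have "openin (zariski_topology R) (V \<inter> D)" using h(1) D(1) by blast
    thus ?thesis
      by (intro exI[of _ "V \<inter> D"] exI[of _ a] exI[of _ f]) (use h p in simp)
  qed
  ultimately show ?thesis unfolding regular_functions_def by simp
qed

locale chart = spec_ring R for R :: "'a ring" (structure) +
  fixes V :: "('p, 'a) ringed_space" and U :: "'p set"
    and F :: "('p, 'a, 'a set, 'a set \<Rightarrow> ('a \<times> 'a) set) rs_morphism"
    and G :: "('a set, 'a set \<Rightarrow> ('a \<times> 'a) set, 'p, 'a) rs_morphism"
  assumes PV: "presheaf_of_rings V" and U: "open_in V U"
    and F: "lrs_morphism (open_subspace V U) (Spec R) F"
    and G: "lrs_morphism (Spec R) (open_subspace V U) G"
    and GF: "comp_morphism (open_subspace V U) (Spec R) (open_subspace V U) G F = id_morphism (open_subspace V U)"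
    and FG: "comp_morphism (Spec R) (open_subspace V U) (Spec R) F G = id_morphism (Spec R)"
begin

abbreviation "A \<equiv> open_subspace V U"
definition primes :: "'a set set" where "primes = {p. primeideal p R}"

text \<open>The elements of R as sections over U.\<close>

definition iota :: "'a \<Rightarrow> 'a" where "iota a = sec_map F primes (frac_section a \<one> primes)"

text \<open>The principal open subset of U where h is invertible.\<close>

definition nbhd :: "'a \<Rightarrow> 'p set" where "nbhd h = {u \<in> U. h \<notin> pt_map F u}"

lemmas pv = presheafD[OF PV]

lemma A_simps: "points A = U" "open_in A W \<longleftrightarrow> open_in V W \<and> W \<subseteq> U" "sections A = sections V" "res A = res V"
proof -
  show "points A = U" using openin_subset[OF U] unfolding open_subspace_def by auto
  show "open_in A W \<longleftrightarrow> open_in V W \<and> W \<subseteq> U"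
    unfolding open_subspace_def using openin_open_subtopology[OF U] by simp
  show "sections A = sections V" "res A = res V" unfolding open_subspace_def by simp_all
qed

lemmas fd = lrsD[OF F, unfolded A_simps]
lemmas gd = lrsD[OF G, unfolded A_simps]

lemma primes_open: "openin (zariski_topology R) primes" "points (Spec R) = primes" "basic \<one> = primes"
  unfolding primes_def spec_simps spec_points using openin_basic[OF one_closed] basic_one by auto

lemma pt_F: "u \<in> U \<Longrightarrow> primeideal (pt_map F u) R"
  using fd(9) primes_open(2) unfolding primes_def by blast

lemma nbhd_preimage: "preimage A F (basic h) = nbhd h" "preimage A F primes = U"
  unfolding nbhd_def preimage_def A_simps basic_def primes_def using pt_F by auto

lemma nbhd_open: "h \<in> carrier R \<Longrightarrow> open_in V (nbhd h)" "nbhd h \<subseteq> U"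
  using fd(8)[of "basic h"] openin_basic[of h] unfolding nbhd_preimage spec_simps
  by (auto simp: nbhd_def)

lemma GF_pt: "u \<in> U \<Longrightarrow> pt_map G (pt_map F u) = u"
  using arg_cong[OF GF, of pt_map] unfolding comp_morphism_def id_morphism_def A_simps
  by (auto dest: fun_cong[of _ _ u])

lemma FG_pt: "p \<in> primes \<Longrightarrow> pt_map F (pt_map G p) = p"
  using arg_cong[OF FG, of pt_map] unfolding comp_morphism_def id_morphism_def primes_open(2)
  by (auto dest: fun_cong[of _ _ p])

lemma G_pt: "p \<in> primes \<Longrightarrow> pt_map G p \<in> U"
  using gd(9) unfolding primes_open(2) by simp

lemma GF_sec:
  assumes "open_in V W" "W \<subseteq> U" "t \<in> carrier (sections V W)"
  shows "sec_map F (preimage (Spec R) G W) (sec_map G W t) = t"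
proof -
  have "sec_map (comp_morphism A (Spec R) A G F) W t = sec_map (id_morphism A) W t" using GF by simp
  thus ?thesis unfolding comp_morphism_def id_morphism_def A_simps using assms by simp
qed

lemma FG_sec:
  assumes "open_in (Spec R) D" "s \<in> carrier (sections (Spec R) D)"
  shows "sec_map G (preimage A F D) (sec_map F D s) = s"
proof -
  have "sec_map (comp_morphism (Spec R) A (Spec R) F G) D s = sec_map (id_morphism (Spec R)) D s" using FG by simp
  thus ?thesis unfolding comp_morphism_def id_morphism_def using assms by simp
qed

lemma preimage_preimage:
  assumes "open_in V W" "W \<subseteq> U"
  shows "preimage A F (preimage (Spec R) G W) = W"
  unfolding preimage_def A_simps using assms(2) GF_pt fd(9) by auto

lemma const_regular: "a \<in> carrier R \<Longrightarrow> openin (zariski_topology R) D \<Longrightarrow>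
    frac_section a \<one> D \<in> carrier (sections (Spec R) D)"
  unfolding spec_simps
  by (rule frac_section_regular) (use open_primes prime_complement(1) in auto)

lemma iota_carrier: "a \<in> carrier R \<Longrightarrow> iota a \<in> carrier (sections V U)"
  using fd(10)[of primes] const_regular primes_open(1) unfolding iota_def nbhd_preimage spec_simps(1) by auto

lemma const_restrict: "D \<subseteq> primes \<Longrightarrow> restrict (frac_section a f primes) D = frac_section a f D"
  unfolding frac_section_def by (auto simp: fun_eq_iff)

lemma iota_res:
  assumes "a \<in> carrier R" "h \<in> carrier R"
  shows "sec_map F (basic h) (frac_section a \<one> (basic h)) = res V U (nbhd h) (iota a)"
proof -
  have sub: "basic h \<subseteq> primes" unfolding basic_def primes_def by auto
  have "sec_map F (basic h) (res (Spec R) primes (basic h) (frac_section a \<one> primes))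
    = res V (preimage A F primes) (preimage A F (basic h)) (sec_map F primes (frac_section a \<one> primes))"
    by (rule fd(6)) (use primes_open(1) openin_basic[OF assms(2)] sub const_regular[OF assms(1) primes_open(1)] in
      \<open>auto simp: spec_simps(1)\<close>)
  thus ?thesis unfolding nbhd_preimage spec_simps(7) const_restrict[OF sub] iota_def .
qed

lemma iota_hom: "iota \<in> ring_hom R (sections V U)"
proof (rule ring_hom_memI)
  have hom: "sec_map F primes \<in> ring_hom (sections (Spec R) primes) (sections V U)"
    using fd(5)[of primes] primes_open(1) unfolding nbhd_preimage spec_simps(1) by simp
  note c = const_regular[OF _ primes_open(1)]
  have pr: "primeideal p R" "\<one> \<in> carrier R - p" if "p \<in> primes" for p
    using that prime_complement(1) unfolding primes_def by auto
  show "iota a \<in> carrier (sections V U)" if "a \<in> carrier R" for a by (rule iota_carrier[OF that])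
  show "iota (a \<otimes> b) = iota a \<otimes>\<^bsub>sections V U\<^esub> iota b" if ab: "a \<in> carrier R" "b \<in> carrier R" for a b
  proof -
    have "frac_section (a \<otimes> b) \<one> primes = frac_section a \<one> primes \<otimes>\<^bsub>sections (Spec R) primes\<^esub> frac_section b \<one> primes"
      unfolding spec_simps frac_section_def
      by (rule restrict_ext) (use pr ab localization_mult in simp)
    thus ?thesis unfolding iota_def using ring_hom_mult[OF hom c[OF ab(1)] c[OF ab(2)]] by simp
  qed
  show "iota (a \<oplus> b) = iota a \<oplus>\<^bsub>sections V U\<^esub> iota b" if ab: "a \<in> carrier R" "b \<in> carrier R" for a b
  proof -
    have "frac_section (a \<oplus> b) \<one> primes = frac_section a \<one> primes \<oplus>\<^bsub>sections (Spec R) primes\<^esub> frac_section b \<one> primes"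
      unfolding spec_simps frac_section_def
      by (rule restrict_ext) (use pr ab localization_add in simp)
    thus ?thesis unfolding iota_def using ring_hom_add[OF hom c[OF ab(1)] c[OF ab(2)]] by simp
  qed
  have "frac_section \<one> \<one> primes = \<one>\<^bsub>sections (Spec R) primes\<^esub>"
    unfolding spec_simps frac_section_def localization_carrier ..
  thus "iota \<one> = \<one>\<^bsub>sections V U\<^esub>" unfolding iota_def using ring_hom_one[OF hom] by simp
qed

text \<open>Under F, the section t is a regular function on an open subset of the spectrum, and
  near a prime such a function is a fraction a/f. Passing to a principal open set inside the
  domain of that fraction multiplies numerator and denominator by an element g.\<close>

lemma section_is_fraction:
  assumes W: "open_in V W" "W \<subseteq> U" and t: "t \<in> carrier (sections V W)" and u: "u \<in> W"
  shows "\<exists>h a. h \<in> carrier R \<and> a \<in> carrier R \<and> h \<notin> pt_map F u \<and> nbhd h \<subseteq> W \<and>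
    res V U (nbhd h) (iota h) \<otimes>\<^bsub>sections V (nbhd h)\<^esub> res V W (nbhd h) t = res V U (nbhd h) (iota a)"
proof -
  define p where "p = pt_map F u"
  define E where "E = preimage (Spec R) G W"
  define s where "s = sec_map G W t"
  have uU: "u \<in> U" using u W by blast
  have pp: "primeideal p R" unfolding p_def by (rule pt_F[OF uU])
  have Eo: "openin (zariski_topology R) E" using gd(8)[of W] W unfolding E_def spec_simps(1) by simp
  have sE: "s \<in> regular_functions R E" using gd(10)[of W t] W t unfolding s_def E_def spec_simps by simp
  have pE: "p \<in> E" unfolding E_def preimage_def p_def using fd(9)[OF uU] GF_pt[OF uU] u by simp
  obtain Y a f where Y: "openin (zariski_topology R) Y" "p \<in> Y" "Y \<subseteq> E" "a \<in> carrier R" "f \<in> carrier R"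
    "\<forall>q\<in>Y. f \<notin> q \<and> s q = fraction R q a f" using regular_at[OF sE pE] by blast
  obtain g where g: "g \<in> carrier R" "g \<notin> p" "basic g \<subseteq> Y" using zariski_basis[OF Y(1,2)] by blast
  define h where "h = g \<otimes> f"
  have h: "h \<in> carrier R" "h \<notin> p"
    using g Y(2,5,6) prime_complement(2)[OF pp, of g f] unfolding h_def by auto
  have Dsub: "basic h \<subseteq> basic g" unfolding h_def basic_mult[OF g(1) Y(5)] by blast
  hence DE: "basic h \<subseteq> E" using g(3) Y(3) by blast
  note Do = openin_basic[OF h(1)]
  have rs: "restrict s (basic h) \<in> carrier (sections (Spec R) (basic h))"
    unfolding spec_simps(2) by (rule regular_restrict[OF sE Do DE])
  have eq: "frac_section h \<one> (basic h) \<otimes>\<^bsub>sections (Spec R) (basic h)\<^esub> restrict s (basic h) = frac_section (g \<otimes> a) \<one> (basic h)"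
    unfolding spec_simps frac_section_def
  proof (rule restrict_ext)
    fix q assume q: "q \<in> basic h"
    hence qp: "primeideal q R" "f \<notin> q" "s q = fraction R q a f"
      using Dsub g(3) Y(6) unfolding basic_def by blast+
    note one = prime_complement(1)[OF qp(1)]
    have f: "f \<in> carrier R - q" using Y(5) qp(2) by simp
    have "fraction R q h \<one> \<otimes>\<^bsub>localization R q\<^esub> fraction R q a f = fraction R q (h \<otimes> a) (\<one> \<otimes> f)"
      by (rule localization_mult[OF qp(1) h(1) one Y(4) f])
    also have "\<dots> = fraction R q (g \<otimes> a) \<one>"
    proof -
      have "\<one> \<otimes> ((h \<otimes> a) \<otimes> \<one>) = \<one> \<otimes> ((g \<otimes> a) \<otimes> (\<one> \<otimes> f))"
        unfolding h_def using g(1) Y(4,5) by (simp add: m_ac)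
      moreover have "\<one> \<otimes> f \<in> carrier R - q" using f by simp
      ultimately show ?thesis
        using fraction_eq[OF qp(1) m_closed[OF h(1) Y(4)] _ m_closed[OF g(1) Y(4)] one] one by blast
    qed
    finally show "(\<lambda>p\<in>basic h. fraction R p h \<one>) q \<otimes>\<^bsub>localization R q\<^esub> restrict s (basic h) q = fraction R q (g \<otimes> a) \<one>"
      using q qp(3) by simp
  qed
  have hom: "sec_map F (basic h) \<in> ring_hom (sections (Spec R) (basic h)) (sections V (nbhd h))"
    using fd(5)[of "basic h"] Do unfolding nbhd_preimage spec_simps(1) by simp
  have resF: "sec_map F (basic h) (restrict s (basic h)) = res V W (nbhd h) t"
  proof -
    have "sec_map F (basic h) (res (Spec R) E (basic h) s) = res V (preimage A F E) (preimage A F (basic h)) (sec_map F E s)"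
      by (rule fd(6)) (use Eo Do DE sE in \<open>auto simp: spec_simps\<close>)
    moreover have "preimage A F E = W" unfolding E_def by (rule preimage_preimage[OF W])
    moreover have "sec_map F E s = t" unfolding E_def s_def by (rule GF_sec[OF W t])
    ultimately show ?thesis unfolding nbhd_preimage spec_simps(7) by simp
  qed
  have "sec_map F (basic h) (frac_section h \<one> (basic h)) \<otimes>\<^bsub>sections V (nbhd h)\<^esub> sec_map F (basic h) (restrict s (basic h))
    = sec_map F (basic h) (frac_section (g \<otimes> a) \<one> (basic h))"
    unfolding eq[symmetric] by (rule ring_hom_mult[OF hom const_regular[OF h(1) Do] rs, symmetric])
  hence main: "res V U (nbhd h) (iota h) \<otimes>\<^bsub>sections V (nbhd h)\<^esub> res V W (nbhd h) t = res V U (nbhd h) (iota (g \<otimes> a))"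
    unfolding resF iota_res[OF h(1,1)] iota_res[OF m_closed[OF g(1) Y(4)] h(1)] .
  have "nbhd h \<subseteq> W"
  proof
    fix w assume w: "w \<in> nbhd h"
    hence wU: "w \<in> U" and "pt_map F w \<in> basic h" using pt_F unfolding nbhd_def basic_def by auto
    hence "pt_map F w \<in> E" using DE by blast
    hence "pt_map G (pt_map F w) \<in> W" unfolding E_def preimage_def by simp
    thus "w \<in> W" using GF_pt[OF wU] by simp
  qed
  thus ?thesis using h main m_closed[OF g(1) Y(4)] unfolding p_def by blast
qed

lemma iota_unit:
  assumes a: "a \<in> carrier R"
  shows "\<exists>t\<in>carrier (sections V (nbhd a)). res V U (nbhd a) (iota a) \<otimes>\<^bsub>sections V (nbhd a)\<^esub> t = \<one>\<^bsub>sections V (nbhd a)\<^esub>"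
proof -
  note Do = openin_basic[OF a]
  have hom: "sec_map F (basic a) \<in> ring_hom (sections (Spec R) (basic a)) (sections V (nbhd a))"
    using fd(5)[of "basic a"] Do unfolding nbhd_preimage spec_simps(1) by simp
  have r: "frac_section \<one> a (basic a) \<in> carrier (sections (Spec R) (basic a))"
    unfolding spec_simps by (rule frac_section_regular[OF Do]) (use a in \<open>auto simp: basic_def\<close>)
  have eq: "frac_section a \<one> (basic a) \<otimes>\<^bsub>sections (Spec R) (basic a)\<^esub> frac_section \<one> a (basic a) = \<one>\<^bsub>sections (Spec R) (basic a)\<^esub>"
    unfolding spec_simps frac_section_def
  proof (rule restrict_ext)
    fix q assume q: "q \<in> basic a"
    hence qp: "primeideal q R" "a \<in> carrier R - q" using a unfolding basic_def by auto
    note one = prime_complement(1)[OF qp(1)]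
    have "fraction R q a \<one> \<otimes>\<^bsub>localization R q\<^esub> fraction R q \<one> a = fraction R q (a \<otimes> \<one>) (\<one> \<otimes> a)"
      by (rule localization_mult[OF qp(1) a one one_closed qp(2)])
    also have "\<dots> = fraction R q \<one> \<one>"
    proof -
      have "\<one> \<otimes> ((a \<otimes> \<one>) \<otimes> \<one>) = \<one> \<otimes> (\<one> \<otimes> (\<one> \<otimes> a))" using a by simp
      moreover have "\<one> \<otimes> a \<in> carrier R - q" using qp(2) by simp
      ultimately show ?thesis using fraction_eq[OF qp(1) m_closed[OF a one_closed] _ one_closed one] one by blast
    qed
    finally show "(\<lambda>p\<in>basic a. fraction R p a \<one>) q \<otimes>\<^bsub>localization R q\<^esub> (\<lambda>p\<in>basic a. fraction R p \<one> a) q = \<one>\<^bsub>localization R q\<^esub>"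
      using q unfolding localization_carrier by simp
  qed
  have "sec_map F (basic a) (frac_section a \<one> (basic a)) \<otimes>\<^bsub>sections V (nbhd a)\<^esub> sec_map F (basic a) (frac_section \<one> a (basic a))
    = \<one>\<^bsub>sections V (nbhd a)\<^esub>"
    using ring_hom_mult[OF hom const_regular[OF a Do] r] ring_hom_one[OF hom] unfolding eq by simp
  thus ?thesis unfolding iota_res[OF a a] using ring_hom_closed[OF hom r] by blast
qed

text \<open>If a were invertible near u, its fraction in the localization at the prime of u would
  be a unit, and so a would lie outside of that prime.\<close>

lemma iota_nonunit:
  assumes a: "a \<in> carrier R" "a \<in> pt_map F u" and u: "u \<in> U"
  shows "\<not> unit_near V u U (iota a)"
proof
  assume "unit_near V u U (iota a)"
  then obtain W t where W: "open_in V W" "u \<in> W" "W \<subseteq> U" "t \<in> carrier (sections V W)"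
    "res V U W (iota a) \<otimes>\<^bsub>sections V W\<^esub> t = \<one>\<^bsub>sections V W\<^esub>" unfolding unit_near_def by blast
  define p where "p = pt_map F u"
  define E where "E = preimage (Spec R) G W"
  have pp: "primeideal p R" unfolding p_def by (rule pt_F[OF u])
  have pE: "p \<in> E" unfolding E_def preimage_def p_def using fd(9)[OF u] GF_pt[OF u] W(2) by simp
  have hom: "sec_map G W \<in> ring_hom (sections V W) (sections (Spec R) E)"
    using gd(5)[of W] W unfolding E_def by simp
  have "sec_map G W (res V U W (iota a)) = res (Spec R) (preimage (Spec R) G U) E (sec_map G U (iota a))"
    unfolding E_def by (rule gd(6)) (use U W iota_carrier[OF a(1)] in auto)
  moreover have "sec_map G U (iota a) = frac_section a \<one> primes"
    using FG_sec[of primes "frac_section a \<one> primes"] primes_open(1) const_regular[OF a(1) primes_open(1)]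
    unfolding nbhd_preimage iota_def spec_simps(1) by simp
  ultimately have 1: "sec_map G W (res V U W (iota a)) = restrict (frac_section a \<one> primes) E"
    unfolding spec_simps by simp
  define s where "s = sec_map G W t"
  have sE: "s \<in> regular_functions R E" using gd(10)[of W t] W unfolding s_def E_def spec_simps by simp
  have "restrict (frac_section a \<one> primes) E \<otimes>\<^bsub>sections (Spec R) E\<^esub> s = \<one>\<^bsub>sections (Spec R) E\<^esub>"
    using ring_hom_mult[OF hom pv(5)[OF U W(1,3) iota_carrier[OF a(1)]] W(4)] ring_hom_one[OF hom]
    unfolding W(5) 1 s_def by simp
  from fun_cong[OF this, of p]
  have "fraction R p a \<one> \<otimes>\<^bsub>localization R p\<^esub> s p = fraction R p \<one> \<one>"
    using pE pp unfolding spec_simps localization_carrier frac_section_def primes_def by simp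
  moreover have "s p \<in> carrier (localization R p)" using sE pE unfolding regular_functions_def by auto
  then obtain b f where bf: "b \<in> carrier R" "f \<in> carrier R - p" "s p = fraction R p b f"
    unfolding localization_carrier by blast
  ultimately have "fraction R p (a \<otimes> b) (\<one> \<otimes> f) = fraction R p \<one> \<one>"
    using localization_mult[OF pp a(1) prime_complement(1)[OF pp] bf(1,2)] by simp
  moreover have "\<one> \<otimes> f \<in> carrier R - p" using bf(2) by simp
  ultimately obtain w where w: "w \<in> carrier R - p" "w \<otimes> ((a \<otimes> b) \<otimes> \<one>) = w \<otimes> (\<one> \<otimes> (\<one> \<otimes> f))"
    using fraction_eq[OF pp m_closed[OF a(1) bf(1)] _ one_closed prime_complement(1)[OF pp]] by blast
  have "w \<otimes> ((a \<otimes> b) \<otimes> \<one>) \<in> p"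
    using prime_complement(5,6)[OF pp] a bf(1) w(1) unfolding p_def by auto
  moreover have "w \<otimes> (\<one> \<otimes> (\<one> \<otimes> f)) \<in> carrier R - p" using prime_complement(2)[OF pp w(1) bf(2)] bf(2) by simp
  ultimately show False using w(2) by simp
qed

end

section \<open>Rational points and their values\<close>

lemma comp_simps:
  "x \<in> points X' \<Longrightarrow> pt_map (comp_morphism X' Y Z g f) x = pt_map g (pt_map f x)"
  "open_in Z W \<Longrightarrow> s \<in> carrier (sections Z W) \<Longrightarrow>
    sec_map (comp_morphism X' Y Z g f) W s = sec_map f (preimage Y g W) (sec_map g W s)"
  unfolding comp_morphism_def by simp_all

locale rational_setting = spec_field k for k :: "'k ring" (structure) +
  fixes V :: "('p, 'a) ringed_space" and \<pi> :: "('p, 'a, 'k set, 'k set \<Rightarrow> ('k \<times> 'k) set) rs_morphism"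
  assumes V: "locally_ringed_space V" and \<pi>: "lrs_morphism V (Spec k) \<pi>"
begin

lemma PV: "presheaf_of_rings V"
  using V unfolding locally_ringed_space_def sheaf_of_rings_def by auto

lemmas pv = presheafD[OF PV]

text \<open>A rational point is described by the point pt_map y pt of V and by the values sec_map
  y W s of sections around it. The values are compatible with restriction, respect scalars, and
  vanish only where they should: the last condition replaces the locality of the map of stalks,
  and in this form it is preserved by endomorphisms of V (move_kpoint). For W not containing the
  point, the value lies in the ring of sections over the empty set, whose only element is the
  function \<lambda>x. undefined with empty domain.\<close>

definition kpoint :: "('k set, 'k set \<Rightarrow> ('k \<times> 'k) set, 'p, 'a) rs_morphism \<Rightarrow> bool"
  where "kpoint y \<longleftrightarrow> pt_map y \<in> extensional {pt} \<and> pt_map y pt \<in> points V \<and>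
    sec_map y \<in> extensional {W. open_in V W} \<and>
    (\<forall>W. open_in V W \<longrightarrow> sec_map y W \<in> extensional (carrier (sections V W)) \<and>
      (pt_map y pt \<in> W \<longrightarrow> sec_map y W \<in> ring_hom (sections V W) K) \<and>
      (pt_map y pt \<notin> W \<longrightarrow> (\<forall>s\<in>carrier (sections V W). sec_map y W s = (\<lambda>x. undefined)))) \<and>
    (\<forall>W W' s. open_in V W \<and> open_in V W' \<and> W' \<subseteq> W \<and> pt_map y pt \<in> W' \<and> s \<in> carrier (sections V W) \<longrightarrow>
      sec_map y W' (res V W W' s) = sec_map y W s) \<and>
    (\<forall>c\<in>carrier K. sec_map y (points V) (sec_map \<pi> {pt} c) = c) \<and>
    (\<forall>W s. open_in V W \<and> pt_map y pt \<in> W \<and> s \<in> carrier (sections V W) \<and> sec_map y W s \<noteq> \<zero>\<^bsub>K\<^esub> \<longrightarrow>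
      unit_near V (pt_map y pt) W s)"

lemma kpointD:
  assumes "kpoint y"
  shows "pt_map y \<in> extensional {pt}" "pt_map y pt \<in> points V" "sec_map y \<in> extensional {W. open_in V W}"
    "open_in V W \<Longrightarrow> sec_map y W \<in> extensional (carrier (sections V W))"
    "open_in V W \<Longrightarrow> pt_map y pt \<in> W \<Longrightarrow> sec_map y W \<in> ring_hom (sections V W) K"
    "open_in V W \<Longrightarrow> pt_map y pt \<notin> W \<Longrightarrow> s \<in> carrier (sections V W) \<Longrightarrow> sec_map y W s = (\<lambda>x. undefined)"
    "open_in V W \<Longrightarrow> open_in V W' \<Longrightarrow> W' \<subseteq> W \<Longrightarrow> pt_map y pt \<in> W' \<Longrightarrow> s \<in> carrier (sections V W) \<Longrightarrow>
      sec_map y W' (res V W W' s) = sec_map y W s"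
    "c \<in> carrier K \<Longrightarrow> sec_map y (points V) (sec_map \<pi> {pt} c) = c"
    "open_in V W \<Longrightarrow> pt_map y pt \<in> W \<Longrightarrow> s \<in> carrier (sections V W) \<Longrightarrow> sec_map y W s \<noteq> \<zero>\<^bsub>K\<^esub> \<Longrightarrow>
      unit_near V (pt_map y pt) W s"
    "open_in V W \<Longrightarrow> pt_map y pt \<in> W \<Longrightarrow> s \<in> carrier (sections V W) \<Longrightarrow> sec_map y W s \<in> carrier K"
proof -
  show h: "open_in V W \<Longrightarrow> pt_map y pt \<in> W \<Longrightarrow> sec_map y W \<in> ring_hom (sections V W) K"
    using assms unfolding kpoint_def by simp
  show "open_in V W \<Longrightarrow> pt_map y pt \<in> W \<Longrightarrow> s \<in> carrier (sections V W) \<Longrightarrow> sec_map y W s \<in> carrier K"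
    using ring_hom_closed[OF h] by simp
qed (use assms in \<open>simp_all add: kpoint_def\<close>)

lemma pi_preimage: "preimage V \<pi> {pt} = points V"
  using lrsD(9)[OF \<pi>] unfolding preimage_def spec_k_points by auto

lemma pi_section: "c \<in> carrier K \<Longrightarrow> sec_map \<pi> {pt} c \<in> carrier (sections V (points V))"
  using lrsD(10)[OF \<pi>, of "{pt}" c] spec_k_open[of "{pt}"] unfolding pi_preimage K_def by simp

lemma rational_kpoint:
  assumes y: "y \<in> rational_points k V \<pi>"
  shows "kpoint y"
proof -
  have l: "lrs_morphism (Spec k) V y" and c: "comp_morphism (Spec k) V (Spec k) \<pi> y = id_morphism (Spec k)"
    using y unfolding rational_points_def by auto
  note d = lrsD[OF l]
  have o: "pt \<in> points (Spec k)" using spec_k_points by simp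
  have sK: "sec_map y W s \<in> carrier K" if "open_in V W" "pt_map y pt \<in> W" "s \<in> carrier (sections V W)" for W s
    using d(10)[OF that(1,3)] that(2) unfolding preimage_spec K_def by simp
  show ?thesis
    unfolding kpoint_def
  proof (intro conjI allI ballI impI)
    show "pt_map y \<in> extensional {pt}" using d(1) unfolding spec_k_points .
    show "pt_map y pt \<in> points V" by (rule d(9)[OF o])
    show "sec_map y \<in> extensional {W. open_in V W}" by (rule d(2))
    fix W assume W: "open_in V W"
    show "sec_map y W \<in> extensional (carrier (sections V W))" by (rule d(3)[OF W])
    show "sec_map y W \<in> ring_hom (sections V W) K" if "pt_map y pt \<in> W"
      using d(5)[OF W] that unfolding preimage_spec K_def by simp
    show "sec_map y W s = (\<lambda>x. undefined)" if "pt_map y pt \<notin> W" "s \<in> carrier (sections V W)" for s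
      using d(10)[OF W that(2)] that(1) sections_empty unfolding preimage_spec by simp
  next
    fix W W' s
    assume h: "open_in V W \<and> open_in V W' \<and> W' \<subseteq> W \<and> pt_map y pt \<in> W' \<and> s \<in> carrier (sections V W)"
    hence "sec_map y W' (res V W W' s) = res (Spec k) (preimage (Spec k) y W) (preimage (Spec k) y W') (sec_map y W s)"
      by (intro d(6)) auto
    thus "sec_map y W' (res V W W' s) = sec_map y W s"
      using h K_restrict[OF sK[of W s]] unfolding preimage_spec spec_simps by auto
  next
    fix e assume e: "e \<in> carrier K"
    have "sec_map (comp_morphism (Spec k) V (Spec k) \<pi> y) {pt} e = sec_map (id_morphism (Spec k)) {pt} e" using c by simp
    moreover have o': "open_in (Spec k) {pt}" "e \<in> carrier (sections (Spec k) {pt})"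
      using spec_k_open[of "{pt}"] e unfolding K_def by auto
    ultimately show "sec_map y (points V) (sec_map \<pi> {pt} e) = e"
      unfolding comp_simps(2)[OF o', where X' = "Spec k" and Y = V and g = \<pi> and f = y] pi_preimage
      using o' unfolding id_morphism_def by simp
  next
    fix W s assume h: "open_in V W \<and> pt_map y pt \<in> W \<and> s \<in> carrier (sections V W) \<and> sec_map y W s \<noteq> \<zero>\<^bsub>K\<^esub>"
    show "unit_near V (pt_map y pt) W s" by (rule unit_near_rational[OF l V]) (use h in auto)
  qed
qed

definition endo :: "('p, 'a, 'p, 'a) rs_morphism \<Rightarrow> bool"
  where "endo f \<longleftrightarrow> lrs_morphism V V f \<and> comp_morphism V V (Spec k) \<pi> f = \<pi>"

abbreviation move :: "('p, 'a, 'p, 'a) rs_morphism \<Rightarrow> ('k set, 'k set \<Rightarrow> ('k \<times> 'k) set, 'p, 'a) rs_morphism \<Rightarrow>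
    ('k set, 'k set \<Rightarrow> ('k \<times> 'k) set, 'p, 'a) rs_morphism"
  where "move f y \<equiv> comp_morphism (Spec k) V V f y"

lemma move_simps:
  "pt_map (move f y) pt = pt_map f (pt_map y pt)"
  "open_in V W \<Longrightarrow> s \<in> carrier (sections V W) \<Longrightarrow> sec_map (move f y) W s = sec_map y (preimage V f W) (sec_map f W s)"
  using comp_simps(1)[of pt "Spec k" V V f y] comp_simps(2)[of V W s "Spec k" V f y] spec_k_points by simp_all

text \<open>For the last condition of kpoint: a section whose pullback under f is invertible near
  the point is itself invertible near the image.\<close>

lemma move_kpoint:
  assumes f: "endo f" and y: "kpoint y"
  shows "kpoint (move f y)"
proof -
  have l: "lrs_morphism V V f" and c: "comp_morphism V V (Spec k) \<pi> f = \<pi>" using f unfolding endo_def by auto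
  note d = lrsD[OF l] and e = kpointD[OF y]
  have pre: "pt_map y pt \<in> preimage V f W \<longleftrightarrow> pt_map f (pt_map y pt) \<in> W" for W
    using e(2) unfolding preimage_def by simp
  show ?thesis
    unfolding kpoint_def move_simps(1)
  proof (intro conjI allI ballI impI)
    show "pt_map (move f y) \<in> extensional {pt}" unfolding comp_morphism_def spec_k_points by simp
    show "pt_map f (pt_map y pt) \<in> points V" by (rule d(9)[OF e(2)])
    show "sec_map (move f y) \<in> extensional {W. open_in V W}" unfolding comp_morphism_def by simp
    fix W assume W: "open_in V W"
    show "sec_map (move f y) W \<in> extensional (carrier (sections V W))" using W unfolding comp_morphism_def by simp
    note pW = d(8)[OF W] and hW = d(5)[OF W]
    show "sec_map (move f y) W \<in> ring_hom (sections V W) K" if p: "pt_map f (pt_map y pt) \<in> W"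
    proof -
      note hy = e(5)[OF pW iffD2[OF pre p]]
      note cl = ring_hom_closed[OF hW]
      interpret C: cring "sections V W" by (rule pv(1)[OF W])
      show ?thesis
      proof (rule ring_hom_memI)
        show "sec_map (move f y) W s \<in> carrier K" if "s \<in> carrier (sections V W)" for s
          unfolding move_simps(2)[OF W that] by (rule ring_hom_closed[OF hy cl[OF that]])
        show "sec_map (move f y) W (s \<otimes>\<^bsub>sections V W\<^esub> t) = sec_map (move f y) W s \<otimes>\<^bsub>K\<^esub> sec_map (move f y) W t"
          if "s \<in> carrier (sections V W)" "t \<in> carrier (sections V W)" for s t
          unfolding move_simps(2)[OF W that(1)] move_simps(2)[OF W that(2)] move_simps(2)[OF W C.m_closed[OF that]]
          by (simp add: ring_hom_mult[OF hW that] ring_hom_mult[OF hy cl[OF that(1)] cl[OF that(2)]])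
        show "sec_map (move f y) W (s \<oplus>\<^bsub>sections V W\<^esub> t) = sec_map (move f y) W s \<oplus>\<^bsub>K\<^esub> sec_map (move f y) W t"
          if "s \<in> carrier (sections V W)" "t \<in> carrier (sections V W)" for s t
          unfolding move_simps(2)[OF W that(1)] move_simps(2)[OF W that(2)] move_simps(2)[OF W C.a_closed[OF that]]
          by (simp add: ring_hom_add[OF hW that] ring_hom_add[OF hy cl[OF that(1)] cl[OF that(2)]])
        show "sec_map (move f y) W \<one>\<^bsub>sections V W\<^esub> = \<one>\<^bsub>K\<^esub>"
          unfolding move_simps(2)[OF W C.one_closed] by (simp add: ring_hom_one[OF hW] ring_hom_one[OF hy])
      qed
    qed
    show "sec_map (move f y) W s = (\<lambda>x. undefined)" if "pt_map f (pt_map y pt) \<notin> W" "s \<in> carrier (sections V W)" for s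
      unfolding move_simps(2)[OF W that(2)] using e(6)[OF pW _ d(10)[OF W that(2)]] that(1) pre by simp
  next
    fix W W' s
    assume h: "open_in V W \<and> open_in V W' \<and> W' \<subseteq> W \<and> pt_map f (pt_map y pt) \<in> W' \<and> s \<in> carrier (sections V W)"
    hence W: "open_in V W" "open_in V W'" "W' \<subseteq> W" "s \<in> carrier (sections V W)" by auto
    have "sec_map (move f y) W' (res V W W' s) = sec_map y (preimage V f W') (res V (preimage V f W) (preimage V f W') (sec_map f W s))"
      unfolding move_simps(2)[OF W(2) pv(5)[OF W]] d(6)[OF W] ..
    also have "\<dots> = sec_map y (preimage V f W) (sec_map f W s)"
      by (rule e(7)[OF d(8)[OF W(1)] d(8)[OF W(2)] preimage_mono[OF W(3)] _ d(10)[OF W(1,4)]]) (use h pre in simp)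
    finally show "sec_map (move f y) W' (res V W W' s) = sec_map (move f y) W s" unfolding move_simps(2)[OF W(1,4)] .
  next
    fix a assume a: "a \<in> carrier K"
    have pts: "preimage V f (points V) = points V" using d(9) unfolding preimage_def by auto
    have "sec_map (comp_morphism V V (Spec k) \<pi> f) {pt} a = sec_map \<pi> {pt} a" using c by simp
    moreover have o': "open_in (Spec k) {pt}" "a \<in> carrier (sections (Spec k) {pt})"
      using spec_k_open[of "{pt}"] a unfolding K_def by auto
    ultimately have "sec_map f (points V) (sec_map \<pi> {pt} a) = sec_map \<pi> {pt} a"
      unfolding comp_simps(2)[OF o', where X' = V and Y = V and g = \<pi> and f = f] pi_preimage by simp
    thus "sec_map (move f y) (points V) (sec_map \<pi> {pt} a) = a"
      using move_simps(2)[OF _ pi_section[OF a]] e(8)[OF a] pts by simp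
  next
    fix W s assume h: "open_in V W \<and> pt_map f (pt_map y pt) \<in> W \<and> s \<in> carrier (sections V W) \<and> sec_map (move f y) W s \<noteq> \<zero>\<^bsub>K\<^esub>"
    hence W: "open_in V W" "pt_map f (pt_map y pt) \<in> W" "s \<in> carrier (sections V W)" by auto
    have "sec_map y (preimage V f W) (sec_map f W s) \<noteq> \<zero>\<^bsub>K\<^esub>" using h move_simps(2)[OF W(1,3)] by simp
    hence "unit_near V (pt_map y pt) (preimage V f W) (sec_map f W s)"
      by (rule e(9)[OF d(8)[OF W(1)] iffD2[OF pre W(2)] d(10)[OF W(1,3)]])
    thus "unit_near V (pt_map f (pt_map y pt)) W s" by (rule unit_near_pullback[OF l V V e(2) W])
  qed
qed

lemma move_comp:
  assumes f: "endo f" and g: "endo g" and y: "kpoint y"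
  shows "move (comp_morphism V V V f g) y = move f (move g y)"
proof -
  have lf: "lrs_morphism V V f" and lg: "lrs_morphism V V g" using f g unfolding endo_def by auto
  have pts: "pt_map y pt \<in> points V" by (rule kpointD(2)[OF y])
  have 1: "pt_map (move (comp_morphism V V V f g) y) = pt_map (move f (move g y))"
    unfolding comp_morphism_def spec_k_points using pts by (auto simp: fun_eq_iff)
  have 2: "sec_map (move (comp_morphism V V V f g) y) = sec_map (move f (move g y))"
  proof (rule extensionalityI[of _ "{W. open_in V W}"])
    show "sec_map (move (comp_morphism V V V f g) y) \<in> extensional {W. open_in V W}"
      "sec_map (move f (move g y)) \<in> extensional {W. open_in V W}" unfolding comp_morphism_def by simp_all
    fix W assume "W \<in> {W. open_in V W}"
    hence W: "open_in V W" by simp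
    show "sec_map (move (comp_morphism V V V f g) y) W = sec_map (move f (move g y)) W"
    proof (rule extensionalityI[of _ "carrier (sections V W)"])
      show "sec_map (move (comp_morphism V V V f g) y) W \<in> extensional (carrier (sections V W))"
        "sec_map (move f (move g y)) W \<in> extensional (carrier (sections V W))"
        using W unfolding comp_morphism_def by simp_all
      fix s assume s: "s \<in> carrier (sections V W)"
      have p: "preimage V (comp_morphism V V V f g) W = preimage V g (preimage V f W)"
        unfolding preimage_def comp_morphism_def using lrsD(9)[OF lg] by auto
      show "sec_map (move (comp_morphism V V V f g) y) W s = sec_map (move f (move g y)) W s"
        unfolding move_simps(2)[OF W s] comp_simps(2)[OF W s] p
          move_simps(2)[OF lrsD(8)[OF lf W] lrsD(10)[OF lf W s]] ..
    qed
  qed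
  show ?thesis using 1 2 by (intro rs_morphism.equality) simp_all
qed

lemma move_id:
  assumes y: "kpoint y"
  shows "move (id_morphism V) y = y"
proof -
  note d = kpointD[OF y]
  have 1: "pt_map (move (id_morphism V) y) = pt_map y"
    by (rule extensionalityI[OF _ d(1)]) (use d(2) in \<open>auto simp: comp_morphism_def id_morphism_def spec_k_points\<close>)
  have 2: "sec_map (move (id_morphism V) y) = sec_map y"
  proof (rule extensionalityI[OF _ d(3)])
    show "sec_map (move (id_morphism V) y) \<in> extensional {W. open_in V W}" unfolding comp_morphism_def by simp
    fix W assume "W \<in> {W. open_in V W}"
    hence W: "open_in V W" by simp
    show "sec_map (move (id_morphism V) y) W = sec_map y W"
    proof (rule extensionalityI[OF _ d(4)[OF W]])
      show "sec_map (move (id_morphism V) y) W \<in> extensional (carrier (sections V W))"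
        using W unfolding comp_morphism_def by simp
      fix s assume s: "s \<in> carrier (sections V W)"
      have "preimage V (id_morphism V) W = W" unfolding preimage_def id_morphism_def using openin_subset[OF W] by auto
      thus "sec_map (move (id_morphism V) y) W s = sec_map y W s"
        unfolding move_simps(2)[OF W s] using W s by (simp add: id_morphism_def)
    qed
  qed
  show ?thesis using 1 2 by (intro rs_morphism.equality) simp_all
qed

end

section \<open>Endomorphisms in an affine chart\<close>

locale point_chart = rational_setting k V \<pi> + C: chart R V U F G
  for k :: "'k ring" (structure) and V :: "('p, 'a) ringed_space" and \<pi> and R :: "'a ring" and U F G
begin

text \<open>A section with nonzero value is invertible near the point, which for elements of R
  means that they lie outside of the prime ideal of the point.\<close>

lemma value_iota:
  assumes y: "kpoint y" "pt_map y pt \<in> U" and a: "a \<in> carrier R"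
  shows "sec_map y U (C.iota a) \<noteq> \<zero>\<^bsub>K\<^esub> \<longleftrightarrow> a \<notin> pt_map F (pt_map y pt)"
proof
  note d = kpointD[OF y(1)]
  assume "sec_map y U (C.iota a) \<noteq> \<zero>\<^bsub>K\<^esub>"
  hence "unit_near V (pt_map y pt) U (C.iota a)" by (rule d(9)[OF C.U y(2) C.iota_carrier[OF a]])
  thus "a \<notin> pt_map F (pt_map y pt)" using C.iota_nonunit[OF a _ y(2)] by blast
next
  note d = kpointD[OF y(1)]
  interpret L: field K by (rule K_field)
  assume an: "a \<notin> pt_map F (pt_map y pt)"
  hence p: "pt_map y pt \<in> C.nbhd a" using y(2) unfolding C.nbhd_def by simp
  note n = C.nbhd_open(1)[OF a] C.nbhd_open(2)[of a]
  obtain t where t: "t \<in> carrier (sections V (C.nbhd a))"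
    "res V U (C.nbhd a) (C.iota a) \<otimes>\<^bsub>sections V (C.nbhd a)\<^esub> t = \<one>\<^bsub>sections V (C.nbhd a)\<^esub>"
    using C.iota_unit[OF a] by blast
  note hom = d(5)[OF n(1) p]
  have "sec_map y (C.nbhd a) (res V U (C.nbhd a) (C.iota a)) \<otimes>\<^bsub>K\<^esub> sec_map y (C.nbhd a) t = \<one>\<^bsub>K\<^esub>"
    using ring_hom_mult[OF hom pv(5)[OF C.U n C.iota_carrier[OF a]] t(1)] ring_hom_one[OF hom] t(2) by simp
  hence "sec_map y U (C.iota a) \<otimes>\<^bsub>K\<^esub> sec_map y (C.nbhd a) t = \<one>\<^bsub>K\<^esub>"
    using d(7)[OF C.U n p C.iota_carrier[OF a]] by simp
  thus "sec_map y U (C.iota a) \<noteq> \<zero>\<^bsub>K\<^esub>" using ring_hom_closed[OF hom t(1)] by auto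
qed

lemma value_fraction:
  assumes W: "open_in V W" "W \<subseteq> U" and t: "t \<in> carrier (sections V W)" and h: "h \<in> carrier R" "a \<in> carrier R"
    and n: "C.nbhd h \<subseteq> W" and y: "kpoint y" "pt_map y pt \<in> C.nbhd h"
    and eq: "res V U (C.nbhd h) (C.iota h) \<otimes>\<^bsub>sections V (C.nbhd h)\<^esub> res V W (C.nbhd h) t = res V U (C.nbhd h) (C.iota a)"
  shows "sec_map y U (C.iota h) \<otimes>\<^bsub>K\<^esub> sec_map y W t = sec_map y U (C.iota a)"
proof -
  note d = kpointD[OF y(1)]
  note o = C.nbhd_open(1)[OF h(1)] C.nbhd_open(2)[of h]
  note i = C.iota_carrier
  have "sec_map y (C.nbhd h) (res V U (C.nbhd h) (C.iota h)) \<otimes>\<^bsub>K\<^esub> sec_map y (C.nbhd h) (res V W (C.nbhd h) t)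
    = sec_map y (C.nbhd h) (res V U (C.nbhd h) (C.iota a))"
    unfolding eq[symmetric]
    by (rule ring_hom_mult[OF d(5)[OF o(1) y(2)] pv(5)[OF C.U o i[OF h(1)]] pv(5)[OF W(1) o(1) n t], symmetric])
  thus ?thesis using d(7)[OF C.U o y(2) i[OF h(1)]] d(7)[OF C.U o y(2) i[OF h(2)]] d(7)[OF W(1) o(1) n y(2) t] by simp
qed

text \<open>The values on U determine the prime ideal, hence the point of V. Every other section
  is a fraction of elements of R near the point, so that its value is determined as well.\<close>

lemma kpoint_determined:
  assumes y: "kpoint y" "pt_map y pt \<in> U" and z: "kpoint z" "pt_map z pt \<in> U"
    and eq: "\<And>g. g \<in> carrier (sections V U) \<Longrightarrow> sec_map y U g = sec_map z U g"
  shows "y = z"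
proof -
  note d = kpointD[OF y(1)] and e = kpointD[OF z(1)]
  interpret L: field K by (rule K_field)
  have sub: "pt_map F (pt_map w pt) \<subseteq> carrier R" if "pt_map w pt \<in> U" for w :: "('k set, 'k set \<Rightarrow> ('k \<times> 'k) set, 'p, 'a) rs_morphism"
    by (rule C.prime_complement(4)[OF C.pt_F[OF that]])
  have "a \<in> pt_map F (pt_map y pt) \<longleftrightarrow> a \<in> pt_map F (pt_map z pt)" if "a \<in> carrier R" for a
    using value_iota[OF y that] value_iota[OF z that] eq[OF C.iota_carrier[OF that]] by simp
  hence "pt_map F (pt_map y pt) = pt_map F (pt_map z pt)" using sub[OF y(2)] sub[OF z(2)] by blast
  hence p: "pt_map y pt = pt_map z pt" using C.GF_pt[OF y(2)] C.GF_pt[OF z(2)] by metis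
  have 1: "pt_map y = pt_map z" by (rule extensionalityI[OF d(1) e(1)]) (use p in simp)
  have 2: "sec_map y = sec_map z"
  proof (rule extensionalityI[OF d(3) e(3)])
    fix W assume "W \<in> {W. open_in V W}"
    hence W: "open_in V W" by simp
    show "sec_map y W = sec_map z W"
    proof (rule extensionalityI[OF d(4)[OF W] e(4)[OF W]])
      fix s assume s: "s \<in> carrier (sections V W)"
      show "sec_map y W s = sec_map z W s"
      proof (cases "pt_map y pt \<in> W")
        case False
        thus ?thesis using d(6)[OF W _ s] e(6)[OF W _ s] p by simp
      next
        case True
        define W' where "W' = W \<inter> U"
        have W': "open_in V W'" "W' \<subseteq> U" "W' \<subseteq> W" "pt_map y pt \<in> W'"
          unfolding W'_def using W C.U True y(2) by auto
        define t where "t = res V W W' s"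
        have t: "t \<in> carrier (sections V W')" unfolding t_def by (rule pv(5)[OF W W'(1,3) s])
        obtain h a where h: "h \<in> carrier R" "a \<in> carrier R" "h \<notin> pt_map F (pt_map y pt)" "C.nbhd h \<subseteq> W'"
          "res V U (C.nbhd h) (C.iota h) \<otimes>\<^bsub>sections V (C.nbhd h)\<^esub> res V W' (C.nbhd h) t = res V U (C.nbhd h) (C.iota a)"
          using C.section_is_fraction[OF W'(1,2) t W'(4)] by blast
        have ny: "pt_map y pt \<in> C.nbhd h" and nz: "pt_map z pt \<in> C.nbhd h"
          using h(3) y(2) p unfolding C.nbhd_def by simp_all
        note fy = value_fraction[OF W'(1,2) t h(1,2,4) y(1) ny h(5)]
        note fz = value_fraction[OF W'(1,2) t h(1,2,4) z(1) nz h(5)]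
        have nz0: "sec_map y U (C.iota h) \<noteq> \<zero>\<^bsub>K\<^esub>" using value_iota[OF y h(1)] h(3) by simp
        have c: "sec_map y U (C.iota h) \<in> carrier K" "sec_map y W' t \<in> carrier K" "sec_map z W' t \<in> carrier K"
          using d(10)[OF C.U y(2) C.iota_carrier[OF h(1)]] d(10)[OF W'(1,4) t] e(10)[OF W'(1) _ t] W'(4) p by simp_all
        have "sec_map y U (C.iota h) \<otimes>\<^bsub>K\<^esub> sec_map y W' t = sec_map y U (C.iota h) \<otimes>\<^bsub>K\<^esub> sec_map z W' t"
          using fy fz eq[OF C.iota_carrier[OF h(1)]] eq[OF C.iota_carrier[OF h(2)]] by simp
        hence "sec_map y W' t = sec_map z W' t" using L.m_lcancel[OF nz0 c] by simp
        thus ?thesis using d(7)[OF W W'(1,3,4) s] e(7)[OF W W'(1,3) _ s] W'(4) p unfolding t_def by simp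
      qed
    qed
  qed
  show ?thesis using 1 2 by (intro rs_morphism.equality) simp_all
qed

lemma value_iota_mult:
  assumes "kpoint y" "pt_map y pt \<in> U" "a \<in> carrier R" "b \<in> carrier R"
  shows "sec_map y U (C.iota (a \<otimes>\<^bsub>R\<^esub> b)) = sec_map y U (C.iota a) \<otimes>\<^bsub>K\<^esub> sec_map y U (C.iota b)"
  unfolding ring_hom_mult[OF C.iota_hom assms(3,4)]
  by (rule ring_hom_mult[OF kpointD(5)[OF assms(1) C.U assms(2)] C.iota_carrier[OF assms(3)] C.iota_carrier[OF assms(4)]])

text \<open>Each section l pulls back along f to a fraction near u. By induction on L the finitely
  many fractions are given a common denominator h, and h vanishes wherever f leads out of U'.\<close>

lemma endo_formulas:
  assumes f: "endo f" and U': "open_in V U'" and L: "finite L" "L \<subseteq> carrier (sections V U')"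
    and u: "u \<in> U" "pt_map f u \<in> U'"
  shows "\<exists>h\<in>carrier R. h \<notin> pt_map F u \<and>
    (\<forall>y. kpoint y \<longrightarrow> pt_map y pt \<in> U \<longrightarrow> sec_map y U (C.iota h) \<noteq> \<zero>\<^bsub>K\<^esub> \<longrightarrow> pt_map f (pt_map y pt) \<in> U') \<and>
    (\<forall>l\<in>L. \<exists>a\<in>carrier R. \<forall>y. kpoint y \<longrightarrow> pt_map y pt \<in> U \<longrightarrow> sec_map y U (C.iota h) \<noteq> \<zero>\<^bsub>K\<^esub> \<longrightarrow>
      sec_map y U (C.iota h) \<otimes>\<^bsub>K\<^esub> sec_map (move f y) U' l = sec_map y U (C.iota a))"
  using L
proof (induct L rule: finite_induct)
  note lf = f[unfolded endo_def, THEN conjunct1]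
  note d = lrsD[OF lf]
  define W where "W = preimage V f U' \<inter> U"
  have pU: "open_in V (preimage V f U')" by (rule d(8)[OF U'])
  have W: "open_in V W" "W \<subseteq> U" "W \<subseteq> preimage V f U'" unfolding W_def using pU C.U by auto
  have uW: "u \<in> W" unfolding W_def preimage_def using u openin_subset[OF C.U] by auto
  have inU': "pt_map f (pt_map y pt) \<in> U'" if "pt_map y pt \<in> W" for y :: "('k set, 'k set \<Rightarrow> ('k \<times> 'k) set, 'p, 'a) rs_morphism"
    using that unfolding W_def preimage_def by simp
  have near: "pt_map y pt \<in> C.nbhd h" if "kpoint y" "pt_map y pt \<in> U" "h \<in> carrier R" "sec_map y U (C.iota h) \<noteq> \<zero>\<^bsub>K\<^esub>" for y h
    using value_iota[OF that(1-3)] that(2,4) unfolding C.nbhd_def by simp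
  {
    case empty
    interpret S: cring "sections V W" by (rule pv(1)[OF W(1)])
    obtain h where h: "h \<in> carrier R" "h \<notin> pt_map F u" "C.nbhd h \<subseteq> W"
      using C.section_is_fraction[OF W(1,2) S.one_closed uW] by blast
    have "pt_map f (pt_map y pt) \<in> U'" if "kpoint y" "pt_map y pt \<in> U" "sec_map y U (C.iota h) \<noteq> \<zero>\<^bsub>K\<^esub>" for y
      using inU' near[OF that(1,2) h(1) that(3)] h(3) by blast
    thus ?case using h(1,2) by (intro bexI[of _ h]) auto
  next
    case (insert l L)
    obtain h where h: "h \<in> carrier R" "h \<notin> pt_map F u"
      "\<And>y. kpoint y \<Longrightarrow> pt_map y pt \<in> U \<Longrightarrow> sec_map y U (C.iota h) \<noteq> \<zero>\<^bsub>K\<^esub> \<Longrightarrow> pt_map f (pt_map y pt) \<in> U'"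
      "\<forall>l\<in>L. \<exists>a\<in>carrier R. \<forall>y. kpoint y \<longrightarrow> pt_map y pt \<in> U \<longrightarrow> sec_map y U (C.iota h) \<noteq> \<zero>\<^bsub>K\<^esub> \<longrightarrow>
        sec_map y U (C.iota h) \<otimes>\<^bsub>K\<^esub> sec_map (move f y) U' l = sec_map y U (C.iota a)"
      using insert.hyps(3) insert.prems by auto
    have l: "l \<in> carrier (sections V U')" using insert.prems by simp
    define t where "t = res V (preimage V f U') W (sec_map f U' l)"
    have fl: "sec_map f U' l \<in> carrier (sections V (preimage V f U'))" by (rule d(10)[OF U' l])
    have t: "t \<in> carrier (sections V W)" unfolding t_def by (rule pv(5)[OF pU W(1,3) fl])
    obtain g b where g: "g \<in> carrier R" "b \<in> carrier R" "g \<notin> pt_map F u" "C.nbhd g \<subseteq> W"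
      "res V U (C.nbhd g) (C.iota g) \<otimes>\<^bsub>sections V (C.nbhd g)\<^esub> res V W (C.nbhd g) t = res V U (C.nbhd g) (C.iota b)"
      using C.section_is_fraction[OF W(1,2) t uW] by blast
    have gl: "sec_map y U (C.iota g) \<otimes>\<^bsub>K\<^esub> sec_map (move f y) U' l = sec_map y U (C.iota b)"
      if y: "kpoint y" "pt_map y pt \<in> U" "sec_map y U (C.iota g) \<noteq> \<zero>\<^bsub>K\<^esub>" for y
    proof -
      have n: "pt_map y pt \<in> C.nbhd g" by (rule near[OF y(1,2) g(1) y(3)])
      have yW: "pt_map y pt \<in> W" using n g(4) by blast
      have "sec_map (move f y) U' l = sec_map y W t"
        unfolding move_simps(2)[OF U' l] t_def by (rule kpointD(7)[OF y(1) pU W(1,3) yW fl, symmetric])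
      thus ?thesis using value_fraction[OF W(1,2) t g(1,2,4) y(1) n g(5)] by simp
    qed
    interpret Kf: field K by (rule K_field)
    define h' where "h' = h \<otimes>\<^bsub>R\<^esub> g"
    have h': "h' \<in> carrier R" "h' \<notin> pt_map F u"
      using C.prime_complement(2)[OF C.pt_F[OF u(1)], of h g] h g unfolding h'_def by auto
    have split: "sec_map y U (C.iota h') = sec_map y U (C.iota h) \<otimes>\<^bsub>K\<^esub> sec_map y U (C.iota g)"
      "sec_map y U (C.iota h) \<in> carrier K" "sec_map y U (C.iota g) \<in> carrier K"
      "sec_map y U (C.iota h') \<noteq> \<zero>\<^bsub>K\<^esub> \<Longrightarrow> sec_map y U (C.iota h) \<noteq> \<zero>\<^bsub>K\<^esub> \<and> sec_map y U (C.iota g) \<noteq> \<zero>\<^bsub>K\<^esub>"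
      if y: "kpoint y" "pt_map y pt \<in> U" for y
    proof -
      show s: "sec_map y U (C.iota h') = sec_map y U (C.iota h) \<otimes>\<^bsub>K\<^esub> sec_map y U (C.iota g)"
        unfolding h'_def by (rule value_iota_mult[OF y h(1) g(1)])
      show c: "sec_map y U (C.iota h) \<in> carrier K" "sec_map y U (C.iota g) \<in> carrier K"
        using kpointD(10)[OF y(1) C.U y(2) C.iota_carrier] h(1) g(1) by blast+
      show "sec_map y U (C.iota h') \<noteq> \<zero>\<^bsub>K\<^esub> \<Longrightarrow> sec_map y U (C.iota h) \<noteq> \<zero>\<^bsub>K\<^esub> \<and> sec_map y U (C.iota g) \<noteq> \<zero>\<^bsub>K\<^esub>"
        unfolding s using c by auto
    qed
    have val: "sec_map (move f y) U' l' \<in> carrier K"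
      if y: "kpoint y" "pt_map f (pt_map y pt) \<in> U'" and "l' \<in> carrier (sections V U')" for y l'
      using kpointD(10)[OF move_kpoint[OF f y(1)] U' _ that(3)] y(2) move_simps(1) by simp
    show ?case
    proof (rule bexI[OF _ h'(1)], intro conjI allI impI ballI)
      show "h' \<notin> pt_map F u" by (rule h'(2))
      fix y assume y: "kpoint y" "pt_map y pt \<in> U" "sec_map y U (C.iota h') \<noteq> \<zero>\<^bsub>K\<^esub>"
      show "pt_map f (pt_map y pt) \<in> U'" using h(3)[OF y(1,2)] split(4)[OF y] by blast
    next
      fix l' assume l': "l' \<in> insert l L"
      have l'c: "l' \<in> carrier (sections V U')" using l' insert.prems by blast
      show "\<exists>a\<in>carrier R. \<forall>y. kpoint y \<longrightarrow> pt_map y pt \<in> U \<longrightarrow> sec_map y U (C.iota h') \<noteq> \<zero>\<^bsub>K\<^esub> \<longrightarrow>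
        sec_map y U (C.iota h') \<otimes>\<^bsub>K\<^esub> sec_map (move f y) U' l' = sec_map y U (C.iota a)"
      proof (cases "l' = l")
        case True
        show ?thesis
        proof (rule bexI[of _ "h \<otimes>\<^bsub>R\<^esub> b"], intro allI impI)
          show "h \<otimes>\<^bsub>R\<^esub> b \<in> carrier R" using h(1) g(2) by simp
          fix y assume y: "kpoint y" "pt_map y pt \<in> U" "sec_map y U (C.iota h') \<noteq> \<zero>\<^bsub>K\<^esub>"
          note sp = split[OF y(1,2)]
          have inU: "pt_map f (pt_map y pt) \<in> U'" using h(3)[OF y(1,2)] sp(4)[OF y(3)] by blast
          have "sec_map y U (C.iota h') \<otimes>\<^bsub>K\<^esub> sec_map (move f y) U' l
            = sec_map y U (C.iota h) \<otimes>\<^bsub>K\<^esub> (sec_map y U (C.iota g) \<otimes>\<^bsub>K\<^esub> sec_map (move f y) U' l)"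
            unfolding sp(1) by (rule Kf.m_assoc[OF sp(2,3) val[OF y(1) inU l]])
          also have "\<dots> = sec_map y U (C.iota h) \<otimes>\<^bsub>K\<^esub> sec_map y U (C.iota b)"
            using gl[OF y(1,2)] sp(4)[OF y(3)] by simp
          also have "\<dots> = sec_map y U (C.iota (h \<otimes>\<^bsub>R\<^esub> b))" by (rule value_iota_mult[OF y(1,2) h(1) g(2), symmetric])
          finally show "sec_map y U (C.iota h') \<otimes>\<^bsub>K\<^esub> sec_map (move f y) U' l' = sec_map y U (C.iota (h \<otimes>\<^bsub>R\<^esub> b))"
            unfolding True .
        qed
      next
        case False
        hence "l' \<in> L" using l' by simp
        then obtain a where a: "a \<in> carrier R" "\<And>y. kpoint y \<Longrightarrow> pt_map y pt \<in> U \<Longrightarrow> sec_map y U (C.iota h) \<noteq> \<zero>\<^bsub>K\<^esub> \<Longrightarrow>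
          sec_map y U (C.iota h) \<otimes>\<^bsub>K\<^esub> sec_map (move f y) U' l' = sec_map y U (C.iota a)" using h(4) by blast
        show ?thesis
        proof (rule bexI[of _ "a \<otimes>\<^bsub>R\<^esub> g"], intro allI impI)
          show "a \<otimes>\<^bsub>R\<^esub> g \<in> carrier R" using a(1) g(1) by simp
          fix y assume y: "kpoint y" "pt_map y pt \<in> U" "sec_map y U (C.iota h') \<noteq> \<zero>\<^bsub>K\<^esub>"
          note sp = split[OF y(1,2)]
          have inU: "pt_map f (pt_map y pt) \<in> U'" using h(3)[OF y(1,2)] sp(4)[OF y(3)] by blast
          have "sec_map y U (C.iota h') \<otimes>\<^bsub>K\<^esub> sec_map (move f y) U' l'
            = (sec_map y U (C.iota h) \<otimes>\<^bsub>K\<^esub> sec_map (move f y) U' l') \<otimes>\<^bsub>K\<^esub> sec_map y U (C.iota g)"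
            unfolding sp(1) using sp(2,3) val[OF y(1) inU l'c] by (simp add: Kf.m_ac)
          also have "\<dots> = sec_map y U (C.iota a) \<otimes>\<^bsub>K\<^esub> sec_map y U (C.iota g)"
            using a(2)[OF y(1,2)] sp(4)[OF y(3)] by simp
          also have "\<dots> = sec_map y U (C.iota (a \<otimes>\<^bsub>R\<^esub> g))" by (rule value_iota_mult[OF y(1,2) a(1) g(1), symmetric])
          finally show "sec_map y U (C.iota h') \<otimes>\<^bsub>K\<^esub> sec_map (move f y) U' l' = sec_map y U (C.iota (a \<otimes>\<^bsub>R\<^esub> g))" .
        qed
      qed
    qed
  }
qed

end

section \<open>Generated submonoids and periodic orbits\<close>

lemma generated_submonoid_rules:
  assumes M: "monoid M" and F: "F \<subseteq> carrier M"
  shows "submonoid (generated_submonoid M F) M" "F \<subseteq> generated_submonoid M F"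
    "\<And>N. submonoid N M \<Longrightarrow> F \<subseteq> N \<Longrightarrow> generated_submonoid M F \<subseteq> N"
proof -
  interpret M: monoid M by fact
  have mem: "x \<in> generated_submonoid M F \<longleftrightarrow> (\<forall>N. submonoid N M \<longrightarrow> F \<subseteq> N \<longrightarrow> x \<in> N)" for x
    unfolding generated_submonoid_def hull_def by blast
  have c: "submonoid (carrier M) M" by (rule submonoid.intro) auto
  show "submonoid (generated_submonoid M F) M"
  proof
    show "generated_submonoid M F \<subseteq> carrier M" using mem c F by blast
    show "\<one>\<^bsub>M\<^esub> \<in> generated_submonoid M F" unfolding mem by (auto intro: submonoid.one_closed)
    show "x \<otimes>\<^bsub>M\<^esub> y \<in> generated_submonoid M F"
      if "x \<in> generated_submonoid M F" "y \<in> generated_submonoid M F" for x y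
      using that unfolding mem by (auto intro: submonoid.m_closed)
  qed
  show "F \<subseteq> generated_submonoid M F" using mem by blast
  show "\<And>N. submonoid N M \<Longrightarrow> F \<subseteq> N \<Longrightarrow> generated_submonoid M F \<subseteq> N" using mem by blast
qed

lemma generated_submonoid_words:
  assumes M: "monoid M" and F: "F \<subseteq> carrier M" and g: "g \<in> generated_submonoid M F"
  shows "\<exists>w. set w \<subseteq> F \<and> g = foldr (\<otimes>\<^bsub>M\<^esub>) w \<one>\<^bsub>M\<^esub>"
proof -
  interpret M: monoid M by fact
  define P where "P = {foldr (\<otimes>\<^bsub>M\<^esub>) w \<one>\<^bsub>M\<^esub> | w. set w \<subseteq> F}"
  have closed: "foldr (\<otimes>\<^bsub>M\<^esub>) w \<one>\<^bsub>M\<^esub> \<in> carrier M" if "set w \<subseteq> F" for w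
    using that by (induct w) (use F in auto)
  have append: "foldr (\<otimes>\<^bsub>M\<^esub>) (u @ w) \<one>\<^bsub>M\<^esub> = foldr (\<otimes>\<^bsub>M\<^esub>) u \<one>\<^bsub>M\<^esub> \<otimes>\<^bsub>M\<^esub> foldr (\<otimes>\<^bsub>M\<^esub>) w \<one>\<^bsub>M\<^esub>"
    if "set u \<subseteq> F" "set w \<subseteq> F" for u w
    using that(1)
  proof (induct u)
    case Nil
    thus ?case using closed[OF that(2)] by simp
  next
    case (Cons a u)
    have "a \<in> carrier M" "set u \<subseteq> F" using Cons.prems F by auto
    thus ?case using Cons.hyps closed[OF that(2)] closed[of u] by (simp add: M.m_assoc)
  qed
  have "submonoid P M"
  proof
    show "P \<subseteq> carrier M" unfolding P_def using closed by blast
    have "foldr (\<otimes>\<^bsub>M\<^esub>) [] \<one>\<^bsub>M\<^esub> \<in> P" unfolding P_def by (intro CollectI exI[of _ "[]"]) simp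
    thus "\<one>\<^bsub>M\<^esub> \<in> P" by simp
    fix x y assume "x \<in> P" "y \<in> P"
    then obtain u w where uw: "set u \<subseteq> F" "set w \<subseteq> F" "x = foldr (\<otimes>\<^bsub>M\<^esub>) u \<one>\<^bsub>M\<^esub>" "y = foldr (\<otimes>\<^bsub>M\<^esub>) w \<one>\<^bsub>M\<^esub>"
      unfolding P_def by blast
    show "x \<otimes>\<^bsub>M\<^esub> y \<in> P"
      unfolding P_def using append[OF uw(1,2)] uw by (intro CollectI exI[of _ "u @ w"]) simp
  qed
  moreover have "F \<subseteq> P"
  proof
    fix a assume a: "a \<in> F"
    hence "a \<in> carrier M" using F by blast
    thus "a \<in> P" unfolding P_def using a by (intro CollectI exI[of _ "[a]"]) simp
  qed
  ultimately have "g \<in> P" using generated_submonoid_rules(3)[OF M F] g by blast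
  thus ?thesis unfolding P_def by blast
qed

locale monoid_action = M: monoid M for M :: "'m monoid" +
  fixes \<phi> :: "'m \<Rightarrow> 'x \<Rightarrow> 'x" and Y :: "'x set"
  assumes act_closed: "g \<in> carrier M \<Longrightarrow> y \<in> Y \<Longrightarrow> \<phi> g y \<in> Y"
    and act_mult: "g \<in> carrier M \<Longrightarrow> h \<in> carrier M \<Longrightarrow> y \<in> Y \<Longrightarrow> \<phi> (g \<otimes>\<^bsub>M\<^esub> h) y = \<phi> g (\<phi> h y)"
    and act_one: "y \<in> Y \<Longrightarrow> \<phi> \<one>\<^bsub>M\<^esub> y = y"
begin

text \<open>The common consequence of the periodicity conditions on submonoids. It does not bound
  the orbit of x, nor the lengths of the cycles.\<close>

definition cyclic :: "'x \<Rightarrow> bool"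
  where "cyclic x \<longleftrightarrow> (\<forall>f\<in>carrier M. \<forall>g\<in>carrier M. \<exists>n>0. (\<phi> f ^^ n) (\<phi> g x) = \<phi> g x)"

lemma periodic_returns:
  assumes N: "submonoid N M" and p: "periodic \<phi> N x" and f: "f \<in> N" and g: "g \<in> N"
  shows "\<exists>n>0. (\<phi> f ^^ n) (\<phi> g x) = \<phi> g x"
proof -
  define S where "S = orbit \<phi> N x"
  have S: "finite S" "bij_betw (\<phi> f) S S" using p f unfolding periodic_def S_def by auto
  have y: "\<phi> g x \<in> S" using g unfolding S_def orbit_def by blast
  have b: "bij_betw (\<phi> f ^^ i) S S" for i by (rule bij_betw_funpow[OF S(2)])
  have "range (\<lambda>i. (\<phi> f ^^ i) (\<phi> g x)) \<subseteq> S" using b y bij_betwE by blast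
  hence "\<not> inj (\<lambda>i. (\<phi> f ^^ i) (\<phi> g x))" using S(1) finite_subset range_inj_infinite by blast
  then obtain i j where ij: "i < j" "(\<phi> f ^^ i) (\<phi> g x) = (\<phi> f ^^ j) (\<phi> g x)"
    unfolding inj_def by (metis linorder_neqE_nat)
  have "(\<phi> f ^^ i) ((\<phi> f ^^ (j - i)) (\<phi> g x)) = (\<phi> f ^^ i) (\<phi> g x)"
    using ij by (metis comp_apply funpow_add le_add_diff_inverse less_imp_le_nat)
  moreover have "(\<phi> f ^^ (j - i)) (\<phi> g x) \<in> S" using b y bij_betwE by blast
  ultimately have "(\<phi> f ^^ (j - i)) (\<phi> g x) = \<phi> g x"
    using b[of i] y unfolding bij_betw_def inj_on_def by blast
  thus ?thesis using ij(1) by (intro exI[of _ "j - i"]) simp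
qed

lemma periodic_submonoid:
  assumes x: "x \<in> Y" and p: "periodic \<phi> (carrier M) x" and N: "submonoid N M"
  shows "periodic \<phi> N x"
proof -
  interpret N: submonoid N M by fact
  have sub: "orbit \<phi> N x \<subseteq> orbit \<phi> (carrier M) x" unfolding orbit_def using N.subset by blast
  hence fin: "finite (orbit \<phi> N x)" using p finite_subset unfolding periodic_def by blast
  have "bij_betw (\<phi> g) (orbit \<phi> N x) (orbit \<phi> N x)" if g: "g \<in> N" for g
  proof -
    have gM: "g \<in> carrier M" using g N.subset by blast
    have "bij_betw (\<phi> g) (orbit \<phi> (carrier M) x) (orbit \<phi> (carrier M) x)" using p gM unfolding periodic_def by blast
    hence inj: "inj_on (\<phi> g) (orbit \<phi> N x)" using sub inj_on_subset unfolding bij_betw_def by blast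
    have "\<phi> g ` orbit \<phi> N x \<subseteq> orbit \<phi> N x"
    proof
      fix z assume "z \<in> \<phi> g ` orbit \<phi> N x"
      then obtain h where h: "h \<in> N" "z = \<phi> g (\<phi> h x)" unfolding orbit_def by blast
      have "z = \<phi> (g \<otimes>\<^bsub>M\<^esub> h) x" unfolding h(2) using act_mult[OF gM _ x] h(1) N.subset by auto
      thus "z \<in> orbit \<phi> N x" unfolding orbit_def using N.m_closed[OF g h(1)] by blast
    qed
    thus ?thesis using endo_inj_surj[OF fin _ inj] inj unfolding bij_betw_def by simp
  qed
  thus ?thesis using fin unfolding periodic_def by blast
qed

lemma cyclic_finite_periodic:
  assumes x: "x \<in> Y" and c: "cyclic x" and fin: "finite (orbit \<phi> (carrier M) x)"
  shows "periodic \<phi> (carrier M) x"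
proof -
  have "bij_betw (\<phi> f) (orbit \<phi> (carrier M) x) (orbit \<phi> (carrier M) x)" if f: "f \<in> carrier M" for f
  proof -
    have sub: "\<phi> f ` orbit \<phi> (carrier M) x \<subseteq> orbit \<phi> (carrier M) x"
    proof
      fix z assume "z \<in> \<phi> f ` orbit \<phi> (carrier M) x"
      then obtain h where h: "h \<in> carrier M" "z = \<phi> f (\<phi> h x)" unfolding orbit_def by blast
      have "z = \<phi> (f \<otimes>\<^bsub>M\<^esub> h) x" unfolding h(2) using act_mult[OF f h(1) x] by simp
      thus "z \<in> orbit \<phi> (carrier M) x" unfolding orbit_def using f h(1) by blast
    qed
    hence iter: "(\<phi> f ^^ n) z \<in> orbit \<phi> (carrier M) x" if "z \<in> orbit \<phi> (carrier M) x" for n z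
      by (induct n) (use that in auto)
    have "orbit \<phi> (carrier M) x \<subseteq> \<phi> f ` orbit \<phi> (carrier M) x"
    proof
      fix z assume z: "z \<in> orbit \<phi> (carrier M) x"
      then obtain n where n: "n > 0" "(\<phi> f ^^ n) z = z" using c f unfolding cyclic_def orbit_def by blast
      then obtain l where "n = Suc l" by (cases n) auto
      hence "z = \<phi> f ((\<phi> f ^^ l) z)" using n(2) by simp
      thus "z \<in> \<phi> f ` orbit \<phi> (carrier M) x" using iter[OF z, of l] by (rule image_eqI)
    qed
    hence "\<phi> f ` orbit \<phi> (carrier M) x = orbit \<phi> (carrier M) x" using sub by blast
    thus ?thesis unfolding bij_betw_def using finite_surj_inj[OF fin] by simp
  qed
  thus ?thesis using fin unfolding periodic_def by blast
qed

text \<open>The point g x lies in the orbit of x under the submonoid generated by f and g.\<close>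

lemma two_generated_cyclic:
  assumes "\<And>N. two_generated_submonoid N M \<Longrightarrow> periodic \<phi> N x"
  shows "cyclic x"
  unfolding cyclic_def
proof (intro ballI)
  fix f g assume fg: "f \<in> carrier M" "g \<in> carrier M"
  note G = generated_submonoid_rules[OF M.monoid_axioms, of "{f, g}"]
  have "periodic \<phi> (generated_submonoid M {f, g}) x"
    by (rule assms) (use fg in \<open>auto simp: two_generated_submonoid_def\<close>)
  thus "\<exists>n>0. (\<phi> f ^^ n) (\<phi> g x) = \<phi> g x" using periodic_returns[of _ x f g] G fg by simp
qed

text \<open>The point g x is periodic under f because x is periodic under the conjugate of f by g.\<close>

lemma group_cyclic:
  assumes G: "group M" and x: "x \<in> Y"
    and p: "\<And>f. f \<in> carrier M \<Longrightarrow> periodic \<phi> (generated_submonoid M {f}) x"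
  shows "cyclic x"
  unfolding cyclic_def
proof (intro ballI)
  fix f g assume fg: "f \<in> carrier M" "g \<in> carrier M"
  interpret G: group M by (rule G)
  define h where "h = inv\<^bsub>M\<^esub> g \<otimes>\<^bsub>M\<^esub> f \<otimes>\<^bsub>M\<^esub> g"
  have h: "h \<in> carrier M" unfolding h_def using fg by simp
  note S = generated_submonoid_rules[OF M.monoid_axioms, of "{h}"]
  have "\<exists>n>0. (\<phi> h ^^ n) (\<phi> \<one>\<^bsub>M\<^esub> x) = \<phi> \<one>\<^bsub>M\<^esub> x"
    by (rule periodic_returns[OF _ p[OF h]]) (use S h submonoid.one_closed in auto)
  then obtain n where n: "n > 0" "(\<phi> h ^^ n) x = x" using act_one[OF x] by auto
  have gh: "g \<otimes>\<^bsub>M\<^esub> h = f \<otimes>\<^bsub>M\<^esub> g" unfolding h_def using fg by (simp add: M.m_assoc[symmetric])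
  have mem: "(\<phi> h ^^ i) x \<in> Y" for i by (induct i) (use x act_closed[OF h] in auto)
  have "\<phi> g ((\<phi> h ^^ i) x) = (\<phi> f ^^ i) (\<phi> g x)" for i
  proof (induct i)
    case (Suc i)
    have "\<phi> g ((\<phi> h ^^ Suc i) x) = \<phi> (g \<otimes>\<^bsub>M\<^esub> h) ((\<phi> h ^^ i) x)" using act_mult[OF fg(2) h mem] by simp
    also have "\<dots> = \<phi> f (\<phi> g ((\<phi> h ^^ i) x))" unfolding gh by (rule act_mult[OF fg mem])
    finally show ?case using Suc by simp
  qed simp
  from this[of n] n show "\<exists>n>0. (\<phi> f ^^ n) (\<phi> g x) = \<phi> g x" by auto
qed

lemma foldr_act:
  assumes "set w \<subseteq> carrier M" "y \<in> Y"
  shows "foldr \<phi> w y = \<phi> (foldr (\<otimes>\<^bsub>M\<^esub>) w \<one>\<^bsub>M\<^esub>) y" "foldr (\<otimes>\<^bsub>M\<^esub>) w \<one>\<^bsub>M\<^esub> \<in> carrier M"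
  using assms(1) by (induct w) (auto simp: act_one[OF assms(2)] act_mult[OF _ _ assms(2)])

end

section \<open>The atlas of a variety\<close>

lemma (in spec_field) affine_open_chart:
  fixes V :: "('p, 'a) ringed_space"
  assumes P: "presheaf_of_rings V" and U: "affine_open V U"
  shows "\<exists>R F G. chart R V U F G"
proof -
  obtain R :: "'a ring" where R: "cring R" "lrs_isomorphic (open_subspace V U) (Spec R)"
    using U unfolding affine_open_def affine_scheme_def by blast
  then obtain F G where "lrs_morphism (open_subspace V U) (Spec R) F" "lrs_morphism (Spec R) (open_subspace V U) G"
    "comp_morphism (open_subspace V U) (Spec R) (open_subspace V U) G F = id_morphism (open_subspace V U)"
    "comp_morphism (Spec R) (open_subspace V U) (Spec R) F G = id_morphism (Spec R)"
    unfolding lrs_isomorphic_def by blast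
  hence "chart R V U F G"
    using R(1) P U by (intro chart.intro spec_ring.intro chart_axioms.intro) (auto simp: affine_open_def)
  thus ?thesis by blast
qed

text \<open>A finite affine cover with finite sets of algebra generators over k, as provided by
  finite type.\<close>

locale variety = rational_setting k V \<pi> for k :: "'k ring" (structure) and V :: "('p, 'a) ringed_space" and \<pi> +
  fixes \<U> :: "'p set set" and gens :: "'p set \<Rightarrow> 'a set"
  assumes finite_cover: "finite \<U>" and cover: "\<Union>\<U> = points V" and affine: "U \<in> \<U> \<Longrightarrow> affine_open V U"
    and gens: "U \<in> \<U> \<Longrightarrow> finite (gens U)" "U \<in> \<U> \<Longrightarrow> gens U \<subseteq> carrier (sections V U)"
    and generated: "U \<in> \<U> \<Longrightarrow> generate_ring (sections V U)
      ((\<lambda>c. res V (points V) U (sec_map \<pi> {pt} c)) ` carrier K \<union> gens U) = carrier (sections V U)"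
begin

definition pts :: "'p set \<Rightarrow> ('k set, 'k set \<Rightarrow> ('k \<times> 'k) set, 'p, 'a) rs_morphism set"
  where "pts U = {y. kpoint y \<and> pt_map y pt \<in> U}"

definition coord :: "'p set \<Rightarrow> 'a \<Rightarrow> ('k set, 'k set \<Rightarrow> ('k \<times> 'k) set, 'p, 'a) rs_morphism \<Rightarrow> 'k set \<Rightarrow> ('k \<times> 'k) set"
  where "coord U l y = sec_map y U l"

lemma cover_open: "U \<in> \<U> \<Longrightarrow> open_in V U"
  using affine unfolding affine_open_def by blast

lemma scalar_value:
  assumes U: "U \<in> \<U>" and y: "y \<in> pts U" and c: "c \<in> carrier K"
  shows "sec_map y U (res V (points V) U (sec_map \<pi> {pt} c)) = c"
proof -
  have yk: "kpoint y" "pt_map y pt \<in> U" using y unfolding pts_def by auto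
  have "sec_map y U (res V (points V) U (sec_map \<pi> {pt} c)) = sec_map y (points V) (sec_map \<pi> {pt} c)"
    by (rule kpointD(7)[OF yk(1) _ cover_open[OF U] openin_subset[OF cover_open[OF U]] yk(2) pi_section[OF c]]) simp
  thus ?thesis using kpointD(8)[OF yk(1) c] by simp
qed

lemma value_hom:
  assumes U: "U \<in> \<U>" and y: "y \<in> pts U"
  shows "ring_hom_ring (sections V U) K (sec_map y U)"
proof -
  have yk: "kpoint y" "pt_map y pt \<in> U" using y unfolding pts_def by auto
  have "cring (sections V U)" by (rule pv(1)[OF cover_open[OF U]])
  moreover have "field K" by (rule K_field)
  ultimately show ?thesis
    using kpointD(5)[OF yk(1) cover_open[OF U] yk(2)]
    by (intro ring_hom_ringI2) (auto simp: cring_def field_def domain_def)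
qed

lemma generators_determine:
  assumes U: "U \<in> \<U>" and y: "y \<in> pts U" and z: "z \<in> pts U" and eq: "\<And>l. l \<in> gens U \<Longrightarrow> sec_map y U l = sec_map z U l"
    and g: "g \<in> carrier (sections V U)"
  shows "sec_map y U g = sec_map z U g"
proof -
  interpret Y: ring_hom_ring "sections V U" K "sec_map y U" by (rule value_hom[OF U y])
  interpret Z: ring_hom_ring "sections V U" K "sec_map z U" by (rule value_hom[OF U z])
  let ?G = "(\<lambda>c. res V (points V) U (sec_map \<pi> {pt} c)) ` carrier K \<union> gens U"
  have "g \<in> generate_ring (sections V U) ?G" using g generated[OF U] by simp
  thus ?thesis
  proof induct
    case one
    show ?case by simp
  next
    case (incl h)
    thus ?case using eq scalar_value[OF U y] scalar_value[OF U z] by auto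
  next
    case (a_inv h)
    thus ?case using generated[OF U] by simp
  next
    case (eng_add h1 h2)
    thus ?case using generated[OF U] by simp
  next
    case (eng_mult h1 h2)
    thus ?case using generated[OF U] by simp
  qed
qed

text \<open>The generators of the coordinate ring of a chart are its coordinates; they separate
  points because values of all sections are determined by those of the generators.\<close>

lemma atlas: "atlas K \<U> pts gens coord"
proof (intro atlas.intro K_field atlas_axioms.intro)
  show "finite \<U>" by (rule finite_cover)
  show "finite (gens U)" if "U \<in> \<U>" for U by (rule gens(1)[OF that])
  show "coord U l y \<in> carrier K" if "U \<in> \<U>" "l \<in> gens U" "y \<in> pts U" for U l y
    using kpointD(10)[OF _ cover_open[OF that(1)]] that gens(2)[OF that(1)] unfolding coord_def pts_def by blast
  show "y = z" if U: "U \<in> \<U>" and y: "y \<in> pts U" and z: "z \<in> pts U" and eq: "\<And>l. l \<in> gens U \<Longrightarrow> coord U l y = coord U l z" for U y z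
  proof -
    obtain R F G where "chart R V U F G" using affine_open_chart[OF PV affine[OF U]] by blast
    then interpret chart: point_chart k V \<pi> R U F G by (intro point_chart.intro rational_setting_axioms)
    show ?thesis
      using chart.kpoint_determined[of y z] y z generators_determine[OF U y z] eq unfolding pts_def coord_def by blast
  qed
qed

sublocale At: atlas K \<U> pts gens coord by (rule atlas)

text \<open>A section over a chart is a polynomial in the generators, so its values are a
  polynomial in the coordinates.\<close>

lemma section_regular:
  assumes U: "U \<in> \<U>" and g: "g \<in> carrier (sections V U)"
  shows "\<exists>r\<in>At.regs (carrier K) U. \<forall>y\<in>pts U. r y = sec_map y U g"
proof -
  let ?G = "(\<lambda>c. res V (points V) U (sec_map \<pi> {pt} c)) ` carrier K \<union> gens U"
  note hom = value_hom[OF U]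
  have car: "h \<in> carrier (sections V U)" if "h \<in> generate_ring (sections V U) ?G" for h
    using that generated[OF U] by simp
  have "g \<in> generate_ring (sections V U) ?G" using g generated[OF U] by simp
  thus ?thesis
  proof induct
    case one
    have "sec_map y U \<one>\<^bsub>sections V U\<^esub> = \<one>\<^bsub>K\<^esub>" if "y \<in> pts U" for y
      using ring_hom_ring.homh[OF hom[OF that]] by (rule ring_hom_one)
    thus ?case using At.regs.const[OF At.one_closed, of U] by (intro bexI[of _ "\<lambda>y. \<one>\<^bsub>K\<^esub>"]) auto
  next
    case (incl h)
    thus ?case
    proof
      assume "h \<in> gens U"
      thus ?case using At.regs.coord[of h U "carrier K"] by (intro bexI[of _ "coord U h"]) (auto simp: coord_def[of U h])
    next
      assume "h \<in> (\<lambda>c. res V (points V) U (sec_map \<pi> {pt} c)) ` carrier K"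
      then obtain c where "c \<in> carrier K" "h = res V (points V) U (sec_map \<pi> {pt} c)" by blast
      thus ?case using At.regs.const[of c "carrier K" U] scalar_value[OF U] by (intro bexI[of _ "\<lambda>y. c"]) auto
    qed
  next
    case (a_inv h)
    then obtain r where r: "r \<in> At.regs (carrier K) U" "\<forall>y\<in>pts U. r y = sec_map y U h" by blast
    have "sec_map y U (\<ominus>\<^bsub>sections V U\<^esub> h) = \<ominus>\<^bsub>K\<^esub> sec_map y U h" if y: "y \<in> pts U" for y
    proof -
      interpret Y: ring_hom_ring "sections V U" K "sec_map y U" by (rule hom[OF y])
      show ?thesis using car[OF a_inv(1)] by simp
    qed
    thus ?case using At.regs.neg[OF r(1)] r(2) by (intro bexI[of _ "\<lambda>y. \<ominus>\<^bsub>K\<^esub> r y"]) auto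
  next
    case (eng_add h1 h2)
    then obtain r s where r: "r \<in> At.regs (carrier K) U" "\<forall>y\<in>pts U. r y = sec_map y U h1"
      and s: "s \<in> At.regs (carrier K) U" "\<forall>y\<in>pts U. s y = sec_map y U h2" by blast
    have "sec_map y U (h1 \<oplus>\<^bsub>sections V U\<^esub> h2) = r y \<oplus>\<^bsub>K\<^esub> s y" if y: "y \<in> pts U" for y
    proof -
      interpret Y: ring_hom_ring "sections V U" K "sec_map y U" by (rule hom[OF y])
      show ?thesis using car[OF eng_add(1)] car[OF eng_add(3)] r s y by simp
    qed
    thus ?case using At.regs.add[OF r(1) s(1)] by (intro bexI[of _ "\<lambda>y. r y \<oplus>\<^bsub>K\<^esub> s y"]) auto
  next
    case (eng_mult h1 h2)
    then obtain r s where r: "r \<in> At.regs (carrier K) U" "\<forall>y\<in>pts U. r y = sec_map y U h1"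
      and s: "s \<in> At.regs (carrier K) U" "\<forall>y\<in>pts U. s y = sec_map y U h2" by blast
    have "sec_map y U (h1 \<otimes>\<^bsub>sections V U\<^esub> h2) = r y \<otimes>\<^bsub>K\<^esub> s y" if y: "y \<in> pts U" for y
    proof -
      interpret Y: ring_hom_ring "sections V U" K "sec_map y U" by (rule hom[OF y])
      show ?thesis using car[OF eng_mult(1)] car[OF eng_mult(3)] r s y by simp
    qed
    thus ?case using At.regs.mult[OF r(1) s(1)] by (intro bexI[of _ "\<lambda>y. r y \<otimes>\<^bsub>K\<^esub> s y"]) auto
  qed
qed

text \<open>By endo_formulas, the denominators of local formulas for f avoid every prime ideal of
  R, so that they admit a partition of unity.\<close>

lemma endo_covers:
  assumes f: "endo f" and U: "U \<in> \<U>"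
  shows "\<exists>es. At.covers (carrier K) (move f) U es"
proof -
  obtain R F G where "chart R V U F G" using affine_open_chart[OF PV affine[OF U]] by blast
  then interpret chart: point_chart k V \<pi> R U F G by (intro point_chart.intro rational_setting_axioms)
  define val where "val h y = sec_map y U (chart.C.iota h)" for h and y :: "('k set, 'k set \<Rightarrow> ('k \<times> 'k) set, 'p, 'a) rs_morphism"
  \<comment> \<open>The denominators h for which f is given by a formula with values in the chart
    U'.\<close>
  define good where "good h U' \<longleftrightarrow> h \<in> carrier R \<and> U' \<in> \<U> \<and>
    (\<forall>y\<in>pts U. val h y \<noteq> \<zero>\<^bsub>K\<^esub> \<longrightarrow> pt_map f (pt_map y pt) \<in> U') \<and>
    (\<forall>l\<in>gens U'. \<exists>a\<in>carrier R. \<forall>y\<in>pts U. val h y \<noteq> \<zero>\<^bsub>K\<^esub> \<longrightarrow>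
      val h y \<otimes>\<^bsub>K\<^esub> sec_map (move f y) U' l = val a y)" for h U'
  have ex: "\<exists>h U'. good h U' \<and> h \<notin> p" if p: "primeideal p R" for p
  proof -
    have pp: "p \<in> chart.C.primes" using p unfolding chart.C.primes_def by simp
    define u where "u = pt_map G p"
    have u: "u \<in> U" "pt_map F u = p" unfolding u_def by (rule chart.C.G_pt[OF pp], rule chart.C.FG_pt[OF pp])
    have lf: "lrs_morphism V V f" using f unfolding endo_def by blast
    have "u \<in> points V" using openin_subset[OF cover_open[OF U]] u(1) by blast
    hence "pt_map f u \<in> points V" by (rule lrsD(9)[OF lf])
    then obtain U' where U': "U' \<in> \<U>" "pt_map f u \<in> U'" using cover by blast
    obtain h where h: "h \<in> carrier R" "h \<notin> pt_map F u"
      "\<forall>y. kpoint y \<longrightarrow> pt_map y pt \<in> U \<longrightarrow> sec_map y U (chart.C.iota h) \<noteq> \<zero>\<^bsub>K\<^esub> \<longrightarrow> pt_map f (pt_map y pt) \<in> U'"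
      "\<forall>l\<in>gens U'. \<exists>a\<in>carrier R. \<forall>y. kpoint y \<longrightarrow> pt_map y pt \<in> U \<longrightarrow> sec_map y U (chart.C.iota h) \<noteq> \<zero>\<^bsub>K\<^esub> \<longrightarrow>
        sec_map y U (chart.C.iota h) \<otimes>\<^bsub>K\<^esub> sec_map (move f y) U' l = sec_map y U (chart.C.iota a)"
      using chart.endo_formulas[OF f cover_open[OF U'(1)] gens[OF U'(1)] u(1) U'(2)] by (elim bexE conjE)
    have "good h U'"
      unfolding good_def val_def
    proof (intro conjI h(1) U'(1) ballI impI)
      show "pt_map f (pt_map y pt) \<in> U'" if "y \<in> pts U" "sec_map y U (chart.C.iota h) \<noteq> \<zero>\<^bsub>K\<^esub>" for y
        using h(3) that unfolding pts_def by simp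
      fix l assume "l \<in> gens U'"
      then obtain a where "a \<in> carrier R" "\<forall>y. kpoint y \<longrightarrow> pt_map y pt \<in> U \<longrightarrow> sec_map y U (chart.C.iota h) \<noteq> \<zero>\<^bsub>K\<^esub> \<longrightarrow>
        sec_map y U (chart.C.iota h) \<otimes>\<^bsub>K\<^esub> sec_map (move f y) U' l = sec_map y U (chart.C.iota a)" using bspec[OF h(4)] by blast
      thus "\<exists>a\<in>carrier R. \<forall>y\<in>pts U. sec_map y U (chart.C.iota h) \<noteq> \<zero>\<^bsub>K\<^esub> \<longrightarrow>
        sec_map y U (chart.C.iota h) \<otimes>\<^bsub>K\<^esub> sec_map (move f y) U' l = sec_map y U (chart.C.iota a)"
        unfolding pts_def by (intro bexI[of _ a]) simp_all
    qed
    thus ?thesis using h(2) unfolding u(2) by blast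
  qed
  define S where "S = {h. \<exists>U'. good h U'}"
  have SR: "S \<subseteq> carrier R" unfolding S_def good_def by blast
  obtain ps where ps: "set ps \<subseteq> carrier R \<times> S" "chart.C.combination ps = \<one>\<^bsub>R\<^esub>"
    using chart.C.partition_of_unity[OF SR] ex unfolding S_def by blast
  have reg: "\<exists>r\<in>At.regs (carrier K) U. \<forall>y\<in>pts U. r y = val a y" if "a \<in> carrier R" for a
    unfolding val_def by (rule section_regular[OF U chart.C.iota_carrier[OF that]])
  have "\<exists>e. At.local_formula (carrier K) (move f) U e \<and>
    (\<forall>y\<in>pts U. fst e y = val (fst q) y \<and> fst (snd e) y = val (snd q) y)" if q: "q \<in> carrier R \<times> S" for q
  proof -
    obtain U' where U': "good (snd q) U'" using q unfolding S_def by auto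
    note g = U'[unfolded good_def]
    have q1: "fst q \<in> carrier R" and q2: "snd q \<in> carrier R" using q SR by auto
    obtain c where c: "c \<in> At.regs (carrier K) U" "\<forall>y\<in>pts U. c y = val (fst q) y" using reg[OF q1] by blast
    obtain h where h: "h \<in> At.regs (carrier K) U" "\<forall>y\<in>pts U. h y = val (snd q) y" using reg[OF q2] by blast
    have "\<forall>l\<in>gens U'. \<exists>r. r \<in> At.regs (carrier K) U \<and> (\<forall>y\<in>pts U. val (snd q) y \<noteq> \<zero>\<^bsub>K\<^esub> \<longrightarrow>
      val (snd q) y \<otimes>\<^bsub>K\<^esub> sec_map (move f y) U' l = r y)"
    proof
      fix l assume "l \<in> gens U'"
      then obtain a where a: "a \<in> carrier R" "\<forall>y\<in>pts U. val (snd q) y \<noteq> \<zero>\<^bsub>K\<^esub> \<longrightarrow>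
        val (snd q) y \<otimes>\<^bsub>K\<^esub> sec_map (move f y) U' l = val a y" using g by blast
      obtain r where "r \<in> At.regs (carrier K) U" "\<forall>y\<in>pts U. r y = val a y" using reg[OF a(1)] by blast
      thus "\<exists>r. r \<in> At.regs (carrier K) U \<and> (\<forall>y\<in>pts U. val (snd q) y \<noteq> \<zero>\<^bsub>K\<^esub> \<longrightarrow>
        val (snd q) y \<otimes>\<^bsub>K\<^esub> sec_map (move f y) U' l = r y)" using a(2) by (intro exI[of _ r]) simp
    qed
    then obtain r where r: "\<forall>l\<in>gens U'. r l \<in> At.regs (carrier K) U \<and> (\<forall>y\<in>pts U. val (snd q) y \<noteq> \<zero>\<^bsub>K\<^esub> \<longrightarrow>
      val (snd q) y \<otimes>\<^bsub>K\<^esub> sec_map (move f y) U' l = r l y)" by (rule bchoice[THEN exE])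
    have inU': "move f y \<in> pts U'" if "y \<in> pts U" "val (snd q) y \<noteq> \<zero>\<^bsub>K\<^esub>" for y
      using g that move_kpoint[OF f, of y] move_simps(1)[of f y] unfolding pts_def by simp
    have "At.local_formula (carrier K) (move f) U (c, h, U', r)"
      unfolding At.local_formula_def prod.case
      using c(1) h g r inU' by (intro conjI ballI impI) (auto simp: coord_def[of U'])
    thus ?thesis using c(2) h(2) by (intro exI[of _ "(c, h, U', r)"]) simp
  qed
  hence "\<forall>q\<in>carrier R \<times> S. \<exists>e. At.local_formula (carrier K) (move f) U e \<and>
    (\<forall>y\<in>pts U. fst e y = val (fst q) y \<and> fst (snd e) y = val (snd q) y)" by blast
  then obtain E where E: "\<forall>q\<in>carrier R \<times> S. At.local_formula (carrier K) (move f) U (E q) \<and>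
    (\<forall>y\<in>pts U. fst (E q) y = val (fst q) y \<and> fst (snd (E q)) y = val (snd q) y)" by (rule bchoice[THEN exE])
  have "At.psum (map E qs) y = val (chart.C.combination qs) y" if y: "y \<in> pts U" and "set qs \<subseteq> carrier R \<times> S" for qs y
    using that(2)
  proof (induct qs)
    interpret Y: ring_hom_ring "sections V U" K "sec_map y U" by (rule value_hom[OF U y])
    interpret J: ring_hom_cring R "sections V U" chart.C.iota
      by (intro ring_hom_cring.intro ring_hom_cring_axioms.intro chart.C.is_cring pv(1)[OF cover_open[OF U]] chart.C.iota_hom)
    case Nil
    show ?case unfolding val_def by simp
  next
    interpret Y: ring_hom_ring "sections V U" K "sec_map y U" by (rule value_hom[OF U y])
    interpret J: ring_hom_cring R "sections V U" chart.C.iota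
      by (intro ring_hom_cring.intro ring_hom_cring_axioms.intro chart.C.is_cring pv(1)[OF cover_open[OF U]] chart.C.iota_hom)
    case (Cons q qs)
    have q: "fst q \<in> carrier R" "snd q \<in> carrier R" "q \<in> carrier R \<times> S" "set qs \<subseteq> carrier R \<times> carrier R" "set qs \<subseteq> carrier R \<times> S"
      using Cons.prems SR by auto
    have "At.psum (map E (q # qs)) y = val (fst q) y \<otimes>\<^bsub>K\<^esub> val (snd q) y \<oplus>\<^bsub>K\<^esub> val (chart.C.combination qs) y"
      using Cons.hyps[OF q(5)] bspec[OF E q(3)] y by simp
    thus ?case unfolding val_def using q chart.C.combination_closed[OF q(4)] by simp
  qed
  moreover have "val \<one>\<^bsub>R\<^esub> y = \<one>\<^bsub>K\<^esub>" if "y \<in> pts U" for y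
    unfolding val_def ring_hom_one[OF chart.C.iota_hom] using ring_hom_ring.homh[OF value_hom[OF U that]] by (rule ring_hom_one)
  ultimately have "\<forall>y\<in>pts U. At.psum (map E ps) y = \<one>\<^bsub>K\<^esub>" using ps by simp
  moreover have "\<forall>e\<in>set (map E ps). At.local_formula (carrier K) (move f) U e" using E ps(1) by auto
  ultimately show ?thesis unfolding At.covers_def by blast
qed

end

text \<open>The spectrum of k is a single point, so that the affine cover in the definition of
  finite type contains the whole spectrum.\<close>

lemma variety_atlas:
  assumes k: "field k" and V: "algebraic_variety k V \<pi>"
  shows "\<exists>\<U> gens. variety k V \<pi> \<U> gens"
proof -
  interpret S: spec_field k using k by (rule spec_field.intro)
  have v: "locally_ringed_space V" "lrs_morphism V (Spec k) \<pi>" "finite_type V (Spec k) \<pi>"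
    using V unfolding algebraic_variety_def scheme_def by auto
  interpret Q: rational_setting k V \<pi>
    using v by (intro rational_setting.intro S.spec_field_axioms rational_setting_axioms.intro)
  obtain \<V> where \<V>: "\<Union>\<V> = points (Spec k)" "\<forall>D\<in>\<V>. affine_open (Spec k) D \<and>
        (\<exists>\<U>. finite \<U> \<and> \<Union>\<U> = preimage V \<pi> D \<and>
          (\<forall>U\<in>\<U>. affine_open V U \<and> finitely_generated_algebra (sections (Spec k) D) (sections V U)
              (\<lambda>t. res V (preimage V \<pi> D) U (sec_map \<pi> D t))))"
    using v(3) unfolding finite_type_def by blast
  obtain D where D: "D \<in> \<V>" "S.pt \<in> D" using \<V>(1) S.spec_k_points by blast
  have "open_in (Spec k) D" using \<V>(2) D(1) unfolding affine_open_def by blast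
  hence De: "D = {S.pt}" using S.spec_k_open D(2) by blast
  obtain \<U> where \<U>: "finite \<U>" "\<Union>\<U> = points V" "\<forall>U\<in>\<U>. affine_open V U \<and> finitely_generated_algebra S.K (sections V U)
              (\<lambda>t. res V (points V) U (sec_map \<pi> {S.pt} t))"
    using bspec[OF \<V>(2) D(1)] unfolding De Q.pi_preimage S.K_def by blast
  have "\<forall>U\<in>\<U>. \<exists>F. finite F \<and> F \<subseteq> carrier (sections V U) \<and> generate_ring (sections V U)
      ((\<lambda>c. res V (points V) U (sec_map \<pi> {S.pt} c)) ` carrier S.K \<union> F) = carrier (sections V U)"
    using \<U>(3) unfolding finitely_generated_algebra_def by blast
  then obtain gens where gens: "\<forall>U\<in>\<U>. finite (gens U) \<and> gens U \<subseteq> carrier (sections V U) \<and> generate_ring (sections V U)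
      ((\<lambda>c. res V (points V) U (sec_map \<pi> {S.pt} c)) ` carrier S.K \<union> gens U) = carrier (sections V U)"
    by (rule bchoice[THEN exE])
  have "variety k V \<pi> \<U> gens"
    using \<U> gens by (intro variety.intro Q.rational_setting_axioms variety_axioms.intro) auto
  thus ?thesis by blast
qed

section \<open>Periodic points of monoids of endomorphisms\<close>

theorem theorem1p4:
  fixes k :: "'k ring"
    and V :: "('p, 'a) ringed_space"
    and \<pi> :: "('p, 'a, 'k set, 'k set \<Rightarrow> ('k \<times> 'k) set) rs_morphism"
    and M :: "'m monoid"
    and \<rho> :: "'m \<Rightarrow> ('p, 'a, 'p, 'a) rs_morphism"
    and x :: "('k set, 'k set \<Rightarrow> ('k \<times> 'k) set, 'p, 'a) rs_morphism"
  assumes "field k"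
    and char_zero: "\<And>n::nat. n > 0 \<Longrightarrow> [n] \<cdot>\<^bsub>k\<^esub> \<one>\<^bsub>k\<^esub> \<noteq> \<zero>\<^bsub>k\<^esub>"
    and "algebraic_variety k V \<pi>"
    and "monoid M"
    and "finitely_generated_monoid M"
    and "acts_by_endomorphisms M k V \<pi> \<rho>"
    and "x \<in> rational_points k V \<pi>"
  shows "(periodic (point_action k V \<rho>) (carrier M) x \<longleftrightarrow>
      (\<forall>N. two_generated_submonoid N M \<longrightarrow> periodic (point_action k V \<rho>) N x)) \<and>
    (group M \<longrightarrow>
      (periodic (point_action k V \<rho>) (carrier M) x \<longleftrightarrow>
        (\<forall>f\<in>carrier M. periodic (point_action k V \<rho>) (generated_submonoid M {f}) x)) \<and>
      ((\<forall>N. two_generated_submonoid N M \<longrightarrow> periodic (point_action k V \<rho>) N x) \<longleftrightarrow>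
        (\<forall>f\<in>carrier M. periodic (point_action k V \<rho>) (generated_submonoid M {f}) x)))"
proof -
  obtain \<U> gens where "variety k V \<pi> \<U> gens" using variety_atlas[OF assms(1,3)] by blast
  then interpret W: variety k V \<pi> \<U> gens .
  define \<phi> where "\<phi> = point_action k V \<rho>"
  have \<phi>: "\<phi> g = W.move (\<rho> g)" for g unfolding \<phi>_def point_action_def by (rule ext) simp
  have hom: "\<rho> \<in> hom M (endomorphism_monoid k V \<pi>)" and one: "\<rho> \<one>\<^bsub>M\<^esub> = id_morphism V"
    using assms(6) unfolding acts_by_endomorphisms_def endomorphism_monoid_def by auto
  have endo: "W.endo (\<rho> g)" if "g \<in> carrier M" for g
    using hom_in_carrier[OF hom that] unfolding endomorphism_monoid_def W.endo_def by simp
  have mult: "\<rho> (g \<otimes>\<^bsub>M\<^esub> h) = comp_morphism V V V (\<rho> g) (\<rho> h)" if "g \<in> carrier M" "h \<in> carrier M" for g h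
    using hom_mult[OF hom that] unfolding endomorphism_monoid_def by simp
  interpret A: monoid_action M \<phi> "{y. W.kpoint y}"
  proof (intro monoid_action.intro assms(4) monoid_action_axioms.intro)
    show "\<phi> g y \<in> {y. W.kpoint y}" if "g \<in> carrier M" "y \<in> {y. W.kpoint y}" for g y
      unfolding \<phi> using W.move_kpoint[OF endo[OF that(1)]] that(2) by simp
    show "\<phi> (g \<otimes>\<^bsub>M\<^esub> h) y = \<phi> g (\<phi> h y)" if "g \<in> carrier M" "h \<in> carrier M" "y \<in> {y. W.kpoint y}" for g h y
      unfolding \<phi> mult[OF that(1,2)] using W.move_comp[OF endo[OF that(1)] endo[OF that(2)]] that(3) by simp
    show "\<phi> \<one>\<^bsub>M\<^esub> y = y" if "y \<in> {y. W.kpoint y}" for y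
      unfolding \<phi> one using W.move_id that by simp
  qed
  have xk: "W.kpoint x" by (rule W.rational_kpoint[OF assms(7)])
  have xY: "x \<in> {y. W.kpoint y}" using xk by simp
  have char: "W.At.char_zero"
    unfolding W.At.char_zero_def
  proof (intro allI impI)
    fix n :: nat assume "n > 0"
    hence "[n] \<cdot>\<^bsub>k\<^esub> \<one>\<^bsub>k\<^esub> \<noteq> \<zero>\<^bsub>k\<^esub>" by (rule char_zero)
    moreover have "[n] \<cdot>\<^bsub>k\<^esub> \<one>\<^bsub>k\<^esub> \<in> carrier k" "\<zero>\<^bsub>k\<^esub> \<in> carrier k" by simp_all
    ultimately show "[n] \<cdot>\<^bsub>W.K\<^esub> \<one>\<^bsub>W.K\<^esub> \<noteq> \<zero>\<^bsub>W.K\<^esub>"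
      unfolding W.K_char W.scalar_zero[symmetric] using W.scalar_inj by (simp add: inj_on_eq_iff)
  qed
  obtain U0 where U0: "U0 \<in> \<U>" "x \<in> W.pts U0"
    using W.cover W.kpointD(2)[OF xk] xk unfolding W.pts_def by blast
  obtain F where F: "finite F" "F \<subseteq> carrier M" "generated_submonoid M F = carrier M"
    using assms(5) unfolding finitely_generated_monoid_def by blast
  have finite: "finite (orbit \<phi> (carrier M) x)" if c: "A.cyclic x"
  proof -
    define J where "J = insert \<one>\<^bsub>M\<^esub> F"
    have J: "finite J" "\<one>\<^bsub>M\<^esub> \<in> J" "J \<subseteq> carrier M" unfolding J_def using F by auto
    note fold = A.foldr_act[OF order_trans[OF _ J(3)] xY]
    have "finite {foldr \<phi> w x | w. set w \<subseteq> J}"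
    proof (rule W.At.finite_orbit[OF char J(1,2) U0])
      show "\<exists>es. W.At.covers (carrier W.K) (\<phi> j) i es" if "j \<in> J" "i \<in> \<U>" for j i
        unfolding \<phi> using W.endo_covers[OF endo that(2)] that(1) J(3) by blast
      fix w u assume w: "set w \<subseteq> J" and u: "set u \<subseteq> J"
      define g where "g = foldr (\<otimes>\<^bsub>M\<^esub>) u \<one>\<^bsub>M\<^esub>"
      define f where "f = foldr (\<otimes>\<^bsub>M\<^esub>) w \<one>\<^bsub>M\<^esub>"
      have g: "g \<in> carrier M" "foldr \<phi> u x = \<phi> g x" unfolding g_def using fold[OF u] by auto
      have f: "f \<in> carrier M" unfolding f_def by (rule fold(2)[OF w])
      have Y: "(\<phi> f ^^ n) (\<phi> g x) \<in> {y. W.kpoint y}" for n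
        by (induct n) (use A.act_closed[OF g(1) xY] A.act_closed[OF f] in simp_all)
      have "(foldr \<phi> w ^^ n) (\<phi> g x) = (\<phi> f ^^ n) (\<phi> g x)" for n
      proof (induct n)
        case (Suc n)
        have "foldr \<phi> w ((\<phi> f ^^ n) (\<phi> g x)) = \<phi> f ((\<phi> f ^^ n) (\<phi> g x))"
          unfolding f_def by (rule A.foldr_act(1)[OF order_trans[OF w J(3)] Y[unfolded f_def]])
        thus ?case using Suc by simp
      qed simp
      thus "\<exists>n>0. (foldr \<phi> w ^^ n) (foldr \<phi> u x) = foldr \<phi> u x"
        unfolding g(2) using c f g(1) unfolding A.cyclic_def by simp
    qed
    moreover have "orbit \<phi> (carrier M) x \<subseteq> {foldr \<phi> w x | w. set w \<subseteq> J}"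
    proof
      fix y assume "y \<in> orbit \<phi> (carrier M) x"
      then obtain g where g: "g \<in> generated_submonoid M F" "y = \<phi> g x" unfolding orbit_def F(3) by blast
      obtain w where w: "set w \<subseteq> F" "g = foldr (\<otimes>\<^bsub>M\<^esub>) w \<one>\<^bsub>M\<^esub>"
        using generated_submonoid_words[OF assms(4) F(2) g(1)] by blast
      have wJ: "set w \<subseteq> J" using w(1) unfolding J_def by blast
      show "y \<in> {foldr \<phi> w x | w. set w \<subseteq> J}" using fold(1)[OF wJ] g(2) w(2) wJ by (intro CollectI exI[of _ w]) simp
    qed
    ultimately show ?thesis by (rule finite_subset[rotated])
  qed
  have cyc: "periodic \<phi> (carrier M) x" if "A.cyclic x"
    by (rule A.cyclic_finite_periodic[OF xY that finite[OF that]])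
  note gen = generated_submonoid_rules(1)[OF assms(4)]
  have ab: "periodic \<phi> N x" if "periodic \<phi> (carrier M) x" "two_generated_submonoid N M" for N
    using A.periodic_submonoid[OF xY that(1)] gen that(2) unfolding two_generated_submonoid_def by auto
  have bc: "periodic \<phi> (generated_submonoid M {f}) x"
    if "periodic \<phi> (carrier M) x" "f \<in> carrier M" for f
    using A.periodic_submonoid[OF xY that(1) gen] that(2) by simp
  have ba: "periodic \<phi> (carrier M) x" if "\<forall>N. two_generated_submonoid N M \<longrightarrow> periodic \<phi> N x"
    by (rule cyc[OF A.two_generated_cyclic]) (use that in blast)
  have ca: "periodic \<phi> (carrier M) x" if "group M" "\<forall>f\<in>carrier M. periodic \<phi> (generated_submonoid M {f}) x"
    by (rule cyc[OF A.group_cyclic[OF that(1) xY]]) (use that(2) in blast)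
  show ?thesis unfolding \<phi>_def[symmetric] using ab ba bc ca by blast
qed

end
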